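(* Every outerpath admits a $2$-star coloring, and such a coloring can be computed in linear time.
   Context: A $\kappa$-star coloring of a graph $G$ is an assignment of one of $\kappa$ colors to each vertex of $G$ such that every monochromatic component (a connected component of the subgraph induced by the vertices of one color) is acyclic and has diameter at most $2$, i.e., is a star (possibly a single vertex or a single edge). An outerpath is an outerplanar graph with an outerplanar embedding whose weak dual is a path, where the weak dual of a plane graph is the subgraph of its dual graph obtained by deleting the vertex corresponding to the unbounded face. Linear time is measured in the size of the graph. *)

theory Defs
  imports "HOL-Analysis.Analysis"
begin

section \<open>Finite simple graphs\<close>

text \<open>A graph is given by its vertex set and its set of edges, each edge being a set of two vertices.\<close>

definition simple_graph :: "'a set \<Rightarrow> 'a set set \<Rightarrow> bool" where
  "simple_graph V E \<longleftrightarrow> finite V \<and> (\<forall>e\<in>E. e \<subseteq> V \<and> card e = 2)"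

definition induced_edges :: "'a set set \<Rightarrow> 'a set \<Rightarrow> 'a set set" where
  "induced_edges E S = {e \<in> E. e \<subseteq> S}"

definition walk :: "'a set \<Rightarrow> 'a set set \<Rightarrow> 'a list \<Rightarrow> bool" where
  "walk V E xs \<longleftrightarrow> xs \<noteq> [] \<and> set xs \<subseteq> V \<and> successively (\<lambda>u v. {u, v} \<in> E) xs"

definition joined :: "'a set \<Rightarrow> 'a set set \<Rightarrow> 'a \<Rightarrow> 'a \<Rightarrow> bool" where
  "joined V E u v \<longleftrightarrow> (\<exists>xs. walk V E xs \<and> hd xs = u \<and> last xs = v)"

definition graph_components :: "'a set \<Rightarrow> 'a set set \<Rightarrow> 'a set set" where
  "graph_components V E = {{v. joined V E u v} | u. u \<in> V}"

definition graph_cycle :: "'a set \<Rightarrow> 'a set set \<Rightarrow> 'a list \<Rightarrow> bool" where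
  "graph_cycle V E xs \<longleftrightarrow>
     walk V E xs \<and> distinct xs \<and> length xs \<ge> 3 \<and> {last xs, hd xs} \<in> E"

definition graph_acyclic :: "'a set \<Rightarrow> 'a set set \<Rightarrow> bool" where
  "graph_acyclic V E \<longleftrightarrow> (\<nexists>xs. graph_cycle V E xs)"

text \<open>Distance and diameter are only used for finite, nonempty, connected graphs; the values
  of \<open>LEAST\<close> and \<open>Max\<close> outside this case are irrelevant.\<close>

definition graph_dist :: "'a set \<Rightarrow> 'a set set \<Rightarrow> 'a \<Rightarrow> 'a \<Rightarrow> nat" where
  "graph_dist V E u v =
     (LEAST k. \<exists>xs. walk V E xs \<and> hd xs = u \<and> last xs = v \<and> length xs = Suc k)"

definition graph_diameter :: "'a set \<Rightarrow> 'a set set \<Rightarrow> nat" where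
  "graph_diameter V E = Max {graph_dist V E u v | u v. u \<in> V \<and> v \<in> V}"

text \<open>The one-vertex graph is a path, and so is the graph without vertices.\<close>

definition path_graph :: "'a set \<Rightarrow> 'a set set \<Rightarrow> bool" where
  "path_graph V E \<longleftrightarrow>
     (\<exists>xs. distinct xs \<and> set xs = V \<and> E = {{xs ! i, xs ! Suc i} | i. Suc i < length xs})"


section \<open>Star colorings\<close>

definition star_coloring :: "nat \<Rightarrow> 'a set \<Rightarrow> 'a set set \<Rightarrow> ('a \<Rightarrow> nat) \<Rightarrow> bool" where
  "star_coloring k V E c \<longleftrightarrow>
     (\<forall>v\<in>V. c v < k) \<and>
     (\<forall>i<k. let S = {v \<in> V. c v = i} in
        \<forall>C \<in> graph_components S (induced_edges E S).
          graph_acyclic C (induced_edges E C) \<and> graph_diameter C (induced_edges E C) \<le> 2)"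


section \<open>Plane drawings, faces, duals\<close>

text \<open>Vertices are placed by \<open>pos\<close> at distinct points of the plane; an edge \<open>e\<close> is the
  Jordan arc \<open>crv e\<close>, which contains no vertices other than the ends of \<open>e\<close> and meets other
  edges only in common end vertices.\<close>

definition plane_embedding ::
    "'a set \<Rightarrow> 'a set set \<Rightarrow> ('a \<Rightarrow> complex) \<Rightarrow> ('a set \<Rightarrow> real \<Rightarrow> complex) \<Rightarrow> bool" where
  "plane_embedding V E pos crv \<longleftrightarrow>
     inj_on pos V \<and>
     (\<forall>e\<in>E. arc (crv e) \<and> {pathstart (crv e), pathfinish (crv e)} = pos ` e \<and>
             path_image (crv e) \<inter> pos ` V = pos ` e) \<and>
     (\<forall>e\<in>E. \<forall>e'\<in>E. e \<noteq> e' \<longrightarrow> path_image (crv e) \<inter> path_image (crv e') \<subseteq> pos ` (e \<inter> e'))"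

definition faces ::
    "'a set \<Rightarrow> 'a set set \<Rightarrow> ('a \<Rightarrow> complex) \<Rightarrow> ('a set \<Rightarrow> real \<Rightarrow> complex) \<Rightarrow> complex set set" where
  "faces V E pos crv = components (- (pos ` V \<union> (\<Union>e\<in>E. path_image (crv e))))"

definition outerplanar_embedding ::
    "'a set \<Rightarrow> 'a set set \<Rightarrow> ('a \<Rightarrow> complex) \<Rightarrow> ('a set \<Rightarrow> real \<Rightarrow> complex) \<Rightarrow> bool" where
  "outerplanar_embedding V E pos crv \<longleftrightarrow>
     plane_embedding V E pos crv \<and>
     (\<exists>F \<in> faces V E pos crv. \<not> bounded F \<and> (\<forall>v\<in>V. pos v \<in> frontier F))"

text \<open>The vertices of the dual graph are the faces, and every edge lying on the boundary of two
  faces makes them adjacent. Loops and multiplicities of dual edges are not recorded: a loop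
  arises only from a bridge, and in an outerplanar embedding of a simple graph all bridges lie
  in the unbounded face and no two bounded faces share more than one edge.\<close>

definition dual_edges ::
    "'a set \<Rightarrow> 'a set set \<Rightarrow> ('a \<Rightarrow> complex) \<Rightarrow> ('a set \<Rightarrow> real \<Rightarrow> complex) \<Rightarrow> complex set set set" where
  "dual_edges V E pos crv =
     {{F, F'} | F F'. F \<in> faces V E pos crv \<and> F' \<in> faces V E pos crv \<and> F \<noteq> F' \<and>
        (\<exists>e\<in>E. path_image (crv e) \<subseteq> frontier F \<inter> frontier F')}"

definition weak_dual_verts ::
    "'a set \<Rightarrow> 'a set set \<Rightarrow> ('a \<Rightarrow> complex) \<Rightarrow> ('a set \<Rightarrow> real \<Rightarrow> complex) \<Rightarrow> complex set set" where
  "weak_dual_verts V E pos crv = {F \<in> faces V E pos crv. bounded F}"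

definition weak_dual_edges ::
    "'a set \<Rightarrow> 'a set set \<Rightarrow> ('a \<Rightarrow> complex) \<Rightarrow> ('a set \<Rightarrow> real \<Rightarrow> complex) \<Rightarrow> complex set set set" where
  "weak_dual_edges V E pos crv =
     induced_edges (dual_edges V E pos crv) (weak_dual_verts V E pos crv)"

definition outerpath :: "'a set \<Rightarrow> 'a set set \<Rightarrow> bool" where
  "outerpath V E \<longleftrightarrow>
     simple_graph V E \<and>
     (\<exists>pos crv. outerplanar_embedding V E pos crv \<and>
        path_graph (weak_dual_verts V E pos crv) (weak_dual_edges V E pos crv))"


section \<open>A random access machine with unit costs\<close>

text \<open>Structured programs over registers (indexed by \<open>nat\<close>) and arrays (indexed by \<open>nat\<close>, with
  indirect access to their cells). The only arithmetic is \<open>+ 1\<close> and \<open>- 1\<close>, so after \<open>t\<close> steps no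
  register or cell exceeds the largest number in the input or the program by more than \<open>t\<close>.
  In time linear in the size of the input all numbers therefore fit into words of logarithmic
  length, which justifies charging one time unit per operation.\<close>

record state =
  regs :: "nat \<Rightarrow> nat"
  arrs :: "nat \<Rightarrow> nat \<Rightarrow> nat"

datatype test = Less nat nat | Equal nat nat | Neg test | Conj test test

primrec holds :: "test \<Rightarrow> state \<Rightarrow> bool" where
  "holds (Less x y) s \<longleftrightarrow> regs s x < regs s y"
| "holds (Equal x y) s \<longleftrightarrow> regs s x = regs s y"
| "holds (Neg b) s \<longleftrightarrow> \<not> holds b s"
| "holds (Conj b b') s \<longleftrightarrow> holds b s \<and> holds b' s"

definition set_reg :: "nat \<Rightarrow> nat \<Rightarrow> state \<Rightarrow> state" where
  "set_reg x k s = s\<lparr>regs := (regs s)(x := k)\<rparr>"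

definition set_cell :: "nat \<Rightarrow> nat \<Rightarrow> nat \<Rightarrow> state \<Rightarrow> state" where
  "set_cell a i k s = s\<lparr>arrs := (arrs s)(a := (arrs s a)(i := k))\<rparr>"

datatype prog =
    Skip
  | Const nat nat
  | Copy nat nat
  | Inc nat
  | Dec nat
  | Load nat nat nat
  | Store nat nat nat
  | Seq prog prog
  | If test prog prog
  | While test prog

text \<open>\<open>exec p s t s'\<close>: started in \<open>s\<close>, the program \<open>p\<close> halts after \<open>t\<close> steps in \<open>s'\<close>.\<close>

inductive exec :: "prog \<Rightarrow> state \<Rightarrow> nat \<Rightarrow> state \<Rightarrow> bool" where
  Skip: "exec Skip s 1 s"
| Const: "exec (Const x k) s 1 (set_reg x k s)"
| Copy: "exec (Copy x y) s 1 (set_reg x (regs s y) s)"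
| Inc: "exec (Inc x) s 1 (set_reg x (regs s x + 1) s)"
| Dec: "exec (Dec x) s 1 (set_reg x (regs s x - 1) s)"
| Load: "exec (Load x a y) s 1 (set_reg x (arrs s a (regs s y)) s)"
| Store: "exec (Store a x y) s 1 (set_cell a (regs s x) (regs s y) s)"
| Seq: "exec p s t s' \<Longrightarrow> exec q s' t' s'' \<Longrightarrow> exec (Seq p q) s (t + t') s''"
| IfTrue: "holds b s \<Longrightarrow> exec p s t s' \<Longrightarrow> exec (If b p q) s (1 + t) s'"
| IfFalse: "\<not> holds b s \<Longrightarrow> exec q s t s' \<Longrightarrow> exec (If b p q) s (1 + t) s'"
| WhileFalse: "\<not> holds b s \<Longrightarrow> exec (While b p) s 1 s"
| WhileTrue: "holds b s \<Longrightarrow> exec p s t s' \<Longrightarrow> exec (While b p) s' t' s'' \<Longrightarrow>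
    exec (While b p) s (1 + t + t') s''"

lemma exec_deterministic:
  "exec p s t s' \<Longrightarrow> exec p s u s'' \<Longrightarrow> u = t \<and> s'' = s'"
proof (induction arbitrary: u s'' rule: exec.induct)
  case (Seq p s t s' q t' s'')
  from Seq.prems Seq.IH show ?case by (cases rule: exec.cases) blast+
next
  case (IfTrue b s p t s' q)
  from IfTrue.prems IfTrue.IH IfTrue.hyps show ?case by (cases rule: exec.cases) blast+
next
  case (IfFalse b s q t s' p)
  from IfFalse.prems IfFalse.IH IfFalse.hyps show ?case by (cases rule: exec.cases) blast+
next
  case (WhileTrue b s p t s' t' s'')
  from WhileTrue.prems WhileTrue.IH WhileTrue.hyps show ?case by (cases rule: exec.cases) blast+
qed (auto elim: exec.cases)

text \<open>A graph on the vertices \<open>0, \<dots>, n - 1\<close> is presented by adjacency lists, in arbitrary order.\<close>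

definition adjacency_lists :: "nat \<Rightarrow> nat set set \<Rightarrow> (nat \<Rightarrow> nat list) \<Rightarrow> bool" where
  "adjacency_lists n E adj \<longleftrightarrow>
     (\<forall>v<n. distinct (adj v) \<and> set (adj v) = {u. {u, v} \<in> E})"

text \<open>Register \<open>0\<close> holds \<open>n\<close>, array \<open>1\<close> the concatenation of the adjacency lists, and array \<open>0\<close>
  the positions in it where they begin (with one more entry for the end of the last list).
  The rest of the memory is \<open>0\<close>. The coloring is to be delivered in array \<open>2\<close>.\<close>

definition list_start :: "(nat \<Rightarrow> nat list) \<Rightarrow> nat \<Rightarrow> nat" where
  "list_start adj v = (\<Sum>u<v. length (adj u))"

definition input_state :: "nat \<Rightarrow> (nat \<Rightarrow> nat list) \<Rightarrow> state" where
  "input_state n adj =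
     \<lparr>regs = (\<lambda>_. 0)(0 := n),
      arrs = (\<lambda>_ _. 0)
        (0 := (\<lambda>v. if v \<le> n then list_start adj v else 0),
         1 := (\<lambda>j. if j < list_start adj n then concat (map adj [0..<n]) ! j else 0))\<rparr>"

definition output_coloring :: "state \<Rightarrow> nat \<Rightarrow> nat" where
  "output_coloring s v = arrs s 2 v"

end

theory Submission
  imports Defs
begin

text \<open>Let \<open>C\<close> be a longest cycle of an outerpath. Since the weak dual is connected, all cycles
  lie on the vertices of \<open>C\<close>. The chords of \<open>C\<close> do not cross, and no three of them cut off pairwise
  disjoint pieces of \<open>C\<close>, since each piece contains an end of the path that is the weak dual.
  Deleting vertices of degree at most one as long as possible leaves the vertex set of \<open>C\<close> (or nothing).
  This core is swept by an edge (not necessarily of the graph) that starts at a suitable end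
  and moves on over one triangle at a time. Along the sweep the colors alternate on both sides,
  with one exception at certain turns, and the monochromatic components are stars. The deleted
  vertices are put back in reverse order, each in the color that its only neighbor does not have.

  The only step that is not obviously linear is to find the end where the sweep starts. It is
  recognized by following a chain of vertices of degree two in the core, and a vertex
  is met by at most two such chains.\<close>

section \<open>Jordan curves and arcs\<close>

text \<open>The obstacle is that the program sees only adjacency lists, no drawing. The topology
  therefore serves to prove three combinatorial facts about a longest cycle, collected in
  \<open>outerpath_structure\<close>. Its main tool is Janiszewski's theorem, which adds one piece
  of a drawing at a time as long as the piece meets the rest in a connected set. From then on an
  order of the vertices is reconstructed from counts alone: a vertex may leave the front when
  exactly one of its neighbors is unvisited. One of the two front vertices has this property,
  because otherwise there would be two chords that cross or that cut off disjoint pieces of the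
  unvisited stretch. The start has to be searched for since it must exclude the disjoint pair: a
  chord with only chordless vertices behind it cuts off a third piece. Being a star is handled
  locally, on each monochromatic edge, so that it can be kept up as an invariant while triangles are
  attached. The exception in the coloring looks two triangles ahead; so the colors are assigned in a
  second pass.\<close>

definition jordan :: "complex set \<Rightarrow> bool" where
  "jordan J \<longleftrightarrow> (\<exists>c. simple_path c \<and> pathfinish c = pathstart c \<and> path_image c = J)"

lemma jordanD:
  assumes "jordan J"
  shows "inside J \<noteq> {}" "open (inside J)" "connected (inside J)" "bounded (inside J)"
    "outside J \<noteq> {}" "open (outside J)" "connected (outside J)" "\<not> bounded (outside J)"
    "frontier (inside J) = J" "frontier (outside J) = J" "compact J" "closed J"
    "closure (inside J) = J \<union> inside J" "closure (outside J) = J \<union> outside J"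
proof -
  obtain c where c: "simple_path c" "pathfinish c = pathstart c" "path_image c = J"
    using assms jordan_def by auto
  note Jordan_inside_outside[OF c(1,2), unfolded c(3)]
  then show 1: "inside J \<noteq> {}" "open (inside J)" "connected (inside J)" "bounded (inside J)"
    "outside J \<noteq> {}" "open (outside J)" "connected (outside J)" "\<not> bounded (outside J)"
    "frontier (inside J) = J" "frontier (outside J) = J"
    by auto
  show "compact J" using c compact_simple_path_image by blast
  then show "closed J" by (rule compact_imp_closed)
  show "closure (inside J) = J \<union> inside J" "closure (outside J) = J \<union> outside J"
    using 1 closure_Un_frontier by blast+
qed

lemma jordan_arcs:
  assumes "arc p" "arc q" "pathstart p = a" "pathfinish p = b" "pathstart q = a" "pathfinish q = b"
    "path_image p \<inter> path_image q = {a, b}"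
  shows "jordan (path_image p \<union> path_image q)"
  unfolding jordan_def
proof (intro exI conjI)
  show "simple_path (p +++ reversepath q)"
    using assms by (intro simple_path_join_loop) (auto simp: arc_reversepath)
  show "path_image (p +++ reversepath q) = path_image p \<union> path_image q"
    using assms by (subst path_image_join) auto
qed (use assms in auto)

lemma connected_inside_or_outside:
  assumes "jordan J" "connected F" "F \<inter> J = {}"
  shows "F \<subseteq> inside J \<or> F \<subseteq> outside J"
proof (rule ccontr)
  assume "\<not> ?thesis"
  moreover have FJ: "F \<subseteq> inside J \<union> outside J" using assms(3) by auto
  ultimately have "inside J \<inter> F \<noteq> {}" "outside J \<inter> F \<noteq> {}" by blast+
  then show False
    using connectedD[OF assms(2) jordanD(2,6)[OF assms(1)] _ FJ] inside_Int_outside[of J] by blast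
qed

lemma unbounded_outside_jordan:
  assumes "jordan J" "connected F" "F \<inter> J = {}" "\<not> bounded F"
  shows "F \<subseteq> outside J"
  using connected_inside_or_outside[OF assms(1-3)] assms(4)
    bounded_subset[OF jordanD(4)[OF assms(1)], of F] by auto

text \<open>The outer regions are easier to compare: \<open>outside J\<close> is connected,
  unbounded and disjoint from \<open>D\<close>, hence contained in \<open>outside D\<close>. Taking
  closures adds the two curves, and complements give the claim.\<close>

lemma jordan_inside_mono:
  assumes "jordan J" "jordan D" "D \<subseteq> J \<union> inside J"
  shows "inside D \<subseteq> inside J"
proof -
  have "outside J \<inter> D = {}" using assms(3) inside_Int_outside[of J] outside_no_overlap[of J] by blast
  then have "outside J \<subseteq> outside D"
    using unbounded_outside_jordan[OF assms(2)] jordanD[OF assms(1)] by blast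
  then have "closure (outside J) \<subseteq> closure (outside D)" by (rule closure_mono)
  then have "J \<union> outside J \<subseteq> D \<union> outside D" using jordanD assms by metis
  then show ?thesis
    using inside_Un_outside[of J] inside_Int_outside[of D] inside_no_overlap[of D] by blast
qed

lemma component_inside_outside:
  assumes "connected_component (- J) x y" "x \<in> inside J" "y \<in> outside J"
  shows False
proof -
  have "connected_component_set (- J) x = connected_component_set (- J) y"
    using connected_component_eq[of y "- J" x] assms(1) by simp
  then show False using assms(2,3) by (auto simp: inside_def outside_def)
qed

lemma component_jordan:
  assumes "jordan J" "(x \<in> inside J \<and> y \<in> inside J) \<or> (x \<in> outside J \<and> y \<in> outside J)"
  shows "connected_component (- J) x y"
proof -
  have "inside J \<subseteq> - J" "outside J \<subseteq> - J"
    using inside_no_overlap[of J] outside_no_overlap[of J] by blast+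
  then show ?thesis
    using assms(2) jordanD(3,7)[OF assms(1)] unfolding connected_component_def by metis
qed

text \<open>Janiszewski's theorem: gluing the rest of \<open>J\<close> onto \<open>X\<close> along the connected set \<open>X \<inter> J\<close>
  separates no more than \<open>J\<close> does.\<close>

lemma two_sides:
  assumes J: "jordan J" and X: "compact X" and con: "connected (X \<inter> J)"
    and side: "(x \<in> inside J \<and> y \<in> inside J) \<or> (x \<in> outside J \<and> y \<in> outside J)"
    and xy: "connected_component (- X) x y"
  shows "connected_component (- (X \<union> J)) x y"
  using Janiszewski[OF X jordanD(12)[OF J] con xy] component_jordan[OF J side] by simp

lemma frontier_ball_obtain:
  assumes "z \<in> closure S" "open U" "z \<in> U"
  obtains x where "x \<in> S" "x \<in> U"
  using assms open_Int_closure_eq_empty[of U S] by blast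

lemma infinite_arc:
  fixes p :: "real \<Rightarrow> complex"
  assumes "arc p"
  shows "infinite (path_image p)"
proof -
  have "inj_on p {0..1}" using assms arc_def by blast
  then show ?thesis unfolding path_image_def using finite_imageD infinite_Icc[of "0::real" 1] by fastforce
qed

lemma arc_not_ends:
  fixes p :: "real \<Rightarrow> complex"
  assumes "arc p"
  shows "\<not> path_image p \<subseteq> {pathstart p, pathfinish p}"
  using infinite_arc[OF assms] finite_subset[of "path_image p" "{pathstart p, pathfinish p}"] by auto

text \<open>A theta curve whose arc \<open>p1\<close> is touched from an unbounded region at an
  inner point \<open>z\<close>, so that one of the other arcs must run in the middle. If neither
  did, \<open>two_sides\<close>, applied near \<open>z\<close>, would place the regions bounded by
  \<open>p1\<close>, \<open>p2\<close> and by \<open>p1\<close>, \<open>p3\<close> in each other,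
  and equal regions have equal boundaries.\<close>

lemma theta:
  fixes F :: "complex set"
  assumes p: "arc p1" "arc p2" "arc p3"
    and st: "pathstart p1 = a" "pathstart p2 = a" "pathstart p3 = a"
    and fi: "pathfinish p1 = b" "pathfinish p2 = b" "pathfinish p3 = b"
    and i12: "path_image p1 \<inter> path_image p2 = {a, b}"
    and i13: "path_image p1 \<inter> path_image p3 = {a, b}"
    and i23: "path_image p2 \<inter> path_image p3 = {a, b}"
    and F: "connected F" "\<not> bounded F" "F \<inter> (path_image p1 \<union> path_image p2 \<union> path_image p3) = {}"
    and z: "z \<in> closure F" "z \<in> path_image p1" "z \<noteq> a" "z \<noteq> b"
  shows "path_image p2 \<inter> inside (path_image p1 \<union> path_image p3) \<noteq> {} \<or>
    path_image p3 \<inter> inside (path_image p1 \<union> path_image p2) \<noteq> {}"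
proof (rule ccontr)
  let ?P1 = "path_image p1" and ?P2 = "path_image p2" and ?P3 = "path_image p3"
  let ?D2 = "?P1 \<union> ?P2" and ?D3 = "?P1 \<union> ?P3"
  assume "\<not> ?thesis"
  then have n: "?P2 \<inter> inside ?D3 = {}" "?P3 \<inter> inside ?D2 = {}" by auto
  have ab: "a \<in> ?P1" "b \<in> ?P1" "a \<in> ?P2" "b \<in> ?P2" "a \<in> ?P3" "b \<in> ?P3"
    using p st fi pathstart_in_path_image pathfinish_in_path_image by metis+
  have J2: "jordan ?D2" using jordan_arcs p st fi i12 by metis
  have J3: "jordan ?D3" using jordan_arcs p st fi i13 by metis
  have cp: "compact ?P1" "compact ?P2" "compact ?P3" using p compact_arc_image by auto
  have cn: "connected ?P2" "connected ?P3" using p connected_arc_image by auto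
  have X: "compact (?P2 \<union> ?P3)" using cp by (simp add: compact_Un)
  \<comment> \<open>A ball at \<open>z\<close> that misses \<open>p2\<close> and \<open>p3\<close>
    joins points of \<open>F\<close> and of both insides without meeting these two arcs.\<close>
  have "z \<notin> ?P2 \<union> ?P3" using z i12 i13 by blast
  then have "open (- (?P2 \<union> ?P3))" "z \<in> - (?P2 \<union> ?P3)" using X compact_imp_closed open_Compl by blast+
  then obtain r where r: "r > 0" "ball z r \<subseteq> - (?P2 \<union> ?P3)" by (meson open_contains_ball)
  have B: "connected_component (- (?P2 \<union> ?P3)) x y" if "x \<in> ball z r" "y \<in> ball z r" for x y
    unfolding connected_component_def using that r connected_ball by blast
  have zb: "z \<in> ball z r" using r by simp
  obtain f where f: "f \<in> F" "f \<in> ball z r" using frontier_ball_obtain[OF z(1) open_ball zb] .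
  have "z \<in> closure (inside ?D2)" "z \<in> closure (inside ?D3)" using jordanD(13) J2 J3 z by auto
  then obtain i2 i3 where i2: "i2 \<in> inside ?D2" "i2 \<in> ball z r" and i3: "i3 \<in> inside ?D3" "i3 \<in> ball z r"
    using frontier_ball_obtain[OF _ open_ball zb] by metis
  have Fo: "F \<subseteq> outside ?D2" "F \<subseteq> outside ?D3"
    using unbounded_outside_jordan[OF J2 F(1) _ F(2)] unbounded_outside_jordan[OF J3 F(1) _ F(2)] F(3) by blast+
  have q2: "(?P2 \<union> ?P3) \<inter> ?D2 = ?P2" and q3: "(?P2 \<union> ?P3) \<inter> ?D3 = ?P3"
    using i12 i13 i23 ab by blast+
  have s3: "inside ?D3 \<subseteq> inside ?D2"
  proof -
    have "inside ?D3 \<inter> ?D2 = {}" using n(1) inside_no_overlap[of ?D3] by blast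
    then have "inside ?D3 \<subseteq> inside ?D2 \<or> inside ?D3 \<subseteq> outside ?D2"
      using connected_inside_or_outside[OF J2] jordanD[OF J3] by blast
    moreover have "i3 \<notin> outside ?D2"
    proof
      \<comment> \<open>Both \<open>i3\<close> and \<open>f\<close> are then outside
        \<open>?D2\<close>, and the ball joins them off \<open>p2\<close> and \<open>p3\<close>.
        Gluing on \<open>p1\<close> does not separate them, although \<open>?D3\<close>
        does.\<close>
      assume "i3 \<in> outside ?D2"
      then have "connected_component (- ((?P2 \<union> ?P3) \<union> ?D2)) i3 f"
        using two_sides[OF J2 X, of i3 f] q2 cn B f i3 Fo by auto
      then have "connected_component (- ?D3) i3 f" by (rule connected_component_of_subset) auto
      then show False using component_inside_outside i3 Fo f by blast
    qed
    ultimately show ?thesis using i3 by blast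
  qed
  have s2: "inside ?D2 \<subseteq> inside ?D3"
  proof -
    have "inside ?D2 \<inter> ?D3 = {}" using n(2) inside_no_overlap[of ?D2] by blast
    then have "inside ?D2 \<subseteq> inside ?D3 \<or> inside ?D2 \<subseteq> outside ?D3"
      using connected_inside_or_outside[OF J3] jordanD[OF J2] by blast
    moreover have "i2 \<notin> outside ?D3"
    proof
      assume "i2 \<in> outside ?D3"
      then have "connected_component (- ((?P2 \<union> ?P3) \<union> ?D3)) i2 f"
        using two_sides[OF J3 X, of i2 f] q3 cn B f i2 Fo by auto
      then have "connected_component (- ?D2) i2 f" by (rule connected_component_of_subset) auto
      then show False using component_inside_outside i2 Fo f by blast
    qed
    ultimately show ?thesis using i2 by blast
  qed
  have "frontier (inside ?D2) = frontier (inside ?D3)" using subset_antisym[OF s2 s3] by simp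
  then have "?D2 = ?D3" by (simp only: jordanD(9)[OF J2] jordanD(9)[OF J3])
  then have "?P2 \<subseteq> ?P1 \<union> ?P3" by auto
  then have "?P2 \<subseteq> {a, b}" using i12 i23 by auto
  then show False using arc_not_ends[OF p(2)] unfolding st fi by simp
qed

lemma arc_interior_inside:
  assumes "jordan J" "arc p" "path_image p \<inter> J = {pathstart p, pathfinish p}" "path_image p \<inter> inside J \<noteq> {}"
  shows "path_image p - {pathstart p, pathfinish p} \<subseteq> inside J"
proof -
  let ?I = "path_image p - {pathstart p, pathfinish p}"
  have "connected ?I" using assms(2) arc_imp_simple_path connected_simple_path_endless by blast
  moreover have "?I \<inter> J = {}" using assms(3) by blast
  ultimately have "?I \<subseteq> inside J \<or> ?I \<subseteq> outside J" using connected_inside_or_outside[OF assms(1)] by blast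
  moreover have "?I \<inter> inside J \<noteq> {}" using assms(3,4) inside_no_overlap[of J] by blast
  ultimately show ?thesis using inside_Int_outside[of J] by blast
qed

fun path_edges :: "'a list \<Rightarrow> 'a set set" where
  "path_edges (x # y # zs) = insert {x, y} (path_edges (y # zs))"
| "path_edges _ = {}"

section \<open>Cycles in plane drawings\<close>

definition cycle_edges :: "'a list \<Rightarrow> 'a set set" where
  "cycle_edges xs = insert {last xs, hd xs} (path_edges xs)"

lemma path_edges_subset: "e \<in> path_edges xs \<Longrightarrow> e \<subseteq> set xs"
  by (induction xs rule: path_edges.induct) auto

lemma path_edges_conv_nth: "path_edges xs = {{xs ! i, xs ! Suc i} | i. Suc i < length xs}"
proof (induction xs rule: path_edges.induct)
  case (1 x y zs)
  have "{{(x # y # zs) ! i, (x # y # zs) ! Suc i} | i. Suc i < length (x # y # zs)} =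
    insert {x, y} {{(y # zs) ! i, (y # zs) ! Suc i} | i. Suc i < length (y # zs)}" (is "?L = ?R")
  proof
    show "?L \<subseteq> ?R"
    proof
      fix e assume "e \<in> ?L"
      then obtain i where i: "e = {(x # y # zs) ! i, (x # y # zs) ! Suc i}" "Suc i < length (x # y # zs)" by auto
      then show "e \<in> ?R" by (cases i) auto
    qed
    show "?R \<subseteq> ?L"
    proof
      fix e assume "e \<in> ?R"
      then consider "e = {x, y}" | i where "e = {(y # zs) ! i, (y # zs) ! Suc i}" "Suc i < length (y # zs)"
        by auto
      then show "e \<in> ?L"
      proof cases
        case 1 then show ?thesis by (auto intro!: exI[of _ 0])
      next
        case (2 i) then show ?thesis by (auto intro!: exI[of _ "Suc i"])
      qed
    qed
  qed
  then show ?case using 1 by simp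
qed auto

lemma walk_iff: "walk V E xs \<longleftrightarrow> xs \<noteq> [] \<and> set xs \<subseteq> V \<and> path_edges xs \<subseteq> E"
proof -
  have "successively (\<lambda>u v. {u, v} \<in> E) xs \<longleftrightarrow> path_edges xs \<subseteq> E"
    by (induction xs rule: path_edges.induct) auto
  then show ?thesis by (simp add: walk_def)
qed

lemma graph_cycle_iff:
  "graph_cycle V E xs \<longleftrightarrow> set xs \<subseteq> V \<and> cycle_edges xs \<subseteq> E \<and> distinct xs \<and> 3 \<le> length xs"
  by (auto simp: graph_cycle_def walk_iff cycle_edges_def)

lemma cycle_edges_subset: "xs \<noteq> [] \<Longrightarrow> e \<in> cycle_edges xs \<Longrightarrow> e \<subseteq> set xs"
  by (auto simp: cycle_edges_def dest: path_edges_subset)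

lemma path_edges_last_hd:
  assumes "distinct xs" "3 \<le> length xs"
  shows "{last xs, hd xs} \<notin> path_edges xs"
proof -
  obtain x y z zs where xs: "xs = x # y # z # zs"
    using assms(2) by (auto simp: numeral_3_eq_3 Suc_le_length_iff)
  then have "last xs \<in> set (z # zs)" by auto
  then have "last xs \<noteq> x" "last xs \<noteq> y" using assms(1) xs by auto
  then have "{last xs, x} \<noteq> {x, y}" by (auto simp: doubleton_eq_iff)
  moreover have "{last xs, x} \<notin> path_edges (y # z # zs)"
    using path_edges_subset[of "{last xs, x}" "y # z # zs"] assms(1) xs by auto
  ultimately show ?thesis using xs by auto
qed

lemma path_edges_append: 
  "xs \<noteq> [] \<Longrightarrow> path_edges (xs @ y # ys) = path_edges xs \<union> insert {last xs, y} (path_edges (y # ys))"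
  by (induction xs rule: path_edges.induct) auto

lemma path_edges_rev: "path_edges (rev xs) = path_edges xs"
proof (induction xs rule: path_edges.induct)
  case (1 x y zs)
  have "path_edges (rev (x # y # zs)) = path_edges (rev (y # zs) @ x # [])" by simp
  also have "\<dots> = path_edges (rev (y # zs)) \<union> {{y, x}}"
    by (subst path_edges_append) (auto simp: last_rev)
  finally show ?case using 1 by (auto simp: insert_commute)
qed auto

definition drawing :: "('a \<Rightarrow> complex) \<Rightarrow> ('a set \<Rightarrow> real \<Rightarrow> complex) \<Rightarrow> 'a set \<Rightarrow> 'a set set \<Rightarrow> complex set" where
  "drawing pos crv S F = pos ` S \<union> (\<Union>e\<in>F. path_image (crv e))"

definition same_face :: "complex set \<Rightarrow> complex \<Rightarrow> complex \<Rightarrow> bool" where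
  "same_face X x y \<longleftrightarrow> connected_component (- X) x y"

lemma same_face_mono: "same_face Y x y \<Longrightarrow> X \<subseteq> Y \<Longrightarrow> same_face X x y"
  unfolding same_face_def using connected_component_of_subset[of "- Y" x y "- X"] by auto

section \<open>Drawings of subgraphs, and cycles that separate two points\<close>

locale plane_graph =
  fixes V :: "'a set" and E :: "'a set set" and pos :: "'a \<Rightarrow> complex" and crv :: "'a set \<Rightarrow> real \<Rightarrow> complex"
  assumes simple: "simple_graph V E" and plane: "plane_embedding V E pos crv"
begin

abbreviation "dr \<equiv> drawing pos crv"

text \<open>Closure under ends of edges is what makes \<open>dr_Int\<close> true: two drawn edges
  meet at a common end, which then has to belong to both vertex sets.\<close>

definition subgraph where "subgraph S F \<longleftrightarrow> S \<subseteq> V \<and> F \<subseteq> E \<and> \<Union>F \<subseteq> S"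

lemma finV: "finite V" and finE: "finite E"
proof -
  show "finite V" using simple simple_graph_def by auto
  moreover have "E \<subseteq> Pow V" using simple by (auto simp: simple_graph_def)
  ultimately show "finite E" using finite_subset by auto
qed

lemma edgeE: assumes "e \<in> E" obtains u v where "e = {u, v}" "u \<noteq> v" "u \<in> V" "v \<in> V"
  using assms simple unfolding simple_graph_def by (metis card_2_iff insert_subset)

lemma edge_ne: "{u, v} \<in> E \<Longrightarrow> u \<noteq> v"
  by (metis edgeE doubleton_eq_iff)

lemma edge_V: "{u, v} \<in> E \<Longrightarrow> u \<in> V \<and> v \<in> V"
  by (metis edgeE doubleton_eq_iff)

lemma pos_inj: "inj_on pos V" using plane plane_embedding_def by auto

lemma crv_arc: "e \<in> E \<Longrightarrow> arc (crv e)" using plane plane_embedding_def by blast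

lemma crv_ends: "e \<in> E \<Longrightarrow> {pathstart (crv e), pathfinish (crv e)} = pos ` e"
  using plane unfolding plane_embedding_def by metis

lemma crv_V: "e \<in> E \<Longrightarrow> path_image (crv e) \<inter> pos ` V = pos ` e"
  using plane unfolding plane_embedding_def by metis

lemma crv_crv: "e \<in> E \<Longrightarrow> e' \<in> E \<Longrightarrow> e \<noteq> e' \<Longrightarrow> path_image (crv e) \<inter> path_image (crv e') \<subseteq> pos ` (e \<inter> e')"
  using plane by (simp add: plane_embedding_def)

lemma subgraph_full: "subgraph V E"
  using edgeE unfolding subgraph_def by blast

lemma pos_in_crv:
  assumes e: "e \<in> E" and v: "v \<in> V"
  shows "pos v \<in> path_image (crv e) \<longleftrightarrow> v \<in> e"
proof -
  have "e \<subseteq> V" using subgraph_full e by (auto simp: subgraph_def)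
  then have "v \<in> e \<longleftrightarrow> pos v \<in> pos ` e" using inj_on_image_mem_iff[OF pos_inj v] by simp
  also have "\<dots> \<longleftrightarrow> pos v \<in> path_image (crv e)" unfolding crv_V[OF e, symmetric] using v by simp
  finally show ?thesis by simp
qed

text \<open>This turns later questions about the intersection of curves into questions about sets of
  vertices and edges.\<close>

lemma dr_Int:
  assumes "subgraph S F" "subgraph S' F'"
  shows "dr S F \<inter> dr S' F' = dr (S \<inter> S') (F \<inter> F')"
proof
  show "dr (S \<inter> S') (F \<inter> F') \<subseteq> dr S F \<inter> dr S' F'" by (auto simp: drawing_def)
  have SV: "S \<subseteq> V" "S' \<subseteq> V" "F \<subseteq> E" "F' \<subseteq> E" "\<Union>F \<subseteq> S" "\<Union>F' \<subseteq> S'" using assms subgraph_def by auto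
  show "dr S F \<inter> dr S' F' \<subseteq> dr (S \<inter> S') (F \<inter> F')"
  proof
    fix z assume z: "z \<in> dr S F \<inter> dr S' F'"
    consider (vv) u v where "u \<in> S" "v \<in> S'" "z = pos u" "z = pos v"
      | (ve) u e where "u \<in> S" "e \<in> F'" "z = pos u" "z \<in> path_image (crv e)"
      | (ev) v e where "v \<in> S'" "e \<in> F" "z = pos v" "z \<in> path_image (crv e)"
      | (ee) e e' where "e \<in> F" "e' \<in> F'" "z \<in> path_image (crv e)" "z \<in> path_image (crv e')"
      using z unfolding drawing_def by blast
    then show "z \<in> dr (S \<inter> S') (F \<inter> F')"
    proof cases
      case vv
      then have "u = v" using pos_inj SV by (metis inj_onD subsetD)
      then show ?thesis using vv by (auto simp: drawing_def)
    next
      case ve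
      then have "u \<in> e" using pos_in_crv SV by blast
      then show ?thesis using ve SV by (auto simp: drawing_def)
    next
      case ev
      then have "v \<in> e" using pos_in_crv SV by blast
      then show ?thesis using ev SV by (auto simp: drawing_def)
    next
      case ee
      show ?thesis
      proof (cases "e = e'")
        case True then show ?thesis using ee by (auto simp: drawing_def)
      next
        case False
        then have "z \<in> pos ` (e \<inter> e')" using crv_crv ee SV by blast
        moreover have "e \<inter> e' \<subseteq> S \<inter> S'" using ee SV by blast
        ultimately show ?thesis by (auto simp: drawing_def)
      qed
    qed
  qed
qed

lemma dr_mono: "S \<subseteq> S' \<Longrightarrow> F \<subseteq> F' \<Longrightarrow> dr S F \<subseteq> dr S' F'"
  by (auto simp: drawing_def)

lemma dr_edge: assumes "{u, v} \<in> E" shows "dr {u, v} {{u, v}} = path_image (crv {u, v})"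
  using crv_V[OF assms] by (auto simp: drawing_def)

lemma subgraph_edge: "{u, v} \<in> E \<Longrightarrow> subgraph {u, v} {{u, v}}"
  using edge_V by (auto simp: subgraph_def)

lemma compact_dr: assumes "subgraph S F" shows "compact (dr S F)"
proof -
  have "finite S" "finite F" using assms finV finE finite_subset unfolding subgraph_def by metis+
  then show ?thesis unfolding drawing_def
    using assms crv_arc by (intro compact_Un compact_UN compact_arc_image) (auto simp: subgraph_def finite_imp_compact)
qed

lemma edge_arc:
  assumes "{u, v} \<in> E"
  obtains g where "arc g" "pathstart g = pos u" "pathfinish g = pos v" "path_image g = path_image (crv {u, v})"
proof -
  have "{pathstart (crv {u, v}), pathfinish (crv {u, v})} = {pos u, pos v}" using crv_ends[OF assms] by simp
  then consider "pathstart (crv {u, v}) = pos u" "pathfinish (crv {u, v}) = pos v"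
    | "pathstart (crv {u, v}) = pos v" "pathfinish (crv {u, v}) = pos u" by (auto simp: doubleton_eq_iff)
  then show ?thesis
  proof cases
    case 1 then show ?thesis using that crv_arc[OF assms] by blast
  next
    case 2 then show ?thesis using that[of "reversepath (crv {u, v})"] crv_arc[OF assms] by (simp add: arc_reversepath)
  qed
qed

lemma subgraph_path: "walk V E xs \<Longrightarrow> subgraph (set xs) (path_edges xs)"
  unfolding subgraph_def walk_iff using path_edges_subset by fastforce

lemma path_arc:
  assumes "walk V E xs" "distinct xs" "2 \<le> length xs"
  obtains g where "arc g" "pathstart g = pos (hd xs)" "pathfinish g = pos (last xs)"
    "path_image g = dr (set xs) (path_edges xs)"
proof -
  have "\<exists>g. arc g \<and> pathstart g = pos (hd xs) \<and> pathfinish g = pos (last xs) \<and>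
    path_image g = dr (set xs) (path_edges xs)"
    using assms
  proof (induction xs rule: path_edges.induct)
    case (1 x y zs)
    have e: "{x, y} \<in> E" using 1(2) by (auto simp: walk_iff)
    obtain g where g: "arc g" "pathstart g = pos x" "pathfinish g = pos y" "path_image g = dr {x, y} {{x, y}}"
      using edge_arc[OF e] dr_edge[OF e] by metis
    show ?case
    proof (cases zs)
      case Nil
      then show ?thesis using g by auto
    next
      case (Cons w ws)
      have w: "walk V E (y # zs)" using 1(2) by (auto simp: walk_iff)
      have "\<exists>g. arc g \<and> pathstart g = pos (hd (y # zs)) \<and> pathfinish g = pos (last (y # zs)) \<and>
        path_image g = dr (set (y # zs)) (path_edges (y # zs))"
        by (rule 1(1)) (use 1 w Cons in auto)
      then obtain h where h: "arc h" "pathstart h = pos y" "pathfinish h = pos (last (y # zs))"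
        "path_image h = dr (set (y # zs)) (path_edges (y # zs))" by auto
      have "{x, y} \<notin> path_edges (y # zs)" using 1(3) path_edges_subset[of "{x, y}" "y # zs"] by auto
      then have i: "path_image g \<inter> path_image h = {pos y}"
        unfolding g(4) h(4) using 1(3)
        by (subst dr_Int[OF subgraph_edge[OF e] subgraph_path[OF w]]) (auto simp: drawing_def)
      show ?thesis
      proof (intro exI conjI)
        show "arc (g +++ h)" using arc_join[of g h] g h i by auto
        show "path_image (g +++ h) = dr (set (x # y # zs)) (path_edges (x # y # zs))"
          using g h by (subst path_image_join) (auto simp: drawing_def)
      qed (use g h in auto)
    qed
  qed auto
  then show ?thesis using that by blast
qed

lemma connected_path: assumes "walk V E xs" "distinct xs" shows "connected (dr (set xs) (path_edges xs))"
proof (cases "2 \<le> length xs")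
  case True
  then show ?thesis using path_arc[OF assms] connected_arc_image by metis
next
  case False
  then have "length xs = 1" using assms(1) by (cases "length xs") (auto simp: walk_iff)
  then obtain x where "xs = [x]" by (auto simp: length_Suc_conv)
  then show ?thesis by (simp add: drawing_def)
qed

abbreviation "cyc xs \<equiv> graph_cycle V E xs"
abbreviation "jc xs \<equiv> dr (set xs) (cycle_edges xs)"

lemma subgraph_cycle: "cyc xs \<Longrightarrow> subgraph (set xs) (cycle_edges xs)"
  unfolding subgraph_def graph_cycle_iff using cycle_edges_subset[of xs] by fastforce

lemma jordan_cycle:
  assumes "cyc xs"
  shows "jordan (jc xs)"
proof -
  have w: "walk V E xs" "distinct xs" "3 \<le> length xs" and e: "{last xs, hd xs} \<in> E"
    using assms graph_cycle_def by auto
  obtain g where g: "arc g" "pathstart g = pos (hd xs)" "pathfinish g = pos (last xs)"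
    "path_image g = dr (set xs) (path_edges xs)" using path_arc[OF w(1,2)] w(3) by auto
  have e': "{hd xs, last xs} \<in> E" using e by (simp add: insert_commute)
  obtain h where h: "arc h" "pathstart h = pos (hd xs)" "pathfinish h = pos (last xs)"
    "path_image h = dr {hd xs, last xs} {{hd xs, last xs}}" using edge_arc[OF e'] dr_edge[OF e'] by metis
  have "xs \<noteq> []" using w by auto
  then have "path_image g \<inter> path_image h = {pos (hd xs), pos (last xs)}"
    unfolding g(4) h(4) using path_edges_last_hd[OF w(2,3)]
    by (subst dr_Int[OF subgraph_path[OF w(1)] subgraph_edge[OF e']]) (auto simp: drawing_def insert_commute)
  then have "jordan (path_image g \<union> path_image h)" using jordan_arcs[of g h] g h by auto
  moreover have "path_image g \<union> path_image h = jc xs"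
    unfolding g(4) h(4) using \<open>xs \<noteq> []\<close> by (auto simp: drawing_def cycle_edges_def insert_commute)
  ultimately show ?thesis by simp
qed

text \<open>The edges of \<open>F\<close> are added one by one. A new edge either closes a cycle,
  which meets the drawing so far in a path, or it links two parts that it meets in single points. In
  both cases the pieces meet in connected sets and Janiszewski's theorem applies.\<close>

lemma separating_cycle:
  assumes "F \<subseteq> E" "x \<notin> dr V E" "y \<notin> dr V E"
    "\<And>xs. cyc xs \<Longrightarrow> cycle_edges xs \<subseteq> F \<Longrightarrow> same_face (jc xs) x y"
  shows "same_face (dr V F) x y"
proof -
  have "finite F" using assms(1) finE finite_subset by blast
  then show ?thesis using assms(1,4)
  proof (induction F rule: finite_induct)
    case empty
    have "connected (- (pos ` V))" using finV connected_open_delete_finite[of UNIV "pos ` V"] connected_UNIV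
      by (simp add: Compl_eq_Diff_UNIV)
    moreover have "x \<in> - (pos ` V)" "y \<in> - (pos ` V)" using assms(2,3) by (auto simp: drawing_def)
    ultimately have "connected_component (- (pos ` V)) x y"
      unfolding connected_component_def by (intro exI[of _ "- (pos ` V)"]) simp
    then show ?case by (simp add: same_face_def drawing_def)
  next
    case (insert e F)
    have F: "same_face (dr V F) x y" using insert by blast
    obtain u v where uv: "e = {u, v}" "u \<noteq> v" "u \<in> V" "v \<in> V" using insert edgeE by (metis insert_subset)
    have eE: "{u, v} \<in> E" using insert uv by auto
    have FE: "F \<subseteq> E" using insert by auto
    have sF: "subgraph V F" using FE subgraph_full by (auto simp: subgraph_def)
    \<comment> \<open>The vertices that \<open>u\<close> reaches in \<open>F\<close>. Paths rather
      than walks are demanded, so that a path to \<open>v\<close> closes at once to a cycle.\<close>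
    define U where "U = {w. \<exists>xs. walk V F xs \<and> distinct xs \<and> hd xs = u \<and> last xs = w}"
    have uU: "u \<in> U" unfolding U_def using uv by (auto simp: walk_iff intro!: exI[of _ "[u]"])
    have Uclosed: "w' \<in> U" if ww: "w \<in> U" "{w, w'} \<in> F" for w w'
    proof -
      obtain xs where xs: "walk V F xs" "distinct xs" "hd xs = u" "last xs = w" using ww U_def by auto
      show ?thesis
      proof (cases "w' \<in> set xs")
        case True
        then obtain ys zs where s: "xs = ys @ w' # zs" by (meson split_list)
        have "walk V F (ys @ [w'])" using xs(1) unfolding s walk_iff
          by (cases "ys = []") (auto simp: path_edges_append)
        moreover have "hd (ys @ [w']) = u" using xs s by (cases ys) auto
        ultimately show ?thesis unfolding U_def using xs s by (auto intro!: exI[of _ "ys @ [w']"])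
      next
        case False
        have "w' \<in> V" using ww FE edge_V by blast
        then have "walk V F (xs @ [w'])" using xs ww unfolding walk_iff
          by (auto simp: path_edges_append)
        then show ?thesis unfolding U_def using xs False by (auto simp: walk_iff intro!: exI[of _ "xs @ [w']"])
      qed
    qed
    have xye: "x \<notin> path_image (crv e)" "y \<notin> path_image (crv e)"
      using assms(2,3) eE uv by (auto simp: drawing_def)
    show ?case
    proof (cases "v \<in> U")
      case True
      then obtain xs where xs: "walk V F xs" "distinct xs" "hd xs = u" "last xs = v" using U_def by auto
      have "3 \<le> length xs"
      proof (rule ccontr)
        assume l: "\<not> 3 \<le> length xs"
        have "xs \<noteq> []" using xs walk_iff by auto
        then have "\<exists>a b. xs = [a] \<or> xs = [a, b]" using l
          by (cases xs; cases "tl xs") (auto simp: numeral_3_eq_3 Suc_le_eq)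
        then obtain a b where "xs = [a] \<or> xs = [a, b]" by blast
        then show False using xs uv insert(2) by (auto simp: walk_iff)
      qed
      then have c: "cyc xs" using xs eE FE by (auto simp: graph_cycle_def walk_iff insert_commute)
      have ce: "cycle_edges xs = insert e (path_edges xs)" using xs uv by (auto simp: cycle_edges_def insert_commute)
      then have "cycle_edges xs \<subseteq> insert e F" using xs by (auto simp: walk_iff)
      then have "same_face (jc xs) x y" by (rule insert.prems(2)[OF c])
      moreover have "connected (dr V F \<inter> jc xs)"
      proof -
        have "F \<inter> cycle_edges xs = path_edges xs" using ce insert(2) xs by (auto simp: walk_iff)
        moreover have "V \<inter> set xs = set xs" using xs by (auto simp: walk_iff)
        ultimately have "dr V F \<inter> jc xs = dr (set xs) (path_edges xs)"
          using dr_Int[OF sF subgraph_cycle[OF c]] by simp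
        moreover have "walk V E xs" using xs FE by (auto simp: walk_iff)
        ultimately show ?thesis using connected_path xs by simp
      qed
      ultimately have "same_face (dr V F \<union> jc xs) x y"
        unfolding same_face_def
        by (intro Janiszewski compact_dr sF jordanD(12) jordan_cycle c) (use F in \<open>auto simp: same_face_def\<close>)
      moreover have "dr V F \<union> jc xs = dr V (insert e F)" using ce xs
        by (auto simp: drawing_def walk_iff)
      ultimately show ?thesis by simp
    next
      case False
      \<comment> \<open>Without a cycle through \<open>e\<close> the drawing falls into the part at
        \<open>u\<close>, the edge \<open>e\<close> and the rest, glued at the single points
        \<open>pos u\<close> and \<open>pos v\<close>. Janiszewski's theorem is used once at each of
        them.\<close>
      define FU where "FU = {f \<in> F. f \<subseteq> U}"
      have UV: "U \<subseteq> V" unfolding U_def walk_iff using last_in_set by fastforce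
      have sep: "f \<subseteq> V - U" if f: "f \<in> F - FU" for f
      proof -
        obtain a b where ab: "f = {a, b}" "a \<in> V" "b \<in> V" using f FE edgeE by (metis DiffD1 subsetD)
        have "a \<in> U \<longleftrightarrow> b \<in> U" using Uclosed[of a b] Uclosed[of b a] that ab by (auto simp: insert_commute)
        then show ?thesis using that ab by (auto simp: FU_def)
      qed
      have s1: "subgraph U FU" using UV FE by (auto simp: subgraph_def FU_def)
      have s2: "subgraph (V - U) (F - FU)" using sep FE by (auto simp: subgraph_def)
      have s3: "subgraph (insert v U) (insert e FU)" using s1 eE uv uU by (auto simp: subgraph_def)
      have arc_e: "same_face (dr {u, v} {e}) x y"
      proof -
        have "connected (- path_image (crv e))" using connected_arc_complement[OF crv_arc] eE uv by auto
        then show ?thesis using xye dr_edge[OF eE] uv unfolding same_face_def connected_component_def by auto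
      qed
      have eF: "e \<notin> F" by fact
      have "dr U FU \<inter> dr {u, v} {e} = {pos u}"
        using dr_Int[OF s1 subgraph_edge[OF eE]] uU False eF uv by (auto simp: drawing_def FU_def)
      moreover have "same_face (dr U FU) x y" by (rule same_face_mono[OF F dr_mono]) (use UV in \<open>auto simp: FU_def\<close>)
      ultimately have "same_face (dr U FU \<union> dr {u, v} {e}) x y"
        using arc_e compact_dr[OF s1] compact_imp_closed[OF compact_dr[OF subgraph_edge[OF eE]]] uv
        unfolding same_face_def by (intro Janiszewski) auto
      moreover have "dr U FU \<union> dr {u, v} {e} = dr (insert v U) (insert e FU)" using uU by (auto simp: drawing_def)
      ultimately have 1: "same_face (dr (insert v U) (insert e FU)) x y" by simp
      have 2: "same_face (dr (V - U) (F - FU)) x y" by (rule same_face_mono[OF F dr_mono]) auto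
      have "insert v U \<inter> (V - U) = {v}" "insert e FU \<inter> (F - FU) = {}" using False uv eF by auto
      then have "dr (insert v U) (insert e FU) \<inter> dr (V - U) (F - FU) = {pos v}"
        using dr_Int[OF s3 s2] by (simp add: drawing_def)
      then have "same_face (dr (insert v U) (insert e FU) \<union> dr (V - U) (F - FU)) x y"
        using 1 2 compact_dr[OF s3] compact_imp_closed[OF compact_dr[OF s2]]
        unfolding same_face_def by (intro Janiszewski) auto
      moreover have "dr (insert v U) (insert e FU) \<union> dr (V - U) (F - FU) = dr V (insert e F)"
        using UV uv by (auto simp: drawing_def FU_def)
      ultimately show ?thesis by simp
    qed
  qed
qed

end

section \<open>Faces along the edges of a cycle\<close>

lemma arc_closure_interior:
  fixes g :: "real \<Rightarrow> complex"
  assumes "arc g"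
  shows "path_image g \<subseteq> closure (path_image g - {pathstart g, pathfinish g})"
proof -
  have i: "inj_on g {0..1}" and c: "continuous_on {0..1} g" using assms by (auto simp: arc_def path_def)
  have "g t \<in> path_image g - {pathstart g, pathfinish g}" if t: "t \<in> {0<..<1}" for t
  proof -
    have "g t \<noteq> g 0" "g t \<noteq> g 1" using t inj_on_eq_iff[OF i, of t 0] inj_on_eq_iff[OF i, of t 1] by auto
    then show ?thesis using t by (auto simp: path_image_def pathstart_def pathfinish_def)
  qed
  then have "g ` {0<..<1} \<subseteq> closure (path_image g - {pathstart g, pathfinish g})" using closure_subset by blast
  moreover have "closure {0<..<1::real} = {0..1}" by simp
  ultimately show ?thesis using image_closure_subset[of "{0<..<1}" g] c closed_closure
    unfolding path_image_def by metis
qed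

lemma path_edges_append': 
  assumes "xs \<noteq> []" "ys \<noteq> []"
  shows "path_edges (xs @ ys) = insert {last xs, hd ys} (path_edges xs \<union> path_edges ys)"
  using path_edges_append[OF assms(1), of "hd ys" "tl ys"] assms(2) by simp

lemma cycle_edges_rotate:
  assumes "xs \<noteq> []" "ys \<noteq> []"
  shows "cycle_edges (xs @ ys) = cycle_edges (ys @ xs)"
  using assms by (auto simp: cycle_edges_def path_edges_append')

lemma cycle_edges_rev: "xs \<noteq> [] \<Longrightarrow> cycle_edges (rev xs) = cycle_edges xs"
  by (simp add: cycle_edges_def path_edges_rev hd_rev last_rev insert_commute)

lemma graph_cycle_rotate: "graph_cycle V E (xs @ ys) \<Longrightarrow> graph_cycle V E (ys @ xs)"
  by (cases "xs = [] \<or> ys = []") (auto simp: graph_cycle_iff cycle_edges_rotate)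

lemma graph_cycle_rev: "graph_cycle V E xs \<Longrightarrow> graph_cycle V E (rev xs)"
  unfolding graph_cycle_iff by (cases "xs = []") (auto simp: cycle_edges_rev)

lemma cycle_edges_split:
  "cycle_edges (u # ys @ v # zs) = path_edges (u # ys @ [v]) \<union> path_edges (v # zs @ [u])"
proof -
  have "path_edges (u # ys @ v # zs) = path_edges (u # ys @ [v]) \<union> path_edges (v # zs)"
    using path_edges_append[of "u # ys" v zs] path_edges_append[of "u # ys" v "[]"] by auto
  moreover have "path_edges (v # zs @ [u]) = insert {last (v # zs), u} (path_edges (v # zs))"
    using path_edges_append[of "v # zs" u "[]"] by auto
  ultimately show ?thesis by (auto simp: cycle_edges_def)
qed

text \<open>Allows any edge of a cycle to be treated as its closing edge.\<close>

lemma cycle_edges_obtain: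
  assumes "e \<in> cycle_edges xs" "xs \<noteq> []"
  obtains ys where "mset ys = mset xs" "cycle_edges ys = cycle_edges xs" "e = {last ys, hd ys}"
proof (cases "e = {last xs, hd xs}")
  case True then show ?thesis using that[of xs] by auto
next
  case False
  then obtain i where i: "e = {xs ! i, xs ! Suc i}" "Suc i < length xs"
    using assms by (auto simp: cycle_edges_def path_edges_conv_nth)
  let ?a = "take (Suc i) xs" and ?b = "drop (Suc i) xs"
  have ab: "?a \<noteq> []" "?b \<noteq> []" "?a @ ?b = xs" using i by auto
  show ?thesis
  proof (rule that[of "?b @ ?a"])
    show "mset (?b @ ?a) = mset xs" using ab(3) by (metis mset_append union_commute)
    show "cycle_edges (?b @ ?a) = cycle_edges xs" using cycle_edges_rotate[OF ab(1,2)] ab(3) by simp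
    show "e = {last (?b @ ?a), hd (?b @ ?a)}" using i ab
      by (simp add: take_Suc_conv_app_nth hd_drop_conv_nth)
  qed
qed

context plane_graph
begin

lemma subgraph_remove: "subgraph V (E - D)"
  using subgraph_full by (auto simp: subgraph_def)

text \<open>Otherwise the arc would meet the drawing only in ends of \<open>e\<close>, but an arc
  has infinitely many points.\<close>

lemma edge_in_drawing:
  assumes "e \<in> E" "subgraph S F" "path_image (crv e) \<subseteq> dr S F"
  shows "e \<in> F"
proof (rule ccontr)
  assume n: "e \<notin> F"
  obtain u v where uv: "e = {u, v}" using assms edgeE by metis
  have "path_image (crv e) = dr e {e} \<inter> dr S F" using assms(1,3) dr_edge uv by auto
  also have "\<dots> = dr (e \<inter> S) ({e} \<inter> F)" using dr_Int[OF subgraph_edge assms(2)] assms(1) uv by metis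
  also have "\<dots> = pos ` (e \<inter> S)" using n by (auto simp: drawing_def)
  finally have "finite (path_image (crv e))" using uv by simp
  then show False using infinite_arc[OF crv_arc[OF assms(1)]] by simp
qed

lemma pos_in_dr: "subgraph S F \<Longrightarrow> v \<in> V \<Longrightarrow> pos v \<in> dr S F \<longleftrightarrow> v \<in> S"
  using dr_Int[of "{v}" "{}" S F] by (auto simp: subgraph_def drawing_def split: if_splits)

abbreviation "FS \<equiv> faces V E pos crv"

lemma faces_components: "FS = components (- dr V E)"
  by (simp add: faces_def drawing_def)

lemma faceD: assumes "F \<in> FS" shows "open F" "connected F" "F \<inter> dr V E = {}" "F \<noteq> {}"
proof -
  have "open (- dr V E)" using compact_dr[OF subgraph_full] compact_imp_closed open_Compl by blast
  then show "open F" using assms open_components faces_components by metis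
qed (use assms in_components_connected in_components_subset in_components_nonempty faces_components in \<open>metis | fastforce\<close>)+

lemma same_face_faces:
  assumes "F \<in> FS" "F' \<in> FS" "x \<in> F" "y \<in> F'" "same_face (dr V E) x y"
  shows "F = F'"
proof -
  have "F = connected_component_set (- dr V E) x" "F' = connected_component_set (- dr V E) y"
    using assms faces_components by (metis components_iff connected_component_eq)+
  then show ?thesis using assms(5) connected_component_eq[of y "- dr V E" x] by (simp add: same_face_def)
qed

text \<open>The setting for \<open>two_sides\<close>: the drawing without \<open>e\<close> and the
  curve of \<open>C\<close> meet in the rest of the cycle, a path, and together they make up the
  whole drawing.\<close>

lemma cycle_minus_edge:
  assumes "cyc C" "e \<in> cycle_edges C"
  shows "connected (dr V (E - {e}) \<inter> jc C)" "dr V (E - {e}) \<union> jc C = dr V E" 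
    "dr V (E - {e}) \<inter> path_image (crv e) = pos ` e" "path_image (crv e) \<subseteq> jc C" "e \<in> E"
proof -
  have "C \<noteq> []" using assms by (auto simp: graph_cycle_iff)
  then obtain P where P: "mset P = mset C" "cycle_edges P = cycle_edges C" "e = {last P, hd P}"
    using cycle_edges_obtain assms(2) by metis
  have sP: "set P = set C" "length P = length C" "distinct P"
    using mset_eq_setD[OF P(1)] mset_eq_length[OF P(1)] mset_eq_imp_distinct_iff[OF P(1)] assms(1)
    by (simp_all add: graph_cycle_iff)
  have cP: "cyc P" using assms(1) P sP by (auto simp: graph_cycle_iff)
  have e: "e \<in> E" using assms by (auto simp: graph_cycle_iff)
  then show "e \<in> E" .
  have "e \<notin> path_edges P" using path_edges_last_hd[of P] sP assms P by (auto simp: graph_cycle_iff)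
  moreover have "cycle_edges P = insert e (path_edges P)" by (simp add: cycle_edges_def P(3))
  ultimately have pe: "path_edges P = cycle_edges C - {e}" using P(2) by auto
  have w: "walk V E P" using cP graph_cycle_def by blast
  have "subgraph V (E - {e})" by (rule subgraph_remove)
  then have "dr V (E - {e}) \<inter> jc C = dr (V \<inter> set C) ((E - {e}) \<inter> cycle_edges C)"
    using dr_Int subgraph_cycle[OF assms(1)] by blast
  also have "\<dots> = dr (set P) (path_edges P)"
  proof -
    have "V \<inter> set C = set P" "(E - {e}) \<inter> cycle_edges C = path_edges P"
      using sP pe assms(1) by (auto simp: graph_cycle_iff)
    then show ?thesis by simp
  qed
  finally show "connected (dr V (E - {e}) \<inter> jc C)" using connected_path[OF w sP(3)] by simp
  show "dr V (E - {e}) \<union> jc C = dr V E" using assms by (auto simp: drawing_def graph_cycle_iff)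
  obtain u v where uv: "e = {u, v}" using e edgeE by metis
  have "dr V (E - {e}) \<inter> dr {u, v} {{u, v}} = dr (V \<inter> {u, v}) ((E - {e}) \<inter> {{u, v}})"
    using dr_Int \<open>subgraph V (E - {e})\<close> subgraph_edge e uv by blast
  also have "\<dots> = pos ` e" using uv e edge_V by (auto simp: drawing_def)
  finally show "dr V (E - {e}) \<inter> path_image (crv e) = pos ` e" using dr_edge e uv by simp
  show "path_image (crv e) \<subseteq> jc C" using assms(2) by (auto simp: drawing_def)
qed

lemma near_edge:
  assumes "e \<in> E" "p \<in> path_image (crv e) - pos ` e" "dr V (E - {e}) \<inter> path_image (crv e) = pos ` e"
  obtains r where "r > 0" "ball p r \<inter> dr V (E - {e}) = {}"
proof -
  have "subgraph V (E - {e})" by (rule subgraph_remove)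
  then have "open (- dr V (E - {e}))" using compact_dr compact_imp_closed open_Compl by blast
  moreover have "p \<in> - dr V (E - {e})" using assms(2,3) by blast
  ultimately obtain r where "r > 0" "ball p r \<subseteq> - dr V (E - {e})" by (meson open_contains_ball)
  then show ?thesis using that[of r] by blast
qed

text \<open>Near an inner point of \<open>e\<close> nothing but \<open>e\<close> is drawn. Points of
  the two faces there are joined off all other edges and lie on the same side of \<open>C\<close>,
  so restoring \<open>C\<close> does not separate them.\<close>

lemma edge_face_unique:
  assumes "cyc C" "e \<in> cycle_edges C" "F \<in> FS" "F' \<in> FS" "F \<subseteq> inside (jc C)" "F' \<subseteq> inside (jc C)"
    "path_image (crv e) \<subseteq> frontier F" "path_image (crv e) \<subseteq> frontier F'"
  shows "F = F'"
proof -
  note c = cycle_minus_edge[OF assms(1,2)]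
  have a: "arc (crv e)" using crv_arc c(5) by blast
  have "\<not> path_image (crv e) \<subseteq> pos ` e" using arc_not_ends[OF a] crv_ends[OF c(5)] by simp
  then obtain p where p: "p \<in> path_image (crv e) - pos ` e" by blast
  obtain r where r: "r > 0" "ball p r \<inter> dr V (E - {e}) = {}" using near_edge[OF c(5) p c(3)] .
  have "p \<in> closure F" "p \<in> closure F'" using p assms(7,8) by (auto simp: frontier_def)
  then obtain x y where xy: "x \<in> F" "x \<in> ball p r" "y \<in> F'" "y \<in> ball p r"
    using frontier_ball_obtain[OF _ open_ball] r(1) centre_in_ball by metis
  have "connected_component (- dr V (E - {e})) x y"
    unfolding connected_component_def using xy r connected_ball by blast
  moreover have "compact (dr V (E - {e}))" using compact_dr[OF subgraph_remove] .
  ultimately have "connected_component (- (dr V (E - {e}) \<union> jc C)) x y"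
    using two_sides[OF jordan_cycle[OF assms(1)] _ c(1)] xy assms(5,6) by blast
  then have "same_face (dr V E) x y" using c(2) by (simp add: same_face_def)
  then show ?thesis using same_face_faces assms xy by blast
qed

text \<open>The face of a point inside \<open>C\<close> near one inner point of \<open>e\<close>
  comes near every other inner point as well: slide along \<open>e\<close> itself, which is absent
  from the drawing without \<open>e\<close>, and then restore \<open>C\<close> by
  \<open>two_sides\<close>.\<close>

lemma edge_face_exists:
  assumes "cyc C" "e \<in> cycle_edges C"
  obtains F where "F \<in> FS" "F \<subseteq> inside (jc C)" "path_image (crv e) \<subseteq> frontier F"
proof -
  note c = cycle_minus_edge[OF assms(1,2)]
  note J = jordan_cycle[OF assms(1)]
  let ?X = "dr V (E - {e})"
  have a: "arc (crv e)" using crv_arc c(5) by blast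
  have ends: "{pathstart (crv e), pathfinish (crv e)} = pos ` e" using crv_ends[OF c(5)] .
  let ?I = "path_image (crv e) - pos ` e"
  have I: "connected ?I" using connected_simple_path_endless[OF arc_imp_simple_path[OF a]] ends by simp
  have "\<not> path_image (crv e) \<subseteq> pos ` e" using arc_not_ends[OF a] ends by simp
  then obtain p where p: "p \<in> ?I" by blast
  have comp: "compact ?X" using compact_dr[OF subgraph_remove] .
  have pick: "\<exists>q r. q \<in> inside (jc C) \<and> q \<in> U \<and> q \<in> ball p' r \<and> ball p' r \<inter> ?X = {} \<and> r > 0"
    if p': "p' \<in> ?I" "open U" "p' \<in> U" for p' U
  proof -
    obtain r where r: "r > 0" "ball p' r \<inter> ?X = {}" using near_edge[OF c(5) p'(1) c(3)] .
    have "p' \<in> closure (inside (jc C))" using p' c(4) jordanD(13)[OF J] by blast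
    then show ?thesis using frontier_ball_obtain[of p' "inside (jc C)" "U \<inter> ball p' r"] p' r
      by (metis IntE IntI centre_in_ball open_Int open_ball)
  qed
  obtain q r where q: "q \<in> inside (jc C)" "q \<in> ball p r" "ball p r \<inter> ?X = {}" "r > 0"
    using pick[OF p open_UNIV] by blast
  have qX: "q \<notin> dr V E" using q inside_no_overlap[of "jc C"] c(2) by blast
  define F where "F = connected_component_set (- dr V E) q"
  have F: "F \<in> FS" "q \<in> F" using qX by (auto simp: F_def faces_components components_def)
  have "F \<subseteq> - jc C" using faceD(3)[OF F(1)] c(2) by blast
  then have "F \<subseteq> inside (jc C)"
    using connected_inside_or_outside[OF J faceD(2)[OF F(1)]] F(2) q(1) inside_Int_outside[of "jc C"] by blast
  moreover have "?I \<subseteq> closure F"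
  proof
    fix p' assume p': "p' \<in> ?I"
    show "p' \<in> closure F"
    proof (rule ccontr)
      assume "p' \<notin> closure F"
      then obtain q' r' where q': "q' \<in> inside (jc C)" "q' \<in> - closure F" "q' \<in> ball p' r'" "ball p' r' \<inter> ?X = {}" "r' > 0"
        using pick[OF p', of "- closure F"] by auto
      have "?I \<inter> ?X = {}" using c(3) by blast
      \<comment> \<open>Two balls strung on the open arc of \<open>e\<close>: a connected set from
        \<open>q\<close> to \<open>q'\<close> that misses every other edge.\<close>
      moreover have "connected (ball p r \<union> ?I \<union> ball p' r')"
      proof (intro connected_Un)
        show "ball p r \<inter> ?I \<noteq> {}" using p q centre_in_ball by blast
        show "(ball p r \<union> ?I) \<inter> ball p' r' \<noteq> {}" using p' q' centre_in_ball by blast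
      qed (use I in auto)
      ultimately have "connected_component (- ?X) q q'"
        unfolding connected_component_def using q q'
        by (intro exI[of _ "ball p r \<union> ?I \<union> ball p' r'"]) blast
      then have "connected_component (- (?X \<union> jc C)) q q'"
        using two_sides[OF J comp c(1), of q q'] q(1) q'(1) by simp
      then have "q' \<in> F" using c(2) by (simp add: F_def)
      then show False using q' closure_subset by blast
    qed
  qed
  then have "closure ?I \<subseteq> closure F" by (simp add: closure_minimal)
  then have "path_image (crv e) \<subseteq> closure F" using arc_closure_interior[OF a] ends by auto
  then have "path_image (crv e) \<subseteq> frontier F"
    using faceD(1,3)[OF F(1)] c(2,4) by (auto simp: frontier_def interior_open)
  ultimately show ?thesis using that F by blast
qed

end

section \<open>Outerplanar drawings\<close>

definition longest_cycle :: "'a set \<Rightarrow> 'a set set \<Rightarrow> 'a list \<Rightarrow> bool" where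
  "longest_cycle V E C \<longleftrightarrow> graph_cycle V E C \<and> (\<forall>D. graph_cycle V E D \<longrightarrow> length D \<le> length C)"

lemma longest_cycle_rotate: "longest_cycle V E (xs @ ys) \<Longrightarrow> longest_cycle V E (ys @ xs)"
  by (auto simp: longest_cycle_def add.commute intro: graph_cycle_rotate)

lemma longest_cycle_rev: "longest_cycle V E xs \<Longrightarrow> longest_cycle V E (rev xs)"
  by (auto simp: longest_cycle_def intro: graph_cycle_rev)

locale outerplane_graph = plane_graph +
  fixes F0
  assumes F0: "F0 \<in> faces V E pos crv" "\<not> bounded F0"
    and outer: "\<And>v. v \<in> V \<Longrightarrow> pos v \<in> frontier F0"
begin

lemma pos_closure_F0: "v \<in> V \<Longrightarrow> pos v \<in> closure F0"
  using outer by (auto simp: frontier_def)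

lemma F0_outside: assumes "jordan J" "J \<subseteq> dr V E" shows "F0 \<subseteq> outside J"
  using unbounded_outside_jordan[OF assms(1) faceD(2)[OF F0(1)] _ F0(2)] faceD(3)[OF F0(1)] assms(2) by blast

text \<open>Every vertex is a limit of points of \<open>F0\<close>, and \<open>F0\<close> is outside
  every Jordan curve in the drawing.\<close>

lemma vertex_not_inside:
  assumes "jordan J" "J \<subseteq> dr V E" "v \<in> V" shows "pos v \<notin> inside J"
proof
  assume i: "pos v \<in> inside J"
  have "pos v \<in> closure (outside J)"
    using closure_mono[OF F0_outside[OF assms(1,2)]] pos_closure_F0[OF assms(3)] by blast
  then have "pos v \<in> J \<union> outside J" using jordanD(14)[OF assms(1)] by simp
  then show False using i inside_no_overlap[of J] inside_Int_outside[of J] by blast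
qed

lemma jc_subset: "cyc C \<Longrightarrow> jc C \<subseteq> dr V E"
  by (intro dr_mono) (auto simp: graph_cycle_iff)

lemma vertex_closure_inside:
  assumes "cyc C" "v \<in> V" "pos v \<in> closure (inside (jc C))" shows "v \<in> set C"
proof -
  have "pos v \<notin> inside (jc C)" using vertex_not_inside[OF jordan_cycle jc_subset] assms by blast
  then have "pos v \<in> jc C" using jordanD(13)[OF jordan_cycle[OF assms(1)]] assms(3) by blast
  then show ?thesis using pos_in_dr[OF subgraph_cycle] assms by blast
qed

text \<open>Only the edge between \<open>u\<close> and \<open>v\<close> could be common to the two
  paths, and the first path, having inner vertices, does not use it.\<close>

lemma path_Int:
  assumes w: "walk V E (u # ps @ [v])" "walk V E (u # qs @ [v])"
    and i: "set (u # ps @ [v]) \<inter> set (u # qs @ [v]) = {u, v}"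
    and d: "distinct (u # ps @ [v])" "ps \<noteq> []"
  shows "dr (set (u # ps @ [v])) (path_edges (u # ps @ [v])) \<inter>
    dr (set (u # qs @ [v])) (path_edges (u # qs @ [v])) = {pos u, pos v}"
proof -
  have "path_edges (u # ps @ [v]) \<inter> path_edges (u # qs @ [v]) = {}"
  proof (rule ccontr)
    assume "\<not> ?thesis"
    then obtain e where e: "e \<in> path_edges (u # ps @ [v])" "e \<in> path_edges (u # qs @ [v])" by blast
    then have "e \<subseteq> {u, v}" using path_edges_subset i by blast
    moreover obtain a b where "e = {a, b}" "a \<noteq> b" using e w edgeE by (metis walk_iff subsetD)
    ultimately have "e = {v, u}" by (auto simp: doubleton_eq_iff)
    moreover have "{last (u # ps @ [v]), hd (u # ps @ [v])} \<notin> path_edges (u # ps @ [v])"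
      using d by (intro path_edges_last_hd) (auto simp: Suc_le_eq)
    ultimately show False using e by simp
  qed
  then show ?thesis unfolding dr_Int[OF subgraph_path[OF w(1)] subgraph_path[OF w(2)]] i
    by (simp add: drawing_def)
qed

text \<open>The vertex \<open>z\<close> provides the contact with \<open>F0\<close> that
  \<open>theta\<close> asks for, and the vertex \<open>y\<close> keeps \<open>p2\<close> from being
  the arc in the middle.\<close>

lemma theta_vertex:
  assumes p: "arc p1" "arc p2" "arc p3"
    and st: "pathstart p1 = a" "pathstart p2 = a" "pathstart p3 = a"
    and fi: "pathfinish p1 = b" "pathfinish p2 = b" "pathfinish p3 = b"
    and i12: "path_image p1 \<inter> path_image p2 = {a, b}"
    and i13: "path_image p1 \<inter> path_image p3 = {a, b}"
    and i23: "path_image p2 \<inter> path_image p3 = {a, b}"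
    and dr: "path_image p1 \<subseteq> dr V E" "path_image p2 \<subseteq> dr V E" "path_image p3 \<subseteq> dr V E"
    and z: "z \<in> V" "pos z \<in> path_image p1 - {a, b}"
    and y: "y \<in> V" "pos y \<in> path_image p2 - {a, b}"
  shows "path_image p3 \<inter> inside (path_image p1 \<union> path_image p2) \<noteq> {}"
proof -
  have "path_image p2 \<inter> inside (path_image p1 \<union> path_image p3) = {}"
  proof (rule ccontr)
    assume *: "path_image p2 \<inter> inside (path_image p1 \<union> path_image p3) \<noteq> {}"
    have J: "jordan (path_image p1 \<union> path_image p3)" using jordan_arcs p st fi i13 by metis
    have "path_image p2 \<inter> (path_image p1 \<union> path_image p3) = {a, b}" using i12 i23 by auto
    then have "path_image p2 - {a, b} \<subseteq> inside (path_image p1 \<union> path_image p3)"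
      using arc_interior_inside[OF J p(2)] * st fi by simp
    then show False using vertex_not_inside[OF J _ y(1)] y dr by blast
  qed
  then show ?thesis
    using theta[OF p st fi i12 i13 i23 faceD(2)[OF F0(1)] F0(2), of "pos z"] pos_closure_F0[OF z(1)] z
      faceD(3)[OF F0(1)] dr by blast
qed

text \<open>An outerplanar graph contains no subdivision of the complete bipartite graph on two and
  three vertices: the arc in the middle would carry a vertex inside a Jordan curve.\<close>

lemma no_theta:
  assumes w: "walk V E (u # ps @ [v])" "walk V E (u # qs @ [v])" "walk V E (u # rs @ [v])"
    and d: "distinct (u # ps @ [v])" "distinct (u # qs @ [v])" "distinct (u # rs @ [v])"
    and i: "set ps \<inter> set qs = {}" "set ps \<inter> set rs = {}" "set qs \<inter> set rs = {}"
    and ne: "ps \<noteq> []" "qs \<noteq> []" "rs \<noteq> []"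
  shows False
proof -
  let ?d = "\<lambda>ps. dr (set (u # ps @ [v])) (path_edges (u # ps @ [v]))"
  have arcs: "\<exists>p. arc p \<and> pathstart p = pos u \<and> pathfinish p = pos v \<and> path_image p = ?d ps"
    if "walk V E (u # ps @ [v])" "distinct (u # ps @ [v])" for ps
    using path_arc[OF that] by auto
  obtain p q r where p: "arc p" "pathstart p = pos u" "pathfinish p = pos v" "path_image p = ?d ps"
    and q: "arc q" "pathstart q = pos u" "pathfinish q = pos v" "path_image q = ?d qs"
    and r: "arc r" "pathstart r = pos u" "pathfinish r = pos v" "path_image r = ?d rs"
    using arcs w d by meson
  have I: "path_image p \<inter> path_image q = {pos u, pos v}" "path_image p \<inter> path_image r = {pos u, pos v}"
    "path_image q \<inter> path_image r = {pos u, pos v}"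
    unfolding p(4) q(4) r(4) using i d by (intro path_Int w d ne; auto)+
  have sub: "?d ps \<subseteq> dr V E" if "walk V E (u # ps @ [v])" for ps
    using that by (intro dr_mono) (auto simp: walk_iff)
  have vert: "\<exists>z \<in> V. z \<in> set ps \<and> pos z \<in> ?d ps - {pos u, pos v}"
    if ps: "walk V E (u # ps @ [v])" "distinct (u # ps @ [v])" "ps \<noteq> []" for ps
  proof -
    obtain z where z: "z \<in> set ps" using ps(3) by (cases ps) auto
    then have "z \<in> V" "u \<in> V" "v \<in> V" "z \<noteq> u" "z \<noteq> v" using ps by (auto simp: walk_iff)
    then have "pos z \<noteq> pos u" "pos z \<noteq> pos v" using pos_inj by (auto dest: inj_onD)
    then show ?thesis using z \<open>z \<in> V\<close> by (auto simp: drawing_def)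
  qed
  obtain x y z where x: "x \<in> V" "pos x \<in> ?d ps - {pos u, pos v}" and y: "y \<in> V" "pos y \<in> ?d qs - {pos u, pos v}"
    and z: "z \<in> V" "pos z \<in> ?d rs - {pos u, pos v}" using vert w d ne by meson
  have sub': "path_image p \<subseteq> dr V E" "path_image q \<subseteq> dr V E" "path_image r \<subseteq> dr V E"
    using sub w p(4) q(4) r(4) by simp_all
  have J: "jordan (path_image p \<union> path_image q)" by (rule jordan_arcs[OF p(1) q(1) p(2,3) q(2,3) I(1)])
  have "path_image r \<inter> inside (path_image p \<union> path_image q) \<noteq> {}"
    by (rule theta_vertex[OF p(1) q(1) r(1) p(2) q(2) r(2) p(3) q(3) r(3) I sub' x(1) _ y(1)])
      (use x y p(4) q(4) in simp_all)
  moreover have "path_image r \<inter> (path_image p \<union> path_image q) = {pos u, pos v}" using I by auto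
  ultimately have "path_image r - {pos u, pos v} \<subseteq> inside (path_image p \<union> path_image q)"
    using arc_interior_inside[OF J r(1)] r(2,3) by simp
  moreover have "pos z \<in> path_image r - {pos u, pos v}" using z r(4) by simp
  moreover have "path_image p \<union> path_image q \<subseteq> dr V E" using sub' by simp
  ultimately show False using vertex_not_inside[OF J _ z(1)] by blast
qed

text \<open>As both arcs of the cycle have inner vertices, \<open>theta_vertex\<close> makes the
  chord the arc in the middle, and a crosscut divides the inside of a Jordan curve into two.\<close>

lemma chord:
  assumes C: "cyc (u # ys @ v # zs)" and ne: "ys \<noteq> []" "zs \<noteq> []" and e: "{u, v} \<in> E"
  shows "cyc (u # ys @ [v])" "cyc (v # zs @ [u])"
    "inside (jc (u # ys @ [v])) \<inter> inside (jc (v # zs @ [u])) = {}"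
    "inside (jc (u # ys @ v # zs)) =
      inside (jc (u # ys @ [v])) \<union> inside (jc (v # zs @ [u])) \<union> (path_image (crv {u, v}) - {pos u, pos v})"
proof -
  let ?P = "u # ys @ [v]" and ?Q = "v # zs @ [u]" and ?R = "u # rev zs @ [v]"
  have dC: "distinct (u # ys @ v # zs)" "set (u # ys @ v # zs) \<subseteq> V" "cycle_edges (u # ys @ v # zs) \<subseteq> E"
    using C by (auto simp: graph_cycle_iff)
  have pe: "path_edges ?P \<subseteq> E" "path_edges ?Q \<subseteq> E" using dC(3) cycle_edges_split[of u ys v zs] by auto
  have R: "path_edges ?R = path_edges ?Q" using path_edges_rev[of ?Q] by simp
  have wP: "walk V E ?P" and wQ: "walk V E ?R" using dC pe R by (auto simp: walk_iff)
  have dP: "distinct ?P" and dQ: "distinct ?R" using dC by auto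
  have lP: "3 \<le> length ?P" "3 \<le> length ?Q" using ne by (auto simp: Suc_le_eq)
  show cP: "cyc ?P" using wP dP lP e by (simp add: graph_cycle_def insert_commute)
  show cQ: "cyc ?Q" using wQ dQ lP e pe by (auto simp: graph_cycle_def walk_iff insert_commute)
  have ceP: "cycle_edges ?P = insert {u, v} (path_edges ?P)" "cycle_edges ?Q = insert {u, v} (path_edges ?Q)"
    by (auto simp: cycle_edges_def insert_commute)
  obtain p where p: "arc p" "pathstart p = pos u" "pathfinish p = pos v" "path_image p = dr (set ?P) (path_edges ?P)"
    using path_arc[OF wP dP] by auto
  obtain q where q: "arc q" "pathstart q = pos u" "pathfinish q = pos v" "path_image q = dr (set ?R) (path_edges ?R)"
    using path_arc[OF wQ dQ] by auto
  obtain r where r: "arc r" "pathstart r = pos u" "pathfinish r = pos v" "path_image r = dr {u, v} {{u, v}}"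
    using edge_arc[OF e] dr_edge[OF e] by metis
  have wr: "walk V E (u # [] @ [v])" using e edge_V by (auto simp: walk_iff)
  have r': "dr {u, v} {{u, v}} = dr (set (u # [] @ [v])) (path_edges (u # [] @ [v]))" by simp
  have I: "path_image p \<inter> path_image q = {pos u, pos v}" "path_image p \<inter> path_image r = {pos u, pos v}"
    "path_image q \<inter> path_image r = {pos u, pos v}"
    unfolding p(4) q(4) r(4) r' using dC ne by (intro path_Int wP wQ wr dP dQ; auto)+
  have jP: "path_image p \<union> path_image r = jc ?P" and jQ: "path_image q \<union> path_image r = jc ?Q"
    and jC: "path_image p \<union> path_image q = jc (u # ys @ v # zs)"
    unfolding p(4) q(4) r(4) ceP R cycle_edges_split[of u ys v zs] by (auto simp: drawing_def)
  obtain y z where y: "y \<in> set ys" and z: "z \<in> set zs" using ne by (metis ex_in_conv set_empty)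
  have uvV: "u \<in> V" "v \<in> V" "y \<in> V" "z \<in> V" using dC y z by auto
  have neq: "y \<noteq> u" "y \<noteq> v" "z \<noteq> u" "z \<noteq> v" using dC y z by auto
  have pn: "pos y \<notin> {pos u, pos v}" "pos z \<notin> {pos u, pos v}"
    using neq uvV pos_inj by (auto dest: inj_onD)
  have py: "pos y \<in> path_image p - {pos u, pos v}" "pos z \<in> path_image q - {pos u, pos v}"
    unfolding p(4) q(4) using y z pn by (auto simp: drawing_def)
  have sub: "path_image p \<subseteq> dr V E" "path_image q \<subseteq> dr V E" "path_image r \<subseteq> dr V E"
    unfolding p(4) q(4) r(4) using wP wQ e edge_V by (intro dr_mono; auto simp: walk_iff)+
  have ri: "path_image r \<inter> inside (path_image p \<union> path_image q) \<noteq> {}"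
    by (rule theta_vertex[OF p(1) q(1) r(1) p(2) q(2) r(2) p(3) q(3) r(3) I sub uvV(3) py(1) uvV(4) py(2)])
  have ab: "pos u \<noteq> pos v" using arc_distinct_ends[OF r(1)] r by simp
  show "inside (jc ?P) \<inter> inside (jc ?Q) = {}"
    "inside (jc (u # ys @ v # zs)) = inside (jc ?P) \<union> inside (jc ?Q) \<union> (path_image (crv {u, v}) - {pos u, pos v})"
    using split_inside_simple_closed_curve[OF arc_imp_simple_path[OF p(1)] p(2,3) arc_imp_simple_path[OF q(1)] q(2,3)
        arc_imp_simple_path[OF r(1)] r(2,3) ab I ri] jP jQ jC r(4) dr_edge[OF e] by metis+
qed

lemma cycle_split_at:
  assumes "cyc C" "a \<in> set C" "b \<in> set C" "a \<noteq> b"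
  obtains ys zs where "cyc (a # ys @ b # zs)" "mset (a # ys @ b # zs) = mset C"
    "cycle_edges (a # ys @ b # zs) = cycle_edges C"
proof -
  obtain l r where C: "C = l @ a # r" using assms(2) by (meson split_list)
  have "b \<in> set (r @ l)" using assms C by auto
  then obtain ys zs where yz: "r @ l = ys @ b # zs" by (meson split_list)
  have e: "a # ys @ b # zs = (a # r) @ l" using yz by simp
  show ?thesis
  proof (rule that[of ys zs]; unfold e)
    show "cyc ((a # r) @ l)" using graph_cycle_rotate[of V E l "a # r"] assms(1) C by simp
    show "mset ((a # r) @ l) = mset C" using C by simp
    show "cycle_edges ((a # r) @ l) = cycle_edges C"
      using cycle_edges_rotate[of l "a # r"] C by (cases "l = []") auto
  qed
qed

lemma edge_closed_inside:
  assumes "cyc C" "{a, b} \<in> E" "a \<in> set C" "b \<in> set C"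
  shows "path_image (crv {a, b}) \<subseteq> jc C \<union> inside (jc C)"
proof -
  have ab: "a \<noteq> b" using assms edge_ne by blast
  obtain ys zs where D: "cyc (a # ys @ b # zs)" "mset (a # ys @ b # zs) = mset C"
    "cycle_edges (a # ys @ b # zs) = cycle_edges C" using cycle_split_at[OF assms(1,3,4) ab] .
  have sD: "set (a # ys @ b # zs) = set C" using mset_eq_setD[OF D(2)] .
  show ?thesis
  proof (cases "ys = [] \<or> zs = []")
    case True
    then have "{a, b} \<in> cycle_edges (a # ys @ b # zs)"
      by (auto simp: cycle_edges_def insert_commute)
    then show ?thesis using D(3) by (auto simp: drawing_def)
  next
    case False
    then have "path_image (crv {a, b}) - {pos a, pos b} \<subseteq> inside (jc (a # ys @ b # zs))"
      using chord(4)[OF D(1) _ _ assms(2)] by blast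
    moreover have "{pos a, pos b} \<subseteq> jc C" using assms by (auto simp: drawing_def)
    ultimately show ?thesis unfolding sD D(3) by blast
  qed
qed

text \<open>Each edge of \<open>D\<close> is an edge or a chord of \<open>C\<close>, hence drawn in
  the closed inside of \<open>C\<close>.\<close>

lemma cycle_inside_mono:
  assumes "cyc C" "cyc D" "set D \<subseteq> set C"
  shows "inside (jc D) \<subseteq> inside (jc C)"
proof (rule jordan_inside_mono)
  show "jc D \<subseteq> jc C \<union> inside (jc C)"
  proof
    fix z assume "z \<in> jc D"
    then consider "z \<in> pos ` set D" | e where "e \<in> cycle_edges D" "z \<in> path_image (crv e)" by (auto simp: drawing_def)
    then show "z \<in> jc C \<union> inside (jc C)"
    proof cases
      case 1 then show ?thesis using assms(3) by (auto simp: drawing_def)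
    next
      case (2 e)
      have eE: "e \<in> E" using 2 assms(2) by (auto simp: graph_cycle_iff)
      obtain a b where ab: "e = {a, b}" using eE edgeE by metis
      have "D \<noteq> []" using assms(2) by (auto simp: graph_cycle_iff)
      then have "e \<subseteq> set C" using cycle_edges_subset 2 assms(3) by blast
      then show ?thesis using edge_closed_inside[of C a b] 2 eE ab assms(1) by auto
    qed
  qed
qed (use assms jordan_cycle in auto)

text \<open>A point of the face and a point of \<open>F0\<close> lie in different faces, so
  \<open>separating_cycle\<close> provides a cycle between them.\<close>

lemma bounded_face_in_cycle:
  assumes "F \<in> FS" "bounded F"
  obtains D where "cyc D" "F \<subseteq> inside (jc D)"
proof -
  obtain x where x: "x \<in> F" using faceD(4)[OF assms(1)] by blast
  obtain y where y: "y \<in> F0" using faceD(4)[OF F0(1)] by blast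
  have xy: "x \<notin> dr V E" "y \<notin> dr V E" using x y faceD(3)[OF assms(1)] faceD(3)[OF F0(1)] by auto
  have "\<not> same_face (dr V E) x y" using same_face_faces[OF assms(1) F0(1) x y] assms(2) F0(2) by blast
  then obtain D where D: "cyc D" "\<not> same_face (jc D) x y" using separating_cycle[OF order_refl xy] by blast
  have "F \<inter> jc D = {}" using faceD(3)[OF assms(1)] jc_subset[OF D(1)] by blast
  then consider "F \<subseteq> inside (jc D)" | "F \<subseteq> outside (jc D)"
    using connected_inside_or_outside[OF jordan_cycle[OF D(1)] faceD(2)[OF assms(1)]] by blast
  then show ?thesis
  proof cases
    case 2
    have "y \<in> outside (jc D)" using F0_outside[OF jordan_cycle[OF D(1)] jc_subset[OF D(1)]] y by blast
    then have False using D(2) component_jordan[OF jordan_cycle[OF D(1)], of x y] 2 x by (auto simp: same_face_def)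
    then show ?thesis ..
  qed (use that D in blast)
qed

abbreviation "lcyc C \<equiv> longest_cycle V E C"

text \<open>If \<open>u\<close> and \<open>v\<close> are adjacent on \<open>C\<close>, the ear can
  replace the edge between them and lengthen the cycle. Otherwise the two arcs of \<open>C\<close>
  and the ear contradict \<open>no_theta\<close>.\<close>

lemma no_ear:
  assumes "lcyc C" "u \<in> set C" "v \<in> set C" "u \<noteq> v" "set ps \<inter> set C = {}" "ps \<noteq> []"
    "walk V E (u # ps @ [v])" "distinct (u # ps @ [v])"
  shows False
proof -
  have C: "cyc C" "\<And>D. cyc D \<Longrightarrow> length D \<le> length C" using assms(1) longest_cycle_def by auto
  obtain ys zs where D: "cyc (u # ys @ v # zs)" "mset (u # ys @ v # zs) = mset C"
    "cycle_edges (u # ys @ v # zs) = cycle_edges C" using cycle_split_at[OF C(1) assms(2-4)] .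
  have sD: "set (u # ys @ v # zs) = set C" "length (u # ys @ v # zs) = length C"
    using mset_eq_setD[OF D(2)] mset_eq_length[OF D(2)] by auto
  have dD: "distinct (u # ys @ v # zs)" "set (u # ys @ v # zs) \<subseteq> V"
    "path_edges (u # ys @ [v]) \<subseteq> E" "path_edges (v # zs @ [u]) \<subseteq> E"
    using D(1) cycle_edges_split[of u ys v zs] by (auto simp: graph_cycle_iff)
  have R: "path_edges (u # rev zs @ [v]) = path_edges (v # zs @ [u])" using path_edges_rev[of "v # zs @ [u]"] by simp
  have R': "path_edges (v # rev ps @ [u]) = path_edges (u # ps @ [v])" using path_edges_rev[of "u # ps @ [v]"] by simp
  have psV: "set ps \<subseteq> V" "path_edges (u # ps @ [v]) \<subseteq> E" using assms(7) by (auto simp: walk_iff)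
  consider "ys = []" | "zs = []" | "ys \<noteq> []" "zs \<noteq> []" by blast
  then show False
  proof cases
    case 1
    have "cyc (u # ps @ v # zs)"
      unfolding graph_cycle_iff cycle_edges_split using dD psV assms(5,6,8) sD(1) 1
      by (auto simp: Suc_le_eq)
    then have "length (u # ps @ v # zs) \<le> length C" by (rule C(2))
    then show False using sD(2) 1 assms(6) by (cases ps) auto
  next
    case 2
    have "cyc (u # ys @ v # rev ps)"
      unfolding graph_cycle_iff cycle_edges_split R' using dD psV assms(5,6,8) sD(1) 2
      by (auto simp: Suc_le_eq)
    then have "length (u # ys @ v # rev ps) \<le> length C" by (rule C(2))
    then show False using sD(2) 2 assms(6) by (cases ps) auto
  next
    case 3
    have "walk V E (u # ys @ [v])" "walk V E (u # rev zs @ [v])" using dD R by (auto simp: walk_iff)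
    then show False
      using no_theta[of u ps v ys "rev zs"] assms(5-8) dD sD(1) 3 by auto
  qed
qed

lemma two_common:
  assumes C: "lcyc C" and D: "cyc D" and ab: "a \<in> set D" "b \<in> set D" "a \<in> set C" "b \<in> set C" "a \<noteq> b"
  shows "set D \<subseteq> set C"
proof (rule ccontr)
  assume "\<not> ?thesis"
  then obtain w where w: "w \<in> set D" "w \<notin> set C" by blast
  obtain l r where D': "D = l @ w # r" using w by (meson split_list)
  define ds where "ds = r @ l"
  have cD: "cyc (w # ds)" using graph_cycle_rotate[of V E l "w # r"] D D' ds_def by simp
  have abd: "a \<in> set ds" "b \<in> set ds" using ab D' w by (auto simp: ds_def)
  \<comment> \<open>With \<open>D\<close> started at \<open>w\<close> off \<open>C\<close>, the
    vertices \<open>u\<close> and \<open>v\<close> are the first and the last one of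
    \<open>C\<close> on it. The stretch from \<open>v\<close> through \<open>w\<close> to
    \<open>u\<close> is then an ear.\<close>
  obtain as u r1 where s1: "ds = as @ u # r1" "u \<in> set C" "\<forall>x\<in>set as. x \<notin> set C"
    using split_list_first_prop[of ds "\<lambda>x. x \<in> set C"] abd ab by blast
  obtain l1 v qs where s2: "ds = l1 @ v # qs" "v \<in> set C" "\<forall>x\<in>set qs. x \<notin> set C"
    using split_list_last_prop[of ds "\<lambda>x. x \<in> set C"] abd ab by blast
  have dd: "distinct (w # ds)" "set (w # ds) \<subseteq> V" "cycle_edges (w # ds) \<subseteq> E"
    using cD by (auto simp: graph_cycle_iff)
  have "u \<noteq> v"
  proof
    assume "u = v"
    then have "as = l1 \<and> r1 = qs" using s1(1) s2(1) dd(1)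
      by (metis append_Cons_eq_iff distinct.simps(2) distinct_append not_distinct_conv_prefix)
    then have "set ds \<inter> set C \<subseteq> {u}" using s1 s2 by auto
    then show False using abd ab by auto
  qed
  moreover have "v \<notin> set as" "u \<notin> set qs" using s1 s2 by auto
  ultimately obtain ms where ms: "r1 = ms @ v # qs"
  proof -
    have "as @ u # r1 = l1 @ v # qs" using s1 s2 by simp
    then obtain us where "as = l1 @ us \<and> us @ u # r1 = v # qs \<or> as @ us = l1 \<and> u # r1 = us @ v # qs"
      unfolding append_eq_append_conv2 by blast
    then show ?thesis
    proof (elim disjE conjE)
      assume "as = l1 @ us" "us @ u # r1 = v # qs"
      then show ?thesis using \<open>u \<noteq> v\<close> \<open>u \<notin> set qs\<close> by (cases us) auto
    next
      assume "as @ us = l1" "u # r1 = us @ v # qs"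
      then show ?thesis using \<open>u \<noteq> v\<close> that by (cases us) auto
    qed
  qed
  have cyc': "cyc (v # qs @ (w # as) @ u # ms)"
    using graph_cycle_rotate[of V E "(w # as) @ u # ms" "v # qs"] cD s1(1) ms by simp
  then have pe: "path_edges (v # (qs @ w # as) @ [u]) \<subseteq> E"
    using cycle_edges_split[of v "qs @ w # as" u ms] by (auto simp: graph_cycle_iff)
  have "walk V E (v # (qs @ w # as) @ [u])" "distinct (v # (qs @ w # as) @ [u])"
    using pe cyc' by (auto simp: walk_iff graph_cycle_iff)
  then show False using no_ear[OF C s2(2) s1(2) \<open>u \<noteq> v\<close>[symmetric], of "qs @ w # as"] s1 s2 w by auto
qed

end

section \<open>Drawings with a path as weak dual\<close>

lemma set_drop_take: "b \<le> length C \<Longrightarrow> set (drop a (take b C)) = (!) C ` {a..<b}"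
proof -
  assume "b \<le> length C"
  then have "drop a (take b C) = map ((!) C) [a..<b]" by (intro nth_equalityI) auto
  then show ?thesis by simp
qed

locale outerpath_graph = outerplane_graph +
  fixes fs
  assumes fs: "distinct fs" "set fs = weak_dual_verts V E pos crv"
    "weak_dual_edges V E pos crv = {{fs ! i, fs ! Suc i} | i. Suc i < length fs}"
begin

lemma fsD: "F \<in> set fs \<longleftrightarrow> F \<in> FS \<and> bounded F"
  by (auto simp: fs weak_dual_verts_def)

lemma consecutive_share_edge:
  assumes "Suc i < length fs"
  obtains e where "e \<in> E" "path_image (crv e) \<subseteq> frontier (fs ! i)" "path_image (crv e) \<subseteq> frontier (fs ! Suc i)"
proof -
  have "{fs ! i, fs ! Suc i} \<in> weak_dual_edges V E pos crv" using fs(3) assms by blast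
  then obtain F F' e where "{fs ! i, fs ! Suc i} = {F, F'}" "e \<in> E" "path_image (crv e) \<subseteq> frontier F \<inter> frontier F'"
    by (auto simp: weak_dual_edges_def induced_edges_def dual_edges_def)
  then show ?thesis using that[of e] by (auto simp: doubleton_eq_iff)
qed

lemma edge_in_cycle:
  assumes "cyc C" "e \<in> E" "path_image (crv e) \<subseteq> jc C" shows "e \<in> cycle_edges C"
  using edge_in_drawing[OF assms(2) subgraph_cycle[OF assms(1)] assms(3)] .

lemma face_inside_or_outside:
  assumes "cyc C" "F \<in> FS" shows "F \<subseteq> inside (jc C) \<or> F \<subseteq> outside (jc C)"
  using connected_inside_or_outside[OF jordan_cycle[OF assms(1)] faceD(2)[OF assms(2)]]
    faceD(3)[OF assms(2)] jc_subset[OF assms(1)] by blast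

lemma closure_frontier_inside:
  assumes "cyc C" "F \<subseteq> inside (jc C)" "A \<subseteq> frontier F" shows "A \<subseteq> jc C \<union> inside (jc C)"
  using closure_mono[OF assms(2)] jordanD(13)[OF jordan_cycle[OF assms(1)]] assms(3)
  by (auto simp: frontier_def)

lemma ends_in_cycle:
  assumes "cyc C" "F \<subseteq> inside (jc C)" "path_image (crv e) \<subseteq> frontier F" "e \<in> E"
  shows "e \<subseteq> set C"
proof
  fix v assume "v \<in> e"
  moreover obtain a b where "e = {a, b}" "a \<in> V" "b \<in> V" using assms(4) edgeE by metis
  ultimately have v: "v \<in> V" "pos v \<in> path_image (crv e)" using pos_in_crv[OF assms(4)] by auto
  have "pos v \<in> closure (inside (jc C))" using closure_mono[OF assms(2)] assms(3) v by (auto simp: frontier_def)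
  then show "v \<in> set C" using vertex_closure_inside[OF assms(1) v(1)] by blast
qed

text \<open>A discrete intermediate value argument along the dual path.\<close>

lemma crossing:
  fixes P :: "complex set \<Rightarrow> bool"
  assumes "i < length fs" "j < length fs" "i < j" "P (fs ! i) \<noteq> P (fs ! j)"
  obtains k where "i \<le> k" "k < j" "P (fs ! k) = P (fs ! i)" "P (fs ! Suc k) = P (fs ! j)"
proof -
  have "\<exists>k\<ge>i. k < j \<and> P (fs ! k) = P (fs ! i) \<and> P (fs ! Suc k) = P (fs ! j)"
    using assms(3,4)
  proof (induction "j - i" arbitrary: i)
    case (Suc d)
    show ?case
    proof (cases "P (fs ! Suc i) = P (fs ! i)")
      case True
      then have "Suc i < j" using Suc.prems by (metis Suc_lessI)
      then show ?thesis using Suc.hyps(1)[of "Suc i"] Suc True by (metis Suc_leD diff_Suc_Suc Suc_diff_Suc Suc_inject)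
    next
      case False
      then have "P (fs ! Suc i) = P (fs ! j)" using Suc.prems(2) by blast
      then show ?thesis using Suc.prems(1) by blast
    qed
  qed simp
  then show ?thesis using that by blast
qed

text \<open>Connectedness of the weak dual enters here. If \<open>D\<close> leaves \<open>C\<close>,
  the dual path has two consecutive faces of which only one is inside \<open>C\<close>. Their common
  edge has both ends on \<open>C\<close>, and a cycle around the other face passes through these
  ends. By \<open>two_common\<close> it stays on the vertices of \<open>C\<close>, so that face is
  inside \<open>C\<close> after all.\<close>

theorem cycles_in_longest:
  assumes C: "lcyc C" and D: "cyc D"
  shows "set D \<subseteq> set C"
proof (rule ccontr)
  assume n: "\<not> ?thesis"
  have cC: "cyc C" using C longest_cycle_def by blast
  have common: "x = y" if "x \<in> set D" "y \<in> set D" "x \<in> set C" "y \<in> set C" for x y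
    using two_common[OF C D that] n by blast
  have hdC: "{last C, hd C} \<in> cycle_edges C" "{last D, hd D} \<in> cycle_edges D" by (auto simp: cycle_edges_def)
  obtain F where F: "F \<in> FS" "F \<subseteq> inside (jc C)" using edge_face_exists[OF cC hdC(1)] .
  obtain F' where F': "F' \<in> FS" "F' \<subseteq> inside (jc D)" "path_image (crv {last D, hd D}) \<subseteq> frontier F'"
    using edge_face_exists[OF D hdC(2)] .
  have b: "F \<in> set fs" "F' \<in> set fs"
    using F F' bounded_subset[OF jordanD(4)[OF jordan_cycle[OF cC]] F(2)]
      bounded_subset[OF jordanD(4)[OF jordan_cycle[OF D]] F'(2)] by (auto simp: fsD)
  have eD: "{last D, hd D} \<in> E" "last D \<noteq> hd D" "D \<noteq> []"
    using D edge_ne by (auto simp: graph_cycle_iff cycle_edges_def)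
  have "\<not> F' \<subseteq> inside (jc C)"
  proof
    assume "F' \<subseteq> inside (jc C)"
    then have "{last D, hd D} \<subseteq> set C" using ends_in_cycle[OF cC _ F'(3) eD(1)] by blast
    then show False using common[of "last D" "hd D"] eD by auto
  qed
  then obtain i j where ij: "i < length fs" "j < length fs" "(fs ! i \<subseteq> inside (jc C))" "\<not> (fs ! j \<subseteq> inside (jc C))"
    using b F(2) by (metis in_set_conv_nth)
  have "\<exists>k. Suc k < length fs \<and> ((fs ! k \<subseteq> inside (jc C)) \<noteq> (fs ! Suc k \<subseteq> inside (jc C)))"
  proof (cases "i < j")
    case True
    then show ?thesis using crossing[of i j "\<lambda>F. F \<subseteq> inside (jc C)"] ij by (metis Suc_leI le_less_trans)
  next
    case False
    then have "j < i" using ij by (metis linorder_neqE_nat)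
    then show ?thesis using crossing[of j i "\<lambda>F. F \<subseteq> inside (jc C)"] ij by (metis Suc_leI le_less_trans)
  qed
  then obtain k where k: "Suc k < length fs" "(fs ! k \<subseteq> inside (jc C)) \<noteq> (fs ! Suc k \<subseteq> inside (jc C))" by blast
  obtain e where e: "e \<in> E" "path_image (crv e) \<subseteq> frontier (fs ! k)" "path_image (crv e) \<subseteq> frontier (fs ! Suc k)"
    using consecutive_share_edge[OF k(1)] .
  have fk: "fs ! k \<in> set fs" "fs ! Suc k \<in> set fs" using k(1) by auto
  obtain G H where GH: "G \<in> set fs" "H \<in> set fs" "H \<subseteq> inside (jc C)" "\<not> G \<subseteq> inside (jc C)"
    "path_image (crv e) \<subseteq> frontier G" "path_image (crv e) \<subseteq> frontier H"
    using k(2) e fk by metis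
  have eC: "e \<subseteq> set C" using ends_in_cycle[OF cC GH(3,6) e(1)] .
  obtain D2 where D2: "cyc D2" "G \<subseteq> inside (jc D2)" using bounded_face_in_cycle GH(1) fsD by metis
  have eD2: "e \<subseteq> set D2" using ends_in_cycle[OF D2(1,2) GH(5) e(1)] .
  obtain a b where ab: "e = {a, b}" "a \<noteq> b" using e(1) edgeE by metis
  have "set D2 \<subseteq> set C" using two_common[OF C D2(1), of a b] ab eC eD2 by auto
  then have "inside (jc D2) \<subseteq> inside (jc C)" using cycle_inside_mono[OF cC D2(1)] by blast
  then show False using D2(2) GH(4) by blast
qed

lemma bounded_face_inside:
  assumes "lcyc C" "F \<in> set fs" shows "F \<subseteq> inside (jc C)"
proof -
  obtain D where D: "cyc D" "F \<subseteq> inside (jc D)" using bounded_face_in_cycle assms(2) fsD by metis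
  then show ?thesis using cycle_inside_mono[OF _ D(1) cycles_in_longest[OF assms(1) D(1)]] assms(1) longest_cycle_def by blast
qed

text \<open>The chord between \<open>b\<close> and \<open>d\<close> runs inside \<open>C\<close> and
  misses the chord between \<open>a\<close> and \<open>c\<close>, hence stays on one side of it.
  Then both its ends would lie on the cycle that bounds this side.\<close>

lemma chords_not_crossing:
  assumes C: "cyc (a # l1 @ b # l2 @ c # l3 @ d # l4)" and e: "{a, c} \<in> E" "{b, d} \<in> E"
  shows False
proof -
  have C': "cyc (a # (l1 @ b # l2) @ c # (l3 @ d # l4))" using C by simp
  let ?P = "a # (l1 @ b # l2) @ [c]" and ?Q = "c # (l3 @ d # l4) @ [a]" and ?C = "a # l1 @ b # l2 @ c # l3 @ d # l4"
  have ne: "l1 @ b # l2 \<noteq> []" "l3 @ d # l4 \<noteq> []" by auto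
  note ch = chord[OF C' ne e(1)]
  have cP: "cyc ?P" and cQ: "cyc ?Q" using ch by auto
  have dist: "distinct ?C" "set ?C \<subseteq> V" using C by (auto simp: graph_cycle_iff)
  let ?I = "path_image (crv {b, d}) - {pos b, pos d}"
  have "b # l2 @ c # l3 @ d # l4 @ a # l1 = (b # l2 @ c # l3 @ d # l4) @ (a # l1)" by simp
  then have C2: "cyc (b # (l2 @ c # l3) @ d # (l4 @ a # l1))"
    using graph_cycle_rotate[of V E "a # l1" "b # l2 @ c # l3 @ d # l4"] C by simp
  have "?I \<subseteq> inside (jc (b # (l2 @ c # l3) @ d # (l4 @ a # l1)))" using chord(4)[OF C2 _ _ e(2)] by auto
  moreover have "jc (b # (l2 @ c # l3) @ d # (l4 @ a # l1)) = jc ?C"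
  proof -
    have "cycle_edges (b # (l2 @ c # l3) @ d # (l4 @ a # l1)) = cycle_edges ?C"
      using cycle_edges_rotate[of "b # l2 @ c # l3 @ d # l4" "a # l1"] by simp
    moreover have "set (b # (l2 @ c # l3) @ d # (l4 @ a # l1)) = set ?C" by auto
    ultimately show ?thesis by simp
  qed
  ultimately have I: "?I \<subseteq> inside (jc ?C)" by simp
  have bd: "path_image (crv {b, d}) \<subseteq> closure ?I" 
    using arc_closure_interior[OF crv_arc[OF e(2)]] crv_ends[OF e(2)] by simp
  have con: "connected ?I" using connected_simple_path_endless[OF arc_imp_simple_path[OF crv_arc[OF e(2)]]] crv_ends[OF e(2)] by simp
  have "path_image (crv {b, d}) \<inter> jc ?P = dr ({b, d} \<inter> set ?P) ({{b, d}} \<inter> cycle_edges ?P)"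
    using dr_Int[OF subgraph_edge[OF e(2)] subgraph_cycle[OF cP]] dr_edge[OF e(2)] by simp
  also have "{{b, d}} \<inter> cycle_edges ?P = {}" using cycle_edges_subset[of ?P "{b, d}"] dist by auto
  finally have "?I \<inter> jc ?P = {}" by (auto simp: drawing_def)
  then consider "?I \<subseteq> inside (jc ?P)" | "?I \<subseteq> outside (jc ?P)"
    using connected_inside_or_outside[OF jordan_cycle[OF cP] con] by blast
  moreover have pp: "pos b \<in> path_image (crv {b, d})" "pos d \<in> path_image (crv {b, d})"
    using pos_in_crv[OF e(2)] dist by auto
  ultimately show False
  proof cases
    case 1
    then have "pos d \<in> closure (inside (jc ?P))" using closure_mono bd pp by blast
    then have "d \<in> set ?P" using vertex_closure_inside[OF cP] dist by auto
    then show False using dist by auto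
  next
    case 2
    have "path_image (crv {b, d}) \<inter> path_image (crv {a, c}) \<subseteq> pos ` ({b, d} \<inter> {a, c})"
      using dist by (intro crv_crv e) (auto simp: doubleton_eq_iff)
    moreover have "{b, d} \<inter> {a, c} = {}" using dist by auto
    ultimately have "?I \<inter> path_image (crv {a, c}) = {}" by auto
    moreover have "?I \<subseteq> inside (jc (a # (l1 @ b # l2) @ c # (l3 @ d # l4)))" using I by simp
    ultimately have "?I \<subseteq> inside (jc ?Q)" unfolding ch(4) using 2 inside_Int_outside[of "jc ?P"] by blast
    then have "pos b \<in> closure (inside (jc ?Q))" using closure_mono bd pp by blast
    then have "b \<in> set ?Q" using vertex_closure_inside[OF cQ] dist by auto
    then show False using dist by auto
  qed
qed

text \<open>The chord \<open>{u, v}\<close> is dual to the only weak dual edge that leaves the faces inside the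
  cycle \<open>u # ys @ [v]\<close>; so these faces form an initial or a final segment of the dual path.\<close>

lemma chord_side_contains_end:
  assumes C: "lcyc (u # ys @ v # zs)" and ne: "ys \<noteq> []" "zs \<noteq> []" and e: "{u, v} \<in> E"
  shows "fs \<noteq> []" "hd fs \<subseteq> inside (jc (u # ys @ [v])) \<or> last fs \<subseteq> inside (jc (u # ys @ [v]))"
proof -
  let ?C = "u # ys @ v # zs" and ?P = "u # ys @ [v]" and ?Q = "v # zs @ [u]"
  have cC: "cyc ?C" using C longest_cycle_def by blast
  note ch = chord[OF cC ne e]
  define S where "S F \<longleftrightarrow> F \<subseteq> inside (jc ?P)" for F
  have ePQ: "{u, v} \<in> cycle_edges ?P" "{u, v} \<in> cycle_edges ?Q" by (auto simp: cycle_edges_def insert_commute)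
  have notS: "F \<subseteq> inside (jc ?Q)" if "F \<in> set fs" "\<not> S F" for F
  proof -
    have F: "F \<in> FS" using that fsD by blast
    have "F \<subseteq> inside (jc ?C)" using bounded_face_inside[OF C that(1)] .
    moreover have "F \<subseteq> outside (jc ?P)" using face_inside_or_outside[OF ch(1) F] that(2) S_def by blast
    moreover have "F \<inter> path_image (crv {u, v}) = {}" using faceD(3)[OF F] e by (auto simp: drawing_def)
    ultimately show ?thesis using ch(4) inside_Int_outside[of "jc ?P"] by blast
  qed
  have cross: "e' = {u, v}" if F: "F \<in> set fs" "S F" "F' \<in> set fs" "\<not> S F'" "e' \<in> E"
    "path_image (crv e') \<subseteq> frontier F" "path_image (crv e') \<subseteq> frontier F'" for F F' e'
  proof -
    have 1: "path_image (crv e') \<subseteq> jc ?P \<union> inside (jc ?P)"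
      using closure_frontier_inside[OF ch(1) _ F(6)] F(2) S_def by blast
    have 2: "path_image (crv e') \<subseteq> jc ?Q \<union> inside (jc ?Q)"
      using closure_frontier_inside[OF ch(2) notS[OF F(3,4)] F(7)] .
    have ceP: "cycle_edges ?P = insert {u, v} (path_edges ?P)" "cycle_edges ?Q = insert {u, v} (path_edges ?Q)"
      by (auto simp: cycle_edges_def insert_commute)
    have sub: "jc ?P \<subseteq> jc ?C \<union> path_image (crv {u, v})" "jc ?Q \<subseteq> jc ?C \<union> path_image (crv {u, v})"
      unfolding ceP cycle_edges_split[of u ys v zs] by (auto simp: drawing_def)
    have uvP: "path_image (crv {u, v}) \<subseteq> jc ?P" "path_image (crv {u, v}) \<subseteq> jc ?Q"
      using ePQ by (auto simp: drawing_def)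
    have "inside (jc ?P) \<inter> jc ?Q = {}"
      using sub(2) ch(4) uvP(1) inside_no_overlap[of "jc ?C"] inside_no_overlap[of "jc ?P"] by blast
    moreover have "inside (jc ?Q) \<inter> jc ?P = {}"
      using sub(1) ch(4) uvP(2) inside_no_overlap[of "jc ?C"] inside_no_overlap[of "jc ?Q"] by blast
    ultimately have "path_image (crv e') \<subseteq> jc ?P" "path_image (crv e') \<subseteq> jc ?Q" using 1 2 ch(3) by blast+
    then have "e' \<in> cycle_edges ?P" "e' \<in> cycle_edges ?Q" using edge_in_cycle ch(1,2) F(5) by blast+
    then have "e' \<subseteq> set ?P \<inter> set ?Q" using cycle_edges_subset[of ?P e'] cycle_edges_subset[of ?Q e'] by auto
    also have "\<dots> = {u, v}" using cC by (auto simp: graph_cycle_iff)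
    finally show ?thesis using edgeE[OF F(5)] by (metis (no_types, lifting) doubleton_eq_iff insert_subset insertE singletonD)
  qed
  obtain g where g: "g \<in> FS" "S g" "path_image (crv {u, v}) \<subseteq> frontier g"
    using edge_face_exists[OF ch(1) ePQ(1)] S_def by metis
  have gf: "g \<in> set fs" using g fsD S_def bounded_subset jordanD(4)[OF jordan_cycle[OF ch(1)]] by metis
  then show ne: "fs \<noteq> []" by auto
  obtain i0 where i0: "i0 < length fs" "fs ! i0 = g" using gf by (metis in_set_conv_nth)
  show "hd fs \<subseteq> inside (jc ?P) \<or> last fs \<subseteq> inside (jc ?P)"
  proof (rule ccontr)
    assume "\<not> ?thesis"
    then have n: "\<not> S (fs ! 0)" "\<not> S (fs ! (length fs - 1))" using ne by (auto simp: S_def hd_conv_nth last_conv_nth)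
    \<comment> \<open>From \<open>g\<close>, a face inside \<open>?P\<close>, the dual path would
      leave this inside in both directions. Both times it crosses the chord, beyond which there is a
      single face inside \<open>?Q\<close>; so it would visit that face twice.\<close>
    have "i0 \<noteq> 0" "i0 \<noteq> length fs - 1" using i0(2) g(2) n by metis+
    then have lt: "0 < i0" "i0 < length fs - 1" using i0 by auto
    obtain a where a: "a < i0" "\<not> S (fs ! a)" "S (fs ! Suc a)"
      using crossing[of 0 i0 S] lt i0 g n by (metis gr_implies_not0 neq0_conv length_0_conv ne)
    obtain b where b: "i0 \<le> b" "b < length fs - 1" "S (fs ! b)" "\<not> S (fs ! Suc b)"
      using crossing[of i0 "length fs - 1" S] lt i0 g n by (metis diff_less length_greater_0_conv ne zero_less_one)
    have la: "Suc a < length fs" "Suc b < length fs" "a < length fs" "b < length fs" using a b i0 by auto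
    obtain e1 where e1: "e1 \<in> E" "path_image (crv e1) \<subseteq> frontier (fs ! a)" "path_image (crv e1) \<subseteq> frontier (fs ! Suc a)"
      using consecutive_share_edge[OF la(1)] .
    obtain e2 where e2: "e2 \<in> E" "path_image (crv e2) \<subseteq> frontier (fs ! b)" "path_image (crv e2) \<subseteq> frontier (fs ! Suc b)"
      using consecutive_share_edge[OF la(2)] .
    have in_fs: "fs ! a \<in> set fs" "fs ! Suc a \<in> set fs" "fs ! b \<in> set fs" "fs ! Suc b \<in> set fs" using la by auto
    have "e1 = {u, v}" using cross[OF in_fs(2) a(3) in_fs(1) a(2) e1(1,3,2)] .
    moreover have "e2 = {u, v}" using cross[OF in_fs(3) b(3) in_fs(4) b(4) e2] .
    moreover have "fs ! a \<in> FS" "fs ! Suc b \<in> FS" using in_fs fsD by blast+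
    ultimately have "fs ! a = fs ! Suc b"
      using edge_face_unique[OF ch(2) ePQ(2)] notS in_fs a b e1 e2 by metis
    then have "a = Suc b" using nth_eq_iff_index_eq[OF fs(1)] la by blast
    then show False using a b by simp
  qed
qed

text \<open>Positions on \<open>C\<close> instead of list segments, so that the pieces cut off by
  different chords can be compared as sets of indices.\<close>

lemma chord_sides:
  assumes C: "lcyc C" and ip: "Suc i < p" "p < length C" "0 < i \<or> Suc p < length C" and e: "{C ! i, C ! p} \<in> E"
  obtains P Q where "cyc P" "cyc Q" "inside (jc P) \<inter> inside (jc Q) = {}"
    "set P = (!) C ` {i..p}" "set Q = (!) C ` ({..i} \<union> {p..<length C})" "fs \<noteq> []"
    "hd fs \<subseteq> inside (jc P) \<or> last fs \<subseteq> inside (jc P)"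
    "hd fs \<subseteq> inside (jc Q) \<or> last fs \<subseteq> inside (jc Q)"
proof -
  define ys where "ys = drop (Suc i) (take p C)"
  define zs where "zs = drop (Suc p) C @ take i C"
  have "take p C = take i C @ C ! i # ys"
    using id_take_nth_drop[of i "take p C"] ip by (simp add: ys_def min_def)
  then have C1: "C = take i C @ C ! i # ys @ C ! p # drop (Suc p) C"
    using id_take_nth_drop[of p C] ip by simp
  have L: "lcyc (C ! i # ys @ C ! p # zs)"
    using longest_cycle_rotate[of V E "take i C" "C ! i # ys @ C ! p # drop (Suc p) C"] C C1
    by (simp add: zs_def)
  have L': "lcyc (C ! p # zs @ C ! i # ys)"
    using longest_cycle_rotate[of V E "C ! i # ys" "C ! p # zs"] L by simp
  have e': "{C ! p, C ! i} \<in> E" using e by (simp add: insert_commute)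
  have ne: "ys \<noteq> []" "zs \<noteq> []" using ip by (auto simp: ys_def zs_def)
  note ch = chord[OF _ ne e]
  have cL: "cyc (C ! i # ys @ C ! p # zs)" using L longest_cycle_def by blast
  show ?thesis
  proof (rule that)
    show "cyc (C ! i # ys @ [C ! p])" "cyc (C ! p # zs @ [C ! i])"
      "inside (jc (C ! i # ys @ [C ! p])) \<inter> inside (jc (C ! p # zs @ [C ! i])) = {}"
      using chord[OF cL ne e] by blast+
    have ys: "set ys = (!) C ` {Suc i..<p}" using ip by (simp add: ys_def set_drop_take)
    have "{i..p} = insert i (insert p {Suc i..<p})" using ip by auto
    then show "set (C ! i # ys @ [C ! p]) = (!) C ` {i..p}" using ys by auto
    have "set (take i C) = (!) C ` {..<i}" using ip set_drop_take[of i C 0] by (simp add: lessThan_atLeast0)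
    moreover have "set (drop (Suc p) C) = (!) C ` {Suc p..<length C}" using set_drop_take[of "length C" C "Suc p"] by simp
    moreover have "{..i} \<union> {p..<length C} = insert i (insert p ({..<i} \<union> {Suc p..<length C}))" using ip by auto
    ultimately show "set (C ! p # zs @ [C ! i]) = (!) C ` ({..i} \<union> {p..<length C})" by (auto simp: zs_def)
    show "fs \<noteq> []" "hd fs \<subseteq> inside (jc (C ! i # ys @ [C ! p])) \<or> last fs \<subseteq> inside (jc (C ! i # ys @ [C ! p]))"
      using chord_side_contains_end[OF L ne e] by blast+
    show "hd fs \<subseteq> inside (jc (C ! p # zs @ [C ! i])) \<or> last fs \<subseteq> inside (jc (C ! p # zs @ [C ! i]))"
      using chord_side_contains_end[OF L' ne(2,1) e'] by blast
  qed
qed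

text \<open>The cycles \<open>P\<close>, \<open>P'\<close> and \<open>Q3\<close> around the three
  pieces have disjoint insides, each of which contains the first or the last face of the dual path.
  Faces are nonempty, so two ends cannot serve three pieces.\<close>

lemma no_three_chords:
  assumes C: "lcyc C" and le: "1 \<le> k" "k \<le> i" "Suc i < p" "p \<le> q" "Suc q < j" "j < length C"
    and e: "{C ! k, C ! (length C - 1)} \<in> E" "{C ! i, C ! p} \<in> E" "{C ! q, C ! j} \<in> E"
  shows False
proof -
  let ?n = "length C - 1"
  have ip: "p < length C" "0 < i \<or> Suc p < length C" "0 < q \<or> Suc j < length C"
    "Suc k < ?n" "?n < length C" "0 < k \<or> Suc ?n < length C" using le by auto
  obtain P Q where P: "cyc P" "cyc Q" "inside (jc P) \<inter> inside (jc Q) = {}"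
    "set P = (!) C ` {i..p}" "set Q = (!) C ` ({..i} \<union> {p..<length C})" "fs \<noteq> []"
    "hd fs \<subseteq> inside (jc P) \<or> last fs \<subseteq> inside (jc P)" using chord_sides[OF C le(3) ip(1,2) e(2)] by metis
  obtain P' Q' where P': "cyc P'" "cyc Q'" "inside (jc P') \<inter> inside (jc Q') = {}"
    "set P' = (!) C ` {q..j}" "set Q' = (!) C ` ({..q} \<union> {j..<length C})"
    "hd fs \<subseteq> inside (jc P') \<or> last fs \<subseteq> inside (jc P')" using chord_sides[OF C le(5,6) ip(3) e(3)] by metis
  obtain Q3 where Q3: "cyc Q3" "set Q3 = (!) C ` ({..k} \<union> {?n..<length C})"
    "hd fs \<subseteq> inside (jc Q3) \<or> last fs \<subseteq> inside (jc Q3)" using chord_sides[OF C ip(4-6) e(1)] by metis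
  have "set P' \<subseteq> set Q" "set Q3 \<subseteq> set Q" "set Q3 \<subseteq> set Q'"
    unfolding P(5) P'(4,5) Q3(2) using le by (intro image_mono; auto)+
  then have "inside (jc P') \<subseteq> inside (jc Q)" "inside (jc Q3) \<subseteq> inside (jc Q)" "inside (jc Q3) \<subseteq> inside (jc Q')"
    using cycle_inside_mono P(1,2) P'(1,2) Q3(1) by blast+
  then have d: "inside (jc P) \<inter> inside (jc P') = {}" "inside (jc P) \<inter> inside (jc Q3) = {}" "inside (jc P') \<inter> inside (jc Q3) = {}"
    using P(3) P'(3) by blast+
  have "hd fs \<in> FS" "last fs \<in> FS" using P(6) fsD hd_in_set last_in_set by blast+
  then have "hd fs \<noteq> {}" "last fs \<noteq> {}" using faceD(4) by blast+
  then show False using d P(7) P'(6) Q3(3) by blast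
qed

lemma no_crossing_chords:
  assumes C: "cyc C" and le: "a < b" "b < c" "c < d" "d < length C"
    and e: "{C ! a, C ! c} \<in> E" "{C ! b, C ! d} \<in> E"
  shows False
proof -
  define l1 l2 l3 where "l1 = drop (Suc a) (take b C)" and "l2 = drop (Suc b) (take c C)" and "l3 = drop (Suc c) (take d C)"
  have "C = take d C @ C ! d # drop (Suc d) C" using id_take_nth_drop le by blast
  moreover have "take d C = take c C @ C ! c # l3"
    using id_take_nth_drop[of c "take d C"] le by (simp add: l3_def min_def)
  moreover have "take c C = take b C @ C ! b # l2"
    using id_take_nth_drop[of b "take c C"] le by (simp add: l2_def min_def)
  moreover have "take b C = take a C @ C ! a # l1"
    using id_take_nth_drop[of a "take b C"] le by (simp add: l1_def min_def)
  ultimately have "C = take a C @ (C ! a # l1 @ C ! b # l2 @ C ! c # l3 @ C ! d # drop (Suc d) C)"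
    by (metis append.assoc append_Cons)
  then have "cyc ((C ! a # l1 @ C ! b # l2 @ C ! c # l3 @ C ! d # drop (Suc d) C) @ take a C)"
    using graph_cycle_rotate C by metis
  then show False using chords_not_crossing[OF _ e, of l1 l2 l3 "drop (Suc d) C @ take a C"] by simp
qed

end

text \<open>The last fact excludes three chords of \<open>C\<close> that cut off disjoint pieces, listed in their
  cyclic order around \<open>C\<close>.\<close>

lemma outerpath_structure:
  assumes "outerpath V E"
  shows "simple_graph V E"
    "\<And>C D. longest_cycle V E C \<Longrightarrow> graph_cycle V E D \<Longrightarrow> set D \<subseteq> set C"
    "\<And>C a b c d. longest_cycle V E C \<Longrightarrow> a < b \<Longrightarrow> b < c \<Longrightarrow> c < d \<Longrightarrow> d < length C \<Longrightarrow>
      {C ! a, C ! c} \<in> E \<Longrightarrow> {C ! b, C ! d} \<notin> E"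
    "\<And>C k i p q j. longest_cycle V E C \<Longrightarrow> 1 \<le> k \<Longrightarrow> k \<le> i \<Longrightarrow> Suc i < p \<Longrightarrow> p \<le> q \<Longrightarrow> Suc q < j \<Longrightarrow>
      j < length C \<Longrightarrow> {C ! k, C ! (length C - 1)} \<in> E \<Longrightarrow> {C ! i, C ! p} \<in> E \<Longrightarrow> {C ! q, C ! j} \<notin> E"
proof -
  show s: "simple_graph V E" using assms by (auto simp: outerpath_def)
  obtain pos crv where o: "outerplanar_embedding V E pos crv"
    "path_graph (weak_dual_verts V E pos crv) (weak_dual_edges V E pos crv)"
    using assms by (auto simp: outerpath_def)
  obtain F0 where F0: "F0 \<in> faces V E pos crv" "\<not> bounded F0" "\<forall>v\<in>V. pos v \<in> frontier F0"
    using o(1) by (auto simp: outerplanar_embedding_def)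
  obtain fs where fs: "distinct fs" "set fs = weak_dual_verts V E pos crv"
    "weak_dual_edges V E pos crv = {{fs ! i, fs ! Suc i} | i. Suc i < length fs}"
    using o(2) by (auto simp: path_graph_def)
  interpret outerpath_graph V E pos crv F0 fs
    by unfold_locales (use s o(1) F0 fs in \<open>auto simp: outerplanar_embedding_def\<close>)
  show "\<And>C D. longest_cycle V E C \<Longrightarrow> graph_cycle V E D \<Longrightarrow> set D \<subseteq> set C"
    by (rule cycles_in_longest)
  show "\<And>C a b c d. longest_cycle V E C \<Longrightarrow> a < b \<Longrightarrow> b < c \<Longrightarrow> c < d \<Longrightarrow> d < length C \<Longrightarrow>
      {C ! a, C ! c} \<in> E \<Longrightarrow> {C ! b, C ! d} \<notin> E"
    using no_crossing_chords longest_cycle_def by blast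
  show "\<And>C k i p q j. longest_cycle V E C \<Longrightarrow> 1 \<le> k \<Longrightarrow> k \<le> i \<Longrightarrow> Suc i < p \<Longrightarrow> p \<le> q \<Longrightarrow> Suc q < j \<Longrightarrow>
      j < length C \<Longrightarrow> {C ! k, C ! (length C - 1)} \<in> E \<Longrightarrow> {C ! i, C ! p} \<in> E \<Longrightarrow> {C ! q, C ! j} \<notin> E"
    using no_three_chords by blast
qed

section \<open>Star colorings of strips\<close>

text \<open>Every monochromatic edge has an end that lies on no other monochromatic edge.\<close>

definition local_star :: "'a set set \<Rightarrow> ('a \<Rightarrow> nat) \<Rightarrow> bool" where
  "local_star E c \<longleftrightarrow> (\<forall>u v. {u, v} \<in> E \<and> c u = c v \<longrightarrow>
     (\<forall>w. {u, w} \<in> E \<and> c w = c u \<longrightarrow> w = v) \<or> (\<forall>w. {v, w} \<in> E \<and> c w = c v \<longrightarrow> w = u))"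

lemma local_star_mono:
  assumes "local_star F c" "\<And>u v. {u, v} \<in> E \<Longrightarrow> c u = c v \<Longrightarrow> {u, v} \<in> F"
  shows "local_star E c"
  using assms unfolding local_star_def by metis

text \<open>Every edge of a cycle has further edges at both ends, against \<open>local_star\<close>.
  For the diameter, the relation of being at distance at most two is closed under one more step: on
  a path of three edges the middle edge would again have further edges at both ends.\<close>

lemma local_star_imp_star_coloring:
  assumes "simple_graph V E" "local_star E c" "\<And>v. v \<in> V \<Longrightarrow> c v < k"
  shows "star_coloring k V E c"
  unfolding star_coloring_def Let_def
proof (intro conjI ballI allI impI)
  fix v assume "v \<in> V" then show "c v < k" by fact
next
  fix i C
  let ?S = "{v \<in> V. c v = i}"
  let ?F = "induced_edges E ?S"
  assume "C \<in> graph_components ?S ?F"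
  then obtain r where r: "r \<in> ?S" "C = {v. joined ?S ?F r v}" by (auto simp: graph_components_def)
  let ?G = "induced_edges E C"
  have CS: "C \<subseteq> ?S"
  proof
    fix z assume "z \<in> C"
    then obtain xs where "walk ?S ?F xs" "last xs = z" using r(2) by (auto simp: joined_def)
    then show "z \<in> ?S" unfolding walk_iff using last_in_set by blast
  qed
  have fin: "finite C" using CS assms(1) finite_subset[of C V] by (auto simp: simple_graph_def)
  have ne: "u \<noteq> v" if "{u, v} \<in> E" for u v using assms(1) that by (auto simp: simple_graph_def)
  have FC: "v \<in> C" if uv: "u \<in> C" "{u, v} \<in> ?F" for u v
  proof -
    obtain xs where xs: "walk ?S ?F xs" "hd xs = r" "last xs = u" using uv r(2) by (auto simp: joined_def)
    then have "walk ?S ?F (xs @ [v])"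
      using uv(2) by (auto simp: walk_iff path_edges_append induced_edges_def)
    moreover have "hd (xs @ [v]) = r" using xs by (auto simp: walk_iff)
    ultimately show ?thesis using r(2) unfolding joined_def by (auto intro!: exI[of _ "xs @ [v]"])
  qed
  have G: "{u, v} \<in> ?G" if "u \<in> C" "{u, v} \<in> ?F" for u v
    using that FC[OF that] by (auto simp: induced_edges_def)
  have star: "(\<forall>w. {u, w} \<in> ?G \<longrightarrow> w = v) \<or> (\<forall>w. {v, w} \<in> ?G \<longrightarrow> w = u)" if "{u, v} \<in> ?G" for u v
    using assms(2) that CS unfolding local_star_def induced_edges_def by (smt (verit, best) insert_subset mem_Collect_eq subsetD)
  show "graph_acyclic C ?G"
    unfolding graph_acyclic_def
  proof
    assume "\<exists>xs. graph_cycle C ?G xs"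
    then obtain xs where xs: "graph_cycle C ?G xs" by blast
    then obtain x y z zs where xyz: "xs = x # y # z # zs"
      by (auto simp: graph_cycle_iff numeral_3_eq_3 Suc_le_length_iff)
    have l: "last xs \<in> set (z # zs)" using xyz by auto
    have "{x, y} \<in> ?G" "{y, z} \<in> ?G" "{x, last xs} \<in> ?G" "x \<noteq> z" "last xs \<noteq> y"
      using xs xyz l by (auto simp: graph_cycle_iff cycle_edges_def insert_commute)
    then show False using star by metis
  qed
  define R where "R u v \<longleftrightarrow> u = v \<or> {u, v} \<in> ?G \<or> (\<exists>w. {u, w} \<in> ?G \<and> {w, v} \<in> ?G)" for u v
  have R_step: "R u v'" if uv: "R u v" "{v, v'} \<in> ?G" for u v v'
  proof (cases "u = v \<or> {u, v} \<in> ?G")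
    case True then show ?thesis using uv by (auto simp: R_def)
  next
    case False
    then obtain w where w: "{u, w} \<in> ?G" "{w, v} \<in> ?G" "u \<noteq> v" using uv by (auto simp: R_def)
    \<comment> \<open>On the edge between \<open>w\<close> and \<open>v\<close> the end
      \<open>w\<close> has the further neighbor \<open>u\<close>, so \<open>v\<close> has to be the
      leaf.\<close>
    have "v' = w" using star[OF w(2)] w uv(2) by (metis insert_commute)
    then show ?thesis using w by (auto simp: R_def)
  qed
  have R_walk: "R (hd xs) (last xs)" if "walk ?S ?F xs" "hd xs \<in> C" for xs
    using that
  proof (induction xs rule: rev_induct)
    case (snoc x xs)
    show ?case
    proof (cases "xs = []")
      case True then show ?thesis by (simp add: R_def)
    next
      case False
      have w: "walk ?S ?F xs" "{last xs, x} \<in> ?F" using snoc.prems False by (auto simp: walk_iff path_edges_append)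
      have "R (hd xs) (last xs)" using snoc w False by auto
      moreover have "last xs \<in> C"
      proof -
        obtain ys where ys: "walk ?S ?F ys" "hd ys = r" "last ys = hd xs" using snoc.prems False r(2) by (auto simp: joined_def)
        have "walk ?S ?F (ys @ tl xs)" 
        proof (cases "tl xs")
          case (Cons a as)
          then have "xs = hd xs # a # as" using False by (metis list.collapse)
          then have "path_edges xs = insert {hd xs, a} (path_edges (a # as))" by (metis path_edges.simps(1))
          then show ?thesis using ys w(1) Cons False unfolding walk_iff
            by (auto simp: path_edges_append dest: list.set_sel(2))
        qed (use ys in auto)
        moreover have "hd (ys @ tl xs) = r" using ys by (auto simp: walk_iff)
        moreover have "last (ys @ tl xs) = last xs" using ys False by (cases xs) (auto simp: walk_iff)
        ultimately show ?thesis using r(2) unfolding joined_def by (auto intro!: exI[of _ "ys @ tl xs"])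
      qed
      ultimately show ?thesis using R_step G w(2) False by simp
    qed
  qed (simp add: walk_iff)
  have dist: "graph_dist C ?G u v \<le> 2" if uv: "u \<in> C" "v \<in> C" for u v
  proof -
    have sym: "{a, b} \<in> ?F \<longleftrightarrow> {b, a} \<in> ?F" for a b by (simp add: insert_commute)
    obtain xs ys where xs: "walk ?S ?F xs" "hd xs = r" "last xs = u" and ys: "walk ?S ?F ys" "hd ys = r" "last ys = v"
      using uv r(2) by (auto simp: joined_def)
    have "walk ?S ?F (rev xs @ tl ys)"
    proof (cases "tl ys")
      case Nil then show ?thesis using xs by (auto simp: walk_iff path_edges_rev)
    next
      case (Cons a as)
      then have "ys = r # a # as" using ys by (metis list.collapse walk_iff)
      then show ?thesis using ys xs Cons by (auto simp: walk_iff path_edges_append path_edges_rev last_rev)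
    qed
    moreover have "hd (rev xs @ tl ys) = u" using xs by (auto simp: walk_iff hd_rev)
    moreover have "last (rev xs @ tl ys) = v" using xs ys by (cases ys) (auto simp: walk_iff last_rev)
    ultimately have "R u v" using R_walk[of "rev xs @ tl ys"] uv by auto
    then obtain ws where ws: "walk C ?G ws" "hd ws = u" "last ws = v" "length ws \<le> 3"
    proof -
      have GC: "a \<in> C \<and> b \<in> C" if "{a, b} \<in> ?G" for a b using that by (auto simp: induced_edges_def)
      consider "u = v" | "{u, v} \<in> ?G" | w where "{u, w} \<in> ?G" "{w, v} \<in> ?G" using \<open>R u v\<close> R_def by blast
      then show ?thesis
      proof cases
        case 1 then show ?thesis using uv by (intro that[of "[u]"]) (auto simp: walk_iff)
      next
        case 2 then show ?thesis using uv by (intro that[of "[u, v]"]) (auto simp: walk_iff)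
      next
        case (3 w) then show ?thesis using uv GC by (intro that[of "[u, w, v]"]) (auto simp: walk_iff)
      qed
    qed
    then obtain k where k: "length ws = Suc k" "k \<le> 2" by (cases "length ws") (auto simp: walk_iff)
    then have "graph_dist C ?G u v \<le> k" unfolding graph_dist_def using ws by (intro Least_le) blast
    then show ?thesis using k by simp
  qed
  have "finite {graph_dist C ?G u v | u v. u \<in> C \<and> v \<in> C}"
    using fin by (intro finite_image_set2) auto
  moreover have "r \<in> C" using r by (auto simp: joined_def walk_iff intro!: exI[of _ "[r]"])
  ultimately show "graph_diameter C ?G \<le> 2"
    unfolding graph_diameter_def using dist by (subst Max_le_iff) auto
qed

text \<open>A strip is built from the edge \<open>{u\<^sub>0, v\<^sub>0}\<close> by attaching triangles: the vertex \<open>x k\<close> is attached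
  to the current front \<open>{p k, q k}\<close> and replaces \<open>p k\<close>. The flag \<open>tw k\<close> records
  a turn, that is, \<open>p k\<close> is the older vertex of the front.\<close>

definition front_new :: "'a \<Rightarrow> (nat \<Rightarrow> 'a) \<Rightarrow> nat \<Rightarrow> 'a" where
  "front_new u x k = (case k of 0 \<Rightarrow> u | Suc j \<Rightarrow> x j)"

definition strip :: "'a \<Rightarrow> 'a \<Rightarrow> (nat \<Rightarrow> 'a) \<Rightarrow> (nat \<Rightarrow> 'a) \<Rightarrow> (nat \<Rightarrow> 'a) \<Rightarrow> (nat \<Rightarrow> bool) \<Rightarrow> nat \<Rightarrow> bool" where
  "strip u v x p q tw m \<longleftrightarrow> u \<noteq> v \<and> (\<forall>k<m. x k \<notin> {u, v} \<union> x ` {..<k} \<and>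
     p k = (if tw k then front_new v q k else front_new u x k) \<and>
     q k = (if tw k then front_new u x k else front_new v q k))"

definition strip_edges :: "'a \<Rightarrow> 'a \<Rightarrow> (nat \<Rightarrow> 'a) \<Rightarrow> (nat \<Rightarrow> 'a) \<Rightarrow> (nat \<Rightarrow> 'a) \<Rightarrow> nat \<Rightarrow> 'a set set" where
  "strip_edges u v x p q m = insert {u, v} (\<Union>k<m. {{x k, p k}, {x k, q k}})"

text \<open>Colors alternate along both sides of the strip, so that the monochromatic edges are chords.
  The exception is the last vertex of a fan with at least two triangles that is followed by
  another such fan: it must not be a leaf of the first fan since it is the center of the next one.\<close>

definition strip_color :: "'a \<Rightarrow> 'a \<Rightarrow> (nat \<Rightarrow> 'a) \<Rightarrow> (nat \<Rightarrow> 'a) \<Rightarrow> (nat \<Rightarrow> 'a) \<Rightarrow> (nat \<Rightarrow> bool) \<Rightarrow> nat \<Rightarrow> ('a \<Rightarrow> nat) \<Rightarrow> bool" where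
  "strip_color u v x p q tw m c \<longleftrightarrow> c u = 0 \<and> c v = 1 \<and>
     (\<forall>k<m. c (x k) = 1 - c (if \<not> tw k \<and> tw (Suc k) \<and> \<not> tw (Suc (Suc k)) then q k else p k))"

lemma strip_vertices:
  assumes "strip u v x p q tw m"
  shows "k < m \<Longrightarrow> front_new u x k \<in> {u, v} \<union> x ` {..<k} \<and> front_new v q k \<in> {u, v} \<union> x ` {..<k}"
proof (induction k)
  case (Suc k)
  have "q k \<in> {front_new u x k, front_new v q k}" using assms Suc.prems by (auto simp: strip_def)
  then have "q k \<in> {u, v} \<union> x ` {..<k}" using Suc by auto
  then show ?case by (auto simp: front_new_def)
qed (auto simp: front_new_def)

lemma strip_colors_less_2:
  assumes "strip u v x p q tw m" "strip_color u v x p q tw m c"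
  shows "k \<le> m \<Longrightarrow> \<forall>z \<in> {u, v} \<union> x ` {..<k}. c z < 2"
proof (induction k)
  case 0 then show ?case using assms(2) by (auto simp: strip_color_def)
next
  case (Suc k)
  have "c (x k) < 2" using assms(2) Suc.prems by (auto simp: strip_color_def)
  then show ?case using Suc by (auto simp: less_Suc_eq)
qed

text \<open>Induction over the triangles. A new vertex gets at most one monochromatic edge: if its
  two neighbors have the same color it takes the other one. What has to be tracked is whether the
  vertex that receives the new edge can be the center of a star.\<close>

lemma strip_local_star:
  assumes s: "strip u v x p q tw m" and c: "strip_color u v x p q tw m c"
  shows "local_star (strip_edges u v x p q m) c"
proof -
  define N where "N k z = {w. {z, w} \<in> strip_edges u v x p q k \<and> c w = c z}" for k z
  \<comment> \<open>The vertices that may still receive leaves.\<close>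
  define cap where "cap k z \<longleftrightarrow> (\<forall>w \<in> N k z. N k w = {z})" for k z
  define star where "star k \<longleftrightarrow> (\<forall>z. \<forall>w \<in> N k z. N k z = {w} \<or> N k w = {z})" for k
  \<comment> \<open>Here \<open>a\<close> is the newest and \<open>b\<close> the older front vertex.
    Equal colors: \<open>a\<close> is a leaf of \<open>b\<close>; if \<open>a\<close> stays in the
    front and then becomes the center of a fan, it must be able to take leaves, which holds if
    \<open>b\<close> has no other leaf. Different colors: the vertex that stays must be able to take
    leaves. Before two turns in a row \<open>a\<close> must have no monochromatic edge, since
    otherwise its next leaf would stay in the front with a center that has several leaves. Without a
    turn \<open>a\<close> is free as well, because the exception may attach the new vertex to
    it.\<close>
  define inv where "inv k \<longleftrightarrow> (let a = front_new u x k; b = front_new v q k in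
    a \<noteq> b \<and> star k \<and>
    (if c a = c b then N k a = {b} \<and> cap k b \<and> (tw k \<longrightarrow> N k b = {a} \<or> tw (Suc k))
     else if tw k then cap k a \<and> (N k a = {} \<or> \<not> tw (Suc k)) else N k a = {} \<and> cap k b))" for k
  have edges_in: "e \<subseteq> {u, v} \<union> x ` {..<k}" if "k \<le> m" "e \<in> strip_edges u v x p q k" for k e
  proof -
    have "p j \<in> {u, v} \<union> x ` {..<k} \<and> q j \<in> {u, v} \<union> x ` {..<k}" if "j < k" for j
    proof -
      have jm: "j < m" using that \<open>k \<le> m\<close> by simp
      have "x ` {..<j} \<subseteq> x ` {..<k}" using that by auto
      then have "front_new u x j \<in> {u, v} \<union> x ` {..<k}" "front_new v q j \<in> {u, v} \<union> x ` {..<k}"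
        using strip_vertices[OF s jm] by auto
      moreover have "p j = front_new u x j \<or> p j = front_new v q j" "q j = front_new u x j \<or> q j = front_new v q j"
        using s jm by (auto simp: strip_def)
      ultimately show ?thesis by metis
    qed
    then show ?thesis using that unfolding strip_edges_def by auto
  qed
  have loopless: "{w, w} \<notin> strip_edges u v x p q k" if "k \<le> m" for w k
  proof
    assume "{w, w} \<in> strip_edges u v x p q k"
    moreover have "x j \<noteq> p j" "x j \<noteq> q j" if "j < k" for j
    proof -
      have jm: "j < m" using that \<open>k \<le> m\<close> by simp
      have "x j \<notin> {u, v} \<union> x ` {..<j}" using s jm by (simp add: strip_def)
      then have "front_new u x j \<noteq> x j" "front_new v q j \<noteq> x j"
        using strip_vertices[OF s jm] by metis+
      then show "x j \<noteq> p j" "x j \<noteq> q j" using s jm by (auto simp: strip_def)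
    qed
    moreover have "u \<noteq> v" using s by (simp add: strip_def)
    ultimately show False unfolding strip_edges_def by (fastforce simp: doubleton_eq_iff)
  qed
  have "inv k" if "k \<le> m" for k
    using that
  proof (induction k)
    case 0
    have "c u = 0" "c v = 1" "u \<noteq> v" using c s by (auto simp: strip_color_def strip_def)
    then have "N 0 z = {}" for z by (auto simp: N_def strip_edges_def doubleton_eq_iff)
    then show ?case using \<open>c u = 0\<close> \<open>c v = 1\<close> \<open>u \<noteq> v\<close> by (simp add: inv_def front_new_def star_def cap_def)
  next
    case (Suc k)
    define a b z where "a = front_new u x k" and "b = front_new v q k" and "z = x k"
    have I: "inv k" and km: "k < m" using Suc by auto
    have pq: "p k = (if tw k then b else a)" "q k = (if tw k then a else b)" and zn: "z \<notin> {u, v} \<union> x ` {..<k}"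
      using s km by (auto simp: strip_def a_def b_def z_def)
    have ab: "a \<in> {u, v} \<union> x ` {..<k}" "b \<in> {u, v} \<union> x ` {..<k}" using strip_vertices[OF s km] by (auto simp: a_def b_def)
    have zab: "z \<noteq> a" "z \<noteq> b" using ab zn by auto
    have abne: "a \<noteq> b" using I by (simp add: inv_def Let_def a_def b_def)
    have E: "strip_edges u v x p q (Suc k) = strip_edges u v x p q k \<union> {{z, a}, {z, b}}"
    proof -
      have "{{x k, p k}, {x k, q k}} = {{z, a}, {z, b}}" unfolding pq z_def by (cases "tw k") auto
      then show ?thesis unfolding strip_edges_def lessThan_Suc UN_insert by (simp add: insert_commute)
    qed
    have zk: "z \<notin> e" if "e \<in> strip_edges u v x p q k" for e using edges_in[OF _ that] km zn by auto
    have Nz: "N (Suc k) z = {w \<in> {a, b}. c w = c z}"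
      using zk zab by (fastforce simp: N_def E doubleton_eq_iff)
    have zNk: "z \<notin> N k w" for w using zk by (auto simp: N_def)
    have Nw: "N (Suc k) w = N k w \<union> (if w \<in> {a, b} \<and> c w = c z then {z} else {})" if "w \<noteq> z" for w
      using that zab by (auto simp: N_def E doubleton_eq_iff)
    have sym: "w \<in> N k w' \<longleftrightarrow> w' \<in> N k w" for w w' by (auto simp: N_def insert_commute)
    have front: "front_new u x (Suc k) = z" "front_new v q (Suc k) = q k" by (auto simp: front_new_def z_def)
    have c2: "c a < 2" "c b < 2" using strip_colors_less_2[OF s c, of k] km ab by auto
    have cz: "c z = 1 - c (if \<not> tw k \<and> tw (Suc k) \<and> \<not> tw (Suc (Suc k)) then q k else p k)"
      using c km by (simp add: strip_color_def z_def)
    have fl: "1 - c a \<noteq> c a" "1 - c b \<noteq> c b" "c a \<noteq> c b \<Longrightarrow> 1 - c a = c b \<and> 1 - c b = c a"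
      using c2 by arith+
    have st: "star k" using I by (simp add: inv_def Let_def)
    have I': "if c a = c b then N k a = {b} \<and> cap k b \<and> (tw k \<longrightarrow> N k b = {a} \<or> tw (Suc k))
     else if tw k then cap k a \<and> (N k a = {} \<or> \<not> tw (Suc k)) else N k a = {} \<and> cap k b"
      using I by (simp add: inv_def Let_def a_def b_def)
    \<comment> \<open>Common to the three cases below in which the new vertex becomes a leaf of some
      \<open>y\<close>.\<close>
    have attach: "cap (Suc k) y \<and> star (Suc k)"
      if y: "N (Suc k) z = {y}" "N (Suc k) y = insert z (N k y)"
        "\<And>w. w \<noteq> z \<Longrightarrow> w \<noteq> y \<Longrightarrow> N (Suc k) w = N k w" "cap k y" for y
    proof
      have irr: "w \<notin> N k w" for w
        using loopless[of k w] km by (auto simp: N_def)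
      show capy: "cap (Suc k) y"
        unfolding cap_def
      proof
        fix w assume "w \<in> N (Suc k) y"
        then consider "w = z" | "w \<in> N k y" "w \<noteq> z" using y(2) by blast
        then show "N (Suc k) w = {y}"
        proof cases
          case 2
          then have "N k w = {y}" "w \<noteq> y" using y(4) irr by (auto simp: cap_def)
          then show ?thesis using y(3) 2 by simp
        qed (use y(1) in simp)
      qed
      show "star (Suc k)"
        unfolding star_def
      proof (intro allI ballI)
        fix r w assume w: "w \<in> N (Suc k) r"
        consider "r = z" | "r = y" | "r \<noteq> z" "r \<noteq> y" "w = y" | "r \<noteq> z" "r \<noteq> y" "w \<noteq> y" by blast
        then show "N (Suc k) r = {w} \<or> N (Suc k) w = {r}"
        proof cases
          case 1 then show ?thesis using w y(1) by simp
        next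
          case 2 then show ?thesis using w capy by (simp add: cap_def)
        next
          case 3
          then have "r \<in> N k y" using w y(3) sym by simp
          then have "r \<in> N (Suc k) y" using y(2) by simp
          then show ?thesis using capy 3 by (simp add: cap_def)
        next
          case 4
          then have "w \<in> N k r" using w y(3) by simp
          moreover have "w \<noteq> z" using calculation zNk by metis
          ultimately show ?thesis using st y(3) 4 by (simp add: star_def)
        qed
      qed
    qed
    \<comment> \<open>\<open>E\<close>: the front has one color and the new vertex takes the other.
      \<open>turn\<close> and \<open>plain\<close>: it becomes a leaf of the front vertex that
      stays. \<open>pattern\<close> is the exception: it is joined to \<open>a\<close>, which leaves
      the front, so that the center of the next fan begins as an end of a single edge.\<close>
    consider (E) "c a = c b" | (turn) "c a \<noteq> c b" "tw k"
      | (plain) "c a \<noteq> c b" "\<not> tw k" "\<not> (tw (Suc k) \<and> \<not> tw (Suc (Suc k)))"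
      | (pattern) "c a \<noteq> c b" "\<not> tw k" "tw (Suc k)" "\<not> tw (Suc (Suc k))" by blast
    then show ?case
    proof cases
      case E
      then have cza: "c z \<noteq> c a" "c z \<noteq> c b" using cz pq fl by (metis (full_types))+
      then have 1: "N (Suc k) z = {}" "\<And>w. w \<noteq> z \<Longrightarrow> N (Suc k) w = N k w" using Nz Nw E by auto
      have st': "star (Suc k)" unfolding star_def
      proof (intro allI ballI)
        fix r w assume w: "w \<in> N (Suc k) r"
        then have r: "r \<noteq> z" using 1(1) by auto
        then have "w \<in> N k r" using w 1(2) by simp
        moreover have "w \<noteq> z" using calculation zNk by metis
        ultimately show "N (Suc k) r = {w} \<or> N (Suc k) w = {r}" using st r 1(2) by (simp add: star_def)
      qed
      have cap: "cap (Suc k) w" if "cap k w" "w \<noteq> z" for w using that 1 zNk unfolding cap_def by metis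
      have "cap (Suc k) z" using 1 by (simp add: cap_def)
      show ?thesis
      proof (cases "tw k")
        case True
        then have qa: "q k = a" using pq by simp
        have "cap k a" if "\<not> tw (Suc k)" using I' E True that by (auto simp: cap_def)
        then show ?thesis unfolding inv_def Let_def front qa
          using cza 1 zab st' cap \<open>cap (Suc k) z\<close> by auto
      next
        case False
        then have qb: "q k = b" using pq by simp
        have "cap k b" using I' E by auto
        then show ?thesis unfolding inv_def Let_def front qb
          using cza 1 zab st' cap \<open>cap (Suc k) z\<close> by auto
      qed
    next
      case turn
      then have cza: "c z = c a" "c z \<noteq> c b" and qa: "q k = a" using cz pq fl by (metis (full_types))+
      have Ia: "cap k a" "N k a = {} \<or> \<not> tw (Suc k)" using I' turn by auto
      have 1: "N (Suc k) z = {a}" "N (Suc k) a = insert z (N k a)" "\<And>w. w \<noteq> z \<Longrightarrow> w \<noteq> a \<Longrightarrow> N (Suc k) w = N k w"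
        using Nz Nw zab cza by auto
      have capa: "cap (Suc k) a" "star (Suc k)" using attach[of a] 1 Ia(1) by auto
      show ?thesis unfolding inv_def Let_def front qa using cza 1 capa zab Ia(2) by auto
    next
      case plain
      then have cza: "c z = c b" "c z \<noteq> c a" and qb: "q k = b" using cz pq fl by (metis (full_types))+
      have Ib: "cap k b" using I' plain by auto
      have 1: "N (Suc k) z = {b}" "N (Suc k) b = insert z (N k b)" "\<And>w. w \<noteq> z \<Longrightarrow> w \<noteq> b \<Longrightarrow> N (Suc k) w = N k w"
        using Nz Nw zab cza by auto
      have capb: "cap (Suc k) b" "star (Suc k)" using attach[of b] 1 Ib by auto
      show ?thesis unfolding inv_def Let_def front qb using cza 1 capb zab plain by auto
    next
      case pattern
      then have cza: "c z = c a" "c z \<noteq> c b" and qb: "q k = b" using cz pq fl by (metis (full_types))+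
      have Ia: "N k a = {}" using I' pattern by auto
      have 1: "N (Suc k) z = {a}" "N (Suc k) a = {z}" "\<And>w. w \<noteq> z \<Longrightarrow> w \<noteq> a \<Longrightarrow> N (Suc k) w = N k w"
        using Nz Nw zab cza Ia by auto
      have capz: "cap (Suc k) z" using 1 unfolding cap_def by auto
      have st': "star (Suc k)" using attach[of a] 1 Ia by (auto simp: cap_def)
      show ?thesis unfolding inv_def Let_def front qb using cza 1 capz st' zab pattern by auto
    qed
  qed
  then have "star m" by (simp add: inv_def Let_def)
  then show ?thesis unfolding local_star_def star_def N_def
    by (smt (verit, best) mem_Collect_eq singletonD)
qed

section \<open>The core\<close>

definition nbrs :: "'a set set \<Rightarrow> 'a \<Rightarrow> 'a set" where
  "nbrs E v = {u. {u, v} \<in> E}"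

lemma nbrs_sym: "u \<in> nbrs E v \<longleftrightarrow> v \<in> nbrs E u"
  by (simp add: nbrs_def insert_commute)

text \<open>All that the coloring and the program take from the drawing; from here on the argument
  is combinatorial. In \<open>no_three\<close> one of the chords ends at the last vertex of
  \<open>C\<close>, a normal form reached by rotating \<open>C\<close>.\<close>

locale outerpath_structure =
  fixes V :: "'a set" and E :: "'a set set"
  assumes simple: "simple_graph V E"
    and cycles_in_longest: "longest_cycle V E C \<Longrightarrow> graph_cycle V E D \<Longrightarrow> set D \<subseteq> set C"
    and no_crossing: "longest_cycle V E C \<Longrightarrow> a < b \<Longrightarrow> b < c \<Longrightarrow> c < d \<Longrightarrow> d < length C \<Longrightarrow>
      {C ! a, C ! c} \<in> E \<Longrightarrow> {C ! b, C ! d} \<notin> E"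
    and no_three: "longest_cycle V E C \<Longrightarrow> 1 \<le> k \<Longrightarrow> k \<le> i \<Longrightarrow> Suc i < p \<Longrightarrow> p \<le> q \<Longrightarrow> Suc q < j \<Longrightarrow>
      j < length C \<Longrightarrow> {C ! k, C ! (length C - 1)} \<in> E \<Longrightarrow> {C ! i, C ! p} \<in> E \<Longrightarrow> {C ! q, C ! j} \<notin> E"

lemma outerpath_structureI:
  assumes "outerpath V E" shows "outerpath_structure V E"
  by unfold_locales (rule outerpath_structure[OF assms]; assumption)+

text \<open>A longest path in \<open>U\<close> cannot be extended at either end.\<close>

lemma longest_path_exists:
  assumes "finite U" "U \<noteq> {}"
  obtains q where "q \<noteq> []" "distinct q" "set q \<subseteq> U" "path_edges q \<subseteq> E"
    "nbrs E (hd q) \<inter> U \<subseteq> set q" "nbrs E (last q) \<inter> U \<subseteq> set q"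
proof -
  define P where "P q \<longleftrightarrow> q \<noteq> [] \<and> distinct q \<and> set q \<subseteq> U \<and> path_edges q \<subseteq> E" for q
  obtain a where "a \<in> U" using assms(2) by blast
  then have "P [a]" by (simp add: P_def)
  moreover have "length q < Suc (card U)" if "P q" for q
    using that card_mono[OF assms(1), of "set q"] distinct_card[of q] by (simp add: P_def)
  ultimately obtain q where q: "P q" "\<And>r. P r \<Longrightarrow> length r \<le> length q"
    using ex_has_greatest_nat[of P "[a]" length "Suc (card U)"] by (metis less_imp_le)
  have "nbrs E (hd q) \<inter> U \<subseteq> set q"
  proof (rule ccontr)
    assume "\<not> ?thesis"
    then obtain z where z: "{z, hd q} \<in> E" "z \<in> U" "z \<notin> set q" by (auto simp: nbrs_def)
    then have "P (z # q)" using q(1) by (cases q) (auto simp: P_def)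
    then show False using q(2) by fastforce
  qed
  moreover have "nbrs E (last q) \<inter> U \<subseteq> set q"
  proof (rule ccontr)
    assume "\<not> ?thesis"
    then obtain z where z: "{last q, z} \<in> E" "z \<in> U" "z \<notin> set q" by (auto simp: nbrs_def insert_commute)
    then have "P (q @ [z])" using q(1) by (auto simp: P_def path_edges_append)
    then show False using q(2) by fastforce
  qed
  ultimately show ?thesis using that q(1) by (auto simp: P_def)
qed

lemma path_edges_prefix: "path_edges (xs @ [y]) \<subseteq> path_edges (xs @ y # ys)"
  by (cases "xs = []") (auto simp: path_edges_append)

text \<open>The end of the path has a second neighbor in \<open>U\<close>, which lies on the path
  and closes a cycle.\<close>

lemma cycle_in_path:
  assumes q: "distinct q" "set q \<subseteq> V" "path_edges q \<subseteq> E" "nbrs E (hd q) \<inter> U \<subseteq> set q" "q \<noteq> []"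
    and two: "2 \<le> card (nbrs E (hd q) \<inter> U)" and irr: "hd q \<notin> nbrs E (hd q)"
  obtains D where "graph_cycle V E D" "set D \<subseteq> set q"
proof -
  obtain a q' where a: "q = a # q'" using q(5) by (cases q) auto
  have "\<not> nbrs E a \<inter> U \<subseteq> {hd q'}" using two a card_mono[of "{hd q'}" "nbrs E a \<inter> U"] by auto
  then obtain z where z: "z \<in> nbrs E a" "z \<in> U" "z \<noteq> hd q'" by blast
  then have "z \<in> set q'" using q(4) irr a by auto
  then obtain r s where rs: "q' = r @ z # s" by (meson split_list)
  then have rne: "r \<noteq> []" using z by auto
  have "path_edges ((a # r) @ [z]) \<subseteq> path_edges ((a # r) @ z # s)" by (rule path_edges_prefix)
  also have "\<dots> \<subseteq> E" using q(3) a rs by simp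
  finally have pe: "path_edges (a # r @ [z]) \<subseteq> E" by simp
  have "{z, a} \<in> E" using z by (simp add: nbrs_def)
  then have "graph_cycle V E (a # r @ [z])"
    using q a rs pe rne by (auto simp: graph_cycle_iff cycle_edges_def Suc_le_eq)
  moreover have "set (a # r @ [z]) \<subseteq> set q" using a rs by auto
  ultimately show ?thesis using that by blast
qed

text \<open>The outcome of peeling when something is left. The bound on the neighbors of
  \<open>qs ! i\<close> serves twice: it keeps peeled vertices off all cycles, and it allows them to
  be colored in reverse order.\<close>

locale core = outerpath_structure +
  fixes K qs
  assumes K: "K \<noteq> {}" "K = V - set qs"
    and deg: "\<And>v. v \<in> K \<Longrightarrow> 2 \<le> card (nbrs E v \<inter> K)"
    and qs: "distinct qs" "set qs \<subseteq> V" "\<And>i. i < length qs \<Longrightarrow> card (nbrs E (qs ! i) - set (take i qs)) \<le> 1"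
begin

lemma finV: "finite V" using simple by (simp add: simple_graph_def)

lemma finK: "finite K" using finV K by simp

lemma edgeD: "{u, v} \<in> E \<Longrightarrow> u \<noteq> v \<and> u \<in> V \<and> v \<in> V"
  using simple by (auto simp: simple_graph_def)

lemma fin_nbrs: "finite (nbrs E v)"
  using finV edgeD by (intro finite_subset[of "nbrs E v" V]) (auto simp: nbrs_def)

lemma irrefl: "v \<notin> nbrs E v" using edgeD[of v v] by (auto simp: nbrs_def)

abbreviation "LC C \<equiv> longest_cycle V E C"

lemma LC_cycle: "LC C \<Longrightarrow> graph_cycle V E C" by (simp add: longest_cycle_def)

text \<open>The first vertex of a cycle to be peeled would still have both its neighbors on the
  cycle.\<close>

lemma cycle_subset_K:
  assumes "graph_cycle V E D" shows "set D \<subseteq> K"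
proof (rule ccontr)
  assume "\<not> ?thesis"
  then obtain y where "y \<in> set D" "y \<notin> K" by blast
  moreover from this have "y \<in> set qs" using assms K(2) by (auto simp: graph_cycle_iff)
  ultimately have "\<exists>i. i < length qs \<and> qs ! i \<in> set D" by (auto simp: in_set_conv_nth[of y qs])
  then obtain i where i: "i < length qs" "qs ! i \<in> set D" "\<And>j. j < i \<Longrightarrow> \<not> (j < length qs \<and> qs ! j \<in> set D)"
    using exists_least_iff[of "\<lambda>i. i < length qs \<and> qs ! i \<in> set D"] by auto
  obtain l r where D: "D = l @ qs ! i # r" using i(2) by (meson split_list)
  have c: "graph_cycle V E (qs ! i # r @ l)" using graph_cycle_rotate[of V E l "qs ! i # r"] assms D by simp
  then have "Suc (Suc 0) \<le> length (r @ l)" by (auto simp: graph_cycle_iff)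
  then obtain y z zs where yz: "r @ l = y # z # zs" unfolding Suc_le_length_iff by blast
  have "last (z # zs) \<in> set (z # zs)" by simp
  then have w: "{y, last (z # zs)} \<subseteq> nbrs E (qs ! i)" "y \<noteq> last (z # zs)"
    using c unfolding yz graph_cycle_iff by (auto simp: nbrs_def cycle_edges_def insert_commute simp del: last_in_set)
  have "{y, last (z # zs)} \<subseteq> set D" using yz D last_in_set[of "z # zs"] by (auto simp del: last_in_set dest!: arg_cong[of _ _ set])
  moreover have "set D \<inter> set (take i qs) = {}"
  proof (rule ccontr)
    assume "\<not> ?thesis"
    then obtain j where "j < i" "qs ! j \<in> set D" by (auto simp: in_set_conv_nth[of _ "take i qs"])
    then show False using i(1,3) by simp
  qed
  ultimately have "{y, last (z # zs)} \<subseteq> nbrs E (qs ! i) - set (take i qs)" using w by blast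
  then have "card {y, last (z # zs)} \<le> card (nbrs E (qs ! i) - set (take i qs))"
    using fin_nbrs by (intro card_mono) auto
  then show False using qs(3)[OF i(1)] w(2) by simp
qed

text \<open>Consider a maximal path in \<open>K\<close> off \<open>C\<close>. There are no cycles
  off \<open>C\<close>, so each end of the path has at most one neighbor off \<open>C\<close> and,
  as degrees in \<open>K\<close> are at least two, one on \<open>C\<close>. The path then closes,
  directly or along \<open>C\<close>, to a cycle that leaves \<open>C\<close>.\<close>

lemma LC_set: "LC C \<Longrightarrow> set C = K"
proof
  assume C: "LC C"
  show "set C \<subseteq> K" by (rule cycle_subset_K[OF LC_cycle[OF C]])
  have cC: "graph_cycle V E C" by (rule LC_cycle[OF C])
  show "K \<subseteq> set C"
  proof (rule ccontr)
    let ?U = "K - set C"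
    assume "\<not> K \<subseteq> set C"
    then have "?U \<noteq> {}" "finite ?U" using finK by auto
    then obtain q where q: "q \<noteq> []" "distinct q" "set q \<subseteq> ?U" "path_edges q \<subseteq> E"
      "nbrs E (hd q) \<inter> ?U \<subseteq> set q" "nbrs E (last q) \<inter> ?U \<subseteq> set q"
      using longest_path_exists[of ?U E] by metis
    have qV: "set q \<subseteq> V" using q(3) K by auto
    have no: "\<not> graph_cycle V E D" if "set D \<inter> ?U \<noteq> {}" for D
      using that cycles_in_longest[OF C] by blast
    have one: "card (nbrs E (hd r) \<inter> ?U) \<le> 1"
      if r: "r \<noteq> []" "distinct r" "set r \<subseteq> ?U" "path_edges r \<subseteq> E" "nbrs E (hd r) \<inter> ?U \<subseteq> set r" for r
    proof (rule ccontr)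
      assume "\<not> ?thesis"
      then have "2 \<le> card (nbrs E (hd r) \<inter> ?U)" by simp
      moreover have "set r \<subseteq> V" using r(3) K by auto
      ultimately obtain D where D: "graph_cycle V E D" "set D \<subseteq> set r"
        using cycle_in_path[OF r(2) _ r(4,5,1) _ irrefl] by metis
      obtain d where "d \<in> set D" using D(1) by (cases D) (auto simp: graph_cycle_iff)
      then have "d \<in> set D \<inter> ?U" using D(2) r(3) by blast
      then have "set D \<inter> ?U \<noteq> {}" by blast
      then show False using no D(1) by blast
    qed
    have split: "card (nbrs E w \<inter> K) = card (nbrs E w \<inter> ?U) + card (nbrs E w \<inter> set C)" for w
    proof -
      have "nbrs E w \<inter> K = (nbrs E w \<inter> ?U) \<union> (nbrs E w \<inter> set C)" using \<open>set C \<subseteq> K\<close> by blast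
      then show ?thesis using card_Un_disjoint[of "nbrs E w \<inter> ?U" "nbrs E w \<inter> set C"] fin_nbrs by auto
    qed
    have hK: "hd q \<in> K" "last q \<in> K" using q(1,3) hd_in_set last_in_set by blast+
    have rv: "rev q \<noteq> []" "distinct (rev q)" "set (rev q) \<subseteq> ?U" "path_edges (rev q) \<subseteq> E" "nbrs E (hd (rev q)) \<inter> ?U \<subseteq> set (rev q)"
      using q by (auto simp: path_edges_rev hd_rev)
    have h1: "card (nbrs E (hd q) \<inter> ?U) \<le> 1" "card (nbrs E (last q) \<inter> ?U) \<le> 1"
      using one[OF q(1-5)] one[OF rv] q(1) by (auto simp: hd_rev)
    \<comment> \<open>A path of one vertex needs two different attachments on \<open>C\<close> to
      close to a cycle; a longer one may return to the same vertex of \<open>C\<close>.\<close>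
    have "\<exists>c c'. c \<in> set C \<and> c' \<in> set C \<and> {c, hd q} \<in> E \<and> {last q, c'} \<in> E \<and> (c \<noteq> c' \<or> 2 \<le> length q)"
    proof (cases "2 \<le> length q")
      case True
      have "card (nbrs E (hd q) \<inter> set C) \<noteq> 0" "card (nbrs E (last q) \<inter> set C) \<noteq> 0"
        using split deg hK h1 by (metis Suc_1 add.right_neutral le_trans not_less_eq_eq One_nat_def)+
      then obtain c c' where "c \<in> nbrs E (hd q) \<inter> set C" "c' \<in> nbrs E (last q) \<inter> set C"
        by (metis card.empty ex_in_conv)
      then show ?thesis using True by (auto simp: nbrs_def insert_commute)
    next
      case False
      then have "length q = 1" using q(1) by (cases "length q") auto
      then obtain a where a: "q = [a]" by (auto simp: length_Suc_conv)
      then have "nbrs E a \<inter> ?U = {}" using q(5) irrefl by auto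
      then have "2 \<le> card (nbrs E a \<inter> set C)" using split[of a] deg hK a by (metis add.left_neutral card.empty list.sel(1))
      then have "\<not> is_singleton (nbrs E a \<inter> set C)" "nbrs E a \<inter> set C \<noteq> {}" by (auto simp: is_singleton_altdef)
      then obtain c c' where "c \<in> nbrs E a \<inter> set C" "c' \<in> nbrs E a \<inter> set C" "c \<noteq> c'"
        by (metis is_singletonI' )
      then show ?thesis using a by (intro exI[of _ c] exI[of _ c']) (auto simp: nbrs_def insert_commute)
    qed
    then obtain c c' where cc: "c \<in> set C" "c' \<in> set C" "{c, hd q} \<in> E" "{last q, c'} \<in> E" "c \<noteq> c' \<or> 2 \<le> length q" by blast
    have disj: "set q \<inter> set C = {}" using q(3) by blast
    show False
    proof (cases "c = c'")
      case True
      have "graph_cycle V E (c # q)"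
        using cc True q disj qV edgeD[OF cc(3)] unfolding graph_cycle_iff cycle_edges_def
        by (cases q) auto
      then show False using no[of "c # q"] q(1,3) by (auto simp: neq_Nil_conv)
    next
      case False
      obtain l r where lr: "C = l @ c' # r" using cc(2) by (meson split_list)
      then have "c \<in> set (r @ l)" using cc(1) False by auto
      then obtain ys zs where yz: "r @ l = ys @ c # zs" by (meson split_list)
      have cyc: "graph_cycle V E (c' # ys @ c # zs)" using graph_cycle_rotate[of V E l "c' # r"] cC lr yz by simp
      then have pe: "path_edges (c' # ys @ [c]) \<subseteq> E" using cycle_edges_split[of c' ys c zs] by (auto simp: graph_cycle_iff)
      have sub: "set (c' # ys @ [c]) \<subseteq> set C" using lr yz by (auto dest!: arg_cong[of _ _ set])
      have "graph_cycle V E ((c' # ys @ [c]) @ q)"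
        unfolding graph_cycle_iff cycle_edges_def
        using cc q pe cyc disj sub qV
        by (auto simp: path_edges_append'[of "c' # ys @ [c]" q, simplified] graph_cycle_iff Suc_le_eq neq_Nil_conv)
      then show False using no[of "(c' # ys @ [c]) @ q"] q(1,3) by (auto simp: neq_Nil_conv)
    qed
  qed
qed

lemma LC_exists: obtains C where "LC C"
proof -
  obtain q where q: "q \<noteq> []" "distinct q" "set q \<subseteq> K" "path_edges q \<subseteq> E" "nbrs E (hd q) \<inter> K \<subseteq> set q"
    using longest_path_exists[OF finK K(1), of E] by metis
  have "hd q \<in> K" using q by (meson hd_in_set subsetD)
  then obtain D where D: "graph_cycle V E D"
    using cycle_in_path[OF q(2) _ q(4,5,1) deg irrefl] q(3) K(2) by (metis Diff_subset subset_trans)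
  have "length r < Suc (card V)" if "graph_cycle V E r" for r
    using that card_mono[OF finV, of "set r"] distinct_card[of r] by (auto simp: graph_cycle_iff)
  then obtain C where "graph_cycle V E C" "\<And>r. graph_cycle V E r \<Longrightarrow> length r \<le> length C"
    using ex_has_greatest_nat[of "graph_cycle V E" D length "Suc (card V)"] D by (metis less_imp_le)
  then show ?thesis using that by (auto simp: longest_cycle_def)
qed

section \<open>Core vertices without chords, and the chains that they form\<close>

definition small where "small v \<longleftrightarrow> card (nbrs E v \<inter> K) = 2"

lemma LC_props:
  assumes "LC C"
  shows "distinct C" "3 \<le> length C" "set C = K" "\<And>t. Suc t < length C \<Longrightarrow> {C ! t, C ! Suc t} \<in> E"
    "{C ! (length C - 1), C ! 0} \<in> E"
proof -
  have c: "graph_cycle V E C" by (rule LC_cycle[OF assms])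
  then show "distinct C" "3 \<le> length C" by (auto simp: graph_cycle_iff)
  show "set C = K" by (rule LC_set[OF assms])
  show "{C ! t, C ! Suc t} \<in> E" if "Suc t < length C" for t
    using c that by (auto simp: graph_cycle_iff cycle_edges_def path_edges_conv_nth)
  have "C \<noteq> []" using c by (auto simp: graph_cycle_iff)
  then show "{C ! (length C - 1), C ! 0} \<in> E"
    using c by (auto simp: graph_cycle_iff cycle_edges_def last_conv_nth hd_conv_nth)
qed

lemma LC_in_K: "LC C \<Longrightarrow> t < length C \<Longrightarrow> C ! t \<in> K"
  using LC_props(3) nth_mem by blast

lemma small_nbrs:
  assumes "LC C" "0 < t" "Suc t < length C" "small (C ! t)"
  shows "nbrs E (C ! t) \<inter> K = {C ! (t - 1), C ! Suc t}"
proof (rule sym, rule card_subset_eq)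
  note c = LC_props[OF assms(1)]
  have "{C ! (t - 1), C ! t} \<in> E" using c(4)[of "t - 1"] assms(2,3) by simp
  then show "{C ! (t - 1), C ! Suc t} \<subseteq> nbrs E (C ! t) \<inter> K"
    using c(4)[OF assms(3)] LC_in_K[OF assms(1)] assms(2,3) by (auto simp: nbrs_def insert_commute)
  have "C ! (t - 1) \<noteq> C ! Suc t" using c(1) assms(2,3) by (simp add: nth_eq_iff_index_eq)
  then show "card {C ! (t - 1), C ! Suc t} = card (nbrs E (C ! t) \<inter> K)" using assms(4) by (simp add: small_def)
qed (use fin_nbrs in simp)

lemma small_nbrs_0:
  assumes "LC C" "small (C ! 0)"
  shows "nbrs E (C ! 0) \<inter> K = {C ! (length C - 1), C ! 1}"
proof (rule sym, rule card_subset_eq)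
  note c = LC_props[OF assms(1)]
  have "{C ! 0, C ! 1} \<in> E" using c(4)[of 0] c(2) by auto
  then show "{C ! (length C - 1), C ! 1} \<subseteq> nbrs E (C ! 0) \<inter> K"
    using c(5) LC_in_K[OF assms(1)] c(2) by (auto simp: nbrs_def insert_commute)
  have "C ! (length C - 1) \<noteq> C ! 1" using c(1,2) by (simp add: nth_eq_iff_index_eq)
  then show "card {C ! (length C - 1), C ! 1} = card (nbrs E (C ! 0) \<inter> K)" using assms(2) by (simp add: small_def)
qed (use fin_nbrs in simp)

lemma LC_rotate_to:
  assumes "LC C" "a < length C"
  obtains D where "LC D" "length D = length C" "\<And>t. t < length C \<Longrightarrow> D ! t = C ! ((a + t) mod length C)"
proof (rule that[of "drop a C @ take a C"])
  show "LC (drop a C @ take a C)" using longest_cycle_rotate[of V E "take a C" "drop a C"] assms by simp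
  show "length (drop a C @ take a C) = length C" using assms by simp
  show "(drop a C @ take a C) ! t = C ! ((a + t) mod length C)" if "t < length C" for t
  proof (cases "a + t < length C")
    case True then show ?thesis using assms by (auto simp: nth_append)
  next
    case False
    then have "(a + t) mod length C = a + t - length C" using that assms(2) by (simp add: mod_if)
    moreover have "\<not> t < length C - a" "t - (length C - a) = a + t - length C" using False assms(2) by linarith+
    ultimately show ?thesis using that assms(2) by (simp add: nth_append)
  qed
qed

text \<open>The two core neighbors of the chordless \<open>x\<close> are next to it on every longest
  cycle. So rotation and, if necessary, reversal put \<open>v\<close> in front of it.\<close>

lemma orient:
  assumes "v \<in> K" "x \<in> K" "{x, v} \<in> E" "small x"
  obtains C where "LC C" "C ! 0 = v" "C ! 1 = x"
proof -
  obtain C0 where C0: "LC C0" using LC_exists .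
  have "x \<in> set C0" using LC_props(3)[OF C0] assms by simp
  then obtain a where a: "a < length C0" "C0 ! a = x" by (metis in_set_conv_nth)
  obtain D where D: "LC D" "length D = length C0" "\<And>t. t < length C0 \<Longrightarrow> D ! t = C0 ! ((a + t) mod length C0)"
    using LC_rotate_to[OF C0 a(1)] by blast
  have l: "3 \<le> length D" using LC_props(2)[OF D(1)] .
  have "0 < length C0" using a(1) by linarith
  then have D0: "D ! 0 = x" using D(3)[of 0] a by simp
  have "v \<in> nbrs E (D ! 0) \<inter> K" using assms D0 by (simp add: nbrs_def insert_commute)
  then have "v = D ! (length D - 1) \<or> v = D ! 1" using small_nbrs_0[OF D(1)] assms(4) D0 by auto
  then show ?thesis
  proof
    assume v: "v = D ! (length D - 1)"
    have n: "D \<noteq> []" using l by auto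
    then have s: "D = butlast D @ [last D]" by simp
    then have "LC ([last D] @ butlast D)" using longest_cycle_rotate[of V E "butlast D" "[last D]"] D(1) by simp
    moreover have "([last D] @ butlast D) ! 0 = v" using v n by (simp add: last_conv_nth)
    moreover have "([last D] @ butlast D) ! 1 = x" using D0 l by (simp add: nth_butlast)
    ultimately show ?thesis using that by blast
  next
    assume v: "v = D ! 1"
    obtain d e ds where s: "D = d # e # ds" using l by (auto simp: numeral_3_eq_3 Suc_le_length_iff)
    have "LC ((e # ds) @ [d])" using longest_cycle_rotate[of V E "[d]" "e # ds"] D(1) s by simp
    then have "LC (rev ((e # ds) @ [d]))" by (rule longest_cycle_rev)
    then have "LC ([d] @ rev ds @ [e])" by simp
    then have "LC (([d] @ rev ds) @ [e])" by simp
    then have "LC ([e] @ [d] @ rev ds)" using longest_cycle_rotate[of V E "[d] @ rev ds" "[e]"] by simp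
    then show ?thesis using that[of "[e] @ [d] @ rev ds"] v D0 s by simp
  qed
qed

lemma LC_length: "LC C \<Longrightarrow> length C = card K"
  using LC_props(1,3) distinct_card by metis

text \<open>At a chordless vertex the way on is forced by the vertex before it. So the chain from
  \<open>v\<close> through \<open>x\<close> does not depend on the cycle along which it is
  read.\<close>

lemma chain_unique:
  assumes "LC C" "LC D" "C ! 0 = D ! 0" "C ! 1 = D ! 1" "m < card K" "\<And>t. 1 \<le> t \<Longrightarrow> t < m \<Longrightarrow> small (C ! t)"
  shows "t \<le> m \<Longrightarrow> C ! t = D ! t"
proof (induction t rule: less_induct)
  case (less t)
  note l = LC_length[OF assms(1)] LC_length[OF assms(2)]
  show ?case
  proof (cases "t \<le> 1")
    case True then show ?thesis using assms(3,4) by (cases "t = 0") (auto simp: le_Suc_eq)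
  next
    case False
    then obtain s where s: "t = Suc s" "0 < s" by (cases t) auto
    then have e: "C ! s = D ! s" "C ! (s - 1) = D ! (s - 1)" using less by auto
    have sm: "small (C ! s)" using assms(6)[of s] s less.prems by simp
    have "{C ! (s - 1), C ! Suc s} = {D ! (s - 1), D ! Suc s}"
      using small_nbrs[OF assms(1) s(2)] small_nbrs[OF assms(2) s(2)] e sm s less.prems assms(5) l by simp
    moreover have "D ! (s - 1) \<noteq> D ! Suc s"
      using LC_props(1)[OF assms(2)] s less.prems assms(5) l by (simp add: nth_eq_iff_index_eq)
    ultimately show ?thesis using e s by (auto simp: doubleton_eq_iff)
  qed
qed

text \<open>The chain from \<open>v\<close> through \<open>x\<close> and further vertices without chords ends at a neighbor of \<open>v\<close>,
  so that it bounds an inner face at an end of the weak dual path.\<close>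

definition good where
  "good v x \<longleftrightarrow> (\<exists>C m. LC C \<and> C ! 0 = v \<and> C ! 1 = x \<and> 2 \<le> m \<and> m < card K \<and>
     (\<forall>t. 1 \<le> t \<and> t < m \<longrightarrow> small (C ! t)) \<and> \<not> small (C ! m) \<and> {C ! 0, C ! m} \<in> E)"

text \<open>By \<open>chain_unique\<close> the first vertex with a chord on the chain is the same on
  every cycle. Hence one negative adjacency test at this vertex refutes
  \<open>good v x\<close>.\<close>

lemma goodD:
  assumes "good v x" "LC C" "C ! 0 = v" "C ! 1 = x" "2 \<le> m" "m < card K"
    "\<And>t. 1 \<le> t \<Longrightarrow> t < m \<Longrightarrow> small (C ! t)" "\<not> small (C ! m)"
  shows "{v, C ! m} \<in> E"
proof -
  obtain D l where D: "LC D" "D ! 0 = v" "D ! 1 = x" "2 \<le> l" "l < card K"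
    "\<And>t. 1 \<le> t \<Longrightarrow> t < l \<Longrightarrow> small (D ! t)" "\<not> small (D ! l)" "{D ! 0, D ! l} \<in> E"
    using assms(1) by (auto simp: good_def)
  have 1: "C ! t = D ! t" if "t \<le> m" for t using chain_unique[OF assms(2) D(1) _ _ assms(6,7)] assms D that by auto
  have 2: "D ! t = C ! t" if "t \<le> l" for t using chain_unique[OF D(1) assms(2) _ _ D(5,6)] assms D that by auto
  have "m = l"
  proof (rule ccontr)
    assume "m \<noteq> l"
    then consider "m < l" | "l < m" by linarith
    then show False
    proof cases
      case 1 then show False using D(6)[of m] assms(5,8) 2[of m] by simp
    next
      case 2 then show False using assms(7)[of l] D(4,7) 1[of l] by simp
    qed
  qed
  then show ?thesis using D 1[of m] by simp
qed

text \<open>The sweep starts at the edge between the first and the last vertex of \<open>C\<close>. It runs over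
  the chain of vertices before \<open>C ! k\<close>, and the chords on the rest of \<open>C\<close> are linearly ordered.\<close>

definition start_ok where
  "start_ok u v \<longleftrightarrow> (\<exists>C k. LC C \<and> C ! 0 = u \<and> C ! (card K - 1) = v \<and> Suc k < card K \<and> (\<forall>t<k. small (C ! t)) \<and>
    (\<forall>i p q j. k \<le> i \<longrightarrow> Suc i < p \<longrightarrow> p \<le> q \<longrightarrow> Suc q < j \<longrightarrow> j < card K \<longrightarrow>
       {C ! i, C ! p} \<in> E \<longrightarrow> {C ! q, C ! j} \<notin> E))"

lemma rotate1_LC:
  assumes "LC C"
  obtains D where "LC D" "\<And>t. Suc t < card K \<Longrightarrow> D ! t = C ! Suc t" "D ! (card K - 1) = C ! 0"
proof -
  note l = LC_length[OF assms] LC_props(2)[OF assms]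
  obtain c cs where c: "C = c # cs" using l by (cases C) auto
  have "LC (cs @ [c])" using longest_cycle_rotate[of V E "[c]" cs] assms c by simp
  moreover have "card K - 1 = length cs" using l c by simp
  ultimately show ?thesis using that[of "cs @ [c]"] l c by (auto simp: nth_append)
qed

text \<open>Rotating \<open>v\<close> to the end of the cycle turns the chord to
  \<open>C ! m\<close> into the one that \<open>no_three\<close> expects at the last vertex, with
  \<open>k = m - 1\<close>. It counts as one of three, so the rest of the cycle has no two chords
  with disjoint pieces.\<close>

lemma good_start:
  assumes C: "LC C" "C ! 0 = v" "C ! 1 = x" and m: "2 \<le> m" "Suc m < card K"
    and s: "\<And>t. 1 \<le> t \<Longrightarrow> t < m \<Longrightarrow> small (C ! t)" and e: "{v, C ! m} \<in> E"
  shows "start_ok x v"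
proof -
  obtain D where D: "LC D" "\<And>t. Suc t < card K \<Longrightarrow> D ! t = C ! Suc t" "D ! (card K - 1) = C ! 0"
    using rotate1_LC[OF C(1)] by blast
  note l = LC_length[OF D(1)]
  have e': "{D ! (m - 1), D ! (length D - 1)} \<in> E" using e C D(2)[of "m - 1"] D(3) m l by (simp add: insert_commute)
  show ?thesis unfolding start_ok_def
  proof (intro exI[of _ D] exI[of _ "m - 1"] conjI allI impI)
    show "LC D" "D ! (card K - 1) = v" using D C by auto
    show "D ! 0 = x" using D(2)[of 0] C m by simp
    show "Suc (m - 1) < card K" using m by simp
    show "small (D ! t)" if "t < m - 1" for t using s[of "Suc t"] D(2)[of t] that m by simp
    show "{D ! q, D ! j} \<notin> E" if "m - 1 \<le> i" "Suc i < p" "p \<le> q" "Suc q < j" "j < card K" "{D ! i, D ! p} \<in> E" for i p q j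
      using no_three[OF D(1) _ that(1-4) _ e' that(6)] that m l by simp
  qed
qed

text \<open>The end of a chord has a third neighbor besides its two neighbors on
  \<open>C\<close>.\<close>

lemma chord_not_small:
  assumes C: "LC C" and ab: "a < length C" "b < length C" "a \<noteq> b" "{C ! a, C ! b} \<in> E"
    "Suc a \<noteq> b" "Suc b \<noteq> a" "\<not> (a = 0 \<and> Suc b = length C)" "\<not> (b = 0 \<and> Suc a = length C)"
  shows "\<not> small (C ! a)"
proof
  assume s: "small (C ! a)"
  note c = LC_props[OF C]
  have b: "C ! b \<in> nbrs E (C ! a) \<inter> K" using ab LC_in_K[OF C] by (auto simp: nbrs_def insert_commute)
  consider "a = 0" | "0 < a" "Suc a < length C" | "0 < a" "Suc a = length C" using ab by linarith
  then show False
  proof cases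
    case 1
    then have "C ! b = C ! (length C - 1) \<or> C ! b = C ! 1" using small_nbrs_0[OF C] s b by auto
    then show False using c(1,2) ab 1 by (auto simp: nth_eq_iff_index_eq)
  next
    case 2
    then have "C ! b = C ! (a - 1) \<or> C ! b = C ! Suc a" using small_nbrs[OF C 2] s b by auto
    then show False using c(1,2) ab 2 by (auto simp: nth_eq_iff_index_eq)
  next
    case 3
    have "{C ! b, C ! (a - 1), C ! 0} \<subseteq> nbrs E (C ! a) \<inter> K"
    proof -
      have "{C ! (a - 1), C ! a} \<in> E" using c(4)[of "a - 1"] 3 by simp
      moreover have "a = length C - 1" using 3 by auto
      then have "{C ! 0, C ! a} \<in> E" using c(5) by (auto simp: insert_commute)
      moreover have "0 < length C" "a - 1 < length C" using 3 by linarith+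
      then have "C ! 0 \<in> K" "C ! (a - 1) \<in> K" using LC_in_K[OF C] by blast+
      ultimately show ?thesis using b
        by (auto simp: nbrs_def insert_commute)
    qed
    then have "card {C ! b, C ! (a - 1), C ! 0} \<le> 2" using s card_mono[of "nbrs E (C ! a) \<inter> K"] fin_nbrs by (metis finite_Int small_def)
    moreover have "0 < length C" "a - 1 < length C" "b \<noteq> a - 1" "b \<noteq> 0" "a - 1 \<noteq> 0" using 3 ab c(2) by linarith+
    then have "C ! b \<noteq> C ! (a - 1)" "C ! b \<noteq> C ! 0" "C ! (a - 1) \<noteq> C ! 0"
      using ab(2) by (simp_all add: nth_eq_iff_index_eq[OF c(1)])
    ultimately show False by simp
  qed
qed

text \<open>Its use is to stop the walk along a chain: the far end \<open>C ! q\<close> of a chord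
  at the first vertex is met before the cycle closes.\<close>

lemma not_small_chord:
  assumes C: "LC C" and s: "\<not> small (C ! 0)"
  obtains q where "2 \<le> q" "Suc q < card K" "\<not> small (C ! q)" 
proof -
  note c = LC_props[OF C] and l = LC_length[OF C]
  have K0: "C ! 0 \<in> K" using LC_in_K[OF C, of 0] c(2) by (cases C) auto
  then have "2 < card (nbrs E (C ! 0) \<inter> K)" using deg[of "C ! 0"] s by (simp add: small_def)
  then have "\<not> nbrs E (C ! 0) \<inter> K \<subseteq> {C ! 1, C ! (length C - 1)}"
    using card_mono[of "{C ! 1, C ! (length C - 1)}" "nbrs E (C ! 0) \<inter> K"] card_insert_le_m1[of 2 "{C ! (length C - 1)}" "C ! 1"]
    by (auto simp: card_insert_if split: if_splits)
  then obtain z where z: "z \<in> nbrs E (C ! 0)" "z \<in> set C" "z \<noteq> C ! 1" "z \<noteq> C ! (length C - 1)" using c(3) by blast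
  then obtain q where q: "q < length C" "z = C ! q" by (metis in_set_conv_nth)
  have "q \<noteq> 0" using z q irrefl by metis
  moreover have "q \<noteq> 1" "q \<noteq> length C - 1" using z q by auto
  ultimately have q2: "2 \<le> q" "Suc q < length C" using q by auto
  moreover have "\<not> small (C ! q)"
    using chord_not_small[OF C q(1), of 0] q2 z q c(2) by (cases C) (auto simp: nbrs_def)
  ultimately show ?thesis using that l by auto
qed

text \<open>If the search fails there are no chords at all. The vertices cut off by a shortest chord
  would be chordless, since a further chord at one of them would cross it or be shorter; so the
  chain along them would be good. Without chords any edge of the core serves as a start.\<close>

lemma chordless_start:
  assumes ng: "\<And>v x. v \<in> K \<Longrightarrow> \<not> small v \<Longrightarrow> x \<in> nbrs E v \<inter> K \<Longrightarrow> small x \<Longrightarrow> \<not> good v x"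
    and uv: "u \<in> K" "v \<in> K" "{u, v} \<in> E"
  shows "start_ok u v"
proof -
  define ch where "ch C d \<longleftrightarrow> (\<exists>a b. a < b \<and> b < length C \<and> Suc a \<noteq> b \<and> \<not> (a = 0 \<and> Suc b = length C) \<and> {C ! a, C ! b} \<in> E \<and> d = b - a)"
    for C :: "'a list" and d
  have nochord: "\<not> ch C d" if C: "LC C" for C d
  proof
    assume "ch C d"
    then obtain d where d: "ch C d" "\<And>d'. d' < d \<Longrightarrow> \<not> ch C d'" using exists_least_iff[of "ch C"] by blast
    then obtain a b where ab: "a < b" "b < length C" "Suc a \<noteq> b" "\<not> (a = 0 \<and> Suc b = length C)" "{C ! a, C ! b} \<in> E" "d = b - a"
      by (auto simp: ch_def)
    note c = LC_props[OF C] and l = LC_length[OF C]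
    have ba: "{C ! b, C ! a} \<in> E" using ab by (simp add: insert_commute)
    have big: "\<not> small (C ! a)" "\<not> small (C ! b)"
      using chord_not_small[OF C _ _ _ ab(5)] chord_not_small[OF C _ _ _ ba] ab by auto
    have sm: "small (C ! t)" if t: "a < t" "t < b" for t
    proof (rule ccontr)
      assume ns: "\<not> small (C ! t)"
      have tK: "C ! t \<in> K" using LC_in_K[OF C] t ab by simp
      then have "2 < card (nbrs E (C ! t) \<inter> K)" using deg[of "C ! t"] ns by (simp add: small_def)
      then have "\<not> nbrs E (C ! t) \<inter> K \<subseteq> {C ! (t - 1), C ! Suc t}"
        using card_mono[of "{C ! (t - 1), C ! Suc t}" "nbrs E (C ! t) \<inter> K"]
        by (auto simp: card_insert_if split: if_splits)
      then obtain z where z: "z \<in> nbrs E (C ! t)" "z \<in> set C" "z \<noteq> C ! (t - 1)" "z \<noteq> C ! Suc t" using c(3) by blast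
      then obtain s where s: "s < length C" "z = C ! s" by (metis in_set_conv_nth)
      have st: "{C ! s, C ! t} \<in> E" "{C ! t, C ! s} \<in> E" using z s by (auto simp: nbrs_def insert_commute)
      have "s \<noteq> t" using z s irrefl by metis
      moreover have "s \<noteq> t - 1" "s \<noteq> Suc t" using z s by auto
      ultimately consider "s < a" | "b < s" | "a \<le> s" "Suc s < t" | "Suc t < s" "s \<le> b" by linarith
      then show False
      proof cases
        case 1 then show False using no_crossing[OF C 1 t ab(2) st(1)] ab by simp
      next
        case 2 then show False using no_crossing[OF C t 2 s(1) ab(5)] st by simp
      next
        case 3
        then have "ch C (t - s)" unfolding ch_def using st t ab by (intro exI[of _ s] exI[of _ t]) auto
        moreover have "t - s < d" using 3 t ab by linarith
        ultimately show False using d(2) by blast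
      next
        case 4
        then have "ch C (s - t)" unfolding ch_def using st t ab s by (intro exI[of _ t] exI[of _ s]) auto
        moreover have "s - t < d" using 4 t ab by linarith
        ultimately show False using d(2) by blast
      qed
    qed
    obtain D where D: "LC D" "length D = length C" "\<And>t. t < length C \<Longrightarrow> D ! t = C ! ((a + t) mod length C)"
      using LC_rotate_to[OF C, of a] ab by auto
    have Dt: "D ! t = C ! (a + t)" if "t \<le> b - a" for t using D(3)[of t] that ab by simp
    have "good (C ! a) (C ! Suc a)" unfolding good_def
    proof (intro exI[of _ D] exI[of _ "b - a"] conjI allI impI)
      show "D ! 0 = C ! a" "D ! 1 = C ! Suc a" "\<not> small (D ! (b - a))" "{D ! 0, D ! (b - a)} \<in> E"
        using Dt ab big by auto
      show "small (D ! t)" if "1 \<le> t \<and> t < b - a" for t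
      proof -
        have "a < a + t" "a + t < b" "t \<le> b - a" using that by linarith+
        then show ?thesis using sm[of "a + t"] Dt[of t] by simp
      qed
    qed (use D ab l in auto)
    moreover have "C ! Suc a \<in> nbrs E (C ! a) \<inter> K" 
      using c(4)[of a] LC_in_K[OF C, of "Suc a"] ab by (auto simp: nbrs_def insert_commute)
    moreover have "small (C ! Suc a)" using sm[of "Suc a"] ab by simp
    ultimately show False using ng[of "C ! a" "C ! Suc a"] big LC_in_K[OF C, of a] ab by simp
  qed
  have all_small: "small w" if w: "w \<in> K" for w
  proof (rule ccontr)
    assume ns: "\<not> small w"
    obtain C where C: "LC C" using LC_exists .
    obtain a where a: "a < length C" "C ! a = w" using LC_props(3)[OF C] w by (metis in_set_conv_nth)
    obtain D where D: "LC D" "length D = length C" "\<And>t. t < length C \<Longrightarrow> D ! t = C ! ((a + t) mod length C)"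
      using LC_rotate_to[OF C a(1)] by auto
    have D0: "\<not> small (D ! 0)" using D(3)[of 0] a ns by (cases C) auto
    have "0 < length D" using LC_props(2)[OF D(1)] by linarith
    then have "2 < card (nbrs E (D ! 0) \<inter> K)" using deg[OF LC_in_K[OF D(1)], of 0] D0
      by (simp add: small_def)
    then have "\<not> nbrs E (D ! 0) \<inter> K \<subseteq> {D ! 1, D ! (length D - 1)}"
      using card_mono[of "{D ! 1, D ! (length D - 1)}" "nbrs E (D ! 0) \<inter> K"]
      by (auto simp: card_insert_if split: if_splits)
    then obtain z where z: "z \<in> nbrs E (D ! 0)" "z \<in> set D" "z \<noteq> D ! 1" "z \<noteq> D ! (length D - 1)"
      using LC_props(3)[OF D(1)] by blast
    then obtain q where q: "q < length D" "z = D ! q" by (metis in_set_conv_nth)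
    have "q \<noteq> 0" using z q irrefl by metis
    moreover have "q \<noteq> 1" "q \<noteq> length D - 1" using z q by auto
    ultimately have "ch D q" unfolding ch_def using z q
      by (intro exI[of _ 0] exI[of _ q]) (auto simp: nbrs_def insert_commute)
    then show False using nochord[OF D(1)] by blast
  qed
  obtain C where C: "LC C" "C ! 0 = v" "C ! 1 = u" using orient[OF uv(2,1) uv(3) all_small[OF uv(1)]] .
  obtain D where D: "LC D" "\<And>t. Suc t < card K \<Longrightarrow> D ! t = C ! Suc t" "D ! (card K - 1) = C ! 0"
    using rotate1_LC[OF C(1)] by blast
  note l = LC_length[OF D(1)] LC_props(2)[OF D(1)]
  show ?thesis unfolding start_ok_def
  proof (intro exI[of _ D] exI[of _ "0::nat"] conjI allI impI)
    show "D ! 0 = u" using D(2)[of 0] C l by simp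
    show "{D ! q, D ! j} \<notin> E" if "0 \<le> i" "Suc i < p" "p \<le> q" "Suc q < j" "j < card K" "{D ! i, D ! p} \<in> E" for i p q j
    proof -
      have "ch D (p - i)" unfolding ch_def using that l by (intro exI[of _ i] exI[of _ p]) auto
      then show ?thesis using nochord[OF D(1)] by blast
    qed
  qed (use D C l in auto)
qed

end

text \<open>The reason is a descent: a monochromatic edge at \<open>qs ! i\<close> forces its other
  end to be peeled earlier, since otherwise that end would be among the neighbors whose color
  \<open>qs ! i\<close> avoids. Then the roles of the two ends can be exchanged, and so on.\<close>

lemma peeled_proper:
  assumes "distinct qs" "{a, b} \<in> E" "c a = c b"
    and col: "\<And>i y. i < length qs \<Longrightarrow> y \<in> nbrs E (qs ! i) - set (take i qs) \<Longrightarrow> c y \<noteq> c (qs ! i)"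
  shows "a \<notin> set qs \<and> b \<notin> set qs"
proof -
  have *: "\<exists>j<i. qs ! j = b" if i: "i < length qs" "qs ! i = a" "{a, b} \<in> E" "c a = c b" for i a b
  proof (rule ccontr)
    assume "\<not> ?thesis"
    then have "b \<notin> set (take i qs)" using i by (auto simp: in_set_conv_nth)
    then have "c b \<noteq> c a" using col[of i b] i by (auto simp: nbrs_def insert_commute)
    then show False using i by simp
  qed
  have "False" if "i < length qs" "qs ! i = a" "{a, b} \<in> E" "c a = c b" for i a b
    using that
  proof (induction i arbitrary: a b rule: less_induct)
    case (less i)
    obtain j where j: "j < i" "qs ! j = b" using *[OF less.prems] by blast
    show False using less.IH[OF j(1), of b a] j less.prems by (simp add: insert_commute)
  qed
  then show ?thesis using assms(2,3) by (metis in_set_conv_nth insert_commute)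
qed

section \<open>How many chains meet a vertex\<close>

context core
begin

text \<open>The vertices that are met when the chain from \<open>v\<close> through \<open>x\<close> is followed.\<close>

definition CH where
  "CH v x = {C ! m | C m. LC C \<and> C ! 0 = v \<and> C ! 1 = x \<and> \<not> small v \<and> 1 \<le> m \<and> m < card K \<and>
     (\<forall>t. 1 \<le> t \<and> t \<le> m \<longrightarrow> small (C ! t))}"

lemma CH_subset: "CH v x \<subseteq> K"
  using LC_in_K LC_length by (auto simp: CH_def)

text \<open>Chordless vertices force the way back as well. The shorter chain arrives at its first
  vertex, which is not chordless, so the longer one cannot pass through it and begins there
  too.\<close>

lemma chain_unique_back:
  assumes C: "LC C" "m < card K" "1 \<le> m" "\<And>t. 1 \<le> t \<Longrightarrow> t \<le> m \<Longrightarrow> small (C ! t)" "\<not> small (C ! 0)"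
    and D: "LC D" "l < card K" "m \<le> l" "\<And>t. 1 \<le> t \<Longrightarrow> t \<le> l \<Longrightarrow> small (D ! t)"
    and e: "C ! m = D ! l" "C ! (m - 1) = D ! (l - 1)"
  shows "C ! 0 = D ! 0 \<and> C ! 1 = D ! 1"
proof -
  note lC = LC_length[OF C(1)] and lD = LC_length[OF D(1)]
  have eq: "t \<le> m \<Longrightarrow> C ! (m - t) = D ! (l - t)" for t
  proof (induction t rule: less_induct)
    case (less t)
    show ?case
    proof (cases "t \<le> 1")
      case True then show ?thesis using e by (cases t) auto
    next
      case False
      then obtain s where s: "t = Suc (Suc s)" by (metis One_nat_def not_less_eq_eq old.nat.exhaust zero_le)
      have i: "0 < m - Suc s" "0 < l - Suc s" using s less.prems D(3) by auto
      have a: "C ! (m - Suc s) = D ! (l - Suc s)" "C ! (m - s) = D ! (l - s)" using less s by auto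
      have c1: "m - Suc s - 1 = m - t" "Suc (m - Suc s) = m - s" "l - Suc s - 1 = l - t" "Suc (l - Suc s) = l - s"
        using s less.prems D(3) by auto
      have sm: "small (C ! (m - Suc s))" "small (D ! (l - Suc s))" using C(4) D(4) i by auto
      have "{C ! (m - t), C ! (m - s)} = {D ! (l - t), D ! (l - s)}"
        using small_nbrs[OF C(1) i(1) _ sm(1)] small_nbrs[OF D(1) i(2) _ sm(2)] a C(2) D(2) lC lD unfolding c1 by simp
      moreover have "D ! (l - t) \<noteq> D ! (l - s)"
        using LC_props(1)[OF D(1)] s less.prems D(2,3) lD by (simp add: nth_eq_iff_index_eq)
      ultimately show ?thesis using a by (auto simp: doubleton_eq_iff)
    qed
  qed
  have "l = m"
  proof (rule ccontr)
    assume "l \<noteq> m"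
    then have "small (D ! (l - m))" using D(3,4) by simp
    then show False using eq[of m] C(5) by simp
  qed
  then show ?thesis using eq[of m] eq[of "m - 1"] C(3) by simp
qed

text \<open>A chain through \<open>z\<close> is determined by the neighbor from which it enters
  \<open>z\<close>, and a vertex on a chain has just two neighbors in the core.\<close>

lemma card_chains_le_2: "card {(v, x). v \<in> K \<and> x \<in> nbrs E v \<inter> K \<and> z \<in> CH v x} \<le> 2" (is "card ?S \<le> 2")
proof (cases "?S = {}")
  case True then show ?thesis by (simp only: card.empty)
next
  case False
  define D where "D vx y \<longleftrightarrow> (\<exists>C m. LC C \<and> C ! 0 = fst vx \<and> C ! 1 = snd vx \<and> \<not> small (C ! 0) \<and> 1 \<le> m \<and> m < card K \<and>
     (\<forall>t. 1 \<le> t \<and> t \<le> m \<longrightarrow> small (C ! t)) \<and> z = C ! m \<and> y = C ! (m - 1))" for vx y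
  have ex: "\<exists>y. D vx y" if "vx \<in> ?S" for vx using that by (fastforce simp: CH_def D_def)
  define f where "f vx = (SOME y. D vx y)" for vx
  have Df: "D vx (f vx)" if "vx \<in> ?S" for vx unfolding f_def using someI_ex[OF ex[OF that]] .
  have uniq: "vx = wy" if D: "D vx y" "D wy y" for vx wy y
  proof -
    obtain C m where C: "LC C" "C ! 0 = fst vx" "C ! 1 = snd vx" "\<not> small (C ! 0)" "1 \<le> m" "m < card K"
     "\<And>t. 1 \<le> t \<Longrightarrow> t \<le> m \<Longrightarrow> small (C ! t)" "z = C ! m" "y = C ! (m - 1)" using D(1) unfolding D_def by blast
    obtain B l where B: "LC B" "B ! 0 = fst wy" "B ! 1 = snd wy" "\<not> small (B ! 0)" "1 \<le> l" "l < card K"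
     "\<And>t. 1 \<le> t \<Longrightarrow> t \<le> l \<Longrightarrow> small (B ! t)" "z = B ! l" "y = B ! (l - 1)" using D(2) unfolding D_def by blast
    have e: "C ! m = B ! l" "C ! (m - 1) = B ! (l - 1)" using C(8,9) B(8,9) by simp_all
    have "C ! 0 = B ! 0 \<and> C ! 1 = B ! 1"
    proof (cases "m \<le> l")
      case True
      show ?thesis using chain_unique_back[OF C(1,6,5) _ C(4) B(1,6) True _ e] C(7) B(7) by blast
    next
      case False
      show ?thesis using chain_unique_back[OF B(1,6,5) _ B(4) C(1,6) _ _ e[symmetric]] C(7) B(7) False by simp
    qed
    then show ?thesis using C(2,3) B(2,3) by (metis prod_eqI)
  qed
  have "inj_on f ?S"
  proof (rule inj_onI)
    fix a b assume "a \<in> ?S" "b \<in> ?S" "f a = f b"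
    then have "D a (f a)" "D b (f a)" using Df[of a] Df[of b] by simp_all
    then show "a = b" by (rule uniq)
  qed
  moreover have sub: "f ` ?S \<subseteq> nbrs E z \<inter> K"
  proof
    fix y assume "y \<in> f ` ?S"
    then obtain vx where "D vx y" using Df by blast
    then obtain C m where C: "LC C" "1 \<le> m" "m < card K" "z = C ! m" "y = C ! (m - 1)" by (auto simp: D_def)
    then show "y \<in> nbrs E z \<inter> K"
      using LC_props(4)[OF C(1), of "m - 1"] LC_in_K[OF C(1), of "m - 1"] LC_length[OF C(1)] by (simp add: nbrs_def)
  qed
  moreover have "card (nbrs E z \<inter> K) = 2"
    using False by (auto simp: CH_def small_def)
  ultimately show ?thesis using card_image[of f ?S] card_mono[OF _ sub] fin_nbrs by simp
qed

text \<open>Double counting of the pairs of a chain and a vertex on it. With the cost of scanning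
  the list of a vertex as \<open>W\<close>, this makes the search for the start linear.\<close>

lemma chase_cost:
  "(\<Sum>v\<in>K. \<Sum>x\<in>nbrs E v \<inter> K. \<Sum>z\<in>CH v x. W z) \<le> 2 * (\<Sum>z\<in>K. W z)" for W :: "'a \<Rightarrow> nat"
proof -
  let ?P = "Sigma K (\<lambda>v. nbrs E v \<inter> K)"
  have finP: "finite ?P" using finK fin_nbrs by auto
  have "(\<Sum>v\<in>K. \<Sum>x\<in>nbrs E v \<inter> K. \<Sum>z\<in>CH v x. W z) = (\<Sum>(v, x)\<in>?P. \<Sum>z\<in>CH v x. W z)"
    using finK fin_nbrs by (subst sum.Sigma) auto
  also have "\<dots> = (\<Sum>vx\<in>?P. \<Sum>z\<in>K. if z \<in> CH (fst vx) (snd vx) then W z else 0)"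
  proof (rule sum.cong[OF refl])
    fix vx
    have "K \<inter> CH (fst vx) (snd vx) = CH (fst vx) (snd vx)" using CH_subset by blast
    then show "(case vx of (v, x) \<Rightarrow> \<Sum>z\<in>CH v x. W z) = (\<Sum>z\<in>K. if z \<in> CH (fst vx) (snd vx) then W z else 0)"
      using sum.inter_restrict[OF finK, of W "CH (fst vx) (snd vx)"] by (simp add: case_prod_beta)
  qed
  also have "\<dots> = (\<Sum>z\<in>K. \<Sum>vx\<in>?P. if z \<in> CH (fst vx) (snd vx) then W z else 0)" by (rule sum.swap)
  also have "\<dots> = (\<Sum>z\<in>K. card {(v, x). v \<in> K \<and> x \<in> nbrs E v \<inter> K \<and> z \<in> CH v x} * W z)"
  proof (rule sum.cong[OF refl])
    fix z
    have "?P \<inter> {vx. z \<in> CH (fst vx) (snd vx)} = {(v, x). v \<in> K \<and> x \<in> nbrs E v \<inter> K \<and> z \<in> CH v x}" by auto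
    then show "(\<Sum>vx\<in>?P. if z \<in> CH (fst vx) (snd vx) then W z else 0) =
       card {(v, x). v \<in> K \<and> x \<in> nbrs E v \<inter> K \<and> z \<in> CH v x} * W z"
      using sum.inter_restrict[OF finP, of "\<lambda>_. W z" "{vx. z \<in> CH (fst vx) (snd vx)}"] by simp
  qed
  also have "\<dots> \<le> (\<Sum>z\<in>K. 2 * W z)" by (intro sum_mono mult_right_mono card_chains_le_2) simp
  finally show ?thesis by (simp add: sum_distrib_left)
qed

section \<open>The sweep of the core\<close>

definition start where
  "start C k \<longleftrightarrow> LC C \<and> Suc k < card K \<and> (\<forall>t<k. small (C ! t)) \<and>
    (\<forall>i p q j. k \<le> i \<longrightarrow> Suc i < p \<longrightarrow> p \<le> q \<longrightarrow> Suc q < j \<longrightarrow> j < card K \<longrightarrow>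
       {C ! i, C ! p} \<in> E \<longrightarrow> {C ! q, C ! j} \<notin> E)"

text \<open>The front is \<open>{u, v}\<close>, with \<open>u\<close> the newest vertex, and \<open>U\<close> has not been visited yet.\<close>

definition sweep where
  "sweep C k u v U \<longleftrightarrow> (\<exists>i j. i < j \<and> j < card K \<and> U = (!) C ` {i<..<j} \<and>
     (u = C ! i \<and> v = C ! j \<or> u = C ! j \<and> v = C ! i) \<and> (i < k \<longrightarrow> u = C ! i \<and> Suc j = card K) \<and>
     (\<forall>t<card K. t < i \<or> j < t \<longrightarrow> nbrs E (C ! t) \<inter> U = {}))"

lemma Int_subset_singleton:
  assumes "A \<inter> B = {a, b}" "a \<notin> U" "U \<subseteq> B" shows "A \<inter> U \<subseteq> {b}"
proof
  fix x assume "x \<in> A \<inter> U"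
  then have "x \<in> A \<inter> B" "x \<in> U" using assms(3) by auto
  then show "x \<in> {b}" using assms(1,2) by auto
qed

text \<open>The unvisited vertices form a stretch of \<open>C\<close> between the two front
  vertices. The front vertex chosen by counting has its neighbor on this stretch of \<open>C\<close>
  as its only unvisited neighbor. The first equivalence lets the same count serve as the loop
  test.\<close>

lemma sweep_step:
  assumes st: "start C k" and sw: "sweep C k u v U"
  shows "U = {} \<longleftrightarrow> nbrs E u \<inter> U = {}"
    and "U \<noteq> {} \<Longrightarrow> (a, b) = (if card (nbrs E u \<inter> U) = 1 then (u, v) else (v, u)) \<Longrightarrow>
      \<exists>z. nbrs E a \<inter> U = {z} \<and> sweep C k z b (U - {z}) \<and> nbrs E z \<inter> (K - U) \<subseteq> {u, v}"
proof -
  have C: "LC C" using st start_def by blast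
  note c = LC_props[OF C] and l = LC_length[OF C]
  obtain i j where *: "i < j \<and> j < card K \<and> U = (!) C ` {i<..<j} \<and>
     (u = C ! i \<and> v = C ! j \<or> u = C ! j \<and> v = C ! i) \<and> (i < k \<longrightarrow> u = C ! i \<and> Suc j = card K) \<and>
     (\<forall>t<card K. t < i \<or> j < t \<longrightarrow> nbrs E (C ! t) \<inter> U = {})"
    using sw unfolding sweep_def by blast
  then have ij: "i < j" "j < card K" "U = (!) C ` {i<..<j}"
    and uv: "u = C ! i \<and> v = C ! j \<or> u = C ! j \<and> v = C ! i" "i < k \<Longrightarrow> u = C ! i \<and> Suc j = card K"
    by simp_all
  have visited: "nbrs E (C ! t) \<inter> U = {}" if "t < card K" "t < i \<or> j < t" for t using * that by blast
  have inj: "C ! s = C ! t \<longleftrightarrow> s = t" if "s < card K" "t < card K" for s t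
    using that l by (simp add: nth_eq_iff_index_eq[OF c(1)])
  have U: "C ! t \<in> U \<longleftrightarrow> i < t \<and> t < j" if "t < card K" for t
    using ij inj that by fastforce
  have finU: "finite (nbrs E w \<inter> U)" for w using fin_nbrs by simp
  have ne: "U = {} \<longleftrightarrow> j = Suc i"
  proof -
    have "Suc i \<in> {i<..<j} \<or> j = Suc i" using ij(1) by auto
    then show ?thesis using ij(3) by auto
  qed
  have nb: "C ! Suc i \<in> nbrs E (C ! i) \<inter> U" "C ! (j - 1) \<in> nbrs E (C ! j) \<inter> U" if "U \<noteq> {}"
  proof -
    have "Suc i < j" using ne ij(1) that by simp
    then show "C ! Suc i \<in> nbrs E (C ! i) \<inter> U" "C ! (j - 1) \<in> nbrs E (C ! j) \<inter> U"
      using c(4)[of i] c(4)[of "j - 1"] U[of "Suc i"] U[of "j - 1"] ij(2) l by (auto simp: nbrs_def insert_commute)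
  qed
  show "U = {} \<longleftrightarrow> nbrs E u \<inter> U = {}" using nb uv(1) by auto
  assume Une: "U \<noteq> {}" and ab: "(a, b) = (if card (nbrs E u \<inter> U) = 1 then (u, v) else (v, u))"
  then have Sij: "Suc i < j" using ne ij(1) by simp
  have i1: "nbrs E (C ! i) \<inter> U = {C ! Suc i}" if "card (nbrs E (C ! i) \<inter> U) = 1"
    using that nb(1)[OF Une] by (metis card_1_singletonE singletonD)
  have j1: "nbrs E (C ! j) \<inter> U = {C ! (j - 1)}" if "card (nbrs E (C ! j) \<inter> U) = 1"
    using that nb(2)[OF Une] by (metis card_1_singletonE singletonD)
  have pos: "card (nbrs E (C ! i) \<inter> U) \<noteq> 0" "card (nbrs E (C ! j) \<inter> U) \<noteq> 0"
    using nb[OF Une] finU by auto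
  \<comment> \<open>In the first phase the newest vertex is chordless, and one of its two core
    neighbors is visited already.\<close>
  have early: "card (nbrs E (C ! i) \<inter> U) = 1" if ik: "i < k"
  proof -
    have sm: "small (C ! i)" using st ik by (simp add: start_def)
    have "nbrs E (C ! i) \<inter> U \<subseteq> {C ! Suc i}"
    proof (cases "i = 0")
      case True
      have "nbrs E (C ! i) \<inter> K = {C ! (length C - 1), C ! 1}" using small_nbrs_0[OF C] sm True by simp
      moreover have "C ! (length C - 1) \<notin> U" 
      proof -
        have "length C - 1 = j" using uv(2)[OF ik] l by linarith
        then show ?thesis using U[of j] ij(2) by simp
      qed
      moreover have "U \<subseteq> K" using ij LC_in_K[OF C] l by auto
      ultimately have "nbrs E (C ! i) \<inter> U \<subseteq> {C ! 1}" by (rule Int_subset_singleton)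
      then show ?thesis using True by simp
    next
      case False
      then have "nbrs E (C ! i) \<inter> K = {C ! (i - 1), C ! Suc i}" using small_nbrs[OF C _ _ sm] ij l by simp
      moreover have "C ! (i - 1) \<notin> U" using U[of "i - 1"] ij by simp
      moreover have "U \<subseteq> K" using ij LC_in_K[OF C] l by auto
      ultimately show ?thesis by (rule Int_subset_singleton)
    qed
    then have "nbrs E (C ! i) \<inter> U = {C ! Suc i}" using nb(1)[OF Une] by blast
    then show ?thesis by simp
  qed
  \<comment> \<open>If both front vertices had further unvisited neighbors, these would give two
    chords that cross (if \<open>q < p\<close>) or that cut off disjoint pieces (if
    \<open>p \<le> q\<close>).\<close>
  have late: "card (nbrs E (C ! i) \<inter> U) = 1 \<or> card (nbrs E (C ! j) \<inter> U) = 1" if ik: "k \<le> i"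
  proof (rule ccontr)
    assume "\<not> ?thesis"
    then have "\<not> nbrs E (C ! i) \<inter> U \<subseteq> {C ! Suc i}" "\<not> nbrs E (C ! j) \<inter> U \<subseteq> {C ! (j - 1)}"
      using nb[OF Une] by (auto dest!: subset_singletonD)
    then obtain x y where x: "x \<in> nbrs E (C ! i) \<inter> U" "x \<noteq> C ! Suc i" and y: "y \<in> nbrs E (C ! j) \<inter> U" "y \<noteq> C ! (j - 1)"
      by auto
    then obtain p q where p: "x = C ! p" "i < p" "p < j" and q: "y = C ! q" "i < q" "q < j" using ij(3) by auto
    have "p \<noteq> Suc i" "q \<noteq> j - 1" using p q x y by auto
    then have pq: "Suc i < p" "Suc q < j" using p q by auto
    have e: "{C ! i, C ! p} \<in> E" "{C ! q, C ! j} \<in> E" using p q x y by (auto simp: nbrs_def insert_commute)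
    have "p \<le> q"
    proof (rule ccontr)
      assume "\<not> p \<le> q"
      then have "q < p" by simp
      then show False using no_crossing[OF C q(2) _ p(3) _ e(1)] e(2) ij(2) l by simp
    qed
    then show False using st ik pq e ij(2) by (auto simp: start_def)
  qed
  have Kt: "\<exists>t<card K. w = C ! t" if "w \<in> K" for w using that c(3) l by (metis in_set_conv_nth)
  have old: "nbrs E z \<inter> (K - U) \<subseteq> {u, v}" if z: "z \<in> U" for z
  proof
    fix w assume w: "w \<in> nbrs E z \<inter> (K - U)"
    then obtain t where t: "t < card K" "w = C ! t" using Kt by blast
    have "nbrs E (C ! t) \<inter> U \<noteq> {}" using w z t by (auto simp: nbrs_def insert_commute)
    then have "\<not> (t < i \<or> j < t)" using visited t(1) by blast
    moreover have "\<not> (i < t \<and> t < j)" using w t U by blast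
    ultimately have "t = i \<or> t = j" by linarith
    then show "w \<in> {u, v}" using uv(1) t by auto
  qed
  have stepi: "sweep C k (C ! Suc i) (C ! j) (U - {C ! Suc i})"
    if "nbrs E (C ! i) \<inter> U = {C ! Suc i}" 
    unfolding sweep_def
  proof (rule exI[of _ "Suc i"], rule exI[of _ j], intro conjI impI allI)
    have "{i<..<j} = insert (Suc i) {Suc i<..<j}" using Sij by auto
    then have U': "U = insert (C ! Suc i) ((!) C ` {Suc i<..<j})" using ij(3) by simp
    moreover have "C ! Suc i \<notin> (!) C ` {Suc i<..<j}" using inj ij(2) Sij by fastforce
    ultimately show "U - {C ! Suc i} = (!) C ` {Suc i<..<j}" by simp
    show "nbrs E (C ! t) \<inter> (U - {C ! Suc i}) = {}" if "t < card K" "t < Suc i \<or> j < t" for t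
    proof (cases "t = i")
      case True then show ?thesis using \<open>nbrs E (C ! i) \<inter> U = {C ! Suc i}\<close> by auto
    next
      case False then show ?thesis using visited[of t] that by auto
    qed
  qed (use Sij ij uv(2) in auto)
  have stepj: "sweep C k (C ! (j - 1)) (C ! i) (U - {C ! (j - 1)})"
    if s: "nbrs E (C ! j) \<inter> U = {C ! (j - 1)}" "k \<le> i"
    unfolding sweep_def
  proof (rule exI[of _ i], rule exI[of _ "j - 1"], intro conjI impI allI)
    have "{i<..<j} = insert (j - 1) {i<..<j - 1}" using Sij by auto
    then have U': "U = insert (C ! (j - 1)) ((!) C ` {i<..<j - 1})" using ij(3) by simp
    moreover have "C ! (j - 1) \<notin> (!) C ` {i<..<j - 1}" using inj ij(2) Sij by fastforce
    ultimately show "U - {C ! (j - 1)} = (!) C ` {i<..<j - 1}" by simp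
    show "nbrs E (C ! t) \<inter> (U - {C ! (j - 1)}) = {}" if "t < card K" "t < i \<or> j - 1 < t" for t
    proof (cases "t = j")
      case True then show ?thesis using s by auto
    next
      case False
      then have "t < i \<or> j < t" using that(2) by linarith
      then show ?thesis using visited[of t] that(1) by auto
    qed
  qed (use Sij ij s in auto)
  have zi: "C ! Suc i \<in> U" "C ! (j - 1) \<in> U" using nb[OF Une] by auto
  \<comment> \<open>Only the newest vertex is counted. It suffices in the first phase by
    \<open>early\<close>; afterwards, if its count is not one, \<open>late\<close> says that the
    count of the other front vertex is.\<close>
  have "a = C ! i \<and> b = C ! j \<and> card (nbrs E (C ! i) \<inter> U) = 1 \<or>
    a = C ! j \<and> b = C ! i \<and> card (nbrs E (C ! j) \<inter> U) = 1 \<and> k \<le> i"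
  proof (cases "i < k")
    case True
    then show ?thesis using early[OF True] uv ab by auto
  next
    case False
    then show ?thesis using late uv(1) ab by (auto split: if_splits)
  qed
  then show "\<exists>z. nbrs E a \<inter> U = {z} \<and> sweep C k z b (U - {z}) \<and> nbrs E z \<inter> (K - U) \<subseteq> {u, v}"
  proof (elim disjE conjE)
    assume "a = C ! i" "b = C ! j" "card (nbrs E (C ! i) \<inter> U) = 1"
    then show ?thesis using i1 stepi[OF i1] old[OF zi(1)] by (intro exI[of _ "C ! Suc i"]) simp
  next
    assume "a = C ! j" "b = C ! i" "card (nbrs E (C ! j) \<inter> U) = 1" "k \<le> i"
    then show ?thesis using j1 stepj[OF j1] old[OF zi(2)] by (intro exI[of _ "C ! (j - 1)"]) simp
  qed
qed

lemma sweep_start: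
  assumes "start C k"
  shows "sweep C k (C ! 0) (C ! (card K - 1)) (K - {C ! 0, C ! (card K - 1)})"
proof -
  have C: "LC C" using assms start_def by blast
  note c = LC_props[OF C] and l = LC_length[OF C]
  have "K = (!) C ` {..<card K}" using c(3) l by (metis lessThan_atLeast0 nth_image order_refl take_all)
  moreover have "{..<card K} = insert 0 (insert (card K - 1) {0<..<card K - 1})" using c(2) l by auto
  ultimately have "K = insert (C ! 0) (insert (C ! (card K - 1)) ((!) C ` {0<..<card K - 1}))" by (metis image_insert)
  moreover have "C ! 0 \<notin> (!) C ` {0<..<card K - 1}" "C ! (card K - 1) \<notin> (!) C ` {0<..<card K - 1}"
    using c(2) l by (auto simp: nth_eq_iff_index_eq[OF c(1)])
  ultimately have U: "K - {C ! 0, C ! (card K - 1)} = (!) C ` {0<..<card K - 1}" by blast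
  show ?thesis unfolding sweep_def U
  proof (rule exI[of _ 0], rule exI[of _ "card K - 1"], intro conjI impI allI)
    show "C ! 0 = C ! 0 \<and> C ! (card K - 1) = C ! (card K - 1) \<or>
      C ! 0 = C ! (card K - 1) \<and> C ! (card K - 1) = C ! 0" by simp
  qed (use c(2) l in auto)
qed

text \<open>Unless the edge is the initial one, the end that was attached later is some
  \<open>x k\<close>, and its earlier neighbors were in the front at that time.\<close>

lemma strip_covers:
  assumes s: "strip u v x p q tw m" and K': "{u, v} \<union> x ` {..<m} = K"
    and old: "\<And>k. k < m \<Longrightarrow> nbrs E (x k) \<inter> ({u, v} \<union> x ` {..<k}) \<subseteq> {p k, q k}"
    and e: "{a, b} \<in> E" "a \<in> K" "b \<in> K"
  shows "{a, b} \<in> strip_edges u v x p q m"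
proof -
  have ne: "a \<noteq> b" using edgeD[OF e(1)] by simp
  have late: "{x k, w} \<in> strip_edges u v x p q m" if "k < m" "w \<in> {u, v} \<union> x ` {..<k}" "{x k, w} \<in> E" for k w
  proof -
    have "w \<in> {p k, q k}" using old[OF that(1)] that by (auto simp: nbrs_def insert_commute)
    then show ?thesis using that(1) by (auto simp: strip_edges_def)
  qed
  have e': "{b, a} \<in> E" using e(1) by (simp add: insert_commute)
  consider "a \<in> {u, v}" "b \<in> {u, v}" | k where "k < m" "a = x k" "b \<in> {u, v}" | k where "k < m" "b = x k" "a \<in> {u, v}"
    | k k' where "k < m" "k' < m" "a = x k" "b = x k'" using e K' by auto
  then show ?thesis
  proof cases
    case 1 then show ?thesis using ne by (auto simp: strip_edges_def insert_commute)
  next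
    case 2 then show ?thesis using late[OF 2(1), of b] e by auto
  next
    case 3 then show ?thesis using late[OF 3(1), of a] e' by (auto simp: insert_commute)
  next
    case 4
    then consider "k' < k" | "k < k'" using ne by (metis linorder_neqE_nat)
    then show ?thesis
    proof cases
      case 1 then show ?thesis using late[OF 4(1), of b] 4 e by auto
    next
      case 2 then show ?thesis using late[OF 4(2), of a] 4 e' by (auto simp: insert_commute)
    qed
  qed
qed

end

section \<open>Correctness and running time of programs\<close>

text \<open>Total correctness with running time as a predicate transformer. Since
  \<open>exec\<close> is deterministic, \<open>ok\<close> of loop-free code unfolds by
  rewriting.\<close>

definition ok :: "prog \<Rightarrow> state \<Rightarrow> (nat \<Rightarrow> state \<Rightarrow> bool) \<Rightarrow> bool" where
  "ok p s Q \<longleftrightarrow> (\<exists>t s'. exec p s t s' \<and> Q t s')"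

lemma ok_exec: "exec p s t s' \<Longrightarrow> ok p s Q = Q t s'"
  by (auto simp: ok_def dest: exec_deterministic)

lemma ok_simps [simp]:
  "ok Skip s Q = Q 1 s"
  "ok (Const x k) s Q = Q 1 (set_reg x k s)"
  "ok (Copy x y) s Q = Q 1 (set_reg x (regs s y) s)"
  "ok (Inc x) s Q = Q 1 (set_reg x (regs s x + 1) s)"
  "ok (Dec x) s Q = Q 1 (set_reg x (regs s x - 1) s)"
  "ok (Load x a y) s Q = Q 1 (set_reg x (arrs s a (regs s y)) s)"
  "ok (Store a x y) s Q = Q 1 (set_cell a (regs s x) (regs s y) s)"
  by (rule ok_exec, rule exec.intros)+

lemma ok_Seq [simp]: "ok (Seq p q) s Q = ok p s (\<lambda>t s'. ok q s' (\<lambda>t'. Q (t + t')))"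
proof
  assume "ok (Seq p q) s Q"
  then obtain t s' where e: "exec (Seq p q) s t s'" "Q t s'" by (auto simp: ok_def)
  from e(1) show "ok p s (\<lambda>t s'. ok q s' (\<lambda>t'. Q (t + t')))"
    using e(2) by cases (auto simp: ok_def)
qed (auto simp: ok_def intro: exec.Seq)

lemma ok_If [simp]: "ok (If b p q) s Q = (if holds b s then ok p s (\<lambda>t. Q (1 + t)) else ok q s (\<lambda>t. Q (1 + t)))"
proof
  assume "ok (If b p q) s Q"
  then obtain t s' where e: "exec (If b p q) s t s'" "Q t s'" by (auto simp: ok_def)
  from e(1) show "if holds b s then ok p s (\<lambda>t. Q (1 + t)) else ok q s (\<lambda>t. Q (1 + t))"
    using e(2) by cases (auto simp: ok_def)
next
  assume "if holds b s then ok p s (\<lambda>t. Q (1 + t)) else ok q s (\<lambda>t. Q (1 + t))"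
  then show "ok (If b p q) s Q"
    unfolding ok_def using exec.IfTrue exec.IfFalse by (metis (full_types))
qed

lemma ok_mono: "ok p s P \<Longrightarrow> (\<And>t s'. P t s' \<Longrightarrow> Q t s') \<Longrightarrow> ok p s Q"
  by (auto simp: ok_def)

text \<open>\<open>I m s\<close> is an invariant at potential \<open>m\<close>.\<close>

lemma ok_While:
  assumes "I m s"
    and step: "\<And>m s. I m s \<Longrightarrow> holds b s \<Longrightarrow> ok p s (\<lambda>t s'. \<exists>m'. I m' s' \<and> 1 + t + m' \<le> m)"
    and post: "\<And>m' s' t. I m' s' \<Longrightarrow> \<not> holds b s' \<Longrightarrow> t + m' \<le> m + 1 \<Longrightarrow> Q t s'"
  shows "ok (While b p) s Q"
proof -
  have "\<exists>t s' m'. exec (While b p) s t s' \<and> I m' s' \<and> \<not> holds b s' \<and> t + m' \<le> m + 1"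
    using assms(1)
  proof (induction m arbitrary: s rule: less_induct)
    case (less m)
    show ?case
    proof (cases "holds b s")
      case False
      then show ?thesis using less.prems exec.WhileFalse[OF False]
        by (intro exI[of _ 1] exI[of _ s] exI[of _ m]) auto
    next
      case True
      obtain t s' m' where s': "exec p s t s'" "I m' s'" "1 + t + m' \<le> m"
        using step[OF less.prems True] by (auto simp: ok_def)
      obtain t' s'' m'' where s'': "exec (While b p) s' t' s''" "I m'' s''" "\<not> holds b s''" "t' + m'' \<le> m' + 1"
        using less.IH[OF _ s'(2)] s'(3) by auto
      then show ?thesis using exec.WhileTrue[OF True s'(1) s''(1)] s'(3)
        by (intro exI[of _ "1 + t + t'"] exI[of _ s''] exI[of _ m'']) auto
    qed
  qed
  then show ?thesis using post unfolding ok_def by blast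
qed

lemma state_simps [simp]:
  "regs (set_reg x k s) = (regs s)(x := k)" "arrs (set_reg x k s) = arrs s"
  "regs (set_cell a i k s) = regs s" "arrs (set_cell a i k s) = (arrs s)(a := (arrs s a)(i := k))"
  by (auto simp: set_reg_def set_cell_def)

definition frame :: "nat set \<Rightarrow> nat set \<Rightarrow> state \<Rightarrow> state \<Rightarrow> bool" where
  "frame R A s s' \<longleftrightarrow> (\<forall>r. r \<notin> R \<longrightarrow> regs s' r = regs s r) \<and> (\<forall>a. a \<notin> A \<longrightarrow> arrs s' a = arrs s a)"

lemma frame_set [simp]:
  "r \<in> R \<Longrightarrow> frame R A s (set_reg r k s') = frame R A s s'"
  "a \<in> A \<Longrightarrow> frame R A s (set_cell a i k s') = frame R A s s'"
  by (auto simp: frame_def)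

lemma frame_refl [simp]: "frame R A s s" by (simp add: frame_def)

lemma frame_trans: "frame R A s s' \<Longrightarrow> frame R' A' s' s'' \<Longrightarrow> R \<subseteq> T \<Longrightarrow> R' \<subseteq> T \<Longrightarrow> A \<subseteq> B \<Longrightarrow> A' \<subseteq> B \<Longrightarrow> frame T B s s''"
  unfolding frame_def by (metis subsetD)

lemma frameD: "frame R A s s' \<Longrightarrow> r \<notin> R \<Longrightarrow> regs s' r = regs s r" "frame R A s s' \<Longrightarrow> a \<notin> A \<Longrightarrow> arrs s' a = arrs s a"
  by (auto simp: frame_def)

text \<open>A list ends where the next one begins, hence the detour of \<open>hi\<close> over the
  successor of the vertex.\<close>

definition scan :: "nat \<Rightarrow> nat \<Rightarrow> nat \<Rightarrow> nat \<Rightarrow> prog \<Rightarrow> prog" where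
  "scan v lo hi y body = Seq (Load lo 0 v) (Seq (Copy hi v) (Seq (Inc hi) (Seq (Load hi 0 hi)
     (While (Less lo hi) (Seq (Load y 1 lo) (Seq (Inc lo) body))))))"

lemma list_start_Suc: "list_start adj (Suc v) = list_start adj v + length (adj v)"
  by (simp add: list_start_def)

lemma concat_nth:
  assumes "v < n" "i < length (adj v)"
  shows "list_start adj v + i < list_start adj n \<and> concat (map adj [0..<n]) ! (list_start adj v + i) = adj v ! i"
  using assms
proof (induction n)
  case (Suc n)
  have len: "length (concat (map adj [0..<n])) = list_start adj n"
    by (induction n) (auto simp: list_start_def)
  show ?case
  proof (cases "v < n")
    case True
    then show ?thesis using Suc len by (simp add: nth_append list_start_Suc)
  next
    case False
    then have "v = n" using Suc by simp
    then show ?thesis using Suc.prems len by (simp add: nth_append list_start_Suc)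
  qed
qed simp

section \<open>Degrees, and the initial queue of vertices to be peeled\<close>

definition degree_loop :: prog where
  "degree_loop = While (Less 4 0) (Seq (Const 5 0) (Seq (scan 4 6 7 8 (Inc 5)) (Seq (Store 3 4 5)
     (Seq (If (Less 5 3) (Seq (Store 5 9 4) (Seq (Inc 9) (Store 4 4 2))) Skip) (Inc 4)))))"

locale ram = outerpath_structure "{..<n}" E for n :: nat and E :: "nat set set" +
  fixes adj :: "nat \<Rightarrow> nat list"
  assumes adj: "adjacency_lists n E adj"
begin

lemma set_adj: "v < n \<Longrightarrow> set (adj v) = nbrs E v" and distinct_adj: "v < n \<Longrightarrow> distinct (adj v)"
  using adj by (auto simp: adjacency_lists_def nbrs_def)

lemma adj_less: "v < n \<Longrightarrow> u \<in> set (adj v) \<Longrightarrow> u < n"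
  using simple by (auto simp: set_adj nbrs_def simple_graph_def)

lemma adj_irrefl: "v < n \<Longrightarrow> v \<notin> set (adj v)"
  using simple by (auto simp: set_adj nbrs_def simple_graph_def)

lemma adj_sym: "v < n \<Longrightarrow> u < n \<Longrightarrow> u \<in> set (adj v) \<longleftrightarrow> v \<in> set (adj u)"
  using set_adj nbrs_sym by metis

text \<open>Registers \<open>1\<close>, \<open>2\<close> and \<open>3\<close> permanently hold the constants \<open>0\<close>, \<open>1\<close> and \<open>2\<close>.
  Besides the input and output, the arrays hold: \<open>3\<close> the number of remaining neighbors, \<open>4\<close> marks of
  the removed vertices, \<open>5\<close> the queue of peeled vertices (its length is in register \<open>9\<close>), \<open>6\<close> stamps,
  \<open>7\<close> to \<open>10\<close> the components \<open>x\<close>, \<open>p\<close>, \<open>q\<close>, \<open>tw\<close> of the strip, \<open>11\<close> marks of the colored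
  vertices. The front of the sweep is in registers \<open>13\<close> (newest vertex) and \<open>14\<close>, the number of
  strip triangles in \<open>23\<close>.\<close>

definition inp :: "state \<Rightarrow> bool" where
  "inp s \<longleftrightarrow> regs s 0 = n \<and> regs s 1 = 0 \<and> regs s 2 = 1 \<and> regs s 3 = 2 \<and>
     (\<forall>v\<le>n. arrs s 0 v = list_start adj v) \<and>
     (\<forall>v<n. \<forall>i<length (adj v). arrs s 1 (list_start adj v + i) = adj v ! i)"

lemma inp_set [simp]:
  "3 < r \<Longrightarrow> inp (set_reg r k s) = inp s"
  "1 < a \<Longrightarrow> inp (set_cell a i k s) = inp s"
  by (auto simp: inp_def)

lemma inp_regs: "inp s \<Longrightarrow> regs s 0 = n" "inp s \<Longrightarrow> regs s 1 = 0" "inp s \<Longrightarrow> regs s (Suc 0) = 0"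
    "inp s \<Longrightarrow> regs s 2 = 1" "inp s \<Longrightarrow> regs s 3 = 2"
  by (auto simp: inp_def)

text \<open>In \<open>I k m\<close> the number \<open>k\<close> counts the list entries done and
  \<open>m\<close> is a potential, so that the work of the body may be charged elsewhere than to the
  list. The loop test and the two instructions before the body account for \<open>tb + 3\<close> per
  entry; the four instructions at the beginning and the last test account for
  \<open>5\<close>.\<close>

lemma ok_scan:
  assumes s: "inp s" "regs s v = x" "x < n" and d: "distinct [v, lo, hi, y]" "3 < lo" "3 < hi" "3 < y"
    and base: "I 0 m s"
    and stable: "\<And>k m s r a. I k m s \<Longrightarrow> r \<in> {lo, hi, y} \<Longrightarrow> I k m (set_reg r a s)"
    and step: "\<And>k m s. k < length (adj x) \<Longrightarrow> I k m s \<Longrightarrow> inp s \<Longrightarrow> regs s y = adj x ! k \<Longrightarrow>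
      ok body s (\<lambda>t s'. \<exists>m'. I (Suc k) m' s' \<and> inp s' \<and> regs s' lo = regs s lo \<and> regs s' hi = regs s hi \<and> t + m' \<le> m + tb)"
    and post: "\<And>t m' s'. I (length (adj x)) m' s' \<Longrightarrow> inp s' \<Longrightarrow> t + m' \<le> m + 5 + length (adj x) * (tb + 3) \<Longrightarrow> Q t s'"
  shows "ok (scan v lo hi y body) s Q"
proof -
  let ?a = "list_start adj x" and ?l = "length (adj x)"
  let ?J = "\<lambda>M s'. \<exists>k m. k \<le> ?l \<and> I k m s' \<and> inp s' \<and> regs s' lo = ?a + k \<and> regs s' hi = ?a + ?l \<and> M = m + (?l - k) * (tb + 3)"
  define s1 where "s1 = set_reg hi (?a + ?l) (set_reg hi (x + 1) (set_reg hi x (set_reg lo ?a s)))"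
  have e: "arrs s 0 x = ?a" "arrs s 0 (Suc x) = ?a + ?l" using s by (auto simp: inp_def list_start_Suc)
  have J: "?J (m + ?l * (tb + 3)) s1"
  proof (rule exI[of _ 0], rule exI[of _ m], intro conjI)
    show "I 0 m s1" using base stable unfolding s1_def by simp
    show "inp s1" using s(1) d unfolding s1_def by simp
  qed (use d in \<open>auto simp: s1_def\<close>)
  have "ok (While (Less lo hi) (Seq (Load y 1 lo) (Seq (Inc lo) body))) s1 (\<lambda>t. Q (4 + t))"
  proof (rule ok_While[where I = ?J, OF J])
    fix M s assume "?J M s" and h: "holds (Less lo hi) s"
    then obtain k m where k: "k \<le> ?l" "I k m s" "inp s" "regs s lo = ?a + k" "regs s hi = ?a + ?l" "M = m + (?l - k) * (tb + 3)"
      by blast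
    then have kl: "k < ?l" using h by simp
    define s2 where "s2 = set_reg lo (?a + k + 1) (set_reg y (adj x ! k) s)"
    have "arrs s 1 (?a + k) = adj x ! k" using k(3) kl s(3) by (simp add: inp_def)
    moreover have "I k m s2" "inp s2" "regs s2 y = adj x ! k"
      using stable k d unfolding s2_def by auto
    note b = step[OF kl this]
    have "ok body s2 (\<lambda>t s'. \<exists>M'. ?J M' s' \<and> 1 + (2 + t) + M' \<le> M)"
    proof (rule ok_mono[OF b])
      fix t s' assume "\<exists>m'. I (Suc k) m' s' \<and> inp s' \<and> regs s' lo = regs s2 lo \<and> regs s' hi = regs s2 hi \<and> t + m' \<le> m + tb"
      then obtain m' where m': "I (Suc k) m' s'" "inp s'" "regs s' lo = regs s2 lo" "regs s' hi = regs s2 hi" "t + m' \<le> m + tb" by blast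
      have "?l - k = Suc (?l - Suc k)" using kl by simp
      then have "M = m + (tb + 3) + (?l - Suc k) * (tb + 3)" using k(6) by simp
      then have le: "1 + (2 + t) + (m' + (?l - Suc k) * (tb + 3)) \<le> M" using m'(5) by simp
      have "?J (m' + (?l - Suc k) * (tb + 3)) s'"
      proof (rule exI[of _ "Suc k"], rule exI[of _ m'], intro conjI)
        show "regs s' lo = ?a + Suc k" using m'(3) by (simp add: s2_def)
        show "regs s' hi = ?a + ?l" using m'(4) k(5) d by (simp add: s2_def)
      qed (use m' kl in auto)
      then show "\<exists>M'. ?J M' s' \<and> 1 + (2 + t) + M' \<le> M" using le by blast
    qed
    ultimately show "ok (Seq (Load y 1 lo) (Seq (Inc lo) body)) s (\<lambda>t s'. \<exists>M'. ?J M' s' \<and> 1 + t + M' \<le> M)"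
      using k(4) d by (simp add: s2_def)
  next
    fix M' s' t assume "?J M' s'" "\<not> holds (Less lo hi) s'" and t: "t + M' \<le> m + ?l * (tb + 3) + 1"
    then obtain k m' where k: "k \<le> ?l" "I k m' s'" "inp s'" "regs s' lo = ?a + k" "regs s' hi = ?a + ?l" "M' = m' + (?l - k) * (tb + 3)" "\<not> k < ?l"
      by auto
    then have "k = ?l" by simp
    then show "Q (4 + t) s'" using post[of m' s' "4 + t"] k t by simp
  qed
  then show ?thesis using s e d by (simp add: scan_def s1_def numeral_eq_Suc)
qed

lemma ok_scan_simple:
  assumes s: "inp s" "regs s v = x" "x < n" and d: "distinct [v, lo, hi, y]" "3 < lo" "3 < hi" "3 < y"
    and base: "I 0 s"
    and stable: "\<And>k s r a. I k s \<Longrightarrow> r \<in> {lo, hi, y} \<Longrightarrow> I k (set_reg r a s)"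
    and step: "\<And>k s. k < length (adj x) \<Longrightarrow> I k s \<Longrightarrow> inp s \<Longrightarrow> regs s y = adj x ! k \<Longrightarrow>
      ok body s (\<lambda>t s'. I (Suc k) s' \<and> inp s' \<and> regs s' lo = regs s lo \<and> regs s' hi = regs s hi \<and> t \<le> tb)"
    and post: "\<And>t s'. I (length (adj x)) s' \<Longrightarrow> inp s' \<Longrightarrow> t \<le> 5 + length (adj x) * (tb + 3) \<Longrightarrow> Q t s'"
  shows "ok (scan v lo hi y body) s Q"
proof (rule ok_scan[where I = "\<lambda>k m s. I k s" and m = 0 and tb = tb, OF s d])
  show "ok body s (\<lambda>t s'. \<exists>m'. I (Suc k) s' \<and> inp s' \<and> regs s' lo = regs s lo \<and> regs s' hi = regs s hi \<and> t + m' \<le> m + tb)"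
    if "k < length (adj x)" "I k s" "inp s" "regs s y = adj x ! k" for k m s
    using step[OF that] by (rule ok_mono) (auto intro!: exI[of _ 0])
qed (use base stable post in auto)

text \<open>The unit in which costs are measured: one scan of the list of \<open>v\<close>,
  including the constant overhead. The weights add up to at most
  \<open>n + 2 * card E\<close>.\<close>

definition wt :: "nat \<Rightarrow> nat" where "wt v = length (adj v) + 1"

definition queue :: "nat list \<Rightarrow> state \<Rightarrow> bool" where
  "queue qs s \<longleftrightarrow> distinct qs \<and> set qs \<subseteq> {..<n} \<and> regs s 9 = length qs \<and> (\<forall>i<length qs. arrs s 5 i = qs ! i) \<and>
     (\<forall>v<n. arrs s 4 v = (if v \<in> set qs then 1 else 0))"

lemma queue_set_reg [simp]: "r \<noteq> 9 \<Longrightarrow> queue qs (set_reg r k s) = queue qs s"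
  by (simp add: queue_def)

lemma queue_set_cell [simp]: "a \<noteq> 4 \<Longrightarrow> a \<noteq> 5 \<Longrightarrow> queue qs (set_cell a i k s) = queue qs s"
  by (simp add: queue_def)

lemma queue_push:
  assumes "queue qs s" "v < n" "v \<notin> set qs"
  shows "queue (qs @ [v]) (set_cell 4 v (Suc 0) (set_reg 9 (Suc (length qs)) (set_cell 5 (length qs) v s)))"
  using assms by (auto simp: queue_def nth_append)

lemma ok_degree_loop:
  assumes s: "inp s" "regs s 4 = 0" "regs s 9 = 0" "\<forall>v. arrs s 4 v = 0"
  shows "ok degree_loop s (\<lambda>t s'. \<exists>qs. queue qs s' \<and> inp s' \<and> frame {4..9} {3, 4, 5} s s' \<and>
    (\<forall>v<n. arrs s' 3 v = length (adj v)) \<and> (\<forall>v<n. v \<in> set qs \<longleftrightarrow> length (adj v) \<le> 1) \<and> t \<le> 20 * (\<Sum>v<n. wt v) + 1)"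
proof -
  define I where "I M s' \<longleftrightarrow> (\<exists>v qs. v \<le> n \<and> regs s' 4 = v \<and> queue qs s' \<and> inp s' \<and> frame {4..9} {3, 4, 5} s s' \<and>
    (\<forall>u<v. arrs s' 3 u = length (adj u)) \<and> (\<forall>u<n. u \<in> set qs \<longleftrightarrow> u < v \<and> length (adj u) \<le> 1) \<and> M = (\<Sum>u\<in>{v..<n}. 20 * wt u))" for M s'
  show ?thesis unfolding degree_loop_def
  proof (rule ok_While[where I = I])
    show "I (\<Sum>u\<in>{0..<n}. 20 * wt u) s"
      using s unfolding I_def by (intro exI[of _ 0] exI[of _ "[]"]) (auto simp: queue_def)
  next
    fix M s1 assume "I M s1" and h: "holds (Less 4 0) s1"
    then obtain v qs where J: "regs s1 4 = v" "queue qs s1" "inp s1" "frame {4..9} {3, 4, 5} s s1"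
      "\<And>u. u < v \<Longrightarrow> arrs s1 3 u = length (adj u)" "\<And>u. u < n \<Longrightarrow> u \<in> set qs \<longleftrightarrow> u < v \<and> length (adj u) \<le> 1"
      "M = (\<Sum>u\<in>{v..<n}. 20 * wt u)" unfolding I_def by blast
    have v: "v < n" using h J(1,3) by (simp add: inp_regs)
    have M: "M = 20 * wt v + (\<Sum>u\<in>{Suc v..<n}. 20 * wt u)"
      using J(7) v by (simp add: sum.atLeast_Suc_lessThan)
    let ?s = "set_reg 5 0 s1"
    let ?Q = "\<lambda>t s2. frame {5..8} {} ?s s2 \<and> regs s2 5 = length (adj v) \<and> inp s2 \<and> t \<le> 5 + length (adj v) * 4"
    have sc: "ok (scan 4 6 7 8 (Inc 5)) ?s ?Q"
      by (rule ok_scan_simple[where I = "\<lambda>k s2. frame {5..8} {} ?s s2 \<and> regs s2 5 = k" and tb = 1 and x = v])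
        (use J(1,3) v in \<open>auto\<close>)
    have "ok (scan 4 6 7 8 (Inc 5)) ?s (\<lambda>t s2. ok (Seq (Store 3 4 5)
     (Seq (If (Less 5 3) (Seq (Store 5 9 4) (Seq (Inc 9) (Store 4 4 2))) Skip) (Inc 4))) s2
      (\<lambda>t' s'. \<exists>m'. I m' s' \<and> 1 + (1 + (t + t')) + m' \<le> M))"
    proof (rule ok_mono[OF sc], elim conjE)
      fix t s2 assume f: "frame {5..8} {} ?s s2" and r: "regs s2 5 = length (adj v)" and i: "inp s2" and t: "t \<le> 5 + length (adj v) * 4"
      have r4: "regs s2 4 = v" "regs s2 9 = length qs" using frameD(1)[OF f, of 4] frameD(1)[OF f, of 9] J(1,2) by (auto simp: queue_def)
      have ar: "arrs s2 = arrs s1" using frameD(2)[OF f] by auto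
      have q: "queue qs s2" using J(2) r4 by (simp add: queue_def ar)
      have f1: "frame {5..8} {} s1 s2" by (rule frame_trans[of "{5}" "{}" s1 ?s "{5..8}" "{}"]) (use f in auto)
      have fr: "frame {4..9} {3, 4, 5} s s2" by (rule frame_trans[OF J(4) f1]) auto
      have vq: "v \<notin> set qs" using J(6) v by simp
      show "ok (Seq (Store 3 4 5) (Seq (If (Less 5 3) (Seq (Store 5 9 4) (Seq (Inc 9) (Store 4 4 2))) Skip) (Inc 4))) s2
        (\<lambda>t' s'. \<exists>m'. I m' s' \<and> 1 + (1 + (t + t')) + m' \<le> M)"
      proof (cases "length (adj v) < 2")
        case True
        let ?s3 = "set_cell 3 v (length (adj v)) s2"
        let ?s4 = "set_reg 4 (Suc v) (set_cell 4 v (Suc 0) (set_reg 9 (Suc (length qs)) (set_cell 5 (length qs) v ?s3)))"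
        have "queue (qs @ [v]) ?s4" using queue_push[of qs ?s3 v] q v vq by simp
        then have "I (\<Sum>u\<in>{Suc v..<n}. 20 * wt u) ?s4"
          unfolding I_def using v i fr J(5,6) True by (intro exI[of _ "Suc v"] exI[of _ "qs @ [v]"]) (auto simp: ar less_Suc_eq)
        then show ?thesis using True r r4 i t M by (auto simp: inp_regs wt_def intro!: exI[of _ "\<Sum>u\<in>{Suc v..<n}. 20 * wt u"])
      next
        case False
        let ?s3 = "set_reg 4 (Suc v) (set_cell 3 v (length (adj v)) s2)"
        have "I (\<Sum>u\<in>{Suc v..<n}. 20 * wt u) ?s3"
          unfolding I_def using v i fr J(5,6) False q by (intro exI[of _ "Suc v"] exI[of _ qs]) (auto simp: ar less_Suc_eq)
        then show ?thesis using False r r4 i t M by (auto simp: inp_regs wt_def intro!: exI[of _ "\<Sum>u\<in>{Suc v..<n}. 20 * wt u"])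
      qed
    qed
    then show "ok (Seq (Const 5 0) (Seq (scan 4 6 7 8 (Inc 5)) (Seq (Store 3 4 5)
     (Seq (If (Less 5 3) (Seq (Store 5 9 4) (Seq (Inc 9) (Store 4 4 2))) Skip) (Inc 4))))) s1
     (\<lambda>t s'. \<exists>m'. I m' s' \<and> 1 + t + m' \<le> M)"
      by (simp only: ok_simps ok_Seq)
  next
    fix M s1 t assume "I M s1" and h: "\<not> holds (Less 4 0) s1" and t: "t + M \<le> (\<Sum>u\<in>{0..<n}. 20 * wt u) + 1"
    then obtain v qs where J: "v \<le> n" "regs s1 4 = v" "queue qs s1" "inp s1" "frame {4..9} {3, 4, 5} s s1"
      "\<forall>u<v. arrs s1 3 u = length (adj u)" "\<forall>u<n. u \<in> set qs \<longleftrightarrow> u < v \<and> length (adj u) \<le> 1" unfolding I_def by blast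
    then have "v = n" using h by (simp add: inp_regs)
    then show "\<exists>qs. queue qs s1 \<and> inp s1 \<and> frame {4..9} {3, 4, 5} s s1 \<and>
      (\<forall>v<n. arrs s1 3 v = length (adj v)) \<and> (\<forall>v<n. v \<in> set qs \<longleftrightarrow> length (adj v) \<le> 1) \<and> t \<le> 20 * (\<Sum>v<n. wt v) + 1"
      using J t by (intro exI[of _ qs]) (auto simp: sum_distrib_left lessThan_atLeast0)
  qed
qed

end

section \<open>Peeling off vertices with at most one remaining neighbor\<close>

definition peel_visit :: prog where
  "peel_visit = Seq (Load 5 3 8) (Seq (Dec 5) (Seq (Store 3 8 5) (Seq (Load 11 4 8)
     (If (Conj (Less 5 3) (Equal 11 1)) (Seq (Store 5 9 8) (Seq (Inc 9) (Store 4 8 2))) Skip))))"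

definition peel_body :: prog where
  "peel_body = Seq (Load 4 5 10) (Seq (Inc 10) (scan 4 6 7 8 peel_visit))"

context ram
begin

text \<open>Here \<open>h\<close> queue entries have been processed and \<open>r\<close> counts
  remaining neighbors. A vertex is marked when it enters the queue, not when it is processed: its
  count may drop further while it waits, and it must not enter twice.\<close>

definition peel_state :: "nat list \<Rightarrow> nat \<Rightarrow> (nat \<Rightarrow> nat) \<Rightarrow> state \<Rightarrow> bool" where
  "peel_state qs h r s \<longleftrightarrow> queue qs s \<and> inp s \<and> h \<le> length qs \<and> (\<forall>v<n. arrs s 3 v = r v) \<and>
     (\<forall>v<n. v \<in> set qs \<longleftrightarrow> r v \<le> 1) \<and> (\<forall>i<h. card (nbrs E (qs ! i) - set (take i qs)) \<le> 1)"

lemma peel_state_set_reg [simp]: "3 < r \<Longrightarrow> r \<noteq> 9 \<Longrightarrow> peel_state qs h d (set_reg r k s) = peel_state qs h d s"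
  by (simp add: peel_state_def)

lemma ok_peel_visit:
  assumes p: "peel_state qs h r s" and y: "regs s 8 = y" "y < n"
  shows "ok peel_visit s (\<lambda>t s'. (\<exists>zs. peel_state (qs @ zs) h (r(y := r y - 1)) s') \<and>
    frame {5, 9, 11} {3, 4, 5} s s' \<and> t \<le> 9)"
proof -
  have q: "queue qs s" "inp s" and r: "arrs s 3 y = r y" and m: "arrs s 4 y = (if y \<in> set qs then 1 else 0)"
    and r9: "regs s 9 = length qs"
    using p y by (auto simp: peel_state_def queue_def)
  have mem: "v \<in> set qs \<longleftrightarrow> r v \<le> 1" if "v < n" for v using p that by (simp add: peel_state_def)
  have ord: "card (nbrs E ((qs @ zs) ! i) - set (take i (qs @ zs))) \<le> 1" if "i < h" for i zs
    using p that by (simp add: peel_state_def nth_append)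
  have hl: "h \<le> length qs" using p by (simp add: peel_state_def)
  show ?thesis
  proof (cases "r y - 1 < 2 \<and> y \<notin> set qs")
    case True
    define s1 where "s1 = set_reg 11 0 (set_cell 3 y (r y - 1) (set_reg 5 (r y - 1) (set_reg 5 (r y) s)))"
    define s2 where "s2 = set_cell 4 y (Suc 0) (set_reg 9 (Suc (length qs)) (set_cell 5 (length qs) y s1))"
    have "queue (qs @ [y]) s2" unfolding s2_def using q True y by (intro queue_push) (auto simp: s1_def)
    then have "peel_state (qs @ [y]) h (r(y := r y - 1)) s2"
      using q ord hl mem p True y unfolding peel_state_def by (auto simp: s2_def s1_def)
    moreover have "frame {5, 9, 11} {3, 4, 5} s s2" by (simp add: s2_def s1_def)
    ultimately show ?thesis
      using True y r m r9 q by (auto simp: peel_visit_def inp_regs s2_def s1_def)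
  next
    case False
    define s1 where "s1 = set_reg 11 (if y \<in> set qs then 1 else 0) (set_cell 3 y (r y - 1) (set_reg 5 (r y - 1) (set_reg 5 (r y) s)))"
    have "queue qs s1" using q by (simp add: s1_def)
    moreover have "y \<in> set qs \<longleftrightarrow> r y - 1 \<le> 1" using False mem[OF y(2)] by auto
    ultimately have "peel_state (qs @ []) h (r(y := r y - 1)) s1"
      using q ord[of _ "[]"] hl mem p unfolding peel_state_def by (auto simp: s1_def)
    moreover have "frame {5, 9, 11} {3, 4, 5} s s1" by (simp add: s1_def)
    ultimately show ?thesis
      using False y r m r9 q by (auto simp: peel_visit_def inp_regs s1_def intro: exI[of _ "[]"])
  qed
qed

lemma ok_peel_loop:
  assumes s: "queue qs0 s" "inp s" "regs s 10 = 0" "\<forall>v<n. arrs s 3 v = length (adj v)"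
    "\<forall>v<n. v \<in> set qs0 \<longleftrightarrow> length (adj v) \<le> 1"
  shows "ok (While (Less 10 9) peel_body) s (\<lambda>t s'. \<exists>qs. peel_state qs (length qs) (\<lambda>v. card (nbrs E v - set qs)) s' \<and>
    frame {4..11} {3, 4, 5} s s' \<and> t \<le> 20 * (\<Sum>v<n. wt v) + 1)"
proof -
  define I where "I M s' \<longleftrightarrow> (\<exists>qs h. regs s' 10 = h \<and> peel_state qs h (\<lambda>v. card (nbrs E v - set (take h qs))) s' \<and>
    frame {4..11} {3, 4, 5} s s' \<and> M = (\<Sum>u\<in>{..<n} - set (take h qs). 20 * wt u))" for M s'
  have cd: "card (nbrs E v) = length (adj v)" if "v < n" for v
    using distinct_card[OF distinct_adj[OF that]] set_adj[OF that] by simp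
  show ?thesis
  proof (rule ok_While[where I = I])
    show "I (\<Sum>u<n. 20 * wt u) s"
      unfolding I_def using s cd by (intro exI[of _ qs0]) (auto simp: peel_state_def)
  next
    fix M s1 assume "I M s1" and h: "holds (Less 10 9) s1"
    then obtain qs h where J: "regs s1 10 = h" "peel_state qs h (\<lambda>v. card (nbrs E v - set (take h qs))) s1"
      "frame {4..11} {3, 4, 5} s s1" "M = (\<Sum>u\<in>{..<n} - set (take h qs). 20 * wt u)"
      unfolding I_def by blast
    define r where "r v = card (nbrs E v - set (take h qs))" for v
    have q: "queue qs s1" "inp s1" "distinct qs" "set qs \<subseteq> {..<n}" using J(2) by (auto simp: peel_state_def queue_def)
    then have hl: "h < length qs" using h J(1) by (simp add: queue_def)
    define x where "x = qs ! h"
    have x: "x < n" "x \<in> set qs" "arrs s1 5 h = x" "x \<notin> set (take h qs)"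
    proof -
      show "x \<in> set qs" using hl by (simp add: x_def)
      then show "x < n" using q by auto
      show "arrs s1 5 h = x" using q hl by (simp add: queue_def x_def)
      show "x \<notin> set (take h qs)" using q(3) hl by (auto simp: x_def in_set_conv_nth nth_eq_iff_index_eq)
    qed
    \<comment> \<open>Being in the queue bounds the number of neighbors outside
      \<open>take h qs\<close>, and this is the condition on the order of peeling at position
      \<open>h\<close>.\<close>
    have "r x \<le> 1" using J(2) x by (simp add: peel_state_def r_def)
    then have P: "peel_state qs (Suc h) r s1" using J(2) hl unfolding peel_state_def r_def x_def by (auto simp: less_Suc_eq)
    have tk: "take (Suc h) qs = take h qs @ [x]" using hl by (simp add: take_Suc_conv_app_nth x_def)
    have "set qs \<subseteq> {..<n}" by fact
    have ins: "{..<n} - set (take h qs) = insert x ({..<n} - set (take (Suc h) qs))" unfolding tk using x(1,4) by auto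
    have "x \<notin> {..<n} - set (take (Suc h) qs)" unfolding tk by simp
    then have M: "M = 20 * wt x + (\<Sum>u\<in>{..<n} - set (take (Suc h) qs). 20 * wt u)"
      unfolding J(4) ins by (intro sum.insert) simp_all
    define s2 where "s2 = set_reg 10 (Suc h) (set_reg 4 x s1)"
    have s2: "regs s2 4 = x" "inp s2" "peel_state qs (Suc h) r s2" using q P by (auto simp: s2_def)
    \<comment> \<open>The counts after the first \<open>k\<close> neighbors of \<open>x\<close> have
      been visited; lists are distinct, so each neighbor is decremented once.\<close>
    define rr where "rr k v = r v - (if v \<in> set (take k (adj x)) then 1 else 0)" for k v
    let ?Q = "\<lambda>t s3. regs s3 10 = Suc h \<and> (\<exists>zs. peel_state (qs @ zs) (Suc h) (rr (length (adj x))) s3) \<and>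
       frame {4..11} {3, 4, 5} s s3 \<and> t \<le> 5 + length (adj x) * 12"
    have f2: "frame {4..11} {3, 4, 5} s s2" using J(3) by (simp add: s2_def)
    have "ok (scan 4 6 7 8 peel_visit) s2 ?Q"
    proof (rule ok_scan_simple[where I = "\<lambda>k s3. regs s3 10 = Suc h \<and> (\<exists>zs. peel_state (qs @ zs) (Suc h) (rr k) s3) \<and>
       frame {4..11} {3, 4, 5} s s3" and tb = 9, OF s2(2,1) x(1)])
      have "rr 0 = r" by (auto simp: rr_def)
      then show "regs s2 10 = Suc h \<and> (\<exists>zs. peel_state (qs @ zs) (Suc h) (rr 0) s2) \<and> frame {4..11} {3, 4, 5} s s2"
        using s2 f2 by (auto simp: s2_def intro!: exI[of _ "[]"])
    next
      fix k s3
      assume k: "k < length (adj x)" and A: "regs s3 10 = Suc h \<and> (\<exists>zs. peel_state (qs @ zs) (Suc h) (rr k) s3) \<and>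
         frame {4..11} {3, 4, 5} s s3" and i: "inp s3" and y: "regs s3 8 = adj x ! k"
      then obtain zs where zs: "peel_state (qs @ zs) (Suc h) (rr k) s3" by blast
      have yn: "adj x ! k < n" using adj_less[OF x(1)] k by simp
      have nk: "adj x ! k \<notin> set (take k (adj x))"
        using distinct_adj[OF x(1)] k by (auto simp: in_set_conv_nth nth_eq_iff_index_eq)
      have rk: "(rr k)(adj x ! k := rr k (adj x ! k) - 1) = rr (Suc k)"
        using nk k by (auto simp: rr_def take_Suc_conv_app_nth fun_eq_iff)
      show "ok peel_visit s3 (\<lambda>t s'. (regs s' 10 = Suc h \<and> (\<exists>zs. peel_state (qs @ zs) (Suc h) (rr (Suc k)) s') \<and>
         frame {4..11} {3, 4, 5} s s') \<and> inp s' \<and> regs s' 6 = regs s3 6 \<and> regs s' 7 = regs s3 7 \<and> t \<le> 9)"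
      proof (rule ok_mono[OF ok_peel_visit[OF zs y yn]], unfold rk, elim conjE exE)
        fix t s' ws assume p': "peel_state ((qs @ zs) @ ws) (Suc h) (rr (Suc k)) s'"
          and f: "frame {5, 9, 11} {3, 4, 5} s3 s'" and t: "t \<le> 9"
        have "frame {4..11} {3, 4, 5} s s'" by (rule frame_trans[OF _ f, of "{4..11}" "{3, 4, 5}"]) (use A in auto)
        moreover have "inp s'" using p' by (simp add: peel_state_def)
        ultimately show "(regs s' 10 = Suc h \<and> (\<exists>zs. peel_state (qs @ zs) (Suc h) (rr (Suc k)) s') \<and>
         frame {4..11} {3, 4, 5} s s') \<and> inp s' \<and> regs s' 6 = regs s3 6 \<and> regs s' 7 = regs s3 7 \<and> t \<le> 9"
          using p' t A frameD(1)[OF f, of 10] frameD(1)[OF f, of 6] frameD(1)[OF f, of 7] by auto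
      qed
    qed auto
    then have "ok (scan 4 6 7 8 peel_visit) s2 (\<lambda>t s'. \<exists>m'. I m' s' \<and> 1 + (2 + t) + m' \<le> M)"
    proof (rule ok_mono, elim conjE exE)
      fix t s3 zs assume A: "regs s3 10 = Suc h" "peel_state (qs @ zs) (Suc h) (rr (length (adj x))) s3"
        "frame {4..11} {3, 4, 5} s s3" "t \<le> 5 + length (adj x) * 12"
      have tk': "take (Suc h) (qs @ zs) = take h qs @ [x]" using tk hl by simp
      have rl: "rr (length (adj x)) v = card (nbrs E v - set (take (Suc h) (qs @ zs)))" if v: "v < n" for v
      proof -
        have "nbrs E v - set (take (Suc h) (qs @ zs)) = (nbrs E v - set (take h qs)) - {x}" unfolding tk' by auto
        moreover have "finite (nbrs E v)" using set_adj[OF v] by (metis List.finite_set)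
        moreover have "v \<in> set (adj x) \<longleftrightarrow> x \<in> nbrs E v" using adj_sym[OF x(1) v] set_adj[OF v] by simp
        ultimately show ?thesis using x(4) by (simp add: rr_def r_def card_Diff_singleton_if)
      qed
      have "peel_state (qs @ zs) (Suc h) (\<lambda>v. card (nbrs E v - set (take (Suc h) (qs @ zs)))) s3"
        using A(2) rl by (simp add: peel_state_def)
      then have "I (\<Sum>u\<in>{..<n} - set (take (Suc h) (qs @ zs)). 20 * wt u) s3"
        unfolding I_def using A(1,3) by (intro exI[of _ "qs @ zs"] conjI) auto
      then show "\<exists>m'. I m' s3 \<and> 1 + (2 + t) + m' \<le> M"
        using M A(4) unfolding tk' tk by (intro exI[of _ "\<Sum>u\<in>{..<n} - set (take h qs @ [x]). 20 * wt u"]) (auto simp: wt_def)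
    qed
    then show "ok peel_body s1 (\<lambda>t s'. \<exists>m'. I m' s' \<and> 1 + t + m' \<le> M)"
      unfolding peel_body_def using x(3) J(1) by (simp add: s2_def)
  next
    fix M s1 t assume "I M s1" and h: "\<not> holds (Less 10 9) s1" and t: "t + M \<le> (\<Sum>u<n. 20 * wt u) + 1"
    then obtain qs h where J: "regs s1 10 = h" "peel_state qs h (\<lambda>v. card (nbrs E v - set (take h qs))) s1"
      "frame {4..11} {3, 4, 5} s s1" unfolding I_def by blast
    then have "h = length qs" using h by (simp add: peel_state_def queue_def)
    then show "\<exists>qs. peel_state qs (length qs) (\<lambda>v. card (nbrs E v - set qs)) s1 \<and>
      frame {4..11} {3, 4, 5} s s1 \<and> t \<le> 20 * (\<Sum>v<n. wt v) + 1"
      using J t by (intro exI[of _ qs]) (auto simp: sum_distrib_left)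
  qed
qed

end

section \<open>Following a chain of chordless vertices\<close>

definition chase_body :: prog where
  "chase_body = Seq (scan 18 19 20 21 (Seq (Load 11 4 21) (If (Conj (Equal 11 1) (Neg (Equal 21 17))) (Copy 22 21) Skip)))
     (Seq (Copy 17 18) (Seq (Copy 18 22) (Load 16 3 18)))"

locale ram_core = ram + core "{..<n}" E K qs for K qs
begin

definition core_state :: "state \<Rightarrow> bool" where
  "core_state s \<longleftrightarrow> inp s \<and> (\<forall>v<n. arrs s 4 v = (if v \<in> K then 0 else 1)) \<and> (\<forall>v<n. arrs s 3 v = card (nbrs E v \<inter> K))"

lemma core_state_set [simp]:
  "3 < r \<Longrightarrow> core_state (set_reg r k s) = core_state s"
  "4 < a \<Longrightarrow> core_state (set_cell a i k s) = core_state s"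
  by (auto simp: core_state_def)

lemma core_state_inp: "core_state s \<Longrightarrow> inp s"
  and core_state_mark: "core_state s \<Longrightarrow> v < n \<Longrightarrow> arrs s 4 v = (if v \<in> K then 0 else 1)"
  and core_state_rem: "core_state s \<Longrightarrow> v < n \<Longrightarrow> arrs s 3 v = card (nbrs E v \<inter> K)"
  by (auto simp: core_state_def)

lemma K_less: "v \<in> K \<Longrightarrow> v < n"
  using K by auto

text \<open>A chordless vertex has two neighbors in the core. The one that differs from the vertex
  just left, which is in register \<open>17\<close>, comes next.\<close>

lemma ok_chase_body:
  assumes s: "core_state s" "regs s 17 = C ! (m - 1)" "regs s 18 = C ! m"
    and C: "LC C" "0 < m" "Suc m < card K" "small (C ! m)"
  shows "ok chase_body s (\<lambda>t s'. core_state s' \<and> frame {11, 16, 17, 18, 19, 20, 21, 22} {} s s' \<and> regs s' 17 = C ! m \<and>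
    regs s' 18 = C ! Suc m \<and> regs s' 16 = card (nbrs E (C ! Suc m) \<inter> K) \<and> t \<le> 8 + length (adj (C ! m)) * 7)"
proof -
  define x where "x = C ! m"
  have l: "length C = card K" using LC_length[OF C(1)] .
  have x: "x \<in> K" "x < n" "C ! Suc m \<in> K" using LC_in_K[OF C(1)] C l K_less by (auto simp: x_def)
  have nb: "nbrs E x \<inter> K = {C ! (m - 1), C ! Suc m}" using small_nbrs[OF C(1,2) _ C(4)] C l by (simp add: x_def)
  define I where "I k s' \<longleftrightarrow> core_state s' \<and> frame {11, 19, 20, 21, 22} {} s s' \<and>
    (C ! Suc m \<in> set (take k (adj x)) \<longrightarrow> regs s' 22 = C ! Suc m)" for k s'
  have sc: "ok (scan 18 19 20 21 (Seq (Load 11 4 21) (If (Conj (Equal 11 1) (Neg (Equal 21 17))) (Copy 22 21) Skip))) s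
    (\<lambda>t s'. I (length (adj x)) s' \<and> t \<le> 5 + length (adj x) * (4 + 3))"
  proof (rule ok_scan_simple[where I = I and tb = 4 and x = x])
    show "inp s" "regs s 18 = x" "x < n" "I 0 s" using s x by (auto simp: I_def x_def core_state_inp)
  next
    fix k s1 assume k: "k < length (adj x)" and I: "I k s1" and "inp s1" and y: "regs s1 21 = adj x ! k"
    have yn: "adj x ! k < n" using adj_less[OF x(2)] k by simp
    have cs: "core_state s1" and f: "frame {11, 19, 20, 21, 22} {} s s1" using I by (auto simp: I_def)
    have r17: "regs s1 17 = C ! (m - 1)" using frameD(1)[OF f, of 17] s by simp
    have yN: "adj x ! k \<in> nbrs E x" using set_adj[OF x(2)] k by (metis nth_mem)
    have I': "core_state s1 \<and> frame {11, 19, 20, 21, 22} {} s s1 \<and>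
      (C ! Suc m \<in> set (take k (adj x)) \<longrightarrow> regs s1 22 = C ! Suc m)" using I by (simp add: I_def)
    show "ok (Seq (Load 11 4 21) (If (Conj (Equal 11 1) (Neg (Equal 21 17))) (Copy 22 21) Skip)) s1
      (\<lambda>t s'. I (Suc k) s' \<and> inp s' \<and> regs s' 19 = regs s1 19 \<and> regs s' 20 = regs s1 20 \<and> t \<le> 4)"
    proof (cases "adj x ! k \<in> K \<and> adj x ! k \<noteq> C ! (m - 1)")
      case True
      then have "adj x ! k = C ! Suc m" using nb yN by blast
      then show ?thesis using True y yn r17 cs I' k
        by (auto simp: I_def core_state_mark core_state_inp inp_regs take_Suc_conv_app_nth)
    next
      case False
      have "C ! Suc m \<noteq> C ! (m - 1)" using LC_props(1)[OF C(1)] C l by (simp add: nth_eq_iff_index_eq)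
      then have "adj x ! k \<noteq> C ! Suc m" using False x(3) by metis
      then show ?thesis using False y yn r17 cs I' k
        by (auto simp: I_def core_state_mark core_state_inp inp_regs take_Suc_conv_app_nth)
    qed
  qed (auto simp: I_def)
  have mem: "C ! Suc m \<in> set (take (length (adj x)) (adj x))" using nb set_adj[OF x(2)] by auto
  show ?thesis unfolding chase_body_def
  proof (subst ok_Seq, rule ok_mono[OF sc], elim conjE)
    fix t s' assume "I (length (adj x)) s'" and t: "t \<le> 5 + length (adj x) * (4 + 3)"
    then have I: "core_state s'" "frame {11, 19, 20, 21, 22} {} s s'" "regs s' 22 = C ! Suc m" using mem by (auto simp: I_def)
    have "regs s' 18 = x" using frameD(1)[OF I(2), of 18] s(3) x_def by simp
    moreover have "frame {11, 16, 17, 18, 19, 20, 21, 22} {} s s'" by (rule frame_trans[OF frame_refl[of "{}" "{}" s] I(2)]) auto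
    ultimately show "ok (Seq (Copy 17 18) (Seq (Copy 18 22) (Load 16 3 18))) s' (\<lambda>t' s'. core_state s' \<and>
      frame {11, 16, 17, 18, 19, 20, 21, 22} {} s s' \<and> regs s' 17 = C ! m \<and> regs s' 18 = C ! Suc m \<and>
      regs s' 16 = card (nbrs E (C ! Suc m) \<inter> K) \<and> t + t' \<le> 8 + length (adj (C ! m)) * 7)"
      using I t x K_less[OF x(3)] by (simp add: core_state_rem x_def)
  qed
qed

text \<open>The potential is the weight of the chain vertices not left yet, at \<open>9\<close> per
  unit: a round takes at most \<open>8 + 7 * length (adj (C ! m))\<close> steps and one more for the
  test. The walk ends at \<open>C ! q\<close> at the latest, so it never closes the cycle.\<close>

lemma ok_chase:
  assumes s: "core_state s" "regs s 17 = v" "regs s 18 = x" "regs s 16 = 2"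
    and C: "LC C" "C ! 0 = v" "C ! 1 = x" "\<not> small v" "small x"
  shows "ok (While (Equal 16 3) chase_body) s (\<lambda>t s'. core_state s' \<and> frame {11, 16, 17, 18, 19, 20, 21, 22} {} s s' \<and>
    (\<exists>m. 2 \<le> m \<and> Suc m < card K \<and> (\<forall>t. 1 \<le> t \<and> t < m \<longrightarrow> small (C ! t)) \<and> \<not> small (C ! m) \<and> regs s' 18 = C ! m) \<and>
    t \<le> 9 * (\<Sum>z\<in>CH v x. wt z) + 1)"
proof -
  obtain q where q: "2 \<le> q" "Suc q < card K" "\<not> small (C ! q)" using not_small_chord[OF C(1)] C(2,4) by metis
  have l: "length C = card K" using LC_length[OF C(1)] .
  have finCH: "finite (CH v x)" using CH_subset finK finite_subset by metis
  define I where "I M s' \<longleftrightarrow> (\<exists>m. 1 \<le> m \<and> m \<le> q \<and> core_state s' \<and> frame {11, 16, 17, 18, 19, 20, 21, 22} {} s s' \<and>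
    regs s' 17 = C ! (m - 1) \<and> regs s' 18 = C ! m \<and> regs s' 16 = card (nbrs E (C ! m) \<inter> K) \<and>
    (\<forall>t. 1 \<le> t \<and> t < m \<longrightarrow> small (C ! t)) \<and> M = 9 * (\<Sum>z\<in>CH v x - (!) C ` {1..<m}. wt z))" for M s'
  show ?thesis
  proof (rule ok_While[where I = I])
    show "I (9 * (\<Sum>z\<in>CH v x. wt z)) s" unfolding I_def using s C q by (intro exI[of _ 1]) (auto simp: small_def)
  next
    fix M s1 assume "I M s1" and h: "holds (Equal 16 3) s1"
    then obtain m where m: "1 \<le> m" "m \<le> q" "core_state s1" "frame {11, 16, 17, 18, 19, 20, 21, 22} {} s s1"
      "regs s1 17 = C ! (m - 1)" "regs s1 18 = C ! m" "regs s1 16 = card (nbrs E (C ! m) \<inter> K)"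
      "\<forall>t. 1 \<le> t \<and> t < m \<longrightarrow> small (C ! t)" "M = 9 * (\<Sum>z\<in>CH v x - (!) C ` {1..<m}. wt z)"
      unfolding I_def by blast
    have sm: "small (C ! m)" using h m(3,7) by (simp add: small_def core_state_inp inp_regs)
    then have "m \<noteq> q" using q by metis
    then have mq: "Suc m \<le> q" "0 < m" "Suc m < card K" using m q by auto
    have "C ! m \<in> CH v x" unfolding CH_def using C m(1,8) sm mq by (auto simp: le_less intro!: exI[of _ C] exI[of _ m])
    moreover have "C ! m \<notin> (!) C ` {1..<m}"
      using LC_props(1)[OF C(1)] mq l by (auto simp: nth_eq_iff_index_eq)
    moreover have im: "(!) C ` {1..<Suc m} = insert (C ! m) ((!) C ` {1..<m})"
    proof -
      have "{1..<Suc m} = insert m {1..<m}" using mq by auto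
      then show ?thesis by simp
    qed
    ultimately have ins: "CH v x - (!) C ` {1..<m} = insert (C ! m) (CH v x - (!) C ` {1..<Suc m})" by auto
    have "C ! m \<notin> CH v x - (!) C ` {1..<Suc m}" unfolding im by simp
    then have "(\<Sum>z\<in>CH v x - (!) C ` {1..<m}. wt z) = wt (C ! m) + (\<Sum>z\<in>CH v x - (!) C ` {1..<Suc m}. wt z)"
      unfolding ins using finCH by (intro sum.insert) simp_all
    then have M: "M = 9 * wt (C ! m) + 9 * (\<Sum>z\<in>CH v x - (!) C ` {1..<Suc m}. wt z)"
      using m(9) by simp
    show "ok chase_body s1 (\<lambda>t s'. \<exists>m'. I m' s' \<and> 1 + t + m' \<le> M)"
    proof (rule ok_mono[OF ok_chase_body[OF m(3,5,6) C(1) mq(2,3) sm]], elim conjE)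
      fix t s' assume A: "core_state s'" "frame {11, 16, 17, 18, 19, 20, 21, 22} {} s1 s'" "regs s' 17 = C ! m"
        "regs s' 18 = C ! Suc m" "regs s' 16 = card (nbrs E (C ! Suc m) \<inter> K)" "t \<le> 8 + length (adj (C ! m)) * 7"
      have "frame {11, 16, 17, 18, 19, 20, 21, 22} {} s s'" by (rule frame_trans[OF m(4) A(2)]) auto
      then have "I (9 * (\<Sum>z\<in>CH v x - (!) C ` {1..<Suc m}. wt z)) s'"
        unfolding I_def using A m(8) sm mq by (intro exI[of _ "Suc m"]) (auto simp: less_Suc_eq)
      moreover have "1 + t + 9 * (\<Sum>z\<in>CH v x - (!) C ` {1..<Suc m}. wt z) \<le> M" using M A(6) by (simp add: wt_def[of "C ! m"])
      ultimately show "\<exists>m'. I m' s' \<and> 1 + t + m' \<le> M" by blast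
    qed
  next
    fix M s1 t assume "I M s1" and h: "\<not> holds (Equal 16 3) s1" and t: "t + M \<le> 9 * (\<Sum>z\<in>CH v x. wt z) + 1"
    then obtain m where m: "1 \<le> m" "m \<le> q" "core_state s1" "frame {11, 16, 17, 18, 19, 20, 21, 22} {} s s1"
      "regs s1 18 = C ! m" "regs s1 16 = card (nbrs E (C ! m) \<inter> K)"
      "\<forall>t. 1 \<le> t \<and> t < m \<longrightarrow> small (C ! t)" unfolding I_def by blast
    have ns: "\<not> small (C ! m)" using h m(3,6) by (simp add: small_def core_state_inp inp_regs)
    then have "m \<noteq> 1" using C by metis
    then show "core_state s1 \<and> frame {11, 16, 17, 18, 19, 20, 21, 22} {} s s1 \<and>
      (\<exists>m. 2 \<le> m \<and> Suc m < card K \<and> (\<forall>t. 1 \<le> t \<and> t < m \<longrightarrow> small (C ! t)) \<and> \<not> small (C ! m) \<and> regs s1 18 = C ! m) \<and>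
      t \<le> 9 * (\<Sum>z\<in>CH v x. wt z) + 1"
      using m ns t q by (intro conjI exI[of _ m]) auto
  qed
qed

end

section \<open>Searching for the start of the sweep\<close>

definition chase_test :: prog where
  "chase_test = Seq (While (Equal 16 3) chase_body) (Seq (Load 11 6 18) (If (Equal 11 15) (Const 12 1) Skip))"

text \<open>Registers \<open>13\<close> and \<open>14\<close> receive the pair before it is tested.
  If all tests fail, the last pair is still an edge of the core, and by
  \<open>chordless_start\<close> it can be used.\<close>

definition test_core :: prog where
  "test_core = Seq (Copy 13 8) (Seq (Copy 14 4) (Seq (Load 5 3 4) (Seq (Load 16 3 8)
     (If (Conj (Less 3 5) (Equal 16 3))
       (Seq (Copy 17 4) (Seq (Copy 18 8) chase_test))
       Skip))))"

definition test_body :: prog where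
  "test_body = Seq (Load 11 4 8) (If (Conj (Equal 11 1) (Equal 12 1)) test_core Skip)"

text \<open>Stamping the neighbors of \<open>v\<close> with \<open>v + 1\<close> enables
  \<open>chase_test\<close> to decide in constant time whether the end of a chain is adjacent to
  \<open>v\<close>. Stamps of earlier vertices are smaller and the initial value is
  \<open>0\<close>, so nothing has to be erased.\<close>

definition find_vertex :: prog where
  "find_vertex = Seq (Copy 15 4) (Seq (Inc 15) (Seq (scan 4 6 7 8 (Store 6 8 15)) (scan 4 6 7 8 test_body)))"

definition find_loop :: prog where
  "find_loop = While (Conj (Less 4 0) (Equal 12 1))
     (Seq (Load 11 4 4) (Seq (If (Equal 11 1) find_vertex Skip) (Inc 4)))"

context ram_core
begin

lemma ok_test_core:
  assumes s: "core_state s" "regs s 4 = v" "regs s 8 = y" "regs s 12 = 0" "regs s 15 = Suc v"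
    "\<And>u. u < n \<Longrightarrow> arrs s 6 u = Suc v \<longleftrightarrow> u \<in> nbrs E v" and vy: "v \<in> K" "y \<in> K" "{y, v} \<in> E"
  shows "ok test_core s (\<lambda>t s'. core_state s' \<and> frame {5, 11, 12, 13, 14, 16, 17, 18, 19, 20, 21, 22} {} s s' \<and>
    regs s' 13 = y \<and> regs s' 14 = v \<and>
    (regs s' 12 = 1 \<and> start_ok y v \<or> regs s' 12 = 0 \<and> (\<not> small v \<longrightarrow> small y \<longrightarrow> \<not> good v y)) \<and>
    t \<le> 9 * (\<Sum>z\<in>CH v y. wt z) + 13)"
proof -
  define Q where "Q t s' \<longleftrightarrow> core_state s' \<and> frame {5, 11, 12, 13, 14, 16, 17, 18, 19, 20, 21, 22} {} s s' \<and>
    regs s' 13 = y \<and> regs s' 14 = v \<and>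
    (regs s' 12 = 1 \<and> start_ok y v \<or> regs s' 12 = 0 \<and> (\<not> small v \<longrightarrow> small y \<longrightarrow> \<not> good v y)) \<and>
    t \<le> 9 * (\<Sum>z\<in>CH v y. wt z) + 13" for t s'
  define s1 where "s1 = set_reg 16 (card (nbrs E y \<inter> K)) (set_reg 5 (card (nbrs E v \<inter> K)) (set_reg 14 v (set_reg 13 y s)))"
  have vn: "v < n" "y < n" using vy K_less by auto
  have c1: "core_state s1" "frame {5, 11, 12, 13, 14, 16, 17, 18, 19, 20, 21, 22} {} s s1" using s by (auto simp: s1_def)
  have run: "ok test_core s Q = (if holds (Conj (Less 3 5) (Equal 16 3)) s1
    then ok chase_test (set_reg 18 y (set_reg 17 v s1)) (\<lambda>t. Q (7 + t)) else Q 6 s1)"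
    using s vn unfolding test_core_def s1_def
    by (simp add: core_state_rem del: holds.simps) (simp add: numeral_eq_Suc del: holds.simps)
  have cond: "holds (Conj (Less 3 5) (Equal 16 3)) s1 \<longleftrightarrow> \<not> small v \<and> small y"
    using deg[OF vy(1)] s(1) by (auto simp: s1_def small_def inp_regs core_state_inp)
  have "ok test_core s Q"
  proof (cases "\<not> small v \<and> small y")
    case False
    then have "\<not> holds (Conj (Less 3 5) (Equal 16 3)) s1" using cond by blast
    moreover have "Q 6 s1" using c1 s(4) False by (auto simp: Q_def s1_def)
    ultimately show ?thesis unfolding run by (simp only: if_not_P if_False)
  next
    case True
    obtain C where C: "LC C" "C ! 0 = v" "C ! 1 = y" using orient[OF vy] True by blast
    define s2 where "s2 = set_reg 18 y (set_reg 17 v s1)"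
    have s2: "core_state s2" "regs s2 17 = v" "regs s2 18 = y" "regs s2 16 = 2"
      "frame {5, 11, 12, 13, 14, 16, 17, 18, 19, 20, 21, 22} {} s s2"
      using c1 True by (auto simp: s2_def s1_def small_def)
    have bs: "\<not> small v" "small y" using True by auto
    have "ok chase_test s2 (\<lambda>t. Q (7 + t))" unfolding chase_test_def
    proof (subst ok_Seq, rule ok_mono[OF ok_chase[OF s2(1-4) C bs]], elim conjE exE)
      fix t s' m
      assume A: "core_state s'" "frame {11, 16, 17, 18, 19, 20, 21, 22} {} s2 s'" "t \<le> 9 * (\<Sum>z\<in>CH v y. wt z) + 1"
        "2 \<le> m" "Suc m < card K" "\<forall>t. 1 \<le> t \<and> t < m \<longrightarrow> small (C ! t)" "\<not> small (C ! m)" "regs s' 18 = C ! m"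
      have f: "frame {5, 11, 12, 13, 14, 16, 17, 18, 19, 20, 21, 22} {} s s'" by (rule frame_trans[OF s2(5) A(2)]) auto
      have r: "regs s' 12 = 0" "regs s' 13 = y" "regs s' 14 = v" "regs s' 15 = Suc v"
        using frameD(1)[OF A(2), of 12] frameD(1)[OF A(2), of 13] frameD(1)[OF A(2), of 14] frameD(1)[OF A(2), of 15] s
        by (auto simp: s2_def s1_def)
      have CmK: "C ! m \<in> K" using LC_in_K[OF C(1), of m] A(5) LC_length[OF C(1)] by simp
      have "arrs s' 6 = arrs s 6" using frameD(2)[OF f, of 6] by simp
      then have st: "arrs s' 6 (C ! m) = Suc v \<longleftrightarrow> {v, C ! m} \<in> E"
        using s(6)[OF K_less[OF CmK]] by (simp add: nbrs_def insert_commute)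
      show "ok (Seq (Load 11 6 18) (If (Equal 11 15) (Const 12 1) Skip)) s' (\<lambda>t'. Q (7 + (t + t')))"
      proof (cases "{v, C ! m} \<in> E")
        case True
        have "start_ok y v" using good_start[OF C A(4,5) _ True] A(6) by blast
        then show ?thesis using A r f st True by (simp add: Q_def)
      next
        case False
        have "\<not> good v y" using goodD[OF _ C A(4) _ _ A(7)] A(5,6) False by auto
        then show ?thesis using A r f st False by (simp add: Q_def)
      qed
    qed
    moreover have "holds (Conj (Less 3 5) (Equal 16 3)) s1" using cond True by blast
    ultimately show ?thesis unfolding run by (simp only: s2_def if_P if_True)
  qed
  then show ?thesis by (rule ok_mono) (simp add: Q_def)
qed

definition tested where
  "tested v x \<longleftrightarrow> (\<not> small v \<longrightarrow> small x \<longrightarrow> \<not> good v x)"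

lemma ok_stamp:
  assumes s: "core_state s" "regs s 4 = v" "regs s 15 = Suc v" "v < n" "\<And>u. u < n \<Longrightarrow> arrs s 6 u \<le> v"
  shows "ok (scan 4 6 7 8 (Store 6 8 15)) s (\<lambda>t s'. core_state s' \<and> frame {6, 7, 8} {6} s s' \<and>
    (\<forall>u<n. arrs s' 6 u \<le> Suc v \<and> (arrs s' 6 u = Suc v \<longleftrightarrow> u \<in> nbrs E v)) \<and> t \<le> 5 + length (adj v) * 4)"
proof (rule ok_scan_simple[where x = v and tb = 1 and I = "\<lambda>k s'. core_state s' \<and> frame {6, 7, 8} {6} s s' \<and>
    (\<forall>u<n. arrs s' 6 u \<le> Suc v \<and> (arrs s' 6 u = Suc v \<longleftrightarrow> u \<in> set (take k (adj v))))"])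
  show "core_state s \<and> frame {6, 7, 8} {6} s s \<and> (\<forall>u<n. arrs s 6 u \<le> Suc v \<and> (arrs s 6 u = Suc v \<longleftrightarrow> u \<in> set (take 0 (adj v))))"
    using s(1,5) by (auto simp: le_Suc_eq) fastforce
next
  fix k s1 assume k: "k < length (adj v)" and A: "core_state s1 \<and> frame {6, 7, 8} {6} s s1 \<and>
    (\<forall>u<n. arrs s1 6 u \<le> Suc v \<and> (arrs s1 6 u = Suc v \<longleftrightarrow> u \<in> set (take k (adj v))))"
    and "inp s1" "regs s1 8 = adj v ! k"
  moreover have "regs s1 15 = Suc v" using frameD(1)[of "{6, 7, 8}" "{6}" s s1 15] A s by simp
  ultimately show "ok (Store 6 8 15) s1 (\<lambda>t s'. (core_state s' \<and> frame {6, 7, 8} {6} s s' \<and>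
    (\<forall>u<n. arrs s' 6 u \<le> Suc v \<and> (arrs s' 6 u = Suc v \<longleftrightarrow> u \<in> set (take (Suc k) (adj v))))) \<and> inp s' \<and>
    regs s' 6 = regs s1 6 \<and> regs s' 7 = regs s1 7 \<and> t \<le> 1)"
    by (auto simp: take_Suc_conv_app_nth)
qed (use s set_adj in \<open>auto simp: core_state_inp\<close>)

text \<open>The chains that start at \<open>v\<close> are paid for by the potential
  \<open>cost k\<close>, which weighs those still to be followed. The list of \<open>v\<close>
  itself pays a constant per entry.\<close>

lemma ok_test_scan:
  assumes s: "core_state s" "regs s 4 = v" "regs s 12 = 0" "regs s 15 = Suc v"
    "\<And>u. u < n \<Longrightarrow> arrs s 6 u = Suc v \<longleftrightarrow> u \<in> nbrs E v" and v: "v \<in> K"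
  shows "ok (scan 4 6 7 8 test_body) s (\<lambda>t s'. core_state s' \<and> frame ({5..22} - {9, 10, 15}) {} s s' \<and>
    (regs s' 12 = 1 \<and> start_ok (regs s' 13) (regs s' 14) \<or>
     regs s' 12 = 0 \<and> regs s' 13 \<in> K \<and> regs s' 14 \<in> K \<and> {regs s' 13, regs s' 14} \<in> E \<and> (\<forall>x \<in> nbrs E v \<inter> K. tested v x)) \<and>
    t \<le> 9 * (\<Sum>x\<in>nbrs E v \<inter> K. \<Sum>z\<in>CH v x. wt z) + 5 + length (adj v) * 20)"
proof -
  define F where "F = {5..22} - {9, 10, 15::nat}"
  have vn: "v < n" using v K_less by blast
  define cost where "cost k = 9 * (\<Sum>x\<in>set (drop k (adj v)) \<inter> K. \<Sum>z\<in>CH v x. wt z)" for k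
  define I where "I k M s' \<longleftrightarrow> core_state s' \<and> frame F {} s s' \<and>
    (regs s' 12 = 1 \<and> start_ok (regs s' 13) (regs s' 14) \<or> regs s' 12 = 0 \<and>
      (set (take k (adj v)) \<inter> K \<noteq> {} \<longrightarrow> regs s' 13 \<in> K \<and> regs s' 14 \<in> K \<and> {regs s' 13, regs s' 14} \<in> E) \<and>
      (\<forall>x \<in> set (take k (adj v)) \<inter> K. tested v x)) \<and> M = cost k" for k M s'
  have "ok (scan 4 6 7 8 test_body) s (\<lambda>t s'. I (length (adj v)) 0 s' \<and> t \<le> cost 0 + 5 + length (adj v) * (17 + 3))"
  proof (rule ok_scan[where I = I and x = v and tb = 17 and m = "cost 0"])
    show "I 0 (cost 0) s" using s by (simp add: I_def)
    show "I k m (set_reg r a s')" if "I k m s'" "r \<in> {6, 7, 8}" for k m s' r a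
      using that by (auto simp: I_def F_def)
  next
    fix k M s1 assume k: "k < length (adj v)" and I: "I k M s1" and i: "inp s1" and y: "regs s1 8 = adj v ! k"
    define x where "x = adj v ! k"
    have xn: "x < n" and xN: "x \<in> nbrs E v" using adj_less[OF vn nth_mem[OF k]] set_adj[OF vn] nth_mem[OF k] by (auto simp: x_def)
    have tk: "set (take (Suc k) (adj v)) = insert x (set (take k (adj v)))" using k by (simp add: take_Suc_conv_app_nth x_def)
    have dk: "drop k (adj v) = x # drop (Suc k) (adj v)" using k by (simp add: Cons_nth_drop_Suc x_def)
    have xd: "x \<notin> set (drop (Suc k) (adj v))" using distinct_drop[OF distinct_adj[OF vn], of k] dk by simp
    have cs: "core_state s1" and f: "frame F {} s s1" and M: "M = cost k" using I by (auto simp: I_def)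
    have r: "regs s1 4 = v" "regs s1 15 = Suc v" "arrs s1 6 = arrs s 6"
      using frameD(1)[OF f, of 4] frameD(1)[OF f, of 15] frameD(2)[OF f, of 6] s by (auto simp: F_def)
    have mk: "arrs s1 4 x = (if x \<in> K then 0 else 1)" using cs xn by (rule core_state_mark)
    have le: "cost (Suc k) \<le> cost k" unfolding cost_def using dk finK
      by (intro mult_left_mono sum_mono2) auto
    show "ok test_body s1 (\<lambda>t s'. \<exists>m'. I (Suc k) m' s' \<and> inp s' \<and> regs s' 6 = regs s1 6 \<and> regs s' 7 = regs s1 7 \<and> t + m' \<le> M + 17)"
    proof (cases "x \<in> K \<and> regs s1 12 = 0")
      case True
      define s2 where "s2 = set_reg 11 0 s1"
      have s2: "core_state s2" "regs s2 4 = v" "regs s2 8 = x" "regs s2 12 = 0" "regs s2 15 = Suc v"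
        "\<And>u. u < n \<Longrightarrow> arrs s2 6 u = Suc v \<longleftrightarrow> u \<in> nbrs E v" "frame F {} s s2"
        using cs r y s True f by (auto simp: s2_def x_def F_def)
      have xK: "x \<in> K" using True by simp
      have xv: "{x, v} \<in> E" using xN by (simp add: nbrs_def)
      have "set (drop k (adj v)) \<inter> K = insert x (set (drop (Suc k) (adj v)) \<inter> K)" using dk True by auto
      then have ck: "cost k = 9 * (\<Sum>z\<in>CH v x. wt z) + cost (Suc k)" using xd by (simp add: cost_def)
      have tc: "ok test_core s2 (\<lambda>t s'. \<exists>m'. I (Suc k) m' s' \<and> inp s' \<and> regs s' 6 = regs s1 6 \<and> regs s' 7 = regs s1 7 \<and> 2 + t + m' \<le> M + 17)"
      proof (rule ok_mono[OF ok_test_core[OF s2(1-6) v xK xv]], assumption, elim conjE)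
        fix t s' assume A: "core_state s'" "frame {5, 11, 12, 13, 14, 16, 17, 18, 19, 20, 21, 22} {} s2 s'"
          "regs s' 13 = x" "regs s' 14 = v"
          "regs s' 12 = 1 \<and> start_ok x v \<or> regs s' 12 = 0 \<and> (\<not> small v \<longrightarrow> small x \<longrightarrow> \<not> good v x)"
          "t \<le> 9 * (\<Sum>z\<in>CH v x. wt z) + 13"
        have "frame F {} s s'" by (rule frame_trans[OF s2(7) A(2)]) (auto simp: F_def)
        moreover have "\<forall>x \<in> set (take k (adj v)) \<inter> K. tested v x" using I True by (simp add: I_def)
        ultimately have "I (Suc k) (cost (Suc k)) s'" unfolding I_def tk using A v True xv by (auto simp: tested_def)
        moreover have "regs s' 6 = regs s1 6" "regs s' 7 = regs s1 7"
          using frameD(1)[OF A(2), of 6] frameD(1)[OF A(2), of 7] by (auto simp: s2_def)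
        moreover have "2 + t + cost (Suc k) \<le> M + 17" using A(6) ck M by simp
        ultimately show "\<exists>m'. I (Suc k) m' s' \<and> inp s' \<and> regs s' 6 = regs s1 6 \<and> regs s' 7 = regs s1 7 \<and> 2 + t + m' \<le> M + 17"
          using core_state_inp[OF A(1)] by blast
      qed
      show ?thesis unfolding test_body_def using tc True mk y i by (simp add: inp_regs s2_def x_def[symmetric])
    next
      case False
      have "I (Suc k) (cost (Suc k)) (set_reg 11 (arrs s1 4 x) s1)"
        using I False cs f unfolding I_def tk by (auto simp: F_def)
      then have "\<exists>m'. I (Suc k) m' (set_reg 11 (arrs s1 4 x) s1) \<and> 3 + m' \<le> M + 17" using le M by (intro exI[of _ "cost (Suc k)"]) simp
      then show ?thesis using False mk y i unfolding test_body_def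
        by (auto simp: inp_regs x_def[symmetric] split: if_splits)
    qed
  next
    fix t m s' assume "I (length (adj v)) m s'" "t + m \<le> cost 0 + 5 + length (adj v) * (17 + 3)"
    then show "I (length (adj v)) 0 s' \<and> t \<le> cost 0 + 5 + length (adj v) * (17 + 3)" by (simp add: I_def cost_def)
  qed (use s vn in \<open>auto simp: core_state_inp\<close>)
  then show ?thesis
  proof (rule ok_mono, elim conjE)
    fix t s' assume I: "I (length (adj v)) 0 s'" and t: "t \<le> cost 0 + 5 + length (adj v) * (17 + 3)"
    have "nbrs E v \<inter> K \<noteq> {}" using deg[OF v] by auto
    then show "core_state s' \<and> frame ({5..22} - {9, 10, 15}) {} s s' \<and>
    (regs s' 12 = 1 \<and> start_ok (regs s' 13) (regs s' 14) \<or>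
     regs s' 12 = 0 \<and> regs s' 13 \<in> K \<and> regs s' 14 \<in> K \<and> {regs s' 13, regs s' 14} \<in> E \<and> (\<forall>x \<in> nbrs E v \<inter> K. tested v x)) \<and>
    t \<le> 9 * (\<Sum>x\<in>nbrs E v \<inter> K. \<Sum>z\<in>CH v x. wt z) + 5 + length (adj v) * 20"
      using I t set_adj[OF vn] unfolding I_def F_def by (auto simp: cost_def)
  qed
qed

lemma ok_find_loop:
  assumes s: "core_state s" "regs s 4 = 0" "regs s 12 = 0" "\<And>u. u < n \<Longrightarrow> arrs s 6 u = 0"
  shows "ok find_loop s (\<lambda>t s'. core_state s' \<and> frame ({4..22} - {9, 10}) {6} s s' \<and>
    start_ok (regs s' 13) (regs s' 14) \<and> t \<le> 60 * (\<Sum>v<n. wt v) + 1)"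
proof -
  define F where "F = {4..22} - {9, 10::nat}"
  \<comment> \<open>The share of \<open>u\<close>: its two scans, and the chains that start at it.
    As a vertex is on at most two chains, the shares add up to at most \<open>40 + 9 * 2\<close> per
    unit of weight, which is below \<open>60\<close>.\<close>
  define g where "g u = 40 * wt u + (if u \<in> K then 9 * (\<Sum>x\<in>nbrs E u \<inter> K. \<Sum>z\<in>CH u x. wt z) else 0)" for u
  define I where "I M s' \<longleftrightarrow> (\<exists>v\<le>n. regs s' 4 = v \<and> core_state s' \<and> frame F {6} s s' \<and> (\<forall>u<n. arrs s' 6 u \<le> v) \<and>
    (regs s' 12 = 1 \<and> start_ok (regs s' 13) (regs s' 14) \<or> regs s' 12 = 0 \<and>
      (\<forall>w\<in>K. w < v \<longrightarrow> (\<forall>x\<in>nbrs E w \<inter> K. tested w x)) \<and>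
      ((\<exists>w\<in>K. w < v) \<longrightarrow> regs s' 13 \<in> K \<and> regs s' 14 \<in> K \<and> {regs s' 13, regs s' 14} \<in> E)) \<and>
    M = (\<Sum>u\<in>{v..<n}. g u))" for M s'
  have total: "(\<Sum>u<n. g u) \<le> 60 * (\<Sum>v<n. wt v)"
  proof -
    have "(\<Sum>u<n. g u) = 40 * (\<Sum>v<n. wt v) + (\<Sum>u<n. if u \<in> K then 9 * (\<Sum>x\<in>nbrs E u \<inter> K. \<Sum>z\<in>CH u x. wt z) else 0)"
      by (simp add: g_def sum.distrib sum_distrib_left)
    also have "(\<Sum>u<n. if u \<in> K then 9 * (\<Sum>x\<in>nbrs E u \<inter> K. \<Sum>z\<in>CH u x. wt z) else 0) =
      (\<Sum>u\<in>K. 9 * (\<Sum>x\<in>nbrs E u \<inter> K. \<Sum>z\<in>CH u x. wt z))"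
    proof -
      have "{..<n} \<inter> K = K" using K_less by auto
      then show ?thesis using sum.inter_restrict[of "{..<n}" "\<lambda>u. 9 * (\<Sum>x\<in>nbrs E u \<inter> K. \<Sum>z\<in>CH u x. wt z)" K] by simp
    qed
    also have "\<dots> \<le> 9 * (2 * (\<Sum>z\<in>K. wt z))" using chase_cost[of wt] by (simp add: sum_distrib_left[symmetric])
    also have "(\<Sum>z\<in>K. wt z) \<le> (\<Sum>v<n. wt v)" using K_less by (intro sum_mono2) auto
    finally show ?thesis by simp
  qed
  have "ok find_loop s (\<lambda>t s'. (\<exists>M. I M s') \<and> \<not> holds (Conj (Less 4 0) (Equal 12 1)) s' \<and> t \<le> (\<Sum>u<n. g u) + 1)"
    unfolding find_loop_def
  proof (rule ok_While[where I = I])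
    show "I (\<Sum>u<n. g u) s" unfolding I_def using s by (intro exI[of _ 0]) (auto simp: lessThan_atLeast0)
  next
    fix M s1 assume "I M s1" and h: "holds (Conj (Less 4 0) (Equal 12 1)) s1"
    then obtain v where J: "regs s1 4 = v" "core_state s1" "frame F {6} s s1" "\<forall>u<n. arrs s1 6 u \<le> v" "M = (\<Sum>u\<in>{v..<n}. g u)"
      "regs s1 12 = 1 \<and> start_ok (regs s1 13) (regs s1 14) \<or> regs s1 12 = 0 \<and>
      (\<forall>w\<in>K. w < v \<longrightarrow> (\<forall>x\<in>nbrs E w \<inter> K. tested w x)) \<and>
      ((\<exists>w\<in>K. w < v) \<longrightarrow> regs s1 13 \<in> K \<and> regs s1 14 \<in> K \<and> {regs s1 13, regs s1 14} \<in> E)"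
      unfolding I_def by blast
    have i: "inp s1" using core_state_inp[OF J(2)] .
    have v: "v < n" "regs s1 12 = 0" using h J(1) i by (auto simp: inp_regs)
    have old: "\<forall>w\<in>K. w < v \<longrightarrow> (\<forall>x\<in>nbrs E w \<inter> K. tested w x)"
      "(\<exists>w\<in>K. w < v) \<longrightarrow> regs s1 13 \<in> K \<and> regs s1 14 \<in> K \<and> {regs s1 13, regs s1 14} \<in> E" using J(6) v(2) by auto
    have M: "M = g v + (\<Sum>u\<in>{Suc v..<n}. g u)" using J(5) v(1) by (simp add: sum.atLeast_Suc_lessThan)
    have mk: "arrs s1 4 v = (if v \<in> K then 0 else 1)" using J(2) v(1) by (rule core_state_mark)
    show "ok (Seq (Load 11 4 4) (Seq (If (Equal 11 1) find_vertex Skip) (Inc 4))) s1 (\<lambda>t s'. \<exists>m'. I m' s' \<and> 1 + t + m' \<le> M)"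
    proof (cases "v \<in> K")
      case False
      let ?s = "set_reg 4 (Suc v) (set_reg 11 1 s1)"
      have "I (\<Sum>u\<in>{Suc v..<n}. g u) ?s"
        unfolding I_def using J v old False by (intro exI[of _ "Suc v"]) (auto simp: F_def less_Suc_eq le_Suc_eq)
      moreover have "5 + (\<Sum>u\<in>{Suc v..<n}. g u) \<le> M" using M by (simp add: g_def wt_def)
      ultimately have "\<exists>m'. I m' ?s \<and> 5 + m' \<le> M" by blast
      then show ?thesis using False mk J(1) i by (auto simp: inp_regs)
    next
      case True
      define s2 where "s2 = set_reg 15 (Suc v) (set_reg 15 v (set_reg 11 0 s1))"
      have s2: "core_state s2" "regs s2 4 = v" "regs s2 15 = Suc v" "frame F {6} s s2" "\<And>u. u < n \<Longrightarrow> arrs s2 6 u \<le> v"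
        using J by (auto simp: s2_def F_def)
      have "ok (Seq (scan 4 6 7 8 (Store 6 8 15)) (scan 4 6 7 8 test_body)) s2
        (\<lambda>t s'. \<exists>m'. I m' (set_reg 4 (Suc v) s') \<and> regs s' 4 = v \<and> 6 + t + m' \<le> M)"
      proof (subst ok_Seq, rule ok_mono[OF ok_stamp[OF s2(1-3) v(1) s2(5)]], assumption, elim conjE)
        fix t s3 assume A: "core_state s3" "frame {6, 7, 8} {6} s2 s3"
          "\<forall>u<n. arrs s3 6 u \<le> Suc v \<and> (arrs s3 6 u = Suc v \<longleftrightarrow> u \<in> nbrs E v)" "t \<le> 5 + length (adj v) * 4"
        have f3: "frame F {6} s s3" by (rule frame_trans[OF s2(4) A(2)]) (auto simp: F_def)
        have r3: "regs s3 4 = v" "regs s3 12 = 0" "regs s3 15 = Suc v"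
          using frameD(1)[OF A(2), of 4] frameD(1)[OF A(2), of 12] frameD(1)[OF A(2), of 15] s2 v(2) by (auto simp: s2_def)
        show "ok (scan 4 6 7 8 test_body) s3 (\<lambda>t' s'. \<exists>m'. I m' (set_reg 4 (Suc v) s') \<and> regs s' 4 = v \<and> 6 + (t + t') + m' \<le> M)"
        proof (rule ok_mono[OF ok_test_scan[OF A(1) r3 _ True]], use A(3) in blast, elim conjE)
          fix t' s4 assume B: "core_state s4" "frame ({5..22} - {9, 10, 15}) {} s3 s4"
            "regs s4 12 = 1 \<and> start_ok (regs s4 13) (regs s4 14) \<or>
             regs s4 12 = 0 \<and> regs s4 13 \<in> K \<and> regs s4 14 \<in> K \<and> {regs s4 13, regs s4 14} \<in> E \<and> (\<forall>x \<in> nbrs E v \<inter> K. tested v x)"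
            "t' \<le> 9 * (\<Sum>x\<in>nbrs E v \<inter> K. \<Sum>z\<in>CH v x. wt z) + 5 + length (adj v) * 20"
          have f4: "frame F {6} s s4" by (rule frame_trans[OF f3 B(2)]) (auto simp: F_def)
          have a6: "arrs s4 6 = arrs s3 6" using frameD(2)[OF B(2), of 6] by simp
          have "I (\<Sum>u\<in>{Suc v..<n}. g u) (set_reg 4 (Suc v) s4)"
            unfolding I_def using B(1,3) f4 a6 A(3) v(1) old(1)
            by (intro exI[of _ "Suc v"]) (auto simp: F_def less_Suc_eq)
          moreover have "regs s4 4 = v" using frameD(1)[OF B(2), of 4] r3 by simp
          moreover have "6 + (t + t') + (\<Sum>u\<in>{Suc v..<n}. g u) \<le> M"
            using M A(4) B(4) True by (simp add: g_def wt_def[of v])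
          ultimately show "\<exists>m'. I m' (set_reg 4 (Suc v) s4) \<and> regs s4 4 = v \<and> 6 + (t + t') + m' \<le> M" by blast
        qed
      qed
      then have fin: "ok (Seq (scan 4 6 7 8 (Store 6 8 15)) (scan 4 6 7 8 test_body)) s2
        (\<lambda>t s'. \<exists>m'. I m' (set_reg 4 (Suc (regs s' 4)) s') \<and> 6 + t + m' \<le> M)" by (rule ok_mono) auto
      have "ok find_vertex (set_reg 11 0 s1) (\<lambda>t s'. \<exists>m'. I m' (set_reg 4 (Suc (regs s' 4)) s') \<and> 4 + t + m' \<le> M)"
        unfolding find_vertex_def using fin J(1) by (simp add: s2_def del: ok_Seq) (simp add: s2_def)
      then have "ok find_vertex (set_reg 11 0 s1)
        (\<lambda>t s'. \<exists>m'. I m' (set_reg 4 (Suc (regs s' 4)) s') \<and> Suc (Suc (Suc (Suc (t + m')))) \<le> M)" by (rule ok_mono) auto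
      then show ?thesis using True mk J(1) i by (simp add: inp_regs)
    qed
  next
    fix M s1 t assume "I M s1" "\<not> holds (Conj (Less 4 0) (Equal 12 1)) s1" "t + M \<le> (\<Sum>u<n. g u) + 1"
    then show "(\<exists>M. I M s1) \<and> \<not> holds (Conj (Less 4 0) (Equal 12 1)) s1 \<and> t \<le> (\<Sum>u<n. g u) + 1" by auto
  qed
  then show ?thesis
  proof (rule ok_mono, elim conjE exE)
    fix t s1 M assume "I M s1" and h: "\<not> holds (Conj (Less 4 0) (Equal 12 1)) s1" and t: "t \<le> (\<Sum>u<n. g u) + 1"
    then obtain v where J: "v \<le> n" "regs s1 4 = v" "core_state s1" "frame F {6} s s1"
      "regs s1 12 = 1 \<and> start_ok (regs s1 13) (regs s1 14) \<or> regs s1 12 = 0 \<and>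
      (\<forall>w\<in>K. w < v \<longrightarrow> (\<forall>x\<in>nbrs E w \<inter> K. tested w x)) \<and>
      ((\<exists>w\<in>K. w < v) \<longrightarrow> regs s1 13 \<in> K \<and> regs s1 14 \<in> K \<and> {regs s1 13, regs s1 14} \<in> E)"
      unfolding I_def by blast
    have i: "inp s1" using core_state_inp[OF J(3)] .
    have "start_ok (regs s1 13) (regs s1 14)"
    proof (cases "regs s1 12 = 1")
      case True then show ?thesis using J(5) by simp
    next
      case False
      then have r0: "regs s1 12 = 0" using J(5) by auto
      then have "v = n" using h J(1,2) i by (auto simp: inp_regs)
      then have "\<forall>w\<in>K. \<forall>x\<in>nbrs E w \<inter> K. tested w x" "regs s1 13 \<in> K" "regs s1 14 \<in> K" "{regs s1 13, regs s1 14} \<in> E"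
        using J(5) r0 K(1) K_less by auto
      then show ?thesis using chordless_start by (auto simp: tested_def)
    qed
    then show "core_state s1 \<and> frame ({4..22} - {9, 10}) {6} s s1 \<and> start_ok (regs s1 13) (regs s1 14) \<and> t \<le> 60 * (\<Sum>v<n. wt v) + 1"
      using J t total by (simp add: F_def)
  qed
qed

end

section \<open>Extending a strip and its coloring by one vertex\<close>

lemma strip_extend:
  assumes s: "strip u v x p q tw k" and z: "z \<notin> {u, v} \<union> x ` {..<k}"
    and a: "a = (if b then front_new v q k else front_new u x k)"
    and c: "c = (if b then front_new u x k else front_new v q k)"
  shows "strip u v (x(k := z)) (p(k := a)) (q(k := c)) (tw(k := b)) (Suc k)"
proof -
  have f: "front_new u (x(k := z)) j = front_new u x j" "front_new v (q(k := c)) j = front_new v q j" if "j \<le> k" for j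
    using that by (auto simp: front_new_def split: nat.split)
  have i: "(x(k := z)) ` {..<j} = x ` {..<j}" if "j \<le> k" for j using that by (auto simp: image_iff)
  show ?thesis using assms f i unfolding strip_def by (auto simp: less_Suc_eq)
qed

text \<open>The edges of the core need not fill the strip, but none of them may be missing from
  it.\<close>

definition attached :: "'a set set \<Rightarrow> 'a \<Rightarrow> 'a \<Rightarrow> (nat \<Rightarrow> 'a) \<Rightarrow> (nat \<Rightarrow> 'a) \<Rightarrow> (nat \<Rightarrow> 'a) \<Rightarrow> nat \<Rightarrow> bool" where
  "attached E u v x p q m \<longleftrightarrow> (\<forall>k<m. nbrs E (x k) \<inter> ({u, v} \<union> x ` {..<k}) \<subseteq> {p k, q k})"

lemma attached_extend:
  assumes "attached E u v x p q k" "nbrs E z \<inter> ({u, v} \<union> x ` {..<k}) \<subseteq> {a, c}"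
  shows "attached E u v (x(k := z)) (p(k := a)) (q(k := c)) (Suc k)"
proof -
  have i: "(x(k := z)) ` {..<j} = x ` {..<j}" if "j \<le> k" for j using that by (auto simp: image_iff)
  show ?thesis using assms i unfolding attached_def by (auto simp: less_Suc_eq)
qed

text \<open>The vertex \<open>x j\<close> is new, so it differs from all vertices in the earlier
  color conditions, and these survive its coloring. The strip is complete by then, since the
  condition for \<open>x j\<close> refers to later flags.\<close>

lemma strip_color_extend:
  assumes s: "strip u v x p q tw m" and c: "strip_color u v x p q tw j c" and j: "j < m"
  shows "strip_color u v x p q tw (Suc j) (c(x j := 1 - c (if \<not> tw j \<and> tw (Suc j) \<and> \<not> tw (Suc (Suc j)) then q j else p j)))"
proof -
  let ?V = "\<lambda>k. {u, v} \<union> x ` {..<k}"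
  have z: "x j \<notin> ?V j" using s j by (simp add: strip_def)
  have pq: "p k \<in> ?V k \<and> q k \<in> ?V k" if k: "k < m" for k
  proof -
    have "p k = front_new u x k \<or> p k = front_new v q k" "q k = front_new u x k \<or> q k = front_new v q k"
      using s k by (auto simp: strip_def)
    then show ?thesis using strip_vertices[OF s k] by metis
  qed
  have ne: "w \<noteq> x j" if "w \<in> ?V k" "k \<le> j" for w k
  proof -
    have "?V k \<subseteq> ?V j" using that(2) by auto
    then show ?thesis using z that(1) by blast
  qed
  have "x k \<noteq> x j" if "k < j" for k
  proof
    assume "x k = x j"
    then have "x j \<in> x ` {..<j}" using that by (metis imageI lessThan_iff)
    then show False using z by blast
  qed
  moreover have "p k \<noteq> x j" "q k \<noteq> x j" if "k \<le> j" for k using ne[of _ k] pq[of k] that j by auto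
  moreover have "u \<noteq> x j" "v \<noteq> x j" using z by auto
  ultimately show ?thesis using c by (auto simp: strip_color_def less_Suc_eq)
qed

section \<open>Coloring the peeled vertices\<close>

definition flip :: prog where
  "flip = If (Equal 5 1) (Copy 5 2) (Copy 5 1)"

definition tree_scan :: prog where
  "tree_scan = Seq (Load 11 11 8) (If (Equal 11 2) (Seq (Load 5 2 8) flip) Skip)"

definition tree_body :: prog where
  "tree_body = Seq (Dec 9) (Seq (Load 4 5 9) (Seq (Const 5 0) (Seq (scan 4 6 7 8 tree_scan) (Seq (Store 2 4 5) (Store 11 4 2)))))"

context ram
begin

lemma ok_flip: "inp s \<Longrightarrow> ok flip s Q = Q 2 (set_reg 5 (1 - regs s 5) s)"
  by (cases "regs s 5") (auto simp: flip_def inp_regs numeral_2_eq_2[symmetric])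

text \<open>Read backwards, the queue presents each vertex at a time when at most one of its
  neighbors is colored, the colored vertices being those outside \<open>take h qs\<close>. The scan
  leaves in register \<open>5\<close> the color that this neighbor does not have, or
  \<open>0\<close> if there is no such neighbor.\<close>

lemma ok_tree_loop:
  assumes s: "inp s" "regs s 9 = length qs" "\<forall>i<length qs. arrs s 5 i = qs ! i"
    and qs: "distinct qs" "set qs \<subseteq> {..<n}" "\<And>i. i < length qs \<Longrightarrow> card (nbrs E (qs ! i) - set (take i qs)) \<le> 1"
    and c: "\<forall>v<n. arrs s 11 v = (if v \<in> set qs then 0 else 1)" "\<forall>v<n. v \<notin> set qs \<longrightarrow> arrs s 2 v < 2"
  shows "ok (While (Less 1 9) tree_body) s (\<lambda>t s'. (\<forall>v<n. arrs s' 2 v < 2) \<and> (\<forall>v<n. v \<notin> set qs \<longrightarrow> arrs s' 2 v = arrs s 2 v) \<and>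
    (\<forall>i<length qs. \<forall>y \<in> nbrs E (qs ! i) - set (take i qs). arrs s' 2 y \<noteq> arrs s' 2 (qs ! i)) \<and> t \<le> 20 * (\<Sum>v<n. wt v) + 1)"
proof -
  define I where "I M s' \<longleftrightarrow> (\<exists>h\<le>length qs. regs s' 9 = h \<and> inp s' \<and> arrs s' 5 = arrs s 5 \<and>
    (\<forall>v<n. arrs s' 11 v = (if v \<in> set (take h qs) then 0 else 1)) \<and> (\<forall>v<n. v \<notin> set (take h qs) \<longrightarrow> arrs s' 2 v < 2) \<and>
    (\<forall>v<n. v \<notin> set qs \<longrightarrow> arrs s' 2 v = arrs s 2 v) \<and>
    (\<forall>i. h \<le> i \<and> i < length qs \<longrightarrow> (\<forall>y \<in> nbrs E (qs ! i) - set (take i qs). arrs s' 2 y \<noteq> arrs s' 2 (qs ! i))) \<and>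
    M = (\<Sum>v\<in>set (take h qs). 20 * wt v))" for M s'
  have total: "(\<Sum>v\<in>set qs. 20 * wt v) \<le> 20 * (\<Sum>v<n. wt v)"
    unfolding sum_distrib_left by (intro sum_mono2 qs) auto
  show ?thesis
  proof (rule ok_While[where I = I])
    show "I (\<Sum>v\<in>set qs. 20 * wt v) s" unfolding I_def using s c by (intro exI[of _ "length qs"]) auto
  next
    fix M s1 assume "I M s1" and h: "holds (Less 1 9) s1"
    then obtain h where J: "h \<le> length qs" "regs s1 9 = h" "inp s1" "arrs s1 5 = arrs s 5"
      "\<forall>v<n. arrs s1 11 v = (if v \<in> set (take h qs) then 0 else 1)" "\<forall>v<n. v \<notin> set (take h qs) \<longrightarrow> arrs s1 2 v < 2"
      "\<forall>v<n. v \<notin> set qs \<longrightarrow> arrs s1 2 v = arrs s 2 v"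
      "\<forall>i. h \<le> i \<and> i < length qs \<longrightarrow> (\<forall>y \<in> nbrs E (qs ! i) - set (take i qs). arrs s1 2 y \<noteq> arrs s1 2 (qs ! i))"
      "M = (\<Sum>v\<in>set (take h qs). 20 * wt v)" unfolding I_def by blast
    define g where "g = h - 1"
    have hg: "h = Suc g" "g < length qs" using h J(1-3) by (auto simp: g_def inp_regs)
    define x where "x = qs ! g"
    have x: "x < n" "x \<in> set qs" "arrs s1 5 g = x" using hg J(4) s(3) qs(2) by (auto simp: x_def subset_iff)
    have tk: "take h qs = take g qs @ [x]" using hg by (simp add: take_Suc_conv_app_nth x_def)
    have xt: "x \<notin> set (take g qs)" using qs(1) hg by (auto simp: x_def in_set_conv_nth nth_eq_iff_index_eq)
    have M: "M = 20 * wt x + (\<Sum>v\<in>set (take g qs). 20 * wt v)" using J(9) tk xt by simp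
    define s2 where "s2 = set_reg 5 0 (set_reg 4 x (set_reg 9 g s1))"
    have s2: "inp s2" "regs s2 4 = x" "regs s2 5 = 0" using J(3) by (auto simp: s2_def)
    have one: "y = y'" if "y \<in> nbrs E x - set (take g qs)" "y' \<in> nbrs E x - set (take g qs)" for y y'
    proof -
      have "finite (nbrs E x)" using set_adj[OF x(1)] by (metis List.finite_set)
      then have "card {y, y'} \<le> card (nbrs E x - set (take g qs))" using that by (intro card_mono) auto
      also have "\<dots> \<le> 1" using qs(3)[OF hg(2)] by (simp add: x_def)
      finally show ?thesis by (cases "y = y'") auto
    qed
    define L where "L k s3 \<longleftrightarrow> frame {5, 6, 7, 8, 11} {} s2 s3 \<and> regs s3 5 < 2 \<and>
      (\<forall>y \<in> set (take k (adj x)). y \<notin> set (take g qs) \<longrightarrow> regs s3 5 = 1 - arrs s1 2 y)" for k s3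
    have "ok (scan 4 6 7 8 tree_scan) s2 (\<lambda>t s3. L (length (adj x)) s3 \<and> inp s3 \<and> t \<le> 5 + length (adj x) * (5 + 3))"
    proof (rule ok_scan_simple[where I = L and tb = 5 and x = x])
      show "L 0 s2" using s2 by (simp add: L_def)
    next
      fix k s3 assume k: "k < length (adj x)" and L: "L k s3" and i: "inp s3" and y: "regs s3 8 = adj x ! k"
      define y' where "y' = adj x ! k"
      have yn: "y' < n" and yN: "y' \<in> nbrs E x"
        using adj_less[OF x(1) nth_mem[OF k]] set_adj[OF x(1)] nth_mem[OF k] by (auto simp: y'_def)
      have yx: "y' \<noteq> x" using adj_irrefl[OF x(1)] nth_mem[OF k] by (auto simp: y'_def)
      have yk: "y' \<notin> set (take k (adj x))"
        using distinct_adj[OF x(1)] k by (auto simp: y'_def in_set_conv_nth nth_eq_iff_index_eq)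
      have f: "frame {5, 6, 7, 8, 11} {} s2 s3" using L by (simp add: L_def)
      have ar: "arrs s3 = arrs s1" using frameD(2)[OF f] by (auto simp: s2_def)
      have tS: "set (take (Suc k) (adj x)) = insert y' (set (take k (adj x)))" using k by (simp add: take_Suc_conv_app_nth y'_def)
      have col: "arrs s1 11 y' = (if y' \<in> set (take g qs) then 0 else 1)" using J(5) yn tk yx by auto
      show "ok tree_scan s3 (\<lambda>t s'. L (Suc k) s' \<and> inp s' \<and> regs s' 6 = regs s3 6 \<and> regs s' 7 = regs s3 7 \<and> t \<le> 5)"
      proof (cases "y' \<in> set (take g qs)")
        case True
        have "L (Suc k) (set_reg 11 0 s3)" using L True unfolding L_def tS by auto
        then show ?thesis unfolding tree_scan_def using True col y i ar by (simp add: inp_regs y'_def[symmetric])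
      next
        case False
        \<comment> \<open>The order of peeling allows a single colored neighbor, so the entries
          scanned before \<open>y'\<close> are all uncolored and impose no condition on register
          \<open>5\<close>.\<close>
        have "set (take k (adj x)) \<subseteq> set (adj x)" by (rule set_take_subset)
        then have none: "w \<in> set (take g qs)" if "w \<in> set (take k (adj x))" for w
          using one[of w y'] that yk yN False set_adj[OF x(1)] by blast
        define s4 where "s4 = set_reg 5 (arrs s1 2 y') (set_reg 11 1 s3)"
        have "L (Suc k) (set_reg 5 (1 - regs s4 5) s4)" using L none unfolding L_def tS by (auto simp: s4_def)
        moreover have "inp s4" using i by (simp add: s4_def)
        ultimately show ?thesis unfolding tree_scan_def using False col y i ar
          by (simp add: inp_regs y'_def[symmetric] s4_def ok_flip)
      qed
    qed (use s2 x in \<open>auto simp: L_def\<close>)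
    then have "ok (scan 4 6 7 8 tree_scan) s2 (\<lambda>t s3. regs s3 4 = x \<and> (\<exists>m'. I m' (set_cell 11 x 1 (set_cell 2 x (regs s3 5) s3)) \<and>
      inp s3 \<and> 6 + t + m' \<le> M))"
    proof (rule ok_mono, elim conjE)
      fix t s3 assume L: "L (length (adj x)) s3" and i: "inp s3" and t: "t \<le> 5 + length (adj x) * (5 + 3)"
      have f: "frame {5, 6, 7, 8, 11} {} s2 s3" "regs s3 5 < 2" using L by (auto simp: L_def)
      have ar: "arrs s3 = arrs s1" using frameD(2)[OF f(1)] by (auto simp: s2_def)
      have r: "regs s3 4 = x" "regs s3 9 = g" using frameD(1)[OF f(1), of 4] frameD(1)[OF f(1), of 9] by (auto simp: s2_def)
      have diff: "arrs s1 2 y \<noteq> regs s3 5" if y: "y \<in> nbrs E x - set (take g qs)" for y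
      proof -
        have "regs s3 5 = 1 - arrs s1 2 y" using L y set_adj[OF x(1)] by (simp add: L_def)
        then show ?thesis by arith
      qed
      let ?s = "set_cell 11 x 1 (set_cell 2 x (regs s3 5) s3)"
      have adjx: "x \<notin> nbrs E x" using adj_irrefl[OF x(1)] set_adj[OF x(1)] by simp
      have "\<forall>y \<in> nbrs E (qs ! i) - set (take i qs). arrs ?s 2 y \<noteq> arrs ?s 2 (qs ! i)" if "g \<le> i" "i < length qs" for i
      proof (cases "i = g")
        case True
        then show ?thesis using diff adjx x_def by (auto simp: ar)
      next
        case False
        then have hi: "h \<le> i" using that hg by simp
        then have "x \<in> set (take i qs)" using hg that hi by (auto simp: x_def in_set_conv_nth intro!: exI[of _ g])
        moreover have "qs ! i \<noteq> x" using False qs(1) that hg by (simp add: x_def nth_eq_iff_index_eq)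
        ultimately show ?thesis using J(8) hi that by (auto simp: ar)
      qed
      then have "I (\<Sum>v\<in>set (take g qs). 20 * wt v) ?s"
        unfolding I_def using hg r i J(4-7) f(2) x tk xt by (intro exI[of _ g]) (auto simp: ar)
      moreover have "6 + t + (\<Sum>v\<in>set (take g qs). 20 * wt v) \<le> M" using M t by (simp add: wt_def[of x])
      ultimately show "regs s3 4 = x \<and> (\<exists>m'. I m' ?s \<and> inp s3 \<and> 6 + t + m' \<le> M)" using r i by blast
    qed
    then have "ok (scan 4 6 7 8 tree_scan) s2 (\<lambda>t s3. ok (Seq (Store 2 4 5) (Store 11 4 2)) s3 (\<lambda>t' s'. \<exists>m'. I m' s' \<and> 4 + t + t' + m' \<le> M))"
      by (rule ok_mono) (auto simp: inp_regs)
    then have "ok (scan 4 6 7 8 tree_scan) s2 (\<lambda>t s3. ok (Seq (Store 2 4 5) (Store 11 4 2)) s3 (\<lambda>t' s'. \<exists>m'. I m' s' \<and> 1 + (1 + (1 + (1 + (t + t')))) + m' \<le> M))"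
      by (rule ok_mono) (rule ok_mono, assumption, auto)
    then show "ok tree_body s1 (\<lambda>t s'. \<exists>m'. I m' s' \<and> 1 + t + m' \<le> M)"
      unfolding tree_body_def using J(2) x(3) hg by (simp add: s2_def del: ok_Seq) (simp add: s2_def)
  next
    fix M s1 t assume "I M s1" and h: "\<not> holds (Less 1 9) s1" and t: "t + M \<le> (\<Sum>v\<in>set qs. 20 * wt v) + 1"
    then obtain h where J: "regs s1 9 = h" "inp s1" "\<forall>v<n. v \<notin> set (take h qs) \<longrightarrow> arrs s1 2 v < 2"
      "\<forall>v<n. v \<notin> set qs \<longrightarrow> arrs s1 2 v = arrs s 2 v"
      "\<forall>i. h \<le> i \<and> i < length qs \<longrightarrow> (\<forall>y \<in> nbrs E (qs ! i) - set (take i qs). arrs s1 2 y \<noteq> arrs s1 2 (qs ! i))"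
      unfolding I_def by blast
    then have "h = 0" using h by (simp add: inp_regs)
    then show "(\<forall>v<n. arrs s1 2 v < 2) \<and> (\<forall>v<n. v \<notin> set qs \<longrightarrow> arrs s1 2 v = arrs s 2 v) \<and>
    (\<forall>i<length qs. \<forall>y \<in> nbrs E (qs ! i) - set (take i qs). arrs s1 2 y \<noteq> arrs s1 2 (qs ! i)) \<and> t \<le> 20 * (\<Sum>v<n. wt v) + 1"
      using J t total by simp
  qed
qed

end

section \<open>Programs for the sweep and for the coloring of the strip\<close>

definition visit :: "nat \<Rightarrow> prog" where
  "visit z = Seq (Store 4 z 2) (scan z 6 7 8 (Seq (Load 5 3 8) (Seq (Dec 5) (Store 3 8 5))))"

definition find_next :: prog where
  "find_next = scan 13 6 7 8 (Seq (Load 11 4 8) (If (Equal 11 1) (Copy 22 8) Skip))"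

text \<open>Register \<open>16\<close> counts the unvisited neighbors of the newest vertex. If there
  are several, the front is exchanged, so that register \<open>13\<close> always holds the vertex to
  be replaced.\<close>

definition turn :: prog where
  "turn = If (Equal 16 2) (Store 10 23 1) (Seq (Copy 24 13) (Seq (Copy 13 14) (Seq (Copy 14 24) (Store 10 23 2))))"

definition sweep_body :: prog where
  "sweep_body = Seq turn (Seq find_next (Seq (Store 7 23 22) (Seq (Store 8 23 13) (Seq (Store 9 23 14)
     (Seq (Inc 23) (Seq (Copy 13 22) (Seq (visit 13) (Load 16 3 13))))))))"

definition sweep_prog :: prog where
  "sweep_prog = Seq (Copy 25 13) (Seq (Copy 26 14) (Seq (visit 13) (Seq (visit 14)
     (Seq (Load 16 3 13) (While (Less 1 16) sweep_body)))))"

text \<open>The flags of the next two triangles are consulted, which is why this is a pass of its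
  own. At the end they are read beyond the strip, which \<open>strip_local_star\<close>
  allows.\<close>

definition color_body :: prog where
  "color_body = Seq (Load 28 10 27) (Seq (Copy 29 27) (Seq (Inc 29) (Seq (Load 30 10 29) (Seq (Inc 29) (Seq (Load 31 10 29)
     (Seq (If (Conj (Neg (Equal 28 2)) (Conj (Equal 30 2) (Neg (Equal 31 2)))) (Load 5 9 27) (Load 5 8 27))
     (Seq (Load 5 2 5) (Seq flip (Seq (Load 8 7 27) (Seq (Store 2 8 5) (Seq (Store 11 8 2) (Inc 27))))))))))))"

definition color_prog :: prog where
  "color_prog = Seq (Store 2 25 1) (Seq (Store 2 26 2) (Seq (Store 11 25 2) (Seq (Store 11 26 2) (While (Less 27 23) color_body))))"

context ram_core
begin

text \<open>Arrays \<open>3\<close> and \<open>4\<close> of the peeling phase are used again; they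
  now refer to the unvisited set \<open>U\<close>, which is \<open>K\<close> at the start.\<close>

definition sweep_state :: "nat set \<Rightarrow> state \<Rightarrow> bool" where
  "sweep_state U s \<longleftrightarrow> inp s \<and> (\<forall>v<n. arrs s 4 v = (if v \<in> U then 0 else 1)) \<and> (\<forall>v<n. arrs s 3 v = card (nbrs E v \<inter> U))"

lemma sweep_state_set [simp]:
  "3 < r \<Longrightarrow> sweep_state U (set_reg r k s) = sweep_state U s"
  "4 < a \<Longrightarrow> sweep_state U (set_cell a i k s) = sweep_state U s"
  by (auto simp: sweep_state_def)

lemma sweep_stateD: "sweep_state U s \<Longrightarrow> inp s"
  "sweep_state U s \<Longrightarrow> v < n \<Longrightarrow> arrs s 4 v = (if v \<in> U then 0 else 1)"
  "sweep_state U s \<Longrightarrow> v < n \<Longrightarrow> arrs s 3 v = card (nbrs E v \<inter> U)"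
  by (auto simp: sweep_state_def)

lemma ok_visit:
  assumes s: "sweep_state U s" "regs s z = x" "x \<in> U" "x < n" "8 < z"
  shows "ok (visit z) s (\<lambda>t s'. sweep_state (U - {x}) s' \<and> frame {5, 6, 7, 8} {3, 4} s s' \<and> t \<le> 6 + length (adj x) * 6)"
proof -
  define s1 where "s1 = set_cell 4 x 1 s"
  define L where "L k s' \<longleftrightarrow> inp s' \<and> frame {5, 6, 7, 8} {3, 4} s s' \<and> (\<forall>v<n. arrs s' 4 v = (if v \<in> U - {x} then 0 else 1)) \<and>
    (\<forall>v<n. arrs s' 3 v = card (nbrs E v \<inter> U) - (if v \<in> set (take k (adj x)) then 1 else 0))" for k s'
  have "ok (scan z 6 7 8 (Seq (Load 5 3 8) (Seq (Dec 5) (Store 3 8 5)))) s1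
    (\<lambda>t s'. L (length (adj x)) s' \<and> t \<le> 5 + length (adj x) * (3 + 3))"
  proof (rule ok_scan_simple[where I = L and tb = 3 and x = x])
    show "L 0 s1" using s by (auto simp: L_def s1_def sweep_state_def)
  next
    fix k s2 assume k: "k < length (adj x)" and L: "L k s2" and i: "inp s2" and y: "regs s2 8 = adj x ! k"
    define y' where "y' = adj x ! k"
    have yn: "y' < n" using adj_less[OF s(4) nth_mem[OF k]] by (simp add: y'_def)
    have yk: "y' \<notin> set (take k (adj x))"
      using distinct_adj[OF s(4)] k by (auto simp: y'_def in_set_conv_nth nth_eq_iff_index_eq)
    have tS: "set (take (Suc k) (adj x)) = insert y' (set (take k (adj x)))" using k by (simp add: take_Suc_conv_app_nth y'_def)
    have "arrs s2 3 y' = card (nbrs E y' \<inter> U)" using L yn yk by (simp add: L_def)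
    then have "L (Suc k) (set_cell 3 y' (card (nbrs E y' \<inter> U) - 1) (set_reg 5 (card (nbrs E y' \<inter> U) - 1) (set_reg 5 (card (nbrs E y' \<inter> U)) s2)))"
      using L unfolding L_def tS by auto
    then show "ok (Seq (Load 5 3 8) (Seq (Dec 5) (Store 3 8 5))) s2 (\<lambda>t s'. L (Suc k) s' \<and> inp s' \<and>
      regs s' 6 = regs s2 6 \<and> regs s' 7 = regs s2 7 \<and> t \<le> 3)"
      using y i \<open>arrs s2 3 y' = card (nbrs E y' \<inter> U)\<close> by (simp add: y'_def[symmetric])
  qed (use s in \<open>auto simp: L_def s1_def sweep_state_def\<close>)
  then have "ok (scan z 6 7 8 (Seq (Load 5 3 8) (Seq (Dec 5) (Store 3 8 5)))) s1
    (\<lambda>t s'. sweep_state (U - {x}) s' \<and> frame {5, 6, 7, 8} {3, 4} s s' \<and> 1 + t \<le> 6 + length (adj x) * 6)"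
  proof (rule ok_mono, elim conjE)
    fix t s' assume L: "L (length (adj x)) s'" and t: "t \<le> 5 + length (adj x) * (3 + 3)"
    have "card (nbrs E v \<inter> U) - (if v \<in> set (adj x) then 1 else 0) = card (nbrs E v \<inter> (U - {x}))" if v: "v < n" for v
    proof -
      have "nbrs E v \<inter> (U - {x}) = (nbrs E v \<inter> U) - {x}" by auto
      moreover have "v \<in> set (adj x) \<longleftrightarrow> x \<in> nbrs E v" using adj_sym[OF s(4) v] set_adj[OF v] by simp
      ultimately show ?thesis using fin_nbrs s(3) by (simp add: card_Diff_singleton_if)
    qed
    then show "sweep_state (U - {x}) s' \<and> frame {5, 6, 7, 8} {3, 4} s s' \<and> 1 + t \<le> 6 + length (adj x) * 6"
      using L t by (auto simp: L_def sweep_state_def)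
  qed
  moreover have "regs s 2 = 1" using s(1) by (simp add: sweep_state_def inp_regs)
  ultimately show ?thesis unfolding visit_def using s(2) by (simp add: s1_def)
qed

lemma ok_find_next:
  assumes s: "sweep_state U s" "regs s 13 = a" "a < n" "nbrs E a \<inter> U = {z}"
  shows "ok find_next s (\<lambda>t s'. sweep_state U s' \<and> frame {6, 7, 8, 11, 22} {} s s' \<and> regs s' 22 = z \<and> t \<le> 5 + length (adj a) * 6)"
proof -
  define L where "L k s' \<longleftrightarrow> sweep_state U s' \<and> frame {6, 7, 8, 11, 22} {} s s' \<and> (z \<in> set (take k (adj a)) \<longrightarrow> regs s' 22 = z)" for k s'
  show ?thesis unfolding find_next_def
  proof (rule ok_scan_simple[where I = L and tb = 3 and x = a])
    show "L 0 s" "inp s" "regs s 13 = a" "a < n" using s(1-3) by (simp_all add: L_def sweep_stateD(1))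
  next
    fix k s2 assume k: "k < length (adj a)" and L: "L k s2" and i: "inp s2" and y: "regs s2 8 = adj a ! k"
    define y' where "y' = adj a ! k"
    have yn: "y' < n" and yN: "y' \<in> nbrs E a"
      using adj_less[OF s(3) nth_mem[OF k]] set_adj[OF s(3)] nth_mem[OF k] by (auto simp: y'_def)
    have tS: "set (take (Suc k) (adj a)) = insert y' (set (take k (adj a)))" using k by (simp add: take_Suc_conv_app_nth y'_def)
    have m: "arrs s2 4 y' = (if y' \<in> U then 0 else 1)" using L yn by (simp add: L_def sweep_stateD)
    show "ok (Seq (Load 11 4 8) (If (Equal 11 1) (Copy 22 8) Skip)) s2 (\<lambda>t s'. L (Suc k) s' \<and> inp s' \<and>
      regs s' 6 = regs s2 6 \<and> regs s' 7 = regs s2 7 \<and> t \<le> 3)"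
    proof (cases "y' \<in> U")
      case True
      then have "y' = z" using yN s(4) by auto
      then have "L (Suc k) (set_reg 22 y' (set_reg 11 0 s2))" using L unfolding L_def tS by auto
      then show ?thesis using True m y i by (simp add: inp_regs y'_def[symmetric])
    next
      case False
      then have "y' \<noteq> z" using s(4) by auto
      then have "L (Suc k) (set_reg 11 1 s2)" using L unfolding L_def tS by auto
      then show ?thesis using False m y i by (simp add: inp_regs y'_def[symmetric])
    qed
  next
    fix t s' assume "L (length (adj a)) s'" "t \<le> 5 + length (adj a) * (3 + 3)"
    moreover have "z \<in> set (adj a)" using s(4) set_adj[OF s(3)] by auto
    ultimately show "sweep_state U s' \<and> frame {6, 7, 8, 11, 22} {} s s' \<and> regs s' 22 = z \<and> t \<le> 5 + length (adj a) * 6"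
      by (simp add: L_def)
  qed (auto simp: L_def)
qed

end

context ram_core
begin

definition swept :: "nat \<Rightarrow> nat \<Rightarrow> nat \<Rightarrow> state \<Rightarrow> bool" where
  "swept u v k s \<longleftrightarrow> strip u v (arrs s 7) (arrs s 8) (arrs s 9) (\<lambda>i. arrs s 10 i = 1) k \<and>
     attached E u v (arrs s 7) (arrs s 8) (arrs s 9) k"

lemma swept_extend:
  assumes s: "swept u v k s" and z: "z \<notin> {u, v} \<union> arrs s 7 ` {..<k}" "nbrs E z \<inter> ({u, v} \<union> arrs s 7 ` {..<k}) \<subseteq> {a, c}"
    and a: "a = (if b then front_new v (arrs s 9) k else front_new u (arrs s 7) k)"
    and c: "c = (if b then front_new u (arrs s 7) k else front_new v (arrs s 9) k)"
    and s': "arrs s' 7 = (arrs s 7)(k := z)" "arrs s' 8 = (arrs s 8)(k := a)" "arrs s' 9 = (arrs s 9)(k := c)"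
      "arrs s' 10 = (arrs s 10)(k := if b then 1 else 0)"
  shows "swept u v (Suc k) s'"
proof -
  have "(\<lambda>i. arrs s' 10 i = 1) = (\<lambda>i. arrs s 10 i = 1)(k := b)" by (auto simp: s' fun_eq_iff)
  then show ?thesis unfolding swept_def s'
    using strip_extend[OF _ z(1) a c] attached_extend[OF _ z(2)] s by (simp add: swept_def)
qed

definition sweep_inv :: "nat list \<Rightarrow> nat \<Rightarrow> nat \<Rightarrow> nat \<Rightarrow> state \<Rightarrow> nat \<Rightarrow> nat set \<Rightarrow> state \<Rightarrow> bool" where
  "sweep_inv C j u v s k U s' \<longleftrightarrow> U \<subseteq> K \<and> regs s' 23 = k \<and> sweep_state U s' \<and> sweep C j (regs s' 13) (regs s' 14) U \<and>
    swept u v k s' \<and> {u, v} \<union> arrs s' 7 ` {..<k} = K - U \<and>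
    regs s' 13 = front_new u (arrs s' 7) k \<and> regs s' 14 = front_new v (arrs s' 9) k \<and> regs s' 13 \<noteq> regs s' 14 \<and>
    regs s' 13 \<in> K - U \<and> regs s' 14 \<in> K - U \<and> regs s' 16 = card (nbrs E (regs s' 13) \<inter> U) \<and>
    regs s' 25 = u \<and> regs s' 26 = v \<and> frame {5, 6, 7, 8, 11, 13, 14, 16, 22, 23, 24, 25, 26} {3, 4, 7, 8, 9, 10} s s'"

text \<open>A round scans two lists: that of \<open>a\<close>, which leaves the front, and that of
  the new vertex \<open>z\<close>. Both are named in the result so that the loop can charge the time
  to them.\<close>

lemma ok_sweep_body:
  assumes I: "sweep_inv C j u v s k U s1" and C: "start C j" and ne: "U \<noteq> {}"
  shows "ok sweep_body s1 (\<lambda>t s'. \<exists>a b z. {a, b} = {regs s1 13, regs s1 14} \<and> z \<in> U \<and> {regs s' 13, regs s' 14} = {z, b} \<and>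
    sweep_inv C j u v s (Suc k) (U - {z}) s' \<and> t \<le> 22 + 6 * (length (adj a) + length (adj z)))"
proof -
  have i: "U \<subseteq> K" "regs s1 23 = k" "sweep_state U s1" "sweep C j (regs s1 13) (regs s1 14) U" "swept u v k s1"
    "{u, v} \<union> arrs s1 7 ` {..<k} = K - U" "regs s1 13 = front_new u (arrs s1 7) k" "regs s1 14 = front_new v (arrs s1 9) k"
    "regs s1 13 \<noteq> regs s1 14" "regs s1 13 \<in> K - U" "regs s1 14 \<in> K - U" "regs s1 16 = card (nbrs E (regs s1 13) \<inter> U)"
    "regs s1 25 = u" "regs s1 26 = v" "frame {5, 6, 7, 8, 11, 13, 14, 16, 22, 23, 24, 25, 26} {3, 4, 7, 8, 9, 10} s s1"
    using I unfolding sweep_inv_def by blast+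
  define F where "F = {5, 6, 7, 8, 11, 13, 14, 16, 22, 23, 24, 25, 26::nat}"
  define A where "A = {3, 4, 7, 8, 9, 10::nat}"
  have f1: "frame F A s s1" using i(15) by (simp add: F_def A_def)
  define fl where "fl \<longleftrightarrow> card (nbrs E (regs s1 13) \<inter> U) \<noteq> 1"
  define a where "a = (if fl then regs s1 14 else regs s1 13)"
  define b where "b = (if fl then regs s1 13 else regs s1 14)"
  have "(a, b) = (if card (nbrs E (regs s1 13) \<inter> U) = 1 then (regs s1 13, regs s1 14) else (regs s1 14, regs s1 13))"
    by (simp add: a_def b_def fl_def)
  from sweep_step(2)[OF C i(4) ne this] obtain z where z: "nbrs E a \<inter> U = {z}" "sweep C j z b (U - {z})"
    "nbrs E z \<inter> (K - U) \<subseteq> {regs s1 13, regs s1 14}" by blast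
  have zU: "z \<in> U" using z(1) by blast
  have ab: "a \<in> K - U" "b \<in> K - U" "a \<noteq> b" "{a, b} = {regs s1 13, regs s1 14}" using i(9-11) by (auto simp: a_def b_def)
  have lt: "a < n" "z < n" using ab zU i(1) K_less by auto
  have tn: "ok turn s1 (\<lambda>t s2. sweep_state U s2 \<and> regs s2 13 = a \<and> regs s2 14 = b \<and> frame F A s1 s2 \<and>
     regs s2 23 = k \<and> regs s2 25 = u \<and> regs s2 26 = v \<and>
     arrs s2 = (arrs s1)(10 := (arrs s1 10)(k := if fl then 1 else 0)) \<and> t \<le> 5)"
    using i(2,3,12-14) by (auto simp: turn_def fl_def a_def b_def F_def A_def inp_regs sweep_stateD(1))
  have tn2: "ok (Seq turn find_next) s1 (\<lambda>t s3. sweep_state U s3 \<and> regs s3 13 = a \<and> regs s3 14 = b \<and> frame F A s s3 \<and>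
     regs s3 22 = z \<and> regs s3 23 = k \<and> regs s3 25 = u \<and> regs s3 26 = v \<and>
     arrs s3 = (arrs s1)(10 := (arrs s1 10)(k := if fl then 1 else 0)) \<and> t \<le> 10 + 6 * length (adj a))"
  proof (subst ok_Seq, rule ok_mono[OF tn], elim conjE)
    fix t :: nat and s2 assume B: "sweep_state U s2" "regs s2 13 = a" "regs s2 14 = b" "frame F A s1 s2"
     "regs s2 23 = k" "regs s2 25 = u" "regs s2 26 = v"
     "arrs s2 = (arrs s1)(10 := (arrs s1 10)(k := if fl then 1 else 0))" "t \<le> 5"
    have f2: "frame F A s s2" by (rule frame_trans[OF f1 B(4)]) auto
    show "ok find_next s2 (\<lambda>t' s3. sweep_state U s3 \<and> regs s3 13 = a \<and> regs s3 14 = b \<and> frame F A s s3 \<and>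
     regs s3 22 = z \<and> regs s3 23 = k \<and> regs s3 25 = u \<and> regs s3 26 = v \<and>
     arrs s3 = (arrs s1)(10 := (arrs s1 10)(k := if fl then 1 else 0)) \<and> t + t' \<le> 10 + 6 * length (adj a))"
    proof (rule ok_mono[OF ok_find_next[OF B(1,2) lt(1) z(1)]], elim conjE)
      fix t' s3 assume D: "sweep_state U s3" "frame {6, 7, 8, 11, 22} {} s2 s3" "regs s3 22 = z" "t' \<le> 5 + length (adj a) * 6"
      have "frame F A s s3" by (rule frame_trans[OF f2 D(2)]) (auto simp: F_def)
      moreover have "arrs s3 = arrs s2" using frameD(2)[OF D(2)] by auto
      ultimately show "sweep_state U s3 \<and> regs s3 13 = a \<and> regs s3 14 = b \<and> frame F A s s3 \<and>
        regs s3 22 = z \<and> regs s3 23 = k \<and> regs s3 25 = u \<and> regs s3 26 = v \<and>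
        arrs s3 = (arrs s1)(10 := (arrs s1 10)(k := if fl then 1 else 0)) \<and> t + t' \<le> 10 + 6 * length (adj a)"
        using B D frameD(1)[OF D(2), of 13] frameD(1)[OF D(2), of 14] frameD(1)[OF D(2), of 23]
          frameD(1)[OF D(2), of 25] frameD(1)[OF D(2), of 26] by simp
    qed
  qed
  define Q where "Q t s' \<longleftrightarrow> (\<exists>a b z. {a, b} = {regs s1 13, regs s1 14} \<and> z \<in> U \<and> {regs s' 13, regs s' 14} = {z, b} \<and>
    sweep_inv C j u v s (Suc k) (U - {z}) s' \<and> t \<le> 22 + 6 * (length (adj a) + length (adj z)))" for t s'
  have "ok (Seq turn find_next) s1 (\<lambda>t s3. ok (Seq (Store 7 23 22) (Seq (Store 8 23 13) (Seq (Store 9 23 14)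
     (Seq (Inc 23) (Seq (Copy 13 22) (Seq (visit 13) (Load 16 3 13))))))) s3 (\<lambda>t'. Q (t + t')))"
  proof (rule ok_mono[OF tn2], elim conjE)
    fix t s3 assume B: "sweep_state U s3" "regs s3 13 = a" "regs s3 14 = b" "frame F A s s3"
     "regs s3 22 = z" "regs s3 23 = k" "regs s3 25 = u" "regs s3 26 = v"
     "arrs s3 = (arrs s1)(10 := (arrs s1 10)(k := if fl then 1 else 0))" "t \<le> 10 + 6 * length (adj a)"
    define s4 where "s4 = set_reg 13 z (set_reg 23 (Suc k) (set_cell 9 k b (set_cell 8 k a (set_cell 7 k z s3))))"
    have s4: "sweep_state U s4" "regs s4 13 = z" "frame F A s s4" using B by (auto simp: s4_def F_def A_def)
    have "ok (visit 13) s4 (\<lambda>t' s5. ok (Load 16 3 13) s5 (\<lambda>t''. Q (t + (5 + (t' + t'')))))"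
    proof (rule ok_mono[OF ok_visit[OF s4(1,2) zU lt(2)]], simp, elim conjE)
      fix t' s5 assume D: "sweep_state (U - {z}) s5" "frame {5, 6, 7, 8} {3, 4} s4 s5" "t' \<le> 6 + length (adj z) * 6"
      have ar: "arrs s5 7 = (arrs s1 7)(k := z)" "arrs s5 8 = (arrs s1 8)(k := a)" "arrs s5 9 = (arrs s1 9)(k := b)"
        "arrs s5 10 = (arrs s1 10)(k := if fl then 1 else 0)"
        using frameD(2)[OF D(2), of 7] frameD(2)[OF D(2), of 8] frameD(2)[OF D(2), of 9] frameD(2)[OF D(2), of 10]
        by (simp_all add: s4_def B(9))
      have r: "regs s5 13 = z" "regs s5 14 = b" "regs s5 23 = Suc k" "regs s5 25 = u" "regs s5 26 = v"
        using frameD(1)[OF D(2), of 13] frameD(1)[OF D(2), of 14] frameD(1)[OF D(2), of 23]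
          frameD(1)[OF D(2), of 25] frameD(1)[OF D(2), of 26] B by (auto simp: s4_def)
      have fr: "frame F A s s5" by (rule frame_trans[OF s4(3) D(2)]) (auto simp: F_def A_def)
      have zn: "z \<notin> {u, v} \<union> arrs s1 7 ` {..<k}" using zU unfolding i(6) by blast
      have zatt: "nbrs E z \<inter> ({u, v} \<union> arrs s1 7 ` {..<k}) \<subseteq> {a, b}" using z(3) ab(4) unfolding i(6) by simp
      have sw: "swept u v (Suc k) s5"
        by (rule swept_extend[OF i(5) zn zatt, where b = fl]) (use ar i(7,8) in \<open>auto simp: a_def b_def\<close>)
      let ?s6 = "set_reg 16 (card (nbrs E z \<inter> (U - {z}))) s5"
      have "((arrs s1 7)(k := z)) ` {..<k} = arrs s1 7 ` {..<k}" by (intro image_cong) auto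
      then have "arrs s5 7 ` {..<Suc k} = insert z (arrs s1 7 ` {..<k})" unfolding ar lessThan_Suc image_insert by (simp only: fun_upd_same)
      then have "{u, v} \<union> arrs s5 7 ` {..<Suc k} = insert z ({u, v} \<union> arrs s1 7 ` {..<k})" by simp
      also have "\<dots> = insert z (K - U)" by (simp only: i(6))
      also have "\<dots> = K - (U - {z})" using zU i(1) by blast
      finally have cov: "{u, v} \<union> arrs s5 7 ` {..<Suc k} = K - (U - {z})" .
      have "sweep_inv C j u v s (Suc k) (U - {z}) ?s6"
        unfolding sweep_inv_def
      proof (intro conjI)
        show "swept u v (Suc k) ?s6" using sw by (simp add: swept_def)
        show "{u, v} \<union> arrs ?s6 7 ` {..<Suc k} = K - (U - {z})" using cov by simp
        show "frame {5, 6, 7, 8, 11, 13, 14, 16, 22, 23, 24, 25, 26} {3, 4, 7, 8, 9, 10} s ?s6"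
          using fr by (simp add: F_def A_def)
        show "regs ?s6 13 = front_new u (arrs ?s6 7) (Suc k)" "regs ?s6 14 = front_new v (arrs ?s6 9) (Suc k)"
          using r ar by (auto simp: front_new_def)
        show "regs ?s6 13 \<noteq> regs ?s6 14" using r zU ab by auto
      qed (use i(1) r D(1) z(2) zU ab in auto)
      moreover have "{regs ?s6 13, regs ?s6 14} = {z, b}" using r by simp
      moreover have "t + (5 + (t' + 1)) \<le> 22 + 6 * (length (adj a) + length (adj z))" using D(3) B(10) by simp
      ultimately have "Q (t + (5 + (t' + 1))) ?s6" unfolding Q_def using ab(4) zU by blast
      moreover have "arrs s5 3 z = card (nbrs E z \<inter> (U - {z}))" using sweep_stateD(3)[OF D(1) lt(2)] .
      ultimately show "ok (Load 16 3 13) s5 (\<lambda>t''. Q (t + (5 + (t' + t''))))" by (simp only: ok_simps r)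
    qed
    then show "ok (Seq (Store 7 23 22) (Seq (Store 8 23 13) (Seq (Store 9 23 14)
     (Seq (Inc 23) (Seq (Copy 13 22) (Seq (visit 13) (Load 16 3 13))))))) s3 (\<lambda>t'. Q (t + t'))"
      using B(2,3,5,6) by (simp add: s4_def numeral_eq_Suc)
  qed
  then have "ok sweep_body s1 Q" unfolding sweep_body_def by (simp add: add.assoc)
  then show ?thesis by (rule ok_mono) (simp add: Q_def)
qed

lemma ok_sweep_prog:
  assumes s: "core_state s" "regs s 13 = u" "regs s 14 = v" "regs s 23 = 0" "start_ok u v"
  shows "ok sweep_prog s (\<lambda>t s'. inp s' \<and> (\<exists>m. regs s' 23 = m \<and> swept u v m s' \<and> {u, v} \<union> arrs s' 7 ` {..<m} = K) \<and>
    regs s' 25 = u \<and> regs s' 26 = v \<and> frame {5, 6, 7, 8, 11, 13, 14, 16, 22, 23, 24, 25, 26} {3, 4, 7, 8, 9, 10} s s' \<and>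
    t \<le> 60 * (\<Sum>v<n. wt v) + 20)"
proof -
  obtain C j where Cj: "start C j" "C ! 0 = u" "C ! (card K - 1) = v"
    using s(5) unfolding start_ok_def start_def by blast
  have LC: "LC C" using Cj(1) start_def by blast
  note c = LC_props[OF LC] and l = LC_length[OF LC]
  have cK: "0 < card K" "card K - 1 < card K" "0 \<noteq> card K - 1" using c(2) l by auto
  have uv: "u \<in> K" "v \<in> K" using LC_in_K[OF LC] cK l Cj(2,3) by (metis, metis)
  have une: "u \<noteq> v" using nth_eq_iff_index_eq[OF c(1), of 0 "card K - 1"] cK l Cj(2,3) by simp
  define F where "F = {5, 6, 7, 8, 11, 13, 14, 16, 22, 23, 24, 25, 26::nat}"
  define A where "A = {3, 4, 7, 8, 9, 10::nat}"
  define s1 where "s1 = set_reg 26 v (set_reg 25 u s)"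
  have s1: "sweep_state K s1" "regs s1 13 = u" "frame F A s s1"
    using s by (auto simp: s1_def core_state_def sweep_state_def inp_def F_def)
  \<comment> \<open>A core vertex pays at two moments, when it leaves \<open>U\<close> as the new
    vertex and when it leaves the front; hence the two sums.\<close>
  define I where "I M s' \<longleftrightarrow> (\<exists>k U. sweep_inv C j u v s k U s' \<and>
    M = (\<Sum>w\<in>U. 20 * wt w) + (\<Sum>w\<in>U \<union> {regs s' 13, regs s' 14}. 20 * wt w))" for M s'
  define Q where "Q t s' \<longleftrightarrow> inp s' \<and> (\<exists>m. regs s' 23 = m \<and> swept u v m s' \<and> {u, v} \<union> arrs s' 7 ` {..<m} = K) \<and>
    regs s' 25 = u \<and> regs s' 26 = v \<and> frame F A s s' \<and> t \<le> 60 * (\<Sum>v<n. wt v) + 20" for t s'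
  let ?T = "\<Sum>v<n. wt v"
  have bnd: "(\<Sum>w\<in>U. 20 * wt w) \<le> 20 * ?T" if "U \<subseteq> K" for U
    unfolding sum_distrib_left using that K_less by (intro sum_mono2) auto
  have one: "wt w \<le> ?T" if "w \<in> K" for w using that K_less member_le_sum[of w "{..<n}" wt] by simp
  \<comment> \<open>Here \<open>t0\<close> is the time spent before the loop, mainly on visiting the
    two start vertices. Together with the potential of at most \<open>40\<close> per unit of weight
    this makes \<open>60\<close>, and the last loop test turns \<open>19\<close> into
    \<open>20\<close>.\<close>
  have loop: "ok (While (Less 1 16) sweep_body) s2 (\<lambda>t. Q (t0 + t))"
    if I0: "I M s2" "M \<le> 40 * ?T" and t0: "t0 \<le> 19 + 20 * ?T" for s2 M t0
  proof (rule ok_While[where I = I, OF I0(1)])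
    fix M s3 assume "I M s3" and h: "holds (Less 1 16) s3"
    then obtain k U where J: "sweep_inv C j u v s k U s3"
      "M = (\<Sum>w\<in>U. 20 * wt w) + (\<Sum>w\<in>U \<union> {regs s3 13, regs s3 14}. 20 * wt w)" unfolding I_def by blast
    have i: "U \<subseteq> K" "sweep_state U s3" "regs s3 13 \<noteq> regs s3 14" "regs s3 13 \<notin> U" "regs s3 14 \<notin> U"
      "regs s3 16 = card (nbrs E (regs s3 13) \<inter> U)" using J(1) by (auto simp: sweep_inv_def)
    have finU: "finite U" using i(1) finK finite_subset by blast
    have "U \<noteq> {}" using h i(2,6) by (auto simp: inp_regs sweep_stateD(1))
    then show "ok sweep_body s3 (\<lambda>t s'. \<exists>m'. I m' s' \<and> 1 + t + m' \<le> M)"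
    proof (rule ok_mono[OF ok_sweep_body[OF J(1) Cj(1)]], elim exE conjE)
      fix t s' a b z assume B: "{a, b} = {regs s3 13, regs s3 14}" "z \<in> U" "{regs s' 13, regs s' 14} = {z, b}"
        "sweep_inv C j u v s (Suc k) (U - {z}) s'" "t \<le> 22 + 6 * (length (adj a) + length (adj z))"
      have ab: "a \<noteq> b" "a \<notin> U" "b \<notin> U" using B(1) i(3-5) by (auto simp: doubleton_eq_iff)
      have "U \<union> {regs s3 13, regs s3 14} = insert a (insert b U)" unfolding B(1)[symmetric] by auto
      moreover have "(U - {z}) \<union> {regs s' 13, regs s' 14} = insert b U" unfolding B(3) using B(2) by auto
      moreover have "(\<Sum>w\<in>U. 20 * wt w) = 20 * wt z + (\<Sum>w\<in>U - {z}. 20 * wt w)" using finU B(2) by (rule sum.remove)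
      moreover have "(\<Sum>w\<in>insert a (insert b U). 20 * wt w) = 20 * wt a + (\<Sum>w\<in>insert b U. 20 * wt w)"
        using finU ab by (intro sum.insert) auto
      ultimately have "1 + t + ((\<Sum>w\<in>U - {z}. 20 * wt w) + (\<Sum>w\<in>(U - {z}) \<union> {regs s' 13, regs s' 14}. 20 * wt w)) \<le> M"
        using J(2) B(5) by (simp add: wt_def[of a] wt_def[of z])
      then show "\<exists>m'. I m' s' \<and> 1 + t + m' \<le> M" using B(4) unfolding I_def by blast
    qed
  next
    fix M' s3 t assume "I M' s3" and h: "\<not> holds (Less 1 16) s3" and t: "t + M' \<le> M + 1"
    then obtain k U where J: "sweep_inv C j u v s k U s3" unfolding I_def by blast
    have i: "sweep_state U s3" "sweep C j (regs s3 13) (regs s3 14) U" "regs s3 16 = card (nbrs E (regs s3 13) \<inter> U)"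
      using J by (auto simp: sweep_inv_def)
    have "card (nbrs E (regs s3 13) \<inter> U) = 0" using h i(1,3) by (auto simp: inp_regs sweep_stateD(1))
    then have "nbrs E (regs s3 13) \<inter> U = {}" using fin_nbrs by simp
    \<comment> \<open>Only the newest vertex is looked at, but if it has no unvisited neighbor then
      no vertex is unvisited.\<close>
    then have "U = {}" using sweep_step(1)[OF Cj(1) i(2)] by simp
    then show "Q (t0 + t) s3" using J t t0 I0(2) i(1) unfolding Q_def sweep_inv_def by (auto simp: F_def A_def sweep_stateD(1))
  qed
  have "ok (visit 13) s1 (\<lambda>t1 s2. ok (visit 14) s2 (\<lambda>t2 s3. ok (Load 16 3 13) s3 (\<lambda>t3 s4.
    ok (While (Less 1 16) sweep_body) s4 (\<lambda>t. Q (2 + (t1 + (t2 + (t3 + t))))))))"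
  proof (rule ok_mono[OF ok_visit[OF s1(1,2) uv(1) K_less[OF uv(1)]]], simp, elim conjE)
    fix t1 s2 assume B: "sweep_state (K - {u}) s2" "frame {5, 6, 7, 8} {3, 4} s1 s2" "t1 \<le> 6 + length (adj u) * 6"
    have r14: "regs s2 14 = v" using frameD(1)[OF B(2), of 14] s by (simp add: s1_def)
    have vK: "v \<in> K - {u}" using uv une by blast
    show "ok (visit 14) s2 (\<lambda>t2 s3. ok (Load 16 3 13) s3 (\<lambda>t3 s4.
      ok (While (Less 1 16) sweep_body) s4 (\<lambda>t. Q (2 + (t1 + (t2 + (t3 + t)))))))"
    proof (rule ok_mono[OF ok_visit[OF B(1) r14 vK K_less[OF uv(2)]]], simp, elim conjE)
      fix t2 s3 assume D: "sweep_state (K - {u} - {v}) s3" "frame {5, 6, 7, 8} {3, 4} s2 s3" "t2 \<le> 6 + length (adj v) * 6"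
      have KU: "K - {u} - {v} = K - {u, v}" by blast
      have D1: "sweep_state (K - {u, v}) s3" using D(1) unfolding KU .
      have f: "frame {5, 6, 7, 8} {3, 4} s1 s3" by (rule frame_trans[OF B(2) D(2)]) auto
      have f': "frame F A s s3" by (rule frame_trans[OF s1(3) f]) (auto simp: F_def A_def)
      have r: "regs s3 13 = u" "regs s3 14 = v" "regs s3 23 = 0" "regs s3 25 = u" "regs s3 26 = v"
        using frameD(1)[OF f, of 13] frameD(1)[OF f, of 14] frameD(1)[OF f, of 23] frameD(1)[OF f, of 25] frameD(1)[OF f, of 26] s
        by (auto simp: s1_def)
      define s4 where "s4 = set_reg 16 (card (nbrs E u \<inter> (K - {u, v}))) s3"
      have "sweep_inv C j u v s 0 (K - {u, v}) s4"
        unfolding sweep_inv_def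
      proof (intro conjI)
        show "sweep C j (regs s4 13) (regs s4 14) (K - {u, v})" using sweep_start[OF Cj(1)] Cj(2,3) r by (simp add: s4_def)
        show "swept u v 0 s4" using une by (simp add: swept_def strip_def attached_def)
        show "{u, v} \<union> arrs s4 7 ` {..<0} = K - (K - {u, v})" using uv by auto
        show "frame {5, 6, 7, 8, 11, 13, 14, 16, 22, 23, 24, 25, 26} {3, 4, 7, 8, 9, 10} s s4"
          using f' by (simp add: F_def A_def s4_def)
      qed (use D1 r une uv in \<open>auto simp: s4_def front_new_def\<close>)
      moreover have "regs s4 13 = u" "regs s4 14 = v" using r by (auto simp: s4_def)
      ultimately have I4: "I ((\<Sum>w\<in>K - {u, v}. 20 * wt w) + (\<Sum>w\<in>(K - {u, v}) \<union> {u, v}. 20 * wt w)) s4"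
        unfolding I_def by auto
      have "(\<Sum>w\<in>K - {u, v}. 20 * wt w) \<le> 20 * ?T" "(\<Sum>w\<in>(K - {u, v}) \<union> {u, v}. 20 * wt w) \<le> 20 * ?T"
        using uv by (intro bnd; auto)+
      then have M4: "(\<Sum>w\<in>K - {u, v}. 20 * wt w) + (\<Sum>w\<in>(K - {u, v}) \<union> {u, v}. 20 * wt w) \<le> 40 * ?T" by simp
      have T: "2 + (t1 + (t2 + 1)) \<le> 19 + 20 * ?T"
        using B(3) D(3) one[OF uv(1)] one[OF uv(2)] by (simp add: wt_def[of u] wt_def[of v])
      have "arrs s3 3 u = card (nbrs E u \<inter> (K - {u, v}))" using sweep_stateD(3)[OF D1 K_less[OF uv(1)]] .
      then show "ok (Load 16 3 13) s3 (\<lambda>t3 s4. ok (While (Less 1 16) sweep_body) s4 (\<lambda>t. Q (2 + (t1 + (t2 + (t3 + t))))))"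
        using loop[OF I4 M4 T] by (simp only: ok_simps r s4_def add.assoc)
    qed
  qed
  then have "ok sweep_prog s Q" unfolding sweep_prog_def using s(2,3) by (simp add: s1_def numeral_2_eq_2)
  then show ?thesis by (rule ok_mono) (simp add: Q_def F_def A_def)
qed

end

section \<open>The coloring program\<close>

definition core_prog :: prog where
  "core_prog = Seq (Const 4 0) (Seq find_loop (Seq sweep_prog color_prog))"

definition star_color_prog :: prog where
  "star_color_prog = Seq (Const 2 1) (Seq (Const 3 2) (Seq degree_loop (Seq (While (Less 10 9) peel_body)
     (Seq (If (Equal 9 0) Skip core_prog) (While (Less 1 9) tree_body)))))"

context ram_core
begin

lemma ok_color_body:
  assumes s: "inp s" "regs s 27 = j" "swept u v m s" "j < m"
    and c: "strip_color u v (arrs s 7) (arrs s 8) (arrs s 9) (\<lambda>i. arrs s 10 i = 1) j (arrs s 2)"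
  shows "ok color_body s (\<lambda>t s'. inp s' \<and> regs s' 27 = Suc j \<and>
    strip_color u v (arrs s 7) (arrs s 8) (arrs s 9) (\<lambda>i. arrs s 10 i = 1) (Suc j) (arrs s' 2) \<and>
    arrs s' 11 = (arrs s 11)(arrs s 7 j := 1) \<and> frame {5, 8, 27, 28, 29, 30, 31} {2, 11} s s' \<and> t \<le> 15)"
proof -
  have st: "strip u v (arrs s 7) (arrs s 8) (arrs s 9) (\<lambda>i. arrs s 10 i = 1) m" using s(3) by (simp add: swept_def)
  note e = strip_color_extend[OF st c s(4)]
  define b where "b \<longleftrightarrow> arrs s 10 j \<noteq> 1 \<and> arrs s 10 (Suc j) = 1 \<and> arrs s 10 (Suc (Suc j)) \<noteq> 1"
  define y where "y = (if b then arrs s 9 j else arrs s 8 j)"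
  define s2 where "s2 = set_reg 5 (arrs s 2 y) (set_reg 5 y (set_reg 31 (arrs s 10 (Suc (Suc j))) (set_reg 29 (Suc (Suc j))
    (set_reg 30 (arrs s 10 (Suc j)) (set_reg 29 (Suc j) (set_reg 29 j (set_reg 28 (arrs s 10 j) s)))))))"
  define s3 where "s3 = set_reg 5 (1 - arrs s 2 y) s2"
  define s4 where "s4 = set_reg 27 (Suc j) (set_cell 11 (arrs s 7 j) 1 (set_cell 2 (arrs s 7 j) (1 - arrs s 2 y) (set_reg 8 (arrs s 7 j) s3)))"
  define Q where "Q t s' \<longleftrightarrow> inp s' \<and> regs s' 27 = Suc j \<and>
    strip_color u v (arrs s 7) (arrs s 8) (arrs s 9) (\<lambda>i. arrs s 10 i = 1) (Suc j) (arrs s' 2) \<and>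
    arrs s' 11 = (arrs s 11)(arrs s 7 j := 1) \<and> frame {5, 8, 27, 28, 29, 30, 31} {2, 11} s s' \<and> t \<le> 15" for t :: nat and s'
  have Q4: "t \<le> 15 \<Longrightarrow> Q t s4" for t
    unfolding Q_def using s(1) e by (simp add: s4_def s3_def s2_def y_def b_def)
  have r: "regs s (Suc 0) = 0" "regs s 2 = 1" using s(1) by (simp_all add: inp_regs)
  have "ok color_body s Q"
  proof (cases b)
    case True
    then show ?thesis
      using Q4 s(1,2) r unfolding color_body_def b_def y_def s4_def s3_def s2_def by (simp add: ok_flip)
  next
    case False
    have "\<not> (arrs s 10 j \<noteq> 1 \<and> arrs s 10 (Suc j) = 1 \<and> arrs s 10 (Suc (Suc j)) \<noteq> 1)" using False unfolding b_def .
    then show ?thesis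
      using Q4 s(1,2) r False unfolding color_body_def y_def s4_def s3_def s2_def by (auto simp: ok_flip)
  qed
  then show ?thesis by (rule ok_mono) (simp add: Q_def)
qed

lemma ok_color_prog:
  assumes s: "inp s" "regs s 23 = m" "regs s 25 = u" "regs s 26 = v" "regs s 27 = 0" "swept u v m s"
    "{u, v} \<union> arrs s 7 ` {..<m} = K" "\<forall>v<n. arrs s 11 v = 0"
  shows "ok color_prog s (\<lambda>t s'. inp s' \<and>
    strip_color u v (arrs s 7) (arrs s 8) (arrs s 9) (\<lambda>i. arrs s 10 i = 1) m (arrs s' 2) \<and>
    (\<forall>v<n. arrs s' 11 v = (if v \<in> K then 1 else 0)) \<and> frame {5, 8, 27, 28, 29, 30, 31} {2, 11} s s' \<and>
    t \<le> 20 * (\<Sum>v<n. wt v) + 5)"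
proof -
  define SC where "SC = strip_color u v (arrs s 7) (arrs s 8) (arrs s 9) (\<lambda>i. arrs s 10 i = 1)"
  define F where "F = {5, 8, 27, 28, 29, 30, 31::nat}"
  have st: "strip u v (arrs s 7) (arrs s 8) (arrs s 9) (\<lambda>i. arrs s 10 i = 1) m" using s(6) by (simp add: swept_def)
  have une: "u \<noteq> v" using st by (simp add: strip_def)
  have new: "arrs s 7 k \<notin> arrs s 7 ` {..<k}" if "k < m" for k using st that unfolding strip_def by blast
  have "arrs s 7 i \<noteq> arrs s 7 k" if "i < k" "k < m" for i k using new[OF that(2)] that(1) by (metis imageI lessThan_iff)
  then have inj: "inj_on (arrs s 7) {..<m}" by (metis inj_onI lessThan_iff linorder_neqE_nat)
  have sub: "arrs s 7 ` {..<m} \<subseteq> K" unfolding s(7)[symmetric] by (rule Un_upper2)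
  \<comment> \<open>The vertices attached to the strip are different vertices of the core, so
    constant time per triangle is linear.\<close>
  have "m = card (arrs s 7 ` {..<m})" using card_image[OF inj] by simp
  also have "\<dots> \<le> card K" using card_mono[OF finK sub] .
  also have "\<dots> \<le> card {..<n}" by (intro card_mono) (auto dest: K_less)
  also have "\<dots> \<le> (\<Sum>v<n. wt v)" using sum_mono[of "{..<n}" "\<lambda>_. 1" wt] by (simp add: wt_def)
  finally have m: "m \<le> (\<Sum>v<n. wt v)" .
  define s1 where "s1 = set_cell 11 v 1 (set_cell 11 u 1 (set_cell 2 v 1 (set_cell 2 u 0 s)))"
  define I where "I M s' \<longleftrightarrow> (\<exists>j\<le>m. regs s' 27 = j \<and> inp s' \<and> SC j (arrs s' 2) \<and>
    (\<forall>w<n. arrs s' 11 w = (if w \<in> {u, v} \<union> arrs s 7 ` {..<j} then 1 else 0)) \<and> frame F {2, 11} s s' \<and> M = 16 * (m - j))" for M s'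
  define Q where "Q t s' \<longleftrightarrow> inp s' \<and> SC m (arrs s' 2) \<and> (\<forall>v<n. arrs s' 11 v = (if v \<in> K then 1 else 0)) \<and>
    frame F {2, 11} s s' \<and> t \<le> 20 * (\<Sum>v<n. wt v) + 5" for t :: nat and s'
  have "ok (While (Less 27 23) color_body) s1 (\<lambda>t. Q (1 + (1 + (1 + (1 + t)))))"
  proof (rule ok_While[where I = I])
    have "\<forall>w<n. arrs s1 11 w = (if w \<in> {u, v} \<union> arrs s 7 ` {..<0} then 1 else 0)" using s(8) by (auto simp: s1_def)
    moreover have "SC 0 (arrs s1 2)" using une by (simp add: SC_def s1_def strip_color_def)
    moreover have "frame F {2, 11} s s1" by (simp add: s1_def)
    ultimately show "I (16 * m) s1" unfolding I_def using s by (intro exI[of _ 0]) (simp add: s1_def)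
  next
    fix M s2 assume "I M s2" and h: "holds (Less 27 23) s2"
    then obtain j where J: "j \<le> m" "regs s2 27 = j" "inp s2" "SC j (arrs s2 2)"
      "\<forall>w<n. arrs s2 11 w = (if w \<in> {u, v} \<union> arrs s 7 ` {..<j} then 1 else 0)" "frame F {2, 11} s s2" "M = 16 * (m - j)"
      unfolding I_def by blast
    have ar: "arrs s2 7 = arrs s 7" "arrs s2 8 = arrs s 8" "arrs s2 9 = arrs s 9" "arrs s2 10 = arrs s 10"
      using frameD(2)[OF J(6)] by auto
    have r23: "regs s2 23 = m" using frameD(1)[OF J(6), of 23] s(2) by (simp add: F_def)
    then have jm: "j < m" using h J(2) by simp
    have sw: "swept u v m s2" using s(6) by (simp add: swept_def ar)
    have c: "strip_color u v (arrs s2 7) (arrs s2 8) (arrs s2 9) (\<lambda>i. arrs s2 10 i = 1) j (arrs s2 2)"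
      using J(4) by (simp add: ar SC_def)
    show "ok color_body s2 (\<lambda>t s'. \<exists>m'. I m' s' \<and> 1 + t + m' \<le> M)"
    proof (rule ok_mono[OF ok_color_body[OF J(3,2) sw jm c]], elim conjE)
      fix t :: nat and s' assume B: "inp s'" "regs s' 27 = Suc j"
        "strip_color u v (arrs s2 7) (arrs s2 8) (arrs s2 9) (\<lambda>i. arrs s2 10 i = 1) (Suc j) (arrs s' 2)"
        "arrs s' 11 = (arrs s2 11)(arrs s2 7 j := 1)" "frame {5, 8, 27, 28, 29, 30, 31} {2, 11} s2 s'" "t \<le> 15"
      have "SC (Suc j) (arrs s' 2)" using B(3) by (simp add: ar SC_def)
      moreover have "\<forall>w<n. arrs s' 11 w = (if w \<in> {u, v} \<union> arrs s 7 ` {..<Suc j} then 1 else 0)"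
        unfolding B(4) ar lessThan_Suc using J(5) by simp
      moreover have "frame F {2, 11} s s'" by (rule frame_trans[OF J(6) B(5)]) (auto simp: F_def)
      ultimately have "I (16 * (m - Suc j)) s'" unfolding I_def using B(1,2) jm by (intro exI[of _ "Suc j"]) simp
      moreover have "1 + t + 16 * (m - Suc j) \<le> M" using B(6) J(7) jm by simp
      ultimately show "\<exists>m'. I m' s' \<and> 1 + t + m' \<le> M" by blast
    qed
  next
    fix M :: nat and s2 and t :: nat assume "I M s2" and h: "\<not> holds (Less 27 23) s2" and t: "t + M \<le> 16 * m + 1"
    then obtain j where J: "j \<le> m" "regs s2 27 = j" "inp s2" "SC j (arrs s2 2)"
      "\<forall>w<n. arrs s2 11 w = (if w \<in> {u, v} \<union> arrs s 7 ` {..<j} then 1 else 0)" "frame F {2, 11} s s2"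
      unfolding I_def by blast
    have "regs s2 23 = m" using frameD(1)[OF J(6), of 23] s(2) by (simp add: F_def)
    then have "j = m" using h J(1,2) by simp
    then have K2: "\<forall>w<n. arrs s2 11 w = (if w \<in> K then 1 else 0)" using J(5) unfolding s(7)[symmetric] by simp
    show "Q (1 + (1 + (1 + (1 + t)))) s2" unfolding Q_def using J(3,4,6) \<open>j = m\<close> K2 t m by simp
  qed
  then have "ok color_prog s Q"
    unfolding color_prog_def using s(1,3,4) by (simp add: s1_def inp_regs)
  then show ?thesis by (rule ok_mono) (simp add: Q_def SC_def F_def)
qed

text \<open>The factor \<open>140\<close> is \<open>60 + 60 + 20\<close> for search, sweep and
  coloring. The witness for \<open>F\<close> is the edge set of the strip, which may be larger than
  that of the core.\<close>

lemma ok_core_prog: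
  assumes s: "core_state s" "regs s 12 = 0" "regs s 23 = 0" "regs s 27 = 0"
    "\<forall>u<n. arrs s 6 u = 0" "\<forall>u<n. arrs s 11 u = 0"
  shows "ok core_prog s (\<lambda>t s'. inp s' \<and> (\<exists>F. local_star F (arrs s' 2) \<and> (\<forall>a\<in>K. \<forall>b\<in>K. {a, b} \<in> E \<longrightarrow> {a, b} \<in> F)) \<and>
    (\<forall>v\<in>K. arrs s' 2 v < 2) \<and> (\<forall>v<n. arrs s' 11 v = (if v \<in> K then 1 else 0)) \<and>
    regs s' 9 = regs s 9 \<and> arrs s' 5 = arrs s 5 \<and> t \<le> 140 * (\<Sum>v<n. wt v) + 27)"
proof -
  define Q where "Q t s' \<longleftrightarrow> inp s' \<and> (\<exists>F. local_star F (arrs s' 2) \<and> (\<forall>a\<in>K. \<forall>b\<in>K. {a, b} \<in> E \<longrightarrow> {a, b} \<in> F)) \<and>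
    (\<forall>v\<in>K. arrs s' 2 v < 2) \<and> (\<forall>v<n. arrs s' 11 v = (if v \<in> K then 1 else 0)) \<and>
    regs s' 9 = regs s 9 \<and> arrs s' 5 = arrs s 5 \<and> t \<le> 140 * (\<Sum>v<n. wt v) + 27" for t :: nat and s'
  define s1 where "s1 = set_reg 4 0 s"
  have s1: "core_state s1" "regs s1 4 = 0" "regs s1 12 = 0" "\<And>u. u < n \<Longrightarrow> arrs s1 6 u = 0"
    using s by (auto simp: s1_def)
  have f1: "frame {4} {} s s1" by (simp add: s1_def)
  have "ok find_loop s1 (\<lambda>t1 s2. ok sweep_prog s2 (\<lambda>t2 s3. ok color_prog s3 (\<lambda>t3. Q (1 + (t1 + (t2 + t3))))))"
  proof (rule ok_mono[OF ok_find_loop[OF s1]], assumption, elim conjE)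
    fix t1 :: nat and s2 assume B: "core_state s2" "frame ({4..22} - {9, 10}) {6} s1 s2" "start_ok (regs s2 13) (regs s2 14)"
      "t1 \<le> 60 * (\<Sum>v<n. wt v) + 1"
    define u where "u = regs s2 13"
    define v where "v = regs s2 14"
    have f2: "frame ({4..22} - {9, 10}) {6} s s2" by (rule frame_trans[OF f1 B(2)]) auto
    have r2: "regs s2 23 = 0" using frameD(1)[OF f2, of 23] s(3) by simp
    show "ok sweep_prog s2 (\<lambda>t2 s3. ok color_prog s3 (\<lambda>t3. Q (1 + (t1 + (t2 + t3)))))"
    proof (rule ok_mono[OF ok_sweep_prog[OF B(1) u_def[symmetric] v_def[symmetric] r2]])
      show "start_ok u v" using B(3) by (simp add: u_def v_def)
    next
      fix t2 :: nat and s3 assume D0: "inp s3 \<and> (\<exists>m. regs s3 23 = m \<and> swept u v m s3 \<and> {u, v} \<union> arrs s3 7 ` {..<m} = K) \<and>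
        regs s3 25 = u \<and> regs s3 26 = v \<and> frame {5, 6, 7, 8, 11, 13, 14, 16, 22, 23, 24, 25, 26} {3, 4, 7, 8, 9, 10} s2 s3 \<and>
        t2 \<le> 60 * (\<Sum>v<n. wt v) + 20"
      then obtain m where D1: "regs s3 23 = m" "swept u v m s3" "{u, v} \<union> arrs s3 7 ` {..<m} = K" by blast
      from D0 have D2: "inp s3" "regs s3 25 = u" "regs s3 26 = v" "t2 \<le> 60 * (\<Sum>v<n. wt v) + 20"
        "frame {5, 6, 7, 8, 11, 13, 14, 16, 22, 23, 24, 25, 26} {3, 4, 7, 8, 9, 10} s2 s3" by blast+
      have f3: "frame ({4..26} - {9, 10}) {3, 4, 6, 7, 8, 9, 10} s s3" by (rule frame_trans[OF f2 D2(5)]) auto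
      have r3: "regs s3 27 = 0" using frameD(1)[OF f3, of 27] s(4) by simp
      have a3: "\<forall>v<n. arrs s3 11 v = 0" using frameD(2)[OF f3, of 11] s(6) by simp
      show "ok color_prog s3 (\<lambda>t3. Q (1 + (t1 + (t2 + t3))))"
      proof (rule ok_mono[OF ok_color_prog[OF D2(1) D1(1) D2(2,3) r3 D1(2,3) a3]], elim conjE)
        fix t3 :: nat and s4 assume G: "inp s4"
          "strip_color u v (arrs s3 7) (arrs s3 8) (arrs s3 9) (\<lambda>i. arrs s3 10 i = 1) m (arrs s4 2)"
          "\<forall>v<n. arrs s4 11 v = (if v \<in> K then 1 else 0)" "frame {5, 8, 27, 28, 29, 30, 31} {2, 11} s3 s4"
          "t3 \<le> 20 * (\<Sum>v<n. wt v) + 5"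
        have st: "strip u v (arrs s3 7) (arrs s3 8) (arrs s3 9) (\<lambda>i. arrs s3 10 i = 1) m"
          and att: "attached E u v (arrs s3 7) (arrs s3 8) (arrs s3 9) m" using D1(2) by (simp_all add: swept_def)
        have "local_star (strip_edges u v (arrs s3 7) (arrs s3 8) (arrs s3 9) m) (arrs s4 2)" by (rule strip_local_star[OF st G(2)])
        moreover have "{a, b} \<in> strip_edges u v (arrs s3 7) (arrs s3 8) (arrs s3 9) m" if "a \<in> K" "b \<in> K" "{a, b} \<in> E" for a b
          using att by (intro strip_covers[OF st D1(3) _ that(3,1,2)]) (simp add: attached_def)
        ultimately have "\<exists>F. local_star F (arrs s4 2) \<and> (\<forall>a\<in>K. \<forall>b\<in>K. {a, b} \<in> E \<longrightarrow> {a, b} \<in> F)" by blast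
        moreover have "\<forall>z\<in>K. arrs s4 2 z < 2" using strip_colors_less_2[OF st G(2) order_refl] unfolding D1(3) .
        moreover have f4: "frame ({4..31} - {9, 10}) {2, 3, 4, 6, 7, 8, 9, 10, 11} s s4" by (rule frame_trans[OF f3 G(4)]) auto
        moreover have "regs s4 9 = regs s 9" "arrs s4 5 = arrs s 5" using frameD(1)[OF f4, of 9] frameD(2)[OF f4, of 5] by simp_all
        ultimately show "Q (1 + (t1 + (t2 + t3))) s4" unfolding Q_def using G(1,3,5) B(4) D2(4) by simp
      qed
    qed
  qed
  then have "ok core_prog s Q" unfolding core_prog_def by (simp add: s1_def)
  then show ?thesis by (rule ok_mono) (simp add: Q_def)
qed

end

lemma local_star_cong:
  assumes "\<And>e v. e \<in> E \<Longrightarrow> v \<in> e \<Longrightarrow> c v = d v" "local_star E c"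
  shows "local_star E d"
proof -
  have "c u = d u \<and> c v = d v" if "{u, v} \<in> E" for u v using assms(1)[OF that] by simp
  then show ?thesis using assms(2) unfolding local_star_def by metis
qed

lemma sum_degrees_le:
  fixes n :: nat
  assumes "simple_graph {..<n} E"
  shows "(\<Sum>v<n. card (nbrs E v)) \<le> 2 * card E"
proof -
  have e: "e \<subseteq> {..<n}" "card e = 2" if "e \<in> E" for e using assms that by (auto simp: simple_graph_def)
  have fin: "finite E" by (rule finite_subset[of _ "Pow {..<n}"]) (use e in auto)
  have "card (nbrs E v) \<le> card {e \<in> E. v \<in> e}" for v
  proof (rule card_inj_on_le[where f = "\<lambda>u. {v, u}"])
    show "inj_on (\<lambda>u. {v, u}) (nbrs E v)" by (auto simp: inj_on_def doubleton_eq_iff)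
    show "(\<lambda>u. {v, u}) ` nbrs E v \<subseteq> {e \<in> E. v \<in> e}" by (auto simp: nbrs_def insert_commute)
  qed (use fin in simp)
  then have "(\<Sum>v<n. card (nbrs E v)) \<le> (\<Sum>v<n. card {e \<in> E. v \<in> e})" by (rule sum_mono)
  also have "\<dots> = (\<Sum>v<n. \<Sum>e\<in>E. if v \<in> e then 1 else 0)" using fin by (simp add: sum.If_cases Int_def)
  also have "\<dots> = (\<Sum>e\<in>E. \<Sum>v<n. if v \<in> e then 1 else 0)" by (rule sum.swap)
  also have "\<dots> = (\<Sum>e\<in>E. 2)"
  proof (rule sum.cong)
    fix e assume "e \<in> E"
    then have "{..<n} \<inter> e = e" "card e = 2" using e by auto
    then show "(\<Sum>v<n. if v \<in> e then 1 else 0) = (2 :: nat)" by (simp add: sum.If_cases)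
  qed simp
  finally show ?thesis by simp
qed

context ram
begin

lemma sum_wt_le: "(\<Sum>v<n. wt v) \<le> n + 2 * card E"
proof -
  have "wt v = card (nbrs E v) + 1" if "v < n" for v
    using distinct_card[OF distinct_adj[OF that]] by (simp add: wt_def set_adj[OF that])
  then have "(\<Sum>v<n. wt v) = (\<Sum>v<n. card (nbrs E v) + 1)" by (intro sum.cong) simp_all
  then show ?thesis using sum_degrees_le[OF simple] unfolding sum.distrib by simp
qed

text \<open>A queue of length \<open>n\<close> means that everything was peeled, so the graph is a
  forest and there is no core to be colored.\<close>

lemma ok_core_if_nonempty:
  assumes s: "peel_state qs (length qs) (\<lambda>v. card (nbrs E v - set qs)) s" "regs s 12 = 0" "regs s 23 = 0" "regs s 27 = 0"
    "\<forall>u. arrs s 6 u = 0" "\<forall>u. arrs s 11 u = 0"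
  shows "ok (If (Equal 9 0) Skip core_prog) s (\<lambda>t s'. inp s' \<and> regs s' 9 = length qs \<and> (\<forall>i<length qs. arrs s' 5 i = qs ! i) \<and>
    (\<forall>v<n. arrs s' 11 v = (if v \<in> set qs then 0 else 1)) \<and> (\<forall>v<n. v \<notin> set qs \<longrightarrow> arrs s' 2 v < 2) \<and>
    local_star {e \<in> E. e \<inter> set qs = {}} (arrs s' 2) \<and> t \<le> 140 * (\<Sum>v<n. wt v) + 28)"
proof -
  define Q where "Q t s' \<longleftrightarrow> inp s' \<and> regs s' 9 = length qs \<and> (\<forall>i<length qs. arrs s' 5 i = qs ! i) \<and>
    (\<forall>v<n. arrs s' 11 v = (if v \<in> set qs then 0 else 1)) \<and> (\<forall>v<n. v \<notin> set qs \<longrightarrow> arrs s' 2 v < 2) \<and>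
    local_star {e \<in> E. e \<inter> set qs = {}} (arrs s' 2) \<and> t \<le> 140 * (\<Sum>v<n. wt v) + 28" for t :: nat and s'
  have q: "distinct qs" "set qs \<subseteq> {..<n}" "regs s 9 = length qs" "\<forall>i<length qs. arrs s 5 i = qs ! i"
    "\<forall>v<n. arrs s 4 v = (if v \<in> set qs then 1 else 0)" and i: "inp s"
    and r: "\<forall>v<n. arrs s 3 v = card (nbrs E v - set qs)" "\<forall>v<n. v \<in> set qs \<longleftrightarrow> card (nbrs E v - set qs) \<le> 1"
    and d: "\<forall>i<length qs. card (nbrs E (qs ! i) - set (take i qs)) \<le> 1"
    using s(1) by (simp_all add: peel_state_def queue_def)
  have inn: "e \<subseteq> {..<n}" "e \<noteq> {}" if "e \<in> E" for e using simple that by (auto simp: simple_graph_def)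
  have cond: "holds (Equal 9 0) s \<longleftrightarrow> set qs = {..<n}"
  proof -
    have "card (set qs) = n \<longleftrightarrow> set qs = {..<n}" using card_subset_eq[OF finite_lessThan q(2)] card_lessThan by metis
    then show ?thesis using q(3) distinct_card[OF q(1)] inp_regs(1)[OF i] by (simp only: holds.simps)
  qed
  have "ok (If (Equal 9 0) Skip core_prog) s Q"
  proof (cases "set qs = {..<n}")
    case True
    have "{e \<in> E. e \<inter> set qs = {}} = {}" unfolding True using inn by blast
    then have "local_star {e \<in> E. e \<inter> set qs = {}} (arrs s 2)" by (simp only: local_star_def empty_iff) simp
    moreover have "v \<in> set qs" if "v < n" for v unfolding True using that by simp
    ultimately have "Q 2 s" unfolding Q_def using i q(3,4) s(6) by simp
    moreover have "holds (Equal 9 0) s" unfolding cond by (rule True)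
    ultimately show ?thesis by (simp add: numeral_2_eq_2 del: holds.simps)
  next
    case False
    define K where "K = {..<n} - set qs"
    have nK: "nbrs E v \<inter> K = nbrs E v - set qs" for v using inn by (force simp: K_def nbrs_def)
    interpret ram_core n E adj K qs
    proof unfold_locales
      show "K \<noteq> {}" unfolding K_def using False q(2) by blast
    next
      fix v assume "v \<in> K"
      then have "v < n" "v \<notin> set qs" by (auto simp: K_def)
      then have "\<not> card (nbrs E v - set qs) \<le> 1" using r(2) by blast
      then show "2 \<le> card (nbrs E v \<inter> K)" unfolding nK by simp
    qed (use q(1,2) d in \<open>simp_all add: K_def\<close>)
    have cs: "core_state s" unfolding core_state_def nK using i r q(5) by (simp add: K_def)
    have "ok core_prog s (\<lambda>t. Q (1 + t))"
    proof (rule ok_mono[OF ok_core_prog[OF cs s(2-4)]])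
      fix t :: nat and s' :: state assume B: "inp s' \<and> (\<exists>F. local_star F (arrs s' 2) \<and> (\<forall>a\<in>K. \<forall>b\<in>K. {a, b} \<in> E \<longrightarrow> {a, b} \<in> F)) \<and>
        (\<forall>v\<in>K. arrs s' 2 v < 2) \<and> (\<forall>v<n. arrs s' 11 v = (if v \<in> K then 1 else 0)) \<and>
        regs s' 9 = regs s 9 \<and> arrs s' 5 = arrs s 5 \<and> t \<le> 140 * (\<Sum>v<n. wt v) + 27"
      then obtain F where F: "local_star F (arrs s' 2)" "\<forall>a\<in>K. \<forall>b\<in>K. {a, b} \<in> E \<longrightarrow> {a, b} \<in> F" by blast
      have "local_star {e \<in> E. e \<inter> set qs = {}} (arrs s' 2)"
      proof (rule local_star_mono[OF F(1)])
        fix a b assume e: "{a, b} \<in> {e \<in> E. e \<inter> set qs = {}}"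
        then have "{a, b} \<subseteq> {..<n}" "{a, b} \<inter> set qs = {}" using inn by blast+
        then have "a \<in> K" "b \<in> K" by (auto simp: K_def)
        then show "{a, b} \<in> F" using F(2) e by blast
      qed
      then show "Q (1 + t) s'" unfolding Q_def using B q by (simp add: K_def)
    qed (use s in auto)
    moreover have "\<not> holds (Equal 9 0) s" unfolding cond by (rule False)
    ultimately show ?thesis by (simp del: holds.simps)
  qed
  then show ?thesis by (rule ok_mono) (simp add: Q_def)
qed

lemma ok_star_color_prog:
  "ok star_color_prog (input_state n adj)
     (\<lambda>t s. (\<forall>v<n. arrs s 2 v < 2) \<and> local_star E (arrs s 2) \<and> t \<le> 400 * (n + card E + 1))"
proof -
  define Q where "Q t s \<longleftrightarrow> (\<forall>v<n. arrs s 2 v < 2) \<and> local_star E (arrs s 2) \<and> t \<le> 400 * (n + card E + 1)" for t :: nat and s :: state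
  define s1 where "s1 = set_reg 3 2 (set_reg 2 1 (input_state n adj))"
  have i1: "inp s1" using concat_nth[of _ n _ adj] by (auto simp: inp_def s1_def input_state_def)
  have z1: "regs s1 r = 0" if "3 < r" for r using that by (simp add: s1_def input_state_def)
  have z1': "arrs s1 a v = 0" if "1 < a" for a v using that by (simp add: s1_def input_state_def)
  have z: "regs s1 4 = 0" "regs s1 9 = 0" "\<forall>v. arrs s1 4 v = 0" by (simp_all add: z1 z1')
  have "ok degree_loop s1 (\<lambda>t1 s2. ok (While (Less 10 9) peel_body) s2 (\<lambda>t2 s3. ok (If (Equal 9 0) Skip core_prog) s3
    (\<lambda>t3 s4. ok (While (Less 1 9) tree_body) s4 (\<lambda>t4. Q (1 + (1 + (t1 + (t2 + (t3 + t4)))))))))"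
  proof (rule ok_mono[OF ok_degree_loop[OF i1 z]], elim exE conjE)
    fix t1 :: nat and s2 :: state and qs0 assume B: "queue qs0 s2" "inp s2" "frame {4..9} {3, 4, 5} s1 s2" "\<forall>v<n. arrs s2 3 v = length (adj v)"
      "\<forall>v<n. v \<in> set qs0 \<longleftrightarrow> length (adj v) \<le> 1" "t1 \<le> 20 * (\<Sum>v<n. wt v) + 1"
    have r10: "regs s2 10 = 0" using frameD(1)[OF B(3), of 10] z1 by simp
    show "ok (While (Less 10 9) peel_body) s2 (\<lambda>t2 s3. ok (If (Equal 9 0) Skip core_prog) s3
      (\<lambda>t3 s4. ok (While (Less 1 9) tree_body) s4 (\<lambda>t4. Q (1 + (1 + (t1 + (t2 + (t3 + t4))))))))"
    proof (rule ok_mono[OF ok_peel_loop[OF B(1,2) r10 B(4,5)]], elim exE conjE)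
      fix t2 :: nat and s3 :: state and qs assume D: "peel_state qs (length qs) (\<lambda>v. card (nbrs E v - set qs)) s3" "frame {4..11} {3, 4, 5} s2 s3"
        "t2 \<le> 20 * (\<Sum>v<n. wt v) + 1"
      have f: "frame {4..11} {3, 4, 5} s1 s3" by (rule frame_trans[OF B(3) D(2)]) auto
      have z3: "regs s3 12 = 0" "regs s3 23 = 0" "regs s3 27 = 0" "\<forall>u. arrs s3 6 u = 0" "\<forall>u. arrs s3 11 u = 0"
        using frameD(1)[OF f, of 12] frameD(1)[OF f, of 23] frameD(1)[OF f, of 27] frameD(2)[OF f, of 6] frameD(2)[OF f, of 11]
        by (simp_all add: z1 z1')
      have q: "distinct qs" "set qs \<subseteq> {..<n}" "\<And>i. i < length qs \<Longrightarrow> card (nbrs E (qs ! i) - set (take i qs)) \<le> 1"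
        using D(1) by (simp_all add: peel_state_def queue_def)
      show "ok (If (Equal 9 0) Skip core_prog) s3
        (\<lambda>t3 s4. ok (While (Less 1 9) tree_body) s4 (\<lambda>t4. Q (1 + (1 + (t1 + (t2 + (t3 + t4)))))))"
      proof (rule ok_mono[OF ok_core_if_nonempty[OF D(1) z3]], elim conjE)
        fix t3 :: nat and s4 :: state assume G: "inp s4" "regs s4 9 = length qs" "\<forall>i<length qs. arrs s4 5 i = qs ! i"
          "\<forall>v<n. arrs s4 11 v = (if v \<in> set qs then 0 else 1)" "\<forall>v<n. v \<notin> set qs \<longrightarrow> arrs s4 2 v < 2"
          "local_star {e \<in> E. e \<inter> set qs = {}} (arrs s4 2)" "t3 \<le> 140 * (\<Sum>v<n. wt v) + 28"
        show "ok (While (Less 1 9) tree_body) s4 (\<lambda>t4. Q (1 + (1 + (t1 + (t2 + (t3 + t4))))))"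
        proof (rule ok_mono[OF ok_tree_loop[OF G(1-3) q G(4,5)]], assumption, elim conjE)
          fix t4 :: nat and s5 :: state assume H: "\<forall>v<n. arrs s5 2 v < 2" "\<forall>v<n. v \<notin> set qs \<longrightarrow> arrs s5 2 v = arrs s4 2 v"
            "\<forall>i<length qs. \<forall>y\<in>nbrs E (qs ! i) - set (take i qs). arrs s5 2 y \<noteq> arrs s5 2 (qs ! i)"
            "t4 \<le> 20 * (\<Sum>v<n. wt v) + 1"
          have "local_star {e \<in> E. e \<inter> set qs = {}} (arrs s5 2)"
          proof (rule local_star_cong[OF _ G(6)])
            fix e v assume "e \<in> {e \<in> E. e \<inter> set qs = {}}" "v \<in> e"
            moreover then have "v < n" using simple by (auto simp: simple_graph_def)
            ultimately show "arrs s4 2 v = arrs s5 2 v" using H(2) by auto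
          qed
          then have "local_star E (arrs s5 2)"
          proof (rule local_star_mono)
            fix a b assume e: "{a, b} \<in> E" "arrs s5 2 a = arrs s5 2 b"
            then have "a \<notin> set qs \<and> b \<notin> set qs" by (rule peeled_proper[OF q(1)]) (use H(3) in blast)
            then show "{a, b} \<in> {e \<in> E. e \<inter> set qs = {}}" using e(1) by simp
          qed
          \<comment> \<open>The phases take \<open>20\<close>, \<open>20\<close>, \<open>140\<close>
            and \<open>20\<close> per unit of weight, and the total weight is at most
            \<open>n + 2 * card E\<close>; this gives \<open>400\<close>.\<close>
          moreover have "1 + (1 + (t1 + (t2 + (t3 + t4)))) \<le> 400 * (n + card E + 1)"
            using sum_wt_le B(6) D(3) G(7) H(4) by simp
          ultimately show "Q (1 + (1 + (t1 + (t2 + (t3 + t4))))) s5" unfolding Q_def using H(1) by simp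
        qed
      qed
    qed
  qed
  then have "ok star_color_prog (input_state n adj) Q" unfolding star_color_prog_def by (simp only: ok_simps ok_Seq s1_def)
  then show ?thesis by (rule ok_mono) (simp add: Q_def)
qed

end

lemma star_color_prog_correct:
  assumes "outerpath {..<n} E" "adjacency_lists n E adj"
  obtains t s where "exec star_color_prog (input_state n adj) t s" "t \<le> 400 * (n + card E + 1)"
    "\<And>v. v < n \<Longrightarrow> output_coloring s v < 2" "local_star E (output_coloring s)"
proof -
  interpret outerpath_structure "{..<n}" E using outerpath_structureI[OF assms(1)] .
  interpret ram n E adj using assms(2) by unfold_locales
  have "output_coloring s = arrs s 2" for s by (simp add: fun_eq_iff output_coloring_def)
  then show thesis using ok_star_color_prog that unfolding ok_def by auto
qed

text \<open>The curves stay where they are and only the names of the vertices change. So the faces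
  are literally the same sets, and the weak dual is the same graph.\<close>

lemma outerpath_relabel:
  assumes "outerpath V E" and h: "bij_betw h V W"
  shows "outerpath W ((`) h ` E)"
proof -
  obtain pos crv where p: "outerplanar_embedding V E pos crv" "path_graph (weak_dual_verts V E pos crv) (weak_dual_edges V E pos crv)"
    and g: "simple_graph V E" using assms(1) by (auto simp: outerpath_def)
  define i where "i = inv_into V h"
  define pos' where "pos' = pos \<circ> i"
  define crv' where "crv' e = crv (i ` e)" for e
  have sub: "e \<subseteq> V" if "e \<in> E" for e using g that by (auto simp: simple_graph_def)
  have ih: "i (h v) = v" if "v \<in> V" for v using h that by (simp add: i_def bij_betw_inv_into_left)
  have ihe: "i ` h ` e = e" if "e \<subseteq> V" for e using ih that by (force simp: image_iff)
  have W: "W = h ` V" using h by (simp add: bij_betw_def)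
  have inj: "inj_on h V" using h by (simp add: bij_betw_def)
  have pe: "pos' ` h ` e = pos ` e" if "e \<subseteq> V" for e
    unfolding pos'_def image_comp[symmetric] ihe[OF that] ..
  have ce: "crv' (h ` e) = crv e" if "e \<in> E" for e by (simp add: crv'_def ihe[OF sub[OF that]])
  have un: "(\<Union>e\<in>(`) h ` E. path_image (crv' e)) = (\<Union>e\<in>E. path_image (crv e))" using ce by auto
  have faces: "faces W ((`) h ` E) pos' crv' = faces V E pos crv"
    unfolding faces_def un unfolding W pe[OF order_refl] ..
  have "(\<exists>e\<in>(`) h ` E. path_image (crv' e) \<subseteq> S) \<longleftrightarrow> (\<exists>e\<in>E. path_image (crv e) \<subseteq> S)" for S using ce by auto
  then have dual: "dual_edges W ((`) h ` E) pos' crv' = dual_edges V E pos crv" by (simp only: dual_edges_def faces)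
  have verts: "weak_dual_verts W ((`) h ` E) pos' crv' = weak_dual_verts V E pos crv" by (simp only: weak_dual_verts_def faces)
  have edges: "weak_dual_edges W ((`) h ` E) pos' crv' = weak_dual_edges V E pos crv"
    by (simp only: weak_dual_edges_def dual verts)
  have "plane_embedding W ((`) h ` E) pos' crv'"
    unfolding plane_embedding_def
  proof (intro conjI ballI impI)
    have "inj_on pos V" using p(1) by (simp add: outerplanar_embedding_def plane_embedding_def)
    then show "inj_on pos' W" unfolding W pos'_def by (auto simp: inj_on_def ih)
  next
    fix e' assume "e' \<in> (`) h ` E"
    then obtain e where e: "e \<in> E" "e' = h ` e" by blast
    then show "arc (crv' e')" "{pathstart (crv' e'), pathfinish (crv' e')} = pos' ` e'"
      "path_image (crv' e') \<inter> pos' ` W = pos' ` e'"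
      using p(1) ce pe[OF sub] pe[OF order_refl] by (auto simp: W outerplanar_embedding_def plane_embedding_def)
  next
    fix e' f' assume "e' \<in> (`) h ` E" "f' \<in> (`) h ` E" "e' \<noteq> f'"
    then obtain e f where e: "e \<in> E" "e' = h ` e" "f \<in> E" "f' = h ` f" "e \<noteq> f" by blast
    have "h ` e \<inter> h ` f = h ` (e \<inter> f)" using inj_on_image_Int[OF inj sub[OF e(1)] sub[OF e(3)]] by simp
    then have "pos' ` (e' \<inter> f') = pos ` (e \<inter> f)" using pe[of "e \<inter> f"] sub[OF e(1)] e by (simp add: le_infI1)
    moreover have "path_image (crv e) \<inter> path_image (crv f) \<subseteq> pos ` (e \<inter> f)"
      using p(1) e by (simp add: outerplanar_embedding_def plane_embedding_def)
    ultimately show "path_image (crv' e') \<inter> path_image (crv' f') \<subseteq> pos' ` (e' \<inter> f')" using e ce by simp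
  qed
  moreover have "pos' (h v) = pos v" if "v \<in> V" for v using ih[OF that] by (simp add: pos'_def)
  ultimately have "outerplanar_embedding W ((`) h ` E) pos' crv'"
    using p(1) unfolding outerplanar_embedding_def faces unfolding W by simp
  moreover have "simple_graph W ((`) h ` E)"
  proof -
    have "card (h ` e) = card e" if "e \<in> E" for e using card_image inj_on_subset[OF inj sub[OF that]] by blast
    then show ?thesis using g sub unfolding simple_graph_def W by auto
  qed
  ultimately show ?thesis unfolding outerpath_def using p(2) verts edges by metis
qed

text \<open>Existence for any vertex type is read off from the program: number the vertices, list
  neighbors in increasing order, and pull the computed coloring back. What is pulled back is
  \<open>local_star\<close>, which only speaks of edges and colors and so passes through the
  bijection directly.\<close>

lemma outerpath_2_star_coloring:
  assumes "outerpath V E"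
  shows "\<exists>c. star_coloring 2 V E c"
proof -
  have g: "simple_graph V E" using assms by (simp add: outerpath_def)
  define n where "n = card V"
  obtain h where h: "bij_betw h V {..<n}"
    using ex_bij_betw_finite_nat[of V] g by (auto simp: simple_graph_def n_def atLeast0LessThan)
  define E' where "E' = (`) h ` E"
  have o: "outerpath {..<n} E'" unfolding E'_def by (rule outerpath_relabel[OF assms h])
  have "finite {u. {u, v} \<in> E'}" for v
    by (rule finite_subset[of _ "{..<n}"]) (use o in \<open>auto simp: outerpath_def simple_graph_def\<close>)
  then have "adjacency_lists n E' (\<lambda>v. sorted_list_of_set {u. {u, v} \<in> E'})" by (simp add: adjacency_lists_def)
  from star_color_prog_correct[OF o this] obtain c :: "nat \<Rightarrow> nat" where c: "\<And>v. v < n \<Longrightarrow> c v < 2" "local_star E' c" by blast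
  have inj: "inj_on h V" using h by (simp add: bij_betw_def)
  have e: "{h u, h v} \<in> E' \<and> u \<in> V \<and> v \<in> V" if "{u, v} \<in> E" for u v
  proof -
    have "{u, v} \<subseteq> V" using that g unfolding simple_graph_def by blast
    moreover have "h ` {u, v} \<in> E'" unfolding E'_def using that by (rule imageI)
    ultimately show ?thesis by simp
  qed
  have "local_star E (c \<circ> h)"
    unfolding local_star_def
  proof (intro allI impI, elim conjE)
    fix u v assume a: "{u, v} \<in> E" "(c \<circ> h) u = (c \<circ> h) v"
    have "(\<forall>w. {h u, w} \<in> E' \<and> c w = c (h u) \<longrightarrow> w = h v) \<or> (\<forall>w. {h v, w} \<in> E' \<and> c w = c (h v) \<longrightarrow> w = h u)"
      using c(2) e[OF a(1)] a(2) unfolding local_star_def by simp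
    then show "(\<forall>w. {u, w} \<in> E \<and> (c \<circ> h) w = (c \<circ> h) u \<longrightarrow> w = v) \<or> (\<forall>w. {v, w} \<in> E \<and> (c \<circ> h) w = (c \<circ> h) v \<longrightarrow> w = u)"
      using e a(1) inj_onD[OF inj] unfolding comp_def by metis
  qed
  moreover have "(c \<circ> h) v < 2" if "v \<in> V" for v using c(1)[of "h v"] h that by (auto simp: bij_betw_def)
  ultimately show ?thesis using local_star_imp_star_coloring[OF g] by blast
qed

theorem theorem2:
  shows "(\<forall>(V :: 'a set) E. outerpath V E \<longrightarrow> (\<exists>c. star_coloring 2 V E c)) \<and>
    (\<exists>(p :: prog) (K :: nat). \<forall>n E adj.
       outerpath {..<n} E \<longrightarrow> adjacency_lists n E adj \<longrightarrow>
       (\<exists>t s. exec p (input_state n adj) t s \<and> t \<le> K * (n + card E + 1) \<and>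
              star_coloring 2 {..<n} E (output_coloring s)))"
proof (intro conjI allI impI)
  fix V :: "'a set" and E assume "outerpath V E"
  then show "\<exists>c. star_coloring 2 V E c" by (rule outerpath_2_star_coloring)
next
  have "\<exists>t s. exec star_color_prog (input_state n adj) t s \<and> t \<le> 400 * (n + card E + 1) \<and>
    star_coloring 2 {..<n} E (output_coloring s)" if o: "outerpath {..<n} E" and a: "adjacency_lists n E adj" for n E adj
  proof -
    have g: "simple_graph {..<n} E" using o by (simp add: outerpath_def)
    obtain t s where ts: "exec star_color_prog (input_state n adj) t s" "t \<le> 400 * (n + card E + 1)"
      "\<And>v. v < n \<Longrightarrow> output_coloring s v < 2" "local_star E (output_coloring s)"
      using star_color_prog_correct[OF o a] by blast
    have "star_coloring 2 {..<n} E (output_coloring s)" by (rule local_star_imp_star_coloring[OF g ts(4)]) (use ts(3) in simp)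
    then show ?thesis using ts(1,2) by blast
  qed
  then show "\<exists>(p :: prog) (K :: nat). \<forall>n E adj. outerpath {..<n} E \<longrightarrow> adjacency_lists n E adj \<longrightarrow>
       (\<exists>t s. exec p (input_state n adj) t s \<and> t \<le> K * (n + card E + 1) \<and>
              star_coloring 2 {..<n} E (output_coloring s))" by blast
qed

end
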